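(* Let $\alpha\in(0,1)$ and let $\mu$ be a probability measure with $\operatorname{supp}(\mu)\subset[\underline\theta,\bar\theta]$, $-\alpha<\underline\theta\le 0\le\bar\theta<+\infty$. Let $(\Pi_n)_{n\ge1}$ be the exchangeable Gibbs partition with parameter $\alpha$ and weights $v_{n,k}=\int v_{n,k}(\alpha,\theta)\,d\mu(\theta)$, with predictive simplex $\mathsf p_n$ and its estimator $\hat{\mathsf p}_n$. Let $\mathsf{TV}(\hat{\mathsf p}_n,\mathsf p_n)=\frac12\sum_{i=0}^{\mathsf k_n}|\hat{\mathsf p}_{n,i}-\mathsf p_{n,i}|$. Then: 1. $n^{1-\frac\alpha2}\cdot\mathsf{TV}(\hat{\mathsf p}_n,\mathsf p_n)$ is bounded in $L_2$, i.e. $\limsup_{n\to\infty} n^{1-\frac\alpha2}\,\mathbb E[\mathsf{TV}(\hat{\mathsf p}_n,\mathsf p_n)^2]^{1/2}<\infty$. 2. As $n\to\infty$, $$n^{1-\frac\alpha2}\cdot\mathsf{TV}(\hat{\mathsf p}_n,\mathsf p_n)\to\sqrt{\frac{\mathsf S_{\alpha,\mu}}{\mathfrak i(\alpha)}}\;|N|\qquad\mathcal F_\infty\text{-stably},$$ where $\mathsf S_{\alpha,\mu}=\lim_{n\to\infty}\mathsf k_n/n^\alpha$ (almost sure limit) and $N\sim\mathcal N(0,1)$ is independent of $\mathcal F_\infty$.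
   Context: Weights: for $1\le k\le n$, $v_{n,k}(\alpha,\theta)=\frac{\prod_{i=1}^{k-1}(\theta+i\alpha)}{\prod_{i=1}^{n-1}(\theta+i)}$ (empty products equal 1) and $v_{n,k}=\int v_{n,k}(\alpha,\theta)\,d\mu(\theta)$; $\mu$ does not depend on $\alpha$. Gibbs partition: $\Pi_n$ is a random partition of $\{1,\dots,n\}$ defined sequentially on a probability space $(\Omega,\mathcal F,P)$. $\Pi_1=\{\{1\}\}$. Given $\Pi_n=\{U_1,\dots,U_{\mathsf k_n}\}$ ($\mathsf k_n$ = number of blocks), $\Pi_{n+1}$ is obtained by putting $n+1$ into a new block with probability $\mathsf p_{n,0}=v_{n+1,\mathsf k_n+1}/v_{n,\mathsf k_n}$ and into $U_i$ with probability $\mathsf p_{n,i}=\frac{v_{n+1,\mathsf k_n}}{v_{n,\mathsf k_n}}(|U_i|-\alpha)$, $i=1,\dots,\mathsf k_n$. The predictive simplex is $\mathsf p_n=(\mathsf p_{n,0},\dots,\mathsf p_{n,\mathsf k_n})$. Let $\mathsf k_{n,j}$ be the number of blocks of $\Pi_n$ of size $j$, $\mathcal F_n=\sigma(\Pi_n)$ and $\mathcal F_\infty=\sigma(\cup_n\mathcal F_n)$. The sequence $n^{-\alpha}\mathsf k_n$ converges almost surely to a positive random variable $\mathsf S_{\alpha,\mu}$. QMLE: for $n\ge2$, $\hat\alpha_n$ is the maximizer over $x\in(0,1)$ of $(\mathsf k_n-1)\log x+\sum_{j=2}^n\mathsf k_{n,j}\sum_{i=1}^{j-1}\log(i-x)$,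 understood as: $\hat\alpha_n=0$ if $\mathsf k_n=1$; $\hat\alpha_n=1$ if $\mathsf k_n=n$; and if $1<\mathsf k_n<n$, $\hat\alpha_n$ is the unique solution $x\in(0,1)$ of $\frac{\mathsf k_n-1}{x}-\sum_{j=2}^n\mathsf k_{n,j}\sum_{i=1}^{j-1}\frac1{i-x}=0$. Estimator: $\hat{\mathsf p}_n=(\hat{\mathsf p}_{n,0},\dots,\hat{\mathsf p}_{n,\mathsf k_n})$ with $\hat{\mathsf p}_{n,0}=\frac{\mathsf k_n}{n}\hat\alpha_n$ and $\hat{\mathsf p}_{n,i}=\frac{|U_i|-\hat\alpha_n}{n}$ for $i=1,\dots,\mathsf k_n$. Fisher information: $\mathfrak i(\alpha)=\sum_{j\ge1}\mathfrak p_\alpha(j)\left(\frac{\partial}{\partial\alpha}\log\mathfrak p_\alpha(j)\right)^2$ with $\mathfrak p_\alpha(j)=\frac{\alpha\prod_{i=1}^{j-1}(i-\alpha)}{j!}$, $j\in\mathbb N$. Stable convergence: for a sub-$\sigma$-field $\mathcal G\subset\mathcal F$, real random variables $X_n\to X$ $\mathcal G$-stably if $\lim_n\mathbb E[f\,\mathbb E[h(X_n)\mid\mathcal G]]=\mathbb E[f\,\mathbb E[h(X)\mid\mathcal G]]$ for every $\mathcal F$-measurable integrable $f$ and every bounded continuous $h:\mathbb R\to\mathbb R$. The probability space is assumed rich enough (enlarged if necessary) to carry $N$ independent of $\mathcal F_\infty$. *)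

theory Defs
  imports "HOL-Probability.Probability"
begin

section \<open>Weights\<close>

definition measure_supp :: "'a::topological_space measure \<Rightarrow> 'a set" where
  "measure_supp \<mu> = {x. \<forall>U. open U \<and> x \<in> U \<longrightarrow> emeasure \<mu> U > 0}"

definition pd_weight :: "real \<Rightarrow> real \<Rightarrow> nat \<Rightarrow> nat \<Rightarrow> real" where
  "pd_weight \<alpha> \<theta> n k =
     (\<Prod>i\<in>{1..<k}. \<theta> + real i * \<alpha>) / (\<Prod>i\<in>{1..<n}. \<theta> + real i)"

definition gibbs_weight :: "real \<Rightarrow> real measure \<Rightarrow> nat \<Rightarrow> nat \<Rightarrow> real" where
  "gibbs_weight \<alpha> \<mu> n k = (LINT \<theta>|\<mu>. pd_weight \<alpha> \<theta> n k)"

section \<open>Gibbs partitions\<close>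

text \<open>A partition of \<open>{1..n}\<close> is represented by the set of its blocks. The entries of the
  predictive simplex other than the one of a new block are therefore indexed by the blocks
  themselves rather than by an enumeration of them.\<close>

definition open_block :: "nat \<Rightarrow> nat set set \<Rightarrow> nat set set" where
  "open_block m P = insert {m} P"

definition join_block :: "nat \<Rightarrow> nat set \<Rightarrow> nat set set \<Rightarrow> nat set set" where
  "join_block m U P = insert (insert m U) (P - {U})"

definition pred_new :: "real \<Rightarrow> real measure \<Rightarrow> nat \<Rightarrow> nat set set \<Rightarrow> real" where
  "pred_new \<alpha> \<mu> n P =
     gibbs_weight \<alpha> \<mu> (n + 1) (card P + 1) / gibbs_weight \<alpha> \<mu> n (card P)"

definition pred_block :: "real \<Rightarrow> real measure \<Rightarrow> nat \<Rightarrow> nat set set \<Rightarrow> nat set \<Rightarrow> real" where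
  "pred_block \<alpha> \<mu> n P U =
     gibbs_weight \<alpha> \<mu> (n + 1) (card P) / gibbs_weight \<alpha> \<mu> n (card P) * (real (card U) - \<alpha>)"

text \<open>The conditions on \<open>Part n\<close> start at \<open>n = 1\<close>; the value \<open>Part 0\<close> is irrelevant. Since \<open>Part n\<close>
  determines \<open>Part 1, \<dots>, Part n\<close> by \<open>step\<close>, conditioning on \<open>Part n\<close> is the same as conditioning
  on the whole past.\<close>

locale gibbs_partition = prob_space M
  for M :: "'a measure" +
  fixes \<alpha> :: real and \<mu> :: "real measure" and Part :: "nat \<Rightarrow> 'a \<Rightarrow> nat set set"
  assumes measurable_partition:
      "n \<ge> 1 \<Longrightarrow> Part n \<in> measurable M (count_space UNIV)"
    and init: "\<omega> \<in> space M \<Longrightarrow> Part 1 \<omega> = {{1}}"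
    and step: "n \<ge> 1 \<Longrightarrow> \<omega> \<in> space M \<Longrightarrow>
      Part (n + 1) \<omega> = open_block (n + 1) (Part n \<omega>) \<or>
      (\<exists>U\<in>Part n \<omega>. Part (n + 1) \<omega> = join_block (n + 1) U (Part n \<omega>))"
    and prob_new: "n \<ge> 1 \<Longrightarrow> \<P>(\<omega> in M. Part n \<omega> = P) > 0 \<Longrightarrow>
      \<P>(\<omega> in M. Part (n + 1) \<omega> = open_block (n + 1) P \<bar> Part n \<omega> = P) = pred_new \<alpha> \<mu> n P"
    and prob_block: "n \<ge> 1 \<Longrightarrow> \<P>(\<omega> in M. Part n \<omega> = P) > 0 \<Longrightarrow> U \<in> P \<Longrightarrow>
      \<P>(\<omega> in M. Part (n + 1) \<omega> = join_block (n + 1) U P \<bar> Part n \<omega> = P) = pred_block \<alpha> \<mu> n P U"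

definition partition_sigma_inf :: "'a measure \<Rightarrow> (nat \<Rightarrow> 'a \<Rightarrow> nat set set) \<Rightarrow> 'a measure" where
  "partition_sigma_inf M Part =
     sigma (space M) (\<Union>n\<in>{1..}. sets (vimage_algebra (space M) (Part n) (count_space UNIV)))"

text \<open>The limit exists only almost surely; elsewhere \<^const>\<open>lim\<close> has an unspecified value.\<close>

definition alpha_diversity ::
    "real \<Rightarrow> (nat \<Rightarrow> 'a \<Rightarrow> nat set set) \<Rightarrow> 'a \<Rightarrow> real" where
  "alpha_diversity \<alpha> Part \<omega> = lim (\<lambda>n. real (card (Part n \<omega>)) / real n powr \<alpha>)"

section \<open>Quasi maximum likelihood and the estimated predictive simplex\<close>

definition num_blocks_of_size :: "nat set set \<Rightarrow> nat \<Rightarrow> nat" where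
  "num_blocks_of_size P j = card {U \<in> P. card U = j}"

text \<open>The score is the derivative in \<open>x\<close> of the quasi log-likelihood
  \<open>(k\<^sub>n - 1) log x + (\<Sum>j = 2..n. k\<^sub>n\<^sub>,\<^sub>j (\<Sum>i = 1..j - 1. log (i - x)))\<close>.\<close>

definition qmle_score :: "nat \<Rightarrow> nat set set \<Rightarrow> real \<Rightarrow> real" where
  "qmle_score n P x = (real (card P) - 1) / x
     - (\<Sum>j\<in>{2..n}. real (num_blocks_of_size P j) * (\<Sum>i\<in>{1..<j}. 1 / (real i - x)))"

definition qmle :: "nat \<Rightarrow> nat set set \<Rightarrow> real" where
  "qmle n P = (if card P = 1 then 0 else if card P = n then 1
     else (THE x. 0 < x \<and> x < 1 \<and> qmle_score n P x = 0))"

definition est_new :: "nat \<Rightarrow> nat set set \<Rightarrow> real" where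
  "est_new n P = real (card P) / real n * qmle n P"

definition est_block :: "nat \<Rightarrow> nat set set \<Rightarrow> nat set \<Rightarrow> real" where
  "est_block n P U = (real (card U) - qmle n P) / real n"

definition tv_error :: "real \<Rightarrow> real measure \<Rightarrow> nat \<Rightarrow> nat set set \<Rightarrow> real" where
  "tv_error \<alpha> \<mu> n P = 1 / 2 *
     (\<bar>est_new n P - pred_new \<alpha> \<mu> n P\<bar>
      + (\<Sum>U\<in>P. \<bar>est_block n P U - pred_block \<alpha> \<mu> n P U\<bar>))"

section \<open>Fisher information\<close>

definition sibuya_pmf :: "real \<Rightarrow> nat \<Rightarrow> real" where
  "sibuya_pmf \<alpha> j = \<alpha> * (\<Prod>i\<in>{1..<j}. real i - \<alpha>) / fact j"

definition fisher_info :: "real \<Rightarrow> real" where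
  "fisher_info \<alpha> =
     (\<Sum>m. sibuya_pmf \<alpha> (Suc m) * (deriv (\<lambda>a. ln (sibuya_pmf a (Suc m))) \<alpha>)\<^sup>2)"

section \<open>Stable convergence\<close>

definition stable_conv ::
    "'a measure \<Rightarrow> 'a measure \<Rightarrow> (nat \<Rightarrow> 'a \<Rightarrow> real) \<Rightarrow> ('a \<Rightarrow> real) \<Rightarrow> bool" where
  "stable_conv M G X Y \<longleftrightarrow>
     subalgebra M G \<and> (\<forall>n. X n \<in> borel_measurable M) \<and> Y \<in> borel_measurable M \<and>
     (\<forall>f h. integrable M f \<longrightarrow> continuous_on UNIV h \<longrightarrow> bounded (range (h :: real \<Rightarrow> real)) \<longrightarrow>
       (\<lambda>n. LINT \<omega>|M. f \<omega> * real_cond_exp M G (\<lambda>\<omega>. h (X n \<omega>)) \<omega>)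
         \<longlonglongrightarrow> (LINT \<omega>|M. f \<omega> * real_cond_exp M G (\<lambda>\<omega>. h (Y \<omega>)) \<omega>))"

end

theory Submission
  imports Defs "HOL-Real_Asymp.Real_Asymp"
begin

text \<open>
  Let \<open>k\<close> be the number of blocks at time \<open>n\<close>, and call a sum of \<open>w (card U)\<close> over the blocks \<open>U\<close> a
  block sum. Up to the constant \<open>1 / \<alpha>\<close>, the quasi-score at \<open>\<alpha>\<close> is the block sum \<open>L\<close> of
  \<open>score_wt \<alpha>\<close>. The quasi-likelihood is the likelihood of the model with \<open>\<theta> = 0\<close>, and uniformly over
  the partitions the predictive probabilities under \<open>\<mu>\<close> differ from those for \<open>\<theta> = 0\<close> only by a
  relative error of order \<open>1 / n\<close>. This has two consequences. First, the total variation error is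
  \<open>(k / n) \<bar>qmle - \<alpha>\<bar>\<close> up to order \<open>1 / n\<close> (\<open>tv_error_approx\<close>), so only the estimator matters. Second,
  \<open>L\<close> is a martingale up to a drift of order \<open>log n\<close>; its jumps are bounded, and the sum of the squares
  of its jumps is the block sum \<open>Q\<close> of \<open>info_wt \<alpha>\<close>, which is at the same time the negated derivative
  of the quasi-score.

  Boundedness in \<open>L\<^sup>2\<close>: the mean of \<open>L\<^sup>2\<close> is at most of the order of the mean of \<open>k\<close>, that is of
  \<open>n powr \<alpha>\<close> (\<open>score_second_moment\<close>), and concavity of the quasi-likelihood gives
  \<open>k \<bar>qmle - \<alpha>\<bar> \<le> 2 \<bar>L\<bar> + 2 / \<alpha>\<close> (\<open>qmle_error_score\<close>).

  Law of large numbers: the number of blocks of size \<open>j\<close> minus \<open>p\<^sub>\<alpha>(j) k\<close> has second moment of order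
  \<open>n powr \<alpha>\<close>, by induction on \<open>j\<close>, so block sums with convergent weights behave like \<open>k\<close> times the mean of
  the weight under the Sibuya distribution (\<open>block_sum_law_of_large_numbers\<close>). For \<open>Q\<close> that mean is the
  Fisher information (\<open>fisher_info_sums\<close>). Together with the almost sure convergence of \<open>k / n powr \<alpha>\<close>
  to the diversity \<open>S\<close> (\<open>alpha_diversity_limit\<close>), this identifies the limit of \<open>Q / n powr \<alpha>\<close> as the
  Fisher information times \<open>S\<close>.

  Central limit theorem: for \<open>u = t n powr (- \<alpha> / 2)\<close> the process \<open>exp (\<i> u L + u\<^sup>2 Q / 2)\<close>, stopped when
  \<open>Q\<close> becomes too large, is bounded and a martingale up to a vanishing error. Its expectation over
  any event of the past therefore converges to the probability of that event, and a monotone class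
  argument extends this to the whole sigma-algebra of the partitions. Dividing by the limit of
  \<open>exp (u\<^sup>2 Q / 2)\<close> yields the limit of the characteristic function of \<open>L / n powr (\<alpha> / 2)\<close> on every event
  (\<open>score_clt\<close>).

  Conclusion: the number of blocks has negative moments of the right order (\<open>negative_moment\<close>), so that
  \<open>n powr \<alpha> / k\<close> is tight and the quasi-score equation can be linearized in probability: the scaled
  total variation error, given the sign of the estimation error, is \<open>L / n powr (\<alpha> / 2)\<close> divided by the
  Fisher information plus a vanishing term (\<open>signed_tv_score_vanishing\<close>). Levy's continuity theorem under
  the conditional probabilities given the events of the sigma-algebra gives stable convergence
  (\<open>tv_stable\<close>).
\<close>

section \<open>Growth of the normalizing products\<close>

text \<open>The product \<open>growth \<alpha> n\<close> is the exact normalization under which the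
  number of blocks is a martingale when \<open>\<theta> = 0\<close>. Working with it instead of with
  \<open>n powr \<alpha>\<close> turns all growth estimates into one-line recursions; both are
  comparable by \<open>growth_bounds\<close>.\<close>
definition growth :: "real \<Rightarrow> nat \<Rightarrow> real" where
  "growth b n = (\<Prod>m\<in>{1..<n}. 1 + b / real m)"

lemma growth_Suc: "n \<ge> 1 \<Longrightarrow> growth b (Suc n) = growth b n * (1 + b / real n)"
  by (simp add: growth_def prod.atLeastLessThan_Suc)

lemma growth_1 [simp]: "growth b (Suc 0) = 1" "growth b 0 = 1"
  by (simp_all add: growth_def)

lemma growth_pos:
  assumes "b > -1" shows "growth b n > 0"
  unfolding growth_def
proof (rule prod_pos)
  fix m assume "m \<in> {1..<n}"
  then have "real m \<ge> 1" by auto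
  with assms have "real m + b > 0" by linarith
  with \<open>real m \<ge> 1\<close> show "1 + b / real m > 0" by (simp add: field_simps)
qed

lemma growth_ge_1: "b \<ge> 0 \<Longrightarrow> growth b n \<ge> 1"
  unfolding growth_def by (intro prod_ge_1) auto

lemma growth_mono:
  assumes "b \<ge> 0" "m \<le> n" shows "growth b m \<le> growth b n"
  unfolding growth_def by (rule prod_mono2) (use assms in auto)

text \<open>The product is the Pochhammer symbol of \<open>1 + z\<close>, so this is the Gauss
  product formula for the reciprocal Gamma function with the index shifted by two.\<close>
lemma shifted_prod_asymp:
  assumes z: "z > (-1::real)"
  shows "(\<lambda>n. (\<Prod>i\<in>{1..<n}. real i + z) / (fact (n - 1) * real n powr z)) \<longlonglongrightarrow> rGamma (1 + z)"
proof -
  have poch: "pochhammer (1 + z) n = (\<Prod>i\<in>{1..<Suc n}. real i + z)" for n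
    by (induction n) (auto simp: pochhammer_Suc prod.atLeastLessThan_Suc algebra_simps)
  have A: "(\<lambda>n. rGamma_series (1 + z) n) \<longlonglongrightarrow> rGamma (1 + z)"
    by (rule rGamma_series_LIMSEQ)
  have B: "(\<lambda>n. real n powr (1+z) / (real (Suc n) * real (n + 2) powr z)) \<longlonglongrightarrow> 1"
    using z by real_asymp
  have "(\<lambda>n. rGamma_series (1 + z) n * (real n powr (1+z) / (real (Suc n) * real (n + 2) powr z))) \<longlonglongrightarrow> rGamma (1 + z) * 1"
    by (rule tendsto_mult[OF A B])
  moreover have "\<forall>\<^sub>F n in sequentially. rGamma_series (1 + z) n * (real n powr (1+z) / (real (Suc n) * real (n + 2) powr z))
     = (\<Prod>i\<in>{1..<n+2}. real i + z) / (fact (n + 2 - 1) * real (n + 2) powr z)"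
    using eventually_gt_at_top[of 0]
  proof eventually_elim
    case (elim n)
    have "rGamma_series (1 + z) n = (\<Prod>i\<in>{1..<n+2}. real i + z) / (fact n * real n powr (1+z))"
      using elim by (simp add: rGamma_series_def poch powr_def mult.commute add.commute)
    moreover have "fact (n + 2 - 1) = real (Suc n) * fact n" by simp
    moreover have "p / (f * y) * (y / (w * u)) = p / (w * f * u)" if "y \<noteq> 0" for p f y w u :: real
      using that by simp
    ultimately show ?case using elim by (simp only:) simp
  qed
  ultimately have "(\<lambda>n. (\<Prod>i\<in>{1..<n+2}. real i + z) / (fact (n + 2 - 1) * real (n + 2) powr z)) \<longlonglongrightarrow> rGamma (1 + z)"
    using Lim_transform_eventually by fastforce
  then show ?thesis by (rule LIMSEQ_offset)
qed

lemma growth_eq: "n \<ge> 1 \<Longrightarrow> growth b n = (\<Prod>i\<in>{1..<n}. real i + b) / fact (n - 1)"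
proof (induction n rule: nat_induct_at_least)
  case (Suc n)
  then have "fact n = real n * fact (n - 1)" by (simp add: fact_reduce)
  with Suc show ?case by (simp add: growth_Suc prod.atLeastLessThan_Suc field_simps)
qed (simp)

lemma growth_asymp:
  assumes "b > -1"
  shows "(\<lambda>n. growth b n / real n powr b) \<longlonglongrightarrow> rGamma (1 + b)"
proof -
  have "\<forall>\<^sub>F n in sequentially. (\<Prod>i\<in>{1..<n}. real i + b) / (fact (n - 1) * real n powr b) = growth b n / real n powr b"
    using eventually_gt_at_top[of 0] by eventually_elim (simp add: growth_eq)
  with shifted_prod_asymp[OF assms] show ?thesis
    by (simp cong: filterlim_cong)
qed

lemma rGamma_pos: "x > 0 \<Longrightarrow> rGamma (x::real) > 0"
  using Gamma_real_pos[of x] by (simp add: rGamma_inverse_Gamma)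

lemma bounds_of_pos_limit:
  fixes f :: "nat \<Rightarrow> real"
  assumes "f \<longlonglongrightarrow> l" "l > 0" "\<And>n. n \<ge> 1 \<Longrightarrow> f n > 0"
  obtains c C where "c > 0" "C > 0" "\<And>n. n \<ge> 1 \<Longrightarrow> c \<le> f n \<and> f n \<le> C"
proof -
  have up: "\<exists>C>0. \<forall>n\<ge>1. g n \<le> C" if "g \<longlonglongrightarrow> m" for g :: "nat \<Rightarrow> real" and m
  proof -
    from that have "Bseq g" by (intro convergent_imp_Bseq) (auto simp: convergent_def)
    then obtain K where "K > 0" "\<And>n. norm (g n) \<le> K" by (auto elim: BseqE)
    then show ?thesis by (intro exI[of _ K]) (auto simp: abs_le_iff)
  qed
  from up[OF assms(1)] obtain C where C: "C > 0" "\<And>n. n \<ge> 1 \<Longrightarrow> f n \<le> C" by auto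
  have "(\<lambda>n. inverse (f n)) \<longlonglongrightarrow> inverse l" using assms by (intro tendsto_inverse) auto
  from up[OF this] obtain D where D: "D > 0" "\<And>n. n \<ge> 1 \<Longrightarrow> inverse (f n) \<le> D" by auto
  have "inverse D \<le> f n" if "n \<ge> 1" for n
    using D(2)[OF that] D(1) assms(3)[OF that] by (metis inverse_inverse_eq le_imp_inverse_le positive_imp_inverse_positive)
  with C D show ?thesis by (intro that[of "inverse D" C]) auto
qed

lemma growth_bounds:
  assumes "b > -1"
  obtains c C where "c > 0" "C > 0" "\<And>n. n \<ge> 1 \<Longrightarrow> c * real n powr b \<le> growth b n"
    "\<And>n. n \<ge> 1 \<Longrightarrow> growth b n \<le> C * real n powr b"
proof -
  obtain c C where cC: "c > 0" "C > 0" "\<And>n. n \<ge> 1 \<Longrightarrow> c \<le> growth b n / real n powr b \<and> growth b n / real n powr b \<le> C"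
  proof (rule bounds_of_pos_limit[OF growth_asymp[OF assms]])
    show "rGamma (1 + b) > 0" using assms by (intro rGamma_pos) simp
    show "0 < growth b n / real n powr b" if "n \<ge> 1" for n
      using that growth_pos[OF assms, of n] by simp
  qed auto
  show ?thesis
    by (rule that[OF cC(1,2)]) (use cC(3) in \<open>auto simp: field_simps\<close>)
qed

lemma LIMSEQ_null_comparison:
  fixes f :: "nat \<Rightarrow> 'b::real_normed_vector"
  assumes "g \<longlonglongrightarrow> 0" "\<And>n. norm (f n) \<le> g n" shows "f \<longlonglongrightarrow> 0"
  using assms by (intro Lim_null_comparison[of f g]) auto

section \<open>The Sibuya distribution and its Fisher information\<close>

text \<open>The tail \<open>P(J \<ge> m)\<close> of a variable \<open>J\<close> with the Sibuya
  distribution; see \<open>sibuya_pmf_diff\<close>.\<close>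
definition sibuya_tail :: "real \<Rightarrow> nat \<Rightarrow> real" where
  "sibuya_tail \<alpha> m = growth (- \<alpha>) m"

text \<open>The weight \<open>score_wt \<alpha> j\<close> is \<open>\<partial>/\<partial>\<alpha>
  log p\<^sub>\<alpha>(j)\<close>, the contribution of a block of size \<open>j\<close> to the score;
  \<open>info_wt\<close> is its negated derivative, which is also the sum of the squares of the
  increments of \<open>score_wt\<close>, counting the first value as an increment from zero. That
  coincidence drives the whole proof.\<close>
definition score_wt :: "real \<Rightarrow> nat \<Rightarrow> real" where
  "score_wt x j = 1 / x - (\<Sum>i\<in>{1..<j}. 1 / (real i - x))"

definition info_wt :: "real \<Rightarrow> nat \<Rightarrow> real" where
  "info_wt x j = 1 / x\<^sup>2 + (\<Sum>i\<in>{1..<j}. 1 / (real i - x)\<^sup>2)"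

lemma score_wt_Suc: "j \<ge> 1 \<Longrightarrow> score_wt x (Suc j) - score_wt x j = - 1 / (real j - x)"
  by (simp add: score_wt_def sum.atLeastLessThan_Suc)

lemma info_wt_Suc: "j \<ge> 1 \<Longrightarrow> info_wt x (Suc j) - info_wt x j = 1 / (real j - x)\<^sup>2"
  by (simp add: info_wt_def sum.atLeastLessThan_Suc)

lemma wt_start [simp]: "score_wt x (Suc 0) = 1 / x" "info_wt x (Suc 0) = 1 / x\<^sup>2"
  by (simp_all add: score_wt_def info_wt_def)

context
  fixes \<alpha> :: real
  assumes a: "0 < \<alpha>" "\<alpha> < 1"
begin

lemma sibuya_tail_pos: "sibuya_tail \<alpha> m > 0"
  using a by (simp add: sibuya_tail_def growth_pos)

lemma sibuya_tail_Suc: "m \<ge> 1 \<Longrightarrow> sibuya_tail \<alpha> (Suc m) = sibuya_tail \<alpha> m * (real m - \<alpha>) / real m"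
  by (simp add: sibuya_tail_def growth_Suc field_simps)

lemma sibuya_pmf_tail: 
  assumes "m \<ge> 1" shows "sibuya_pmf \<alpha> m = \<alpha> * sibuya_tail \<alpha> m / real m"
proof -
  have "fact m = real m * fact (m - 1)" using assms by (simp add: fact_reduce)
  then show ?thesis using assms by (simp add: sibuya_pmf_def sibuya_tail_def growth_eq field_simps)
qed

lemma sibuya_tail_Suc_pmf:
  assumes "m \<ge> 1" shows "(real m - \<alpha>) * sibuya_pmf \<alpha> m = \<alpha> * sibuya_tail \<alpha> (Suc m)"
  using assms by (simp add: sibuya_pmf_tail sibuya_tail_Suc field_simps)

lemma sibuya_pmf_nonneg: "m \<ge> 1 \<Longrightarrow> sibuya_pmf \<alpha> m \<ge> 0"
  using a sibuya_tail_pos[of m] by (simp add: sibuya_pmf_tail)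

lemma sibuya_pmf_diff: "m \<ge> 1 \<Longrightarrow> sibuya_pmf \<alpha> m = sibuya_tail \<alpha> m - sibuya_tail \<alpha> (Suc m)"
  by (simp add: sibuya_pmf_tail sibuya_tail_Suc field_simps)

lemma sibuya_rec:
  assumes "m \<ge> 1" shows "real (Suc m) * sibuya_pmf \<alpha> (Suc m) = (real m - \<alpha>) * sibuya_pmf \<alpha> m"
  using assms by (simp add: sibuya_pmf_tail sibuya_tail_Suc del: of_nat_Suc)

lemma sibuya_pmf_1 [simp]: "sibuya_pmf \<alpha> (Suc 0) = \<alpha>"
  by (simp add: sibuya_pmf_def)

text \<open>Summation by parts against the tails. For the weights used below, the factor \<open>j -
  \<alpha>\<close> cancels the denominators of the increments.\<close>
lemma sibuya_abel:
  "(\<Sum>m<n. sibuya_pmf \<alpha> (Suc m) * f (Suc m)) =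
    f 1 - sibuya_tail \<alpha> (Suc n) * f (Suc n)
    + (\<Sum>m<n. sibuya_pmf \<alpha> (Suc m) * ((real (Suc m) - \<alpha>) * (f (Suc (Suc m)) - f (Suc m))) / \<alpha>)"
proof (induction n)
  case 0
  then show ?case by (simp add: sibuya_tail_def)
next
  case (Suc n)
  have t: "sibuya_pmf \<alpha> (Suc n) * ((real (Suc n) - \<alpha>) * d) / \<alpha> = sibuya_tail \<alpha> (Suc (Suc n)) * d" for d
    using sibuya_tail_Suc_pmf[of "Suc n"] a by (simp add: field_simps del: of_nat_Suc)
  have e: "sibuya_pmf \<alpha> (Suc n) * f (Suc n) = sibuya_tail \<alpha> (Suc n) * f (Suc n) - sibuya_tail \<alpha> (Suc (Suc n)) * f (Suc n)"
    by (simp add: sibuya_pmf_diff left_diff_distrib)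
  show ?case unfolding sum.lessThan_Suc e t using Suc.IH by (simp add: right_diff_distrib)
qed

text \<open>The score weights grow only logarithmically, which the polynomial decay of the Sibuya
  tail absorbs.\<close>
lemma score_wt_bound: "j \<ge> 1 \<Longrightarrow> \<bar>score_wt \<alpha> j\<bar> \<le> 1 / \<alpha> + (1 + ln (real j)) / (1 - \<alpha>)"
proof -
  assume j: "j \<ge> 1"
  have "(\<Sum>i\<in>{1..<j}. 1 / (real i - \<alpha>)) \<le> (\<Sum>i\<in>{1..<j}. 1 / (1 - \<alpha>) * (1 / real i))"
  proof (rule sum_mono)
    fix i assume "i \<in> {1..<j}"
    then have i: "real i \<ge> 1" by auto
    then have "real i * (1 - \<alpha>) \<le> real i - \<alpha>" using a mult_left_mono[of 1 "real i" \<alpha>] by (simp add: algebra_simps)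
    then have "1 / (real i - \<alpha>) \<le> 1 / (real i * (1 - \<alpha>))"
      using i a by (intro divide_left_mono mult_pos_pos) auto
    then show "1 / (real i - \<alpha>) \<le> 1 / (1 - \<alpha>) * (1 / real i)" by (simp add: mult.commute)
  qed
  also have "\<dots> = 1 / (1 - \<alpha>) * (\<Sum>i\<in>{1..<j}. 1 / real i)" by (simp add: sum_distrib_left)
  also have "\<dots> \<le> 1 / (1 - \<alpha>) * (1 + ln (real j))"
  proof (rule mult_left_mono)
    have "(\<Sum>i\<in>{1..<j}. 1 / real i) \<le> harm j"
      unfolding harm_def inverse_eq_divide by (rule sum_mono2) auto
    also have "harm j \<le> 1 + ln (real j)"
      using decseqD[OF decseq_harm_diff_ln, of 0 "j - 1"] j by (simp add: harm_expand)
    finally show "(\<Sum>i\<in>{1..<j}. 1 / real i) \<le> 1 + ln (real j)" .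
  qed (use a in simp)
  finally have "(\<Sum>i\<in>{1..<j}. 1 / (real i - \<alpha>)) \<le> (1 + ln (real j)) / (1 - \<alpha>)" by simp
  moreover have "(\<Sum>i\<in>{1..<j}. 1 / (real i - \<alpha>)) \<ge> 0"
    using a by (intro sum_nonneg) auto
  ultimately show ?thesis using a by (simp add: score_wt_def abs_le_iff add_nonneg_nonneg) (smt (verit) divide_nonneg_pos zero_less_divide_1_iff)
qed

lemma info_wt_mono: "i \<le> j \<Longrightarrow> info_wt \<alpha> i \<le> info_wt \<alpha> j"
  unfolding info_wt_def by (intro add_left_mono sum_mono2) auto

lemma info_wt_pos: "info_wt \<alpha> j > 0"
  unfolding info_wt_def using a by (intro add_pos_nonneg sum_nonneg) auto

lemma info_wt_bound: "info_wt \<alpha> j \<le> 1 / \<alpha>\<^sup>2 + pi\<^sup>2 / 6 / (1 - \<alpha>)\<^sup>2"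
proof -
  have "(\<Sum>i\<in>{1..<j}. 1 / (real i - \<alpha>)\<^sup>2) \<le> (\<Sum>i\<in>{1..<j}. 1 / (1 - \<alpha>)\<^sup>2 * (1 / (real i)\<^sup>2))"
  proof (rule sum_mono)
    fix i assume "i \<in> {1..<j}"
    then have i: "real i \<ge> 1" by auto
    then have "real i * (1 - \<alpha>) \<le> real i - \<alpha>" using a mult_left_mono[of 1 "real i" \<alpha>] by (simp add: algebra_simps)
    then have "(real i * (1 - \<alpha>))\<^sup>2 \<le> (real i - \<alpha>)\<^sup>2" using a i by (intro power_mono) auto
    then have "1 / (real i - \<alpha>)\<^sup>2 \<le> 1 / (real i * (1 - \<alpha>))\<^sup>2"
      using i a by (intro divide_left_mono mult_pos_pos) auto
    then show "1 / (real i - \<alpha>)\<^sup>2 \<le> 1 / (1 - \<alpha>)\<^sup>2 * (1 / (real i)\<^sup>2)" by (simp add: mult.commute power_mult_distrib)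
  qed
  also have "\<dots> = 1 / (1 - \<alpha>)\<^sup>2 * (\<Sum>i\<in>{1..<j}. 1 / (real i)\<^sup>2)" by (simp add: sum_distrib_left)
  also have "(\<Sum>i\<in>{1..<j}. 1 / (real i)\<^sup>2) = (\<Sum>i<j-1. 1 / (real i + 1)\<^sup>2)"
    by (rule sum.reindex_bij_witness[of _ Suc "\<lambda>i. i - 1"]) auto
  also have "\<dots> \<le> pi\<^sup>2 / 6"
    using inverse_squares_sums by (intro sum_le_suminf[of "\<lambda>i. 1 / (real i + 1)\<^sup>2", THEN order_trans])
      (auto simp: sums_iff algebra_simps)
  finally show ?thesis using a by (simp add: info_wt_def divide_right_mono mult_left_mono field_simps)
qed

lemma info_wt_convergent: "convergent (info_wt \<alpha>)"
proof -
  have "incseq (info_wt \<alpha>)" by (simp add: incseq_def info_wt_mono)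
  moreover have "bdd_above (range (info_wt \<alpha>))" using info_wt_bound by (auto intro!: bdd_aboveI2)
  ultimately show ?thesis using LIMSEQ_incseq_SUP convergent_def by blast
qed

lemma sibuya_tail_upper: obtains C where "C > 0" "\<And>m. m \<ge> 1 \<Longrightarrow> sibuya_tail \<alpha> m \<le> C * real m powr (-\<alpha>)"
  using growth_bounds[of "-\<alpha>"] a unfolding sibuya_tail_def by (metis neg_less_iff_less)

lemma sibuya_tail_score: "(\<lambda>m. sibuya_tail \<alpha> (Suc m) * (score_wt \<alpha> (Suc m))\<^sup>2) \<longlonglongrightarrow> 0"
proof -
  obtain C where C: "C > 0" "\<And>m. m \<ge> 1 \<Longrightarrow> sibuya_tail \<alpha> m \<le> C * real m powr (-\<alpha>)"
    by (rule sibuya_tail_upper) auto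
  define D where "D = 1 / (1 - \<alpha>)"
  define F where "F = 1 / \<alpha>"
  have D: "D > 0" using a by (simp add: D_def)
  have "(\<lambda>m. C * real (Suc m) powr (-\<alpha>) * (F + D * (1 + ln (real (Suc m))))\<^sup>2) \<longlonglongrightarrow> 0"
    using a C D by real_asymp
  moreover have "norm (sibuya_tail \<alpha> (Suc m) * (score_wt \<alpha> (Suc m))\<^sup>2)
     \<le> C * real (Suc m) powr (-\<alpha>) * (F + D * (1 + ln (real (Suc m))))\<^sup>2" for m
  proof -
    have "\<bar>score_wt \<alpha> (Suc m)\<bar> \<le> F + D * (1 + ln (real (Suc m)))"
      using score_wt_bound[of "Suc m"] by (simp add: F_def D_def)
    then have "(score_wt \<alpha> (Suc m))\<^sup>2 \<le> (F + D * (1 + ln (real (Suc m))))\<^sup>2"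
      by (metis abs_ge_zero power2_abs power_mono)
    then show ?thesis using C(2)[of "Suc m"] sibuya_tail_pos[of "Suc m"]
      by (simp add: abs_mult mult_mono)
  qed
  ultimately show ?thesis by (rule LIMSEQ_null_comparison)
qed

lemma sibuya_tail_0: "(\<lambda>m. sibuya_tail \<alpha> (Suc m)) \<longlonglongrightarrow> 0"
proof -
  obtain C where C: "C > 0" "\<And>m. m \<ge> 1 \<Longrightarrow> sibuya_tail \<alpha> m \<le> C * real m powr (-\<alpha>)"
    by (rule sibuya_tail_upper) auto
  have "(\<lambda>m. C * real (Suc m) powr (-\<alpha>)) \<longlonglongrightarrow> 0" using a by real_asymp
  then show ?thesis
  proof (rule LIMSEQ_null_comparison)
    show "norm (sibuya_tail \<alpha> (Suc n)) \<le> C * real (Suc n) powr (-\<alpha>)" for n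
      using C(2)[of "Suc n"] sibuya_tail_pos[of "Suc n"] by simp
  qed
qed

lemma sibuya_sums: "(\<lambda>m. sibuya_pmf \<alpha> (Suc m)) sums 1"
proof -
  have "(\<Sum>m<n. sibuya_pmf \<alpha> (Suc m)) = 1 - sibuya_tail \<alpha> (Suc n)" for n
    using sibuya_abel[of "\<lambda>_. 1" n] by simp
  moreover have "(\<lambda>n. 1 - sibuya_tail \<alpha> (Suc n)) \<longlonglongrightarrow> 1 - 0"
    by (intro tendsto_intros sibuya_tail_0)
  ultimately show ?thesis by (simp add: sums_def)
qed

lemma sibuya_summable_bounded:
  assumes "\<And>m. \<bar>f m\<bar> \<le> B" shows "summable (\<lambda>m. sibuya_pmf \<alpha> (Suc m) * f (Suc m))"
proof (rule summable_comparison_test)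
  show "\<exists>N. \<forall>n\<ge>N. norm (sibuya_pmf \<alpha> (Suc n) * f (Suc n)) \<le> sibuya_pmf \<alpha> (Suc n) * B"
    using assms sibuya_pmf_nonneg by (auto simp: abs_mult intro!: exI[of _ 0] mult_left_mono)
  show "summable (\<lambda>n. sibuya_pmf \<alpha> (Suc n) * B)"
    using sibuya_sums by (intro summable_mult2) (auto simp: sums_iff)
qed

lemma sibuya_score_mean: "(\<lambda>m. sibuya_pmf \<alpha> (Suc m) * score_wt \<alpha> (Suc m)) sums 0"
proof -
  have "(\<Sum>m<n. sibuya_pmf \<alpha> (Suc m) * ((real (Suc m) - \<alpha>) * (score_wt \<alpha> (Suc (Suc m)) - score_wt \<alpha> (Suc m))) / \<alpha>)
     = (\<Sum>m<n. - (sibuya_pmf \<alpha> (Suc m)) / \<alpha>)" for n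
    by (rule sum.cong) (use a in \<open>auto simp: score_wt_Suc simp del: of_nat_Suc\<close>)
  then have "(\<Sum>m<n. sibuya_pmf \<alpha> (Suc m) * score_wt \<alpha> (Suc m)) =
     1 / \<alpha> - sibuya_tail \<alpha> (Suc n) * score_wt \<alpha> (Suc n) - (\<Sum>m<n. sibuya_pmf \<alpha> (Suc m)) / \<alpha>" for n
    using sibuya_abel[of "score_wt \<alpha>" n] by (simp add: sum_negf sum_divide_distrib)
  moreover have "(\<lambda>n. sibuya_tail \<alpha> (Suc n) * score_wt \<alpha> (Suc n)) \<longlonglongrightarrow> 0"
  proof (rule Lim_null_comparison[OF always_eventually])
    show "\<forall>n. norm (sibuya_tail \<alpha> (Suc n) * score_wt \<alpha> (Suc n))
        \<le> sibuya_tail \<alpha> (Suc n) + sibuya_tail \<alpha> (Suc n) * (score_wt \<alpha> (Suc n))\<^sup>2"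
    proof
      fix n
      have "\<bar>score_wt \<alpha> (Suc n)\<bar> \<le> 1 + (score_wt \<alpha> (Suc n))\<^sup>2"
        using zero_le_power2[of "\<bar>score_wt \<alpha> (Suc n)\<bar> - 1/2"] by (simp add: power2_eq_square algebra_simps)
      then show "norm (sibuya_tail \<alpha> (Suc n) * score_wt \<alpha> (Suc n))
        \<le> sibuya_tail \<alpha> (Suc n) + sibuya_tail \<alpha> (Suc n) * (score_wt \<alpha> (Suc n))\<^sup>2"
        using sibuya_tail_pos[of "Suc n"] mult_left_mono[of _ _ "sibuya_tail \<alpha> (Suc n)"]
        by (fastforce simp: abs_mult distrib_left)
    qed
    show "(\<lambda>n. sibuya_tail \<alpha> (Suc n) + sibuya_tail \<alpha> (Suc n) * (score_wt \<alpha> (Suc n))\<^sup>2) \<longlonglongrightarrow> 0"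
      using tendsto_add[OF sibuya_tail_0 sibuya_tail_score] by simp
  qed
  then have "(\<lambda>n. 1 / \<alpha> - sibuya_tail \<alpha> (Suc n) * score_wt \<alpha> (Suc n) - (\<Sum>m<n. sibuya_pmf \<alpha> (Suc m)) / \<alpha>)
     \<longlonglongrightarrow> 1 / \<alpha> - 0 - 1 / \<alpha>"
    using sibuya_sums a by (intro tendsto_intros) (auto simp: sums_def)
  ultimately show ?thesis by (simp add: sums_def)
qed

lemma deriv_log_sibuya:
  "deriv (\<lambda>x. ln (sibuya_pmf x (Suc m))) \<alpha> = score_wt \<alpha> (Suc m)"
proof (rule DERIV_imp_deriv)
  have pos: "i \<in> {1..<Suc m} \<Longrightarrow> real i - x > 0" if "x \<in> {0<..<1}" for i x using that by auto
  define F where "F = (\<lambda>x. ln x + (\<Sum>i\<in>{1..<Suc m}. ln (real i - x)) - ln (fact (Suc m)))"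
  have "(F has_real_derivative score_wt \<alpha> (Suc m)) (at \<alpha>)"
    unfolding F_def score_wt_def diff_conv_add_uminus sum_negf[symmetric]
    by (rule derivative_eq_intros refl | use a in force)+
  moreover have "\<forall>\<^sub>F x in nhds \<alpha>. ln (sibuya_pmf x (Suc m)) = F x"
  proof (rule eventually_nhds_in_open[THEN eventually_mono])
    show "open {0<..<1::real}" "\<alpha> \<in> {0<..<1}" using a by auto
    fix x :: real assume x: "x \<in> {0<..<1}"
    have "(\<Prod>i\<in>{1..<Suc m}. real i - x) > 0" by (rule prod_pos) (use pos[OF x] in auto)
    moreover have "ln (\<Prod>i\<in>{1..<Suc m}. real i - x) = (\<Sum>i\<in>{1..<Suc m}. ln (real i - x))"
      using x by (intro ln_prod) auto
    ultimately show "ln (sibuya_pmf x (Suc m)) = F x"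
      using x unfolding sibuya_pmf_def F_def
      by (simp add: ln_div ln_mult del: fact_Suc prod.op_ivl_Suc sum.op_ivl_Suc)
  qed
  ultimately show "((\<lambda>x. ln (sibuya_pmf x (Suc m))) has_real_derivative score_wt \<alpha> (Suc m)) (at \<alpha>)"
    by (subst DERIV_cong_ev[OF refl _ refl])
qed

text \<open>The information identity. Both the mean of the squared score weight and the mean of
  \<open>info_wt\<close> are summed by parts; the results differ by a multiple of the mean score,
  which is zero, and by boundary terms that vanish.\<close>
theorem fisher_info_sums:
  "(\<lambda>m. sibuya_pmf \<alpha> (Suc m) * info_wt \<alpha> (Suc m)) sums fisher_info \<alpha>"
proof -
  let ?p = "\<lambda>m. sibuya_pmf \<alpha> (Suc m)" and ?s = "\<lambda>m. score_wt \<alpha> (Suc m)" and ?q = "\<lambda>m. info_wt \<alpha> (Suc m)"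
  have bq: "\<bar>info_wt \<alpha> m\<bar> \<le> 1 / \<alpha>\<^sup>2 + pi\<^sup>2 / 6 / (1 - \<alpha>)\<^sup>2" for m
    using info_wt_bound info_wt_pos[of m] by simp
  have S: "summable (\<lambda>m. ?p m * ?q m)"
    by (rule sibuya_summable_bounded[OF bq])
  have "(\<Sum>m<n. ?p m * (?s m)\<^sup>2) = (\<Sum>m<n. ?p m * ?q m) - 2 / \<alpha> * (\<Sum>m<n. ?p m * ?s m)
     - sibuya_tail \<alpha> (Suc n) * (?s n)\<^sup>2 + sibuya_tail \<alpha> (Suc n) * ?q n" for n
  proof -
    have 1: "?p m * ((real (Suc m) - \<alpha>) * ((score_wt \<alpha> (Suc (Suc m)))\<^sup>2 - (?s m)\<^sup>2)) / \<alpha>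
       = ?p m * ((real (Suc m) - \<alpha>) * (info_wt \<alpha> (Suc (Suc m)) - ?q m)) / \<alpha> - 2 / \<alpha> * (?p m * ?s m)" for m
    proof -
      have d: "real (Suc m) - \<alpha> > 0" using a by auto
      have s: "score_wt \<alpha> (Suc (Suc m)) = ?s m - 1 / (real (Suc m) - \<alpha>)"
        using score_wt_Suc[of "Suc m" \<alpha>] by simp
      have key: "d * ((x - 1 / d)\<^sup>2 - x\<^sup>2) = d * (1 / d\<^sup>2) - 2 * x" if "d > 0" for d x :: real
        using that by (simp add: power2_eq_square field_simps)
      have i: "info_wt \<alpha> (Suc (Suc m)) - ?q m = 1 / (real (Suc m) - \<alpha>)\<^sup>2"
        using info_wt_Suc[of "Suc m" \<alpha>] by simp
      show ?thesis unfolding s i key[OF d] by (simp add: right_diff_distrib diff_divide_distrib)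
    qed
    show ?thesis
      unfolding sibuya_abel[of "\<lambda>j. (score_wt \<alpha> j)\<^sup>2" n] sibuya_abel[of "info_wt \<alpha>" n]
        1 sum_subtractf sum_distrib_left[symmetric]
      by (simp add: power_one_over)
  qed
  moreover have "(\<lambda>n. (\<Sum>m<n. ?p m * ?q m) - 2 / \<alpha> * (\<Sum>m<n. ?p m * ?s m)
     - sibuya_tail \<alpha> (Suc n) * (?s n)\<^sup>2 + sibuya_tail \<alpha> (Suc n) * ?q n)
      \<longlonglongrightarrow> (\<Sum>m. ?p m * ?q m) - 2 / \<alpha> * 0 - 0 + 0"
  proof (intro tendsto_intros)
    show "(\<lambda>n. \<Sum>m<n. ?p m * ?q m) \<longlonglongrightarrow> (\<Sum>m. ?p m * ?q m)" using S by (rule summable_LIMSEQ)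
    show "(\<lambda>n. \<Sum>m<n. ?p m * ?s m) \<longlonglongrightarrow> 0" using sibuya_score_mean by (simp add: sums_def)
    show "(\<lambda>n. sibuya_tail \<alpha> (Suc n) * (?s n)\<^sup>2) \<longlonglongrightarrow> 0" by (rule sibuya_tail_score)
    show "(\<lambda>n. sibuya_tail \<alpha> (Suc n) * ?q n) \<longlonglongrightarrow> 0"
    proof (rule Lim_null_comparison[OF always_eventually])
      show "\<forall>n. norm (sibuya_tail \<alpha> (Suc n) * ?q n) \<le> sibuya_tail \<alpha> (Suc n) * (1 / \<alpha>\<^sup>2 + pi\<^sup>2 / 6 / (1 - \<alpha>)\<^sup>2)"
        using bq sibuya_tail_pos by (auto simp: abs_mult less_imp_le intro!: mult_mono)
      show "(\<lambda>n. sibuya_tail \<alpha> (Suc n) * (1 / \<alpha>\<^sup>2 + pi\<^sup>2 / 6 / (1 - \<alpha>)\<^sup>2)) \<longlonglongrightarrow> 0"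
        using tendsto_mult_left_zero[OF sibuya_tail_0] by simp
    qed
  qed
  ultimately have "(\<lambda>m. ?p m * (?s m)\<^sup>2) sums (\<Sum>m. ?p m * ?q m)"
    by (simp add: sums_def)
  then have "fisher_info \<alpha> = (\<Sum>m. ?p m * ?q m)"
    unfolding fisher_info_def deriv_log_sibuya by (rule sums_unique[symmetric])
  with S show ?thesis by (simp add: summable_sums)
qed

lemma fisher_info_pos: "fisher_info \<alpha> > 0"
proof -
  have "(\<Sum>m<1. sibuya_pmf \<alpha> (Suc m) * info_wt \<alpha> (Suc m)) \<le> (\<Sum>m. sibuya_pmf \<alpha> (Suc m) * info_wt \<alpha> (Suc m))"
    using fisher_info_sums sibuya_pmf_nonneg info_wt_pos
    by (intro sum_le_suminf) (auto simp: sums_iff less_imp_le)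
  also have "\<dots> = fisher_info \<alpha>" using fisher_info_sums by (simp add: sums_iff)
  finally have "(\<Sum>m<1. sibuya_pmf \<alpha> (Suc m) * info_wt \<alpha> (Suc m)) \<le> fisher_info \<alpha>" .
  moreover have "(\<Sum>m<1. sibuya_pmf \<alpha> (Suc m) * info_wt \<alpha> (Suc m)) > 0"
    using a by simp
  ultimately show ?thesis by linarith
qed

end

section \<open>Partitions and sums over blocks\<close>

definition block_sum :: "(nat \<Rightarrow> real) \<Rightarrow> nat set set \<Rightarrow> real" where
  "block_sum w P = (\<Sum>U\<in>P. w (card U))"

lemma block_sum_diff: "block_sum (\<lambda>j. v j - w j) P = block_sum v P - block_sum w P"
  and block_sum_cmult: "block_sum (\<lambda>j. c * w j) P = c * block_sum w P"
  and block_sum_const: "block_sum (\<lambda>j. c) P = real (card P) * c"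
  by (simp_all add: block_sum_def sum_subtractf sum_distrib_left)

text \<open>Removing the newest element recovers the previous partition, so that the current
  partition carries the whole history.\<close>
definition forget :: "nat \<Rightarrow> nat set set \<Rightarrow> nat set set" where
  "forget m P = (\<lambda>U. U - {m}) ` P - {{}}"

context
  fixes n :: nat and P :: "nat set set"
  assumes part: "partition_on {1..n} P"
begin

lemma part_finite: "finite P"
  using part finite_elements by blast

lemma part_block:
  assumes "U \<in> P"
  shows "U \<subseteq> {1..n}" "finite U" "U \<noteq> {}" "card U \<ge> 1" "card U \<le> n" "Suc n \<notin> U"
proof -
  show 1: "U \<subseteq> {1..n}" "U \<noteq> {}" using part assms by (auto simp: partition_on_def)
  then show 2: "finite U" using finite_subset by blast
  show "card U \<ge> 1" using 1 2 by (simp add: Suc_leI card_gt_0_iff)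
  show "card U \<le> n" using card_mono[OF _ 1(1)] by simp
  show "Suc n \<notin> U" using 1 by auto
qed

lemma part_sum_card: "(\<Sum>U\<in>P. card U) = n"
proof -
  have "card (\<Union>P) = sum card P"
    using part by (intro card_Union_disjoint) (auto simp: partition_on_def part_block)
  moreover have "\<Union>P = {1..n}" using part by (simp add: partition_on_def)
  ultimately show ?thesis by simp
qed

lemma part_card_le: "card P \<le> n"
  using sum_mono[of P "\<lambda>_. 1::nat" card] part_block part_sum_card by simp

lemma part_card_pos: "n \<ge> 1 \<Longrightarrow> card P \<ge> 1"
  using part_sum_card part_finite by (cases "P = {}") (auto simp: Suc_le_eq card_gt_0_iff)

lemma part_fresh: "U \<in> P \<Longrightarrow> insert (Suc n) V \<noteq> U" "{Suc n} \<notin> P" "insert (Suc n) V \<notin> P"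
  using part_block(6) by auto

lemma card_open_block: "card (open_block (Suc n) P) = Suc (card P)"
  using part_finite part_fresh by (simp add: open_block_def)

lemma card_join_block: "U \<in> P \<Longrightarrow> card (join_block (Suc n) U P) = card P"
  using part_finite part_fresh by (simp add: join_block_def card_Suc_Diff1 del: card_Diff_insert)

lemma block_sum_open: "block_sum w (open_block (Suc n) P) = block_sum w P + w 1"
  using part_finite part_fresh by (simp add: open_block_def block_sum_def)

lemma block_sum_join:
  assumes "U \<in> P"
  shows "block_sum w (join_block (Suc n) U P) = block_sum w P + (w (Suc (card U)) - w (card U))"
proof -
  have "block_sum w (join_block (Suc n) U P) = w (card (insert (Suc n) U)) + (\<Sum>V\<in>P-{U}. w (card V))"
    using part_finite part_fresh by (simp add: join_block_def block_sum_def)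
  also have "card (insert (Suc n) U) = Suc (card U)" using part_block[OF assms] by simp
  also have "(\<Sum>V\<in>P-{U}. w (card V)) = block_sum w P - w (card U)"
    using part_finite assms by (simp add: block_sum_def sum_diff1)
  finally show ?thesis by simp
qed

lemma partition_on_open: "partition_on {1..Suc n} (open_block (Suc n) P)"
proof -
  have "{1..Suc n} - {Suc n} = {1..n}" by auto
  moreover have "disjnt {Suc n} (\<Union>P)" using part by (auto simp: disjnt_def partition_on_def)
  ultimately show ?thesis unfolding open_block_def
    using part by (subst partition_on_insert) auto
qed

lemma partition_on_join:
  assumes "U \<in> P" shows "partition_on {1..Suc n} (join_block (Suc n) U P)"
proof -
  have d: "disjnt U (\<Union>(P - {U}))"
    using part assms by (auto simp: partition_on_def disjoint_def disjnt_def)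
  have "partition_on {1..n} (insert U (P - {U}))" using part assms by (simp add: insert_absorb)
  then have p: "partition_on ({1..n} - U) (P - {U})" using partition_on_insert[OF d] by blast
  have "{1..Suc n} - insert (Suc n) U = {1..n} - U" using part_block[OF assms] by auto
  moreover have "disjnt (insert (Suc n) U) (\<Union>(P - {U}))"
    using d part_block(6) by (auto simp: disjnt_def)
  ultimately show ?thesis unfolding join_block_def
    using p part_block[OF assms] by (subst partition_on_insert) auto
qed

lemma forget_open: "forget (Suc n) (open_block (Suc n) P) = P"
proof -
  have "(\<lambda>U. U - {Suc n}) ` P = P" using part_block(6) by (force simp: image_iff)
  moreover have "{} \<notin> P" using part by (simp add: partition_on_def)
  ultimately show ?thesis by (simp add: forget_def open_block_def)
qed

lemma forget_join: assumes "U \<in> P" shows "forget (Suc n) (join_block (Suc n) U P) = P"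
proof -
  have "(\<lambda>V. V - {Suc n}) ` (P - {U}) = P - {U}" using part_block(6) by (force simp: image_iff)
  moreover have "insert (Suc n) U - {Suc n} = U" using part_block(6)[OF assms] by simp
  moreover have "{} \<notin> P" using part by (simp add: partition_on_def)
  ultimately show ?thesis using assms by (auto simp: forget_def join_block_def)
qed

lemma open_neq_join: "U \<in> P \<Longrightarrow> open_block (Suc n) P \<noteq> join_block (Suc n) U P"
  using card_open_block card_join_block by fastforce

lemma inj_on_join: "inj_on (\<lambda>U. join_block (Suc n) U P) P"
proof (rule inj_onI)
  fix U V assume UV: "U \<in> P" "V \<in> P" "join_block (Suc n) U P = join_block (Suc n) V P"
  then have "insert (Suc n) U \<in> insert (insert (Suc n) V) (P - {V})"
    unfolding join_block_def by blast
  then have "insert (Suc n) U = insert (Suc n) V" using part_fresh by auto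
  then show "U = V" using part_block(6) UV by (metis insert_ident)
qed

section \<open>The quasi maximum likelihood estimator\<close>

text \<open>Slopes of the secants of the score weights in the parameter. As score differences are
  exact multiples of the secant slopes, the quasi-score equation can be solved for the estimation
  error.\<close>
definition secant_wt :: "real \<Rightarrow> real \<Rightarrow> nat \<Rightarrow> real" where
  "secant_wt x y j = 1 / (x * y) + (\<Sum>i\<in>{1..<j}. 1 / ((real i - x) * (real i - y)))"

lemma score_wt_secant:
  assumes "x \<in> {0<..<1}" "y \<in> {0<..<1}"
  shows "score_wt y j - score_wt x j = (x - y) * secant_wt x y j"
proof -
  have "(\<Sum>i\<in>{1..<j}. 1 / (real i - x)) - (\<Sum>i\<in>{1..<j}. 1 / (real i - y)) =
      (\<Sum>i\<in>{1..<j}. (x - y) * (1 / ((real i - x) * (real i - y))))"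
    unfolding sum_subtractf[symmetric]
  proof (rule sum.cong[OF refl])
    fix i assume "i \<in> {1..<j}"
    then have "real i - x > 0" "real i - y > 0" using assms by auto
    then show "1 / (real i - x) - 1 / (real i - y) = (x - y) * (1 / ((real i - x) * (real i - y)))"
      by (simp add: field_simps)
  qed
  moreover have "1 / y - 1 / x = (x - y) * (1 / (x * y))" using assms by (simp add: field_simps)
  ultimately show ?thesis by (simp add: score_wt_def secant_wt_def distrib_left sum_distrib_left)
qed

text \<open>The term \<open>1 / x\<close> accounts for the \<open>k - 1\<close>, rather than
  \<open>k\<close>, in front of \<open>log x\<close> in the quasi log-likelihood.\<close>
lemma qmle_score_block_sum: "qmle_score n P x = block_sum (score_wt x) P - 1 / x"
proof -
  define a where "a j = (\<Sum>i\<in>{1..<j}. 1 / (real i - x))" for j :: nat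
  have "(\<Sum>U\<in>P. a (card U)) = (\<Sum>j\<in>{1..n}. \<Sum>U\<in>{U\<in>P. card U = j}. a (card U))"
    using part_finite part_block by (intro sum.group[symmetric]) auto
  also have "\<dots> = (\<Sum>j\<in>{1..n}. real (num_blocks_of_size P j) * a j)"
    by (rule sum.cong) (auto simp: num_blocks_of_size_def)
  also have "\<dots> = (\<Sum>j\<in>{2..n}. real (num_blocks_of_size P j) * a j)"
    by (rule sum.mono_neutral_right) (auto simp: a_def)
  finally show ?thesis
    by (simp add: qmle_score_def a_def block_sum_def score_wt_def sum_subtractf diff_divide_distrib)
qed

lemma qmle_score_secant:
  assumes "x \<in> {0<..<1}" "y \<in> {0<..<1}"
  shows "qmle_score n P y - qmle_score n P x = (x - y) * (block_sum (secant_wt x y) P - 1 / (x * y))"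
proof -
  have "block_sum (score_wt y) P - block_sum (score_wt x) P = (x - y) * block_sum (secant_wt x y) P"
    using assms by (simp add: block_sum_diff[symmetric] score_wt_secant block_sum_cmult)
  moreover have "1 / y - 1 / x = (x - y) * (1 / (x * y))" using assms by (simp add: field_simps)
  ultimately show ?thesis unfolding qmle_score_block_sum right_diff_distrib by linarith
qed

text \<open>All secants are at least as steep as the part coming from the number of blocks, since
  \<open>x y < 1\<close>. This gives both uniqueness of the estimator and the bound on its error by
  the score.\<close>
lemma secant_ge:
  assumes "x \<in> {0<..<1}" "y \<in> {0<..<1}" "n \<ge> 1"
  shows "block_sum (secant_wt x y) P - 1 / (x * y) \<ge> real (card P) - 1"
proof -
  have "real (card P) * (1 / (x * y)) \<le> block_sum (secant_wt x y) P"
    unfolding block_sum_const[symmetric] unfolding block_sum_def secant_wt_def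
  proof (rule sum_mono)
    fix U
    have "(\<Sum>i = 1..<card U. 1 / ((real i - x) * (real i - y))) \<ge> 0"
      using assms by (intro sum_nonneg divide_nonneg_nonneg mult_nonneg_nonneg) auto
    then show "1 / (x * y) \<le> 1 / (x * y) + (\<Sum>i = 1..<card U. 1 / ((real i - x) * (real i - y)))" by simp
  qed
  moreover have "(real (card P) - 1) * 1 \<le> (real (card P) - 1) * (1 / (x * y))"
  proof (rule mult_left_mono)
    have "x * y \<le> 1 * 1" using assms by (intro mult_mono) auto
    then show "1 \<le> 1 / (x * y)" using assms by (simp add: field_simps)
  qed (use part_card_pos[OF assms(3)] in simp)
  ultimately show ?thesis unfolding left_diff_distrib by linarith
qed

text \<open>Near \<open>0\<close> the term \<open>(k - 1) / x\<close> dominates, near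
  \<open>1\<close> the term \<open>1 / (1 - x)\<close> of a block with at least two elements; the
  intermediate value theorem applies between \<open>1 / (4 n)\<close> and \<open>1 - 1 / (4
  n)\<close>.\<close>
lemma qmle_exists:
  assumes k: "1 < card P" "card P < n"
  shows "\<exists>x. 0 < x \<and> x < 1 \<and> qmle_score n P x = 0"
proof -
  have n: "n \<ge> 1" using k by simp
  define e where "e = 1 / (4 * real n)"
  have e: "0 < e" "e \<le> 1/4" using n by (auto simp: e_def field_simps)
  define h where "h x = (\<Sum>U\<in>P. \<Sum>i\<in>{1..<card U}. 1 / (real i - x))" for x :: real
  have sc: "qmle_score n P x = (real (card P) - 1) / x - h x" for x
    by (simp add: qmle_score_block_sum block_sum_def score_wt_def sum_subtractf h_def diff_divide_distrib)
  have "h e \<le> (\<Sum>U\<in>P. \<Sum>i\<in>{1..<card U}. 2)"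
    unfolding h_def
  proof (intro sum_mono)
    fix U i assume "i \<in> {1..<card U}"
    then have "real i - e \<ge> 1/2" using e by auto
    then show "1 / (real i - e) \<le> 2" by (simp add: field_simps)
  qed
  also have "\<dots> \<le> (\<Sum>U\<in>P. 2 * real (card U))" by (intro sum_mono) auto
  also have "\<dots> = 2 * real n" using part_sum_card by (simp add: sum_distrib_left[symmetric] of_nat_sum[symmetric])
  finally have "h e \<le> 2 * real n" .
  moreover have "(real (card P) - 1) / e \<ge> 1 / e" using k e by (intro divide_right_mono) auto
  moreover have "1 / e = 4 * real n" by (simp add: e_def)
  ultimately have pos: "qmle_score n P e \<ge> 0" unfolding sc by linarith
  have "\<exists>U\<in>P. card U \<noteq> 1"
  proof (rule ccontr)
    assume "\<not> ?thesis"
    then have "(\<Sum>U\<in>P. card U) = card P" by simp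
    then show False using part_sum_card k by simp
  qed
  then obtain V where V: "V \<in> P" "card V \<ge> 2" using part_block(4) by force
  have nn: "0 \<le> 1 / (real i - (1 - e))" if "i \<in> {1..<m}" for i m
    using that e by auto
  have "1 / (real 1 - (1 - e)) \<le> (\<Sum>i\<in>{1..<card V}. 1 / (real i - (1 - e)))"
    using V by (intro member_le_sum nn) auto
  also have "\<dots> \<le> h (1 - e)"
    unfolding h_def by (rule member_le_sum[OF V(1) _ part_finite]) (intro sum_nonneg nn, auto)
  finally have "4 * real n \<le> h (1 - e)" by (simp add: e_def)
  moreover have "(real (card P) - 1) / (1 - e) \<le> real n / (1/2)"
    using k e by (intro frac_le) auto
  moreover have "real n / (1/2) = 2 * real n" "real n \<ge> 0" by simp_all
  ultimately have neg: "qmle_score n P (1 - e) \<le> 0" unfolding sc by argo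
  have "continuous_on {e..1 - e} (qmle_score n P)"
    unfolding sc[abs_def] h_def by (intro continuous_intros) (use e in auto)
  from IVT2'[OF neg pos _ this] e obtain x where "e \<le> x" "x \<le> 1 - e" "qmle_score n P x = 0" by auto
  with e show ?thesis by (intro exI[of _ x]) auto
qed

lemma qmle_root:
  assumes k: "1 < card P" "card P < n"
  shows "0 < qmle n P" "qmle n P < 1" "qmle_score n P (qmle n P) = 0"
proof -
  let ?Q = "\<lambda>x. 0 < x \<and> x < 1 \<and> qmle_score n P x = 0"
  have "\<exists>!x. ?Q x"
  proof (rule ex_ex1I)
    fix x y assume xy: "?Q x" "?Q y"
    then have "(x - y) * (block_sum (secant_wt x y) P - 1 / (x * y)) = 0"
      using qmle_score_secant[of x y] by auto
    moreover have "block_sum (secant_wt x y) P - 1 / (x * y) > 0"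
      using secant_ge[of x y] xy k by auto
    ultimately show "x = y" by simp
  qed (rule qmle_exists[OF k])
  then have "?Q (THE x. ?Q x)" by (rule theI')
  moreover have "qmle n P = (THE x. ?Q x)" using k by (simp add: qmle_def)
  ultimately show "0 < qmle n P" "qmle n P < 1" "qmle_score n P (qmle n P) = 0" by auto
qed

text \<open>The score at \<open>\<alpha>\<close> is the error of the estimator times a secant slope
  of size at least \<open>k - 1\<close>. The degenerate partitions, where the estimator is
  \<open>0\<close> or \<open>1\<close> by convention, satisfy the bound by direct computation.\<close>
lemma qmle_error_score:
  assumes a: "0 < \<alpha>" "\<alpha> < 1" and n: "n \<ge> 1"
  shows "real (card P) * \<bar>qmle n P - \<alpha>\<bar> \<le> 2 * \<bar>block_sum (score_wt \<alpha>) P\<bar> + 2 / \<alpha>"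
proof -
  have k1: "card P \<ge> 1" by (rule part_card_pos[OF n])
  consider "card P = 1" | "card P \<noteq> 1" "card P = n" | "1 < card P" "card P < n"
    using part_card_le k1 by linarith
  then show ?thesis
  proof cases
    case 1
    then have "real (card P) * \<bar>qmle n P - \<alpha>\<bar> = \<alpha>" using a by (simp add: qmle_def)
    also have "\<dots> \<le> 2 / \<alpha>" using a by (smt (verit, best) divide_less_eq_1_pos less_divide_eq)
    finally show ?thesis by simp
  next
    case 2
    have "(\<Sum>U\<in>P. card U - 1) = 0"
      using part_sum_card 2 part_block(4) by (subst sum_subtractf_nat) auto
    then have "card U = 1" if "U \<in> P" for U using part_finite part_block(4)[OF that] that by auto
    then have "block_sum (score_wt \<alpha>) P = real n / \<alpha>" using 2 by (simp add: block_sum_def)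
    moreover have "real (card P) * \<bar>qmle n P - \<alpha>\<bar> = real n * (1 - \<alpha>)" using 2 a by (simp add: qmle_def)
    moreover have "real n * (1 - \<alpha>) \<le> real n / \<alpha>"
    proof -
      have "(1 - \<alpha>) * \<alpha> \<le> 1 * 1" using a by (intro mult_mono) auto
      then have "1 - \<alpha> \<le> 1 / \<alpha>" using a by (simp add: field_simps)
      from mult_left_mono[OF this, of "real n"] show ?thesis by simp
    qed
    moreover have "real n / \<alpha> \<ge> 0" "2 / \<alpha> \<ge> 0" using a by simp_all
    ultimately show ?thesis by linarith
  next
    case 3
    note r = qmle_root[OF 3]
    let ?x = "qmle n P"
    have "qmle_score n P \<alpha> = (?x - \<alpha>) * (block_sum (secant_wt ?x \<alpha>) P - 1 / (?x * \<alpha>))"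
      using qmle_score_secant[of ?x \<alpha>] r a by simp
    then have "\<bar>qmle_score n P \<alpha>\<bar> = \<bar>?x - \<alpha>\<bar> * \<bar>block_sum (secant_wt ?x \<alpha>) P - 1 / (?x * \<alpha>)\<bar>"
      by (simp add: abs_mult)
    moreover have "real (card P) / 2 \<le> \<bar>block_sum (secant_wt ?x \<alpha>) P - 1 / (?x * \<alpha>)\<bar>"
      using secant_ge[of ?x \<alpha>] r a n 3 by auto
    ultimately have "\<bar>?x - \<alpha>\<bar> * (real (card P) / 2) \<le> \<bar>qmle_score n P \<alpha>\<bar>"
      by (metis mult_left_mono abs_ge_zero)
    also have "\<dots> \<le> \<bar>block_sum (score_wt \<alpha>) P\<bar> + 1 / \<alpha>"
      unfolding qmle_score_block_sum using a by (smt (verit) divide_pos_pos)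
    finally show ?thesis by (simp add: algebra_simps)
  qed
qed

lemma secant_info_diff:
  assumes a: "0 < \<alpha>" "\<alpha> < 1" and x: "\<bar>x - \<alpha>\<bar> \<le> min \<alpha> (1 - \<alpha>) / 2"
  shows "\<bar>secant_wt x \<alpha> j - info_wt \<alpha> j\<bar> \<le> \<bar>x - \<alpha>\<bar> * ((2 / \<alpha> + 2 / (1 - \<alpha>)) * info_wt \<alpha> j)"
proof -
  let ?K = "2 / \<alpha> + 2 / (1 - \<alpha>)"
  have "\<bar>x - \<alpha>\<bar> \<le> \<alpha> / 2" "\<bar>x - \<alpha>\<bar> \<le> (1 - \<alpha>) / 2" using x by simp_all
  then have x1: "x \<ge> \<alpha> / 2" "1 - x \<ge> (1 - \<alpha>) / 2" by argo+
  have gen: "\<bar>1 / (d * e) - 1 / e\<^sup>2\<bar> \<le> \<bar>x - \<alpha>\<bar> * (?K * (1 / e\<^sup>2))"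
    if "e > 0" "d > 0" "\<bar>e - d\<bar> = \<bar>x - \<alpha>\<bar>" "1 / d \<le> ?K" for d e :: real
  proof -
    have "1 / (d * e) - 1 / e\<^sup>2 = (e - d) * (1 / d * (1 / e\<^sup>2))" using that by (simp add: power2_eq_square field_simps)
    then have "\<bar>1 / (d * e) - 1 / e\<^sup>2\<bar> = \<bar>x - \<alpha>\<bar> * (1 / d * (1 / e\<^sup>2))" using that by (simp add: abs_mult)
    also have "\<dots> \<le> \<bar>x - \<alpha>\<bar> * (?K * (1 / e\<^sup>2))" using that by (intro mult_left_mono mult_right_mono) auto
    finally show ?thesis .
  qed
  have "secant_wt x \<alpha> j - info_wt \<alpha> j = (1 / (x * \<alpha>) - 1 / \<alpha>\<^sup>2)
     + (\<Sum>i\<in>{1..<j}. 1 / ((real i - x) * (real i - \<alpha>)) - 1 / (real i - \<alpha>)\<^sup>2)"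
    by (simp add: secant_wt_def info_wt_def sum_subtractf)
  also have "\<bar>\<dots>\<bar> \<le> \<bar>1 / (x * \<alpha>) - 1 / \<alpha>\<^sup>2\<bar> + (\<Sum>i\<in>{1..<j}. \<bar>1 / ((real i - x) * (real i - \<alpha>)) - 1 / (real i - \<alpha>)\<^sup>2\<bar>)"
    by (intro order_trans[OF abs_triangle_ineq] add_left_mono sum_abs)
  also have "\<dots> \<le> \<bar>x - \<alpha>\<bar> * (?K * (1 / \<alpha>\<^sup>2)) + (\<Sum>i\<in>{1..<j}. \<bar>x - \<alpha>\<bar> * (?K * (1 / (real i - \<alpha>)\<^sup>2)))"
  proof (intro add_mono sum_mono gen)
    have "1 / x \<le> 1 / (\<alpha> / 2)" using x1 a by (intro divide_left_mono) auto
    also have "\<dots> \<le> ?K" using a by simp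
    finally show "1 / x \<le> ?K" .
    fix i assume i: "i \<in> {1..<j}"
    then show "real i - \<alpha> > 0" "real i - x > 0" using x1 a by auto
    have "1 / (real i - x) \<le> 1 / ((1 - \<alpha>) / 2)" using x1 a i by (intro divide_left_mono) auto
    also have "\<dots> \<le> ?K" using a by simp
    finally show "1 / (real i - x) \<le> ?K" .
  qed (use a x1 in auto)
  also have "\<dots> = \<bar>x - \<alpha>\<bar> * (?K * info_wt \<alpha> j)"
    by (simp add: info_wt_def sum_distrib_left distrib_left)
  finally show ?thesis .
qed

text \<open>One Newton step: with \<open>c\<close> the Fisher information, the score is \<open>c
  k\<close> times the error of the estimator up to terms that are small because the observed
  information is close to \<open>c k\<close> and the secant slope is close to the observed
  information. The degenerate partitions are excluded by the hypothesis that the estimator is near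
  \<open>\<alpha>\<close>.\<close>
lemma qmle_linearization:
  assumes a: "0 < \<alpha>" "\<alpha> < 1" and n: "n \<ge> 1"
    and near: "\<bar>qmle n P - \<alpha>\<bar> \<le> min \<alpha> (1 - \<alpha>) / 2"
  shows "\<bar>c * real (card P) * (qmle n P - \<alpha>) - block_sum (score_wt \<alpha>) P\<bar>
    \<le> 1 / \<alpha> + \<bar>qmle n P - \<alpha>\<bar> * (\<bar>block_sum (info_wt \<alpha>) P - c * real (card P)\<bar> + 2 / \<alpha>\<^sup>2
       + \<bar>qmle n P - \<alpha>\<bar> * real (card P) * ((2 / \<alpha> + 2 / (1 - \<alpha>)) * (1 / \<alpha>\<^sup>2 + pi\<^sup>2 / 6 / (1 - \<alpha>)\<^sup>2)))"
    (is "_ \<le> 1 / \<alpha> + _ * (_ + _ + _ * _ * ?B)")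
proof -
  let ?x = "qmle n P"
  have "?x \<noteq> 0" "?x \<noteq> 1" using near a by auto
  then have k: "1 < card P" "card P < n"
    using part_card_le part_card_pos[OF n] by (auto simp: qmle_def split: if_splits)
  note r = qmle_root[OF k]
  let ?D = "block_sum (secant_wt ?x \<alpha>) P - 1 / (?x * \<alpha>)"
  have "qmle_score n P \<alpha> = (?x - \<alpha>) * ?D"
    using qmle_score_secant[of ?x \<alpha>] r a by simp
  then have e: "c * real (card P) * (?x - \<alpha>) - block_sum (score_wt \<alpha>) P = (?x - \<alpha>) * (c * real (card P) - ?D) - 1 / \<alpha>"
    unfolding qmle_score_block_sum by (simp add: algebra_simps)
  have "\<bar>block_sum (secant_wt ?x \<alpha>) P - block_sum (info_wt \<alpha>) P\<bar> \<le> (\<Sum>U\<in>P. \<bar>?x - \<alpha>\<bar> * ?B)"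
    unfolding block_sum_diff[symmetric] unfolding block_sum_def
  proof (intro order_trans[OF sum_abs] sum_mono)
    fix U
    show "\<bar>secant_wt ?x \<alpha> (card U) - info_wt \<alpha> (card U)\<bar> \<le> \<bar>?x - \<alpha>\<bar> * ?B"
      by (rule order_trans[OF secant_info_diff[OF a near]])
        (use a in \<open>intro mult_left_mono info_wt_bound; simp\<close>)
  qed
  moreover have "\<bar>1 / (?x * \<alpha>)\<bar> \<le> 2 / \<alpha>\<^sup>2"
  proof -
    have "\<bar>?x - \<alpha>\<bar> \<le> \<alpha> / 2" using near by simp
    then have "?x \<ge> \<alpha> / 2" by linarith
    then have "1 / (?x * \<alpha>) \<le> 1 / (\<alpha> / 2 * \<alpha>)" using a r by (intro divide_left_mono mult_right_mono) auto
    then show ?thesis using a r by (simp add: power2_eq_square)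
  qed
  ultimately have "\<bar>c * real (card P) - ?D\<bar> \<le> \<bar>block_sum (info_wt \<alpha>) P - c * real (card P)\<bar> + 2 / \<alpha>\<^sup>2 + \<bar>?x - \<alpha>\<bar> * real (card P) * ?B"
    unfolding sum_constant mult.assoc[symmetric] mult.commute[of "real (card P)" "\<bar>?x - \<alpha>\<bar>"] by linarith
  from mult_left_mono[OF this, of "\<bar>?x - \<alpha>\<bar>"]
  have "\<bar>(?x - \<alpha>) * (c * real (card P) - ?D)\<bar> \<le> \<bar>?x - \<alpha>\<bar> * (\<bar>block_sum (info_wt \<alpha>) P - c * real (card P)\<bar> + 2 / \<alpha>\<^sup>2 + \<bar>?x - \<alpha>\<bar> * real (card P) * ?B)"
    by (simp add: abs_mult)
  moreover have "\<bar>1 / \<alpha>\<bar> = 1 / \<alpha>" using a by simp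
  ultimately show ?thesis unfolding e by linarith
qed

end

section \<open>Gibbs weights and predictive probabilities\<close>

text \<open>The complement of the support is covered by the null sets of a countable base.\<close>
lemma AE_measure_supp:
  fixes \<mu> :: "'b::second_countable_topology measure"
  assumes sets: "sets \<mu> = sets borel" and supp: "measure_supp \<mu> \<subseteq> S"
  shows "AE x in \<mu>. x \<in> S"
proof -
  obtain B :: "'b set set" where B: "countable B" "topological_basis B"
    using ex_countable_basis by blast
  define N where "N = \<Union>{b\<in>B. emeasure \<mu> b = 0}"
  have "N \<in> null_sets \<mu>"
  proof -
    have "(\<Union>b\<in>{b \<in> B. emeasure \<mu> b = 0}. b) \<in> null_sets \<mu>"
      using B sets by (intro null_sets_UN') (auto simp: null_sets_def topological_basis_open)
    then show ?thesis by (simp add: N_def)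
  qed
  moreover have "{x \<in> space \<mu>. x \<notin> S} \<subseteq> N"
  proof
    fix x assume "x \<in> {x \<in> space \<mu>. x \<notin> S}"
    then have "x \<notin> measure_supp \<mu>" using supp by auto
    then obtain U where U: "open U" "x \<in> U" "emeasure \<mu> U = 0"
      by (auto simp: measure_supp_def zero_less_iff_neq_zero)
    then obtain b where b: "b \<in> B" "x \<in> b" "b \<subseteq> U"
      using topological_basisE[OF B(2)] by metis
    have "emeasure \<mu> b \<le> emeasure \<mu> U"
      using b U sets by (intro emeasure_mono) auto
    then show "x \<in> N" using b U by (auto simp: N_def)
  qed
  ultimately show ?thesis by (rule AE_I')
qed

locale gibbs_weights =
  fixes \<alpha> lo hi :: real and \<mu> :: "real measure"
  assumes alpha: "0 < \<alpha>" "\<alpha> < 1"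
    and prob_mu: "prob_space \<mu>" and sets_mu: "sets \<mu> = sets borel"
    and supp: "measure_supp \<mu> \<subseteq> {lo..hi}"
    and lo: "- \<alpha> < lo" "lo \<le> 0" and hi: "0 \<le> hi"
begin

sublocale mu: prob_space \<mu> by (rule prob_mu)

lemma AE_range: "AE \<theta> in \<mu>. lo \<le> \<theta> \<and> \<theta> \<le> hi"
  using AE_measure_supp[OF sets_mu supp] by simp

abbreviation "v n k \<equiv> gibbs_weight \<alpha> \<mu> n k"

lemma theta_pos:
  assumes "lo \<le> \<theta>" "i \<ge> 1" shows "\<theta> + real i * \<alpha> > 0" "\<theta> + real i > 0"
proof -
  have "1 * \<alpha> \<le> real i * \<alpha>" using assms alpha by (intro mult_right_mono) auto
  then show "\<theta> + real i * \<alpha> > 0" using assms lo by linarith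
  show "\<theta> + real i > 0" using assms lo alpha by linarith
qed

lemma pd_measurable_borel [measurable]: "(\<lambda>\<theta>. pd_weight \<alpha> \<theta> n k) \<in> borel_measurable borel"
  unfolding pd_weight_def by measurable

lemma pd_measurable [measurable]: "(\<lambda>\<theta>. pd_weight \<alpha> \<theta> n k) \<in> borel_measurable \<mu>"
  unfolding pd_weight_def measurable_cong_sets[OF sets_mu refl] by measurable

lemma pd_bounds:
  obtains c C where "c > 0" "\<And>\<theta>. lo \<le> \<theta> \<Longrightarrow> \<theta> \<le> hi \<Longrightarrow> c \<le> pd_weight \<alpha> \<theta> n k \<and> pd_weight \<alpha> \<theta> n k \<le> C"
proof
  let ?c = "(\<Prod>i\<in>{1..<k}. lo + real i * \<alpha>) / (\<Prod>i\<in>{1..<n}. hi + real i)"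
  let ?C = "(\<Prod>i\<in>{1..<k}. hi + real i * \<alpha>) / (\<Prod>i\<in>{1..<n}. lo + real i)"
  have l: "lo \<le> lo" "lo \<le> hi" using lo hi by auto
  show "?c > 0" using theta_pos[OF l(1)] theta_pos[OF l(2)] by (intro divide_pos_pos prod_pos) auto
  show "?c \<le> pd_weight \<alpha> \<theta> n k \<and> pd_weight \<alpha> \<theta> n k \<le> ?C" if t: "lo \<le> \<theta>" "\<theta> \<le> hi" for \<theta>
    unfolding pd_weight_def using theta_pos[OF l(1)] theta_pos[OF l(2)] theta_pos[OF t(1)] t
    by (intro conjI frac_le prod_mono prod_nonneg prod_pos) (auto intro: less_imp_le)
qed

lemma pd_integrable:
  assumes [measurable]: "g \<in> borel_measurable borel" and g: "\<And>\<theta>. lo \<le> \<theta> \<Longrightarrow> \<theta> \<le> hi \<Longrightarrow> \<bar>g \<theta>\<bar> \<le> B"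
  shows "integrable \<mu> (\<lambda>\<theta>. g \<theta> * pd_weight \<alpha> \<theta> n k)"
proof -
  obtain c C where cC: "c > 0" "\<And>\<theta>. lo \<le> \<theta> \<Longrightarrow> \<theta> \<le> hi \<Longrightarrow> c \<le> pd_weight \<alpha> \<theta> n k \<and> pd_weight \<alpha> \<theta> n k \<le> C"
    by (rule pd_bounds) blast
  have [measurable]: "g \<in> borel_measurable \<mu>" unfolding measurable_cong_sets[OF sets_mu refl] by (rule assms)
  show ?thesis
  proof (rule mu.integrable_const_bound[of _ "B * C"])
    show "AE \<theta> in \<mu>. norm (g \<theta> * pd_weight \<alpha> \<theta> n k) \<le> B * C"
      using AE_range
    proof eventually_elim
      case (elim \<theta>)
      then show ?case using g[of \<theta>] cC(2)[of \<theta>] cC(1) by (auto simp: abs_mult intro!: mult_mono)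
    qed
  qed measurable
qed

lemma pd_integrable': "integrable \<mu> (\<lambda>\<theta>. pd_weight \<alpha> \<theta> n k)"
  "integrable \<mu> (\<lambda>\<theta>. \<theta> * pd_weight \<alpha> \<theta> n k)"
proof -
  show "integrable \<mu> (\<lambda>\<theta>. pd_weight \<alpha> \<theta> n k)" using pd_integrable[of "\<lambda>_. 1" 1] by simp
  have "\<bar>\<theta>\<bar> \<le> 1 + hi" if "lo \<le> \<theta>" "\<theta> \<le> hi" for \<theta> using that lo alpha hi by linarith
  then show "integrable \<mu> (\<lambda>\<theta>. \<theta> * pd_weight \<alpha> \<theta> n k)"
    by (intro pd_integrable[where B = "1 + hi"]) auto
qed

lemma v_pos: "v n k > 0"
proof -
  obtain c C where cC: "c > 0" "\<And>\<theta>. lo \<le> \<theta> \<Longrightarrow> \<theta> \<le> hi \<Longrightarrow> c \<le> pd_weight \<alpha> \<theta> n k \<and> pd_weight \<alpha> \<theta> n k \<le> C"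
    by (rule pd_bounds) blast
  have "c \<le> v n k" unfolding gibbs_weight_def
    by (rule mu.integral_ge_const[OF pd_integrable'(1)]) (rule eventually_mono[OF AE_range], use cC(2) in blast)
  with cC(1) show ?thesis by simp
qed

text \<open>The moment of \<open>\<theta>\<close> that enters the recursions of the weights. After
  division by \<open>v n k\<close> it becomes \<open>bias\<close>, the posterior mean of
  \<open>\<theta> / (\<theta> + n)\<close>, while \<open>rate\<close> is the posterior mean of
  \<open>1 / (\<theta> + n)\<close>. For \<open>\<theta> = 0\<close> they are \<open>0\<close> and
  \<open>1 / n\<close>.\<close>
definition "tilt n k = (LINT \<theta>|\<mu>. \<theta> * pd_weight \<alpha> \<theta> (Suc n) k)"

lemma weight_rec:
  assumes "n \<ge> 1" "k \<ge> 1"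
  shows "v n k = tilt n k + real n * v (Suc n) k"
    "v (Suc n) (Suc k) = tilt n k + real k * \<alpha> * v (Suc n) k"
proof -
  have "AE \<theta> in \<mu>. pd_weight \<alpha> \<theta> n k = \<theta> * pd_weight \<alpha> \<theta> (Suc n) k + real n * pd_weight \<alpha> \<theta> (Suc n) k"
    using AE_range
  proof eventually_elim
    case (elim \<theta>)
    then have "\<theta> + real n > 0" using theta_pos assms by auto
    then have "pd_weight \<alpha> \<theta> n k = (\<theta> + real n) * pd_weight \<alpha> \<theta> (Suc n) k"
      using assms by (simp add: pd_weight_def)
    then show ?case by (simp add: distrib_right)
  qed
  then have "v n k = (LINT \<theta>|\<mu>. \<theta> * pd_weight \<alpha> \<theta> (Suc n) k + real n * pd_weight \<alpha> \<theta> (Suc n) k)"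
    unfolding gibbs_weight_def by (intro integral_cong_AE) (auto simp: measurable_cong_sets[OF sets_mu refl])
  then show "v n k = tilt n k + real n * v (Suc n) k"
    by (simp add: tilt_def gibbs_weight_def pd_integrable')
  have "pd_weight \<alpha> \<theta> (Suc n) (Suc k) = \<theta> * pd_weight \<alpha> \<theta> (Suc n) k + real k * \<alpha> * pd_weight \<alpha> \<theta> (Suc n) k" for \<theta>
    using assms by (simp add: pd_weight_def field_simps add_divide_distrib)
  then show "v (Suc n) (Suc k) = tilt n k + real k * \<alpha> * v (Suc n) k"
    by (simp add: tilt_def gibbs_weight_def pd_integrable')
qed

lemma tilt_bounds: "lo * v (Suc n) k \<le> tilt n k" "tilt n k \<le> hi * v (Suc n) k"
proof -
  have pd0: "pd_weight \<alpha> \<theta> (Suc n) k \<ge> 0" if "lo \<le> \<theta>" "\<theta> \<le> hi" for \<theta>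
    using that by (metis less_imp_le order_less_le_trans pd_bounds)
  have le: "AE \<theta> in \<mu>. lo * pd_weight \<alpha> \<theta> (Suc n) k \<le> \<theta> * pd_weight \<alpha> \<theta> (Suc n) k"
    "AE \<theta> in \<mu>. \<theta> * pd_weight \<alpha> \<theta> (Suc n) k \<le> hi * pd_weight \<alpha> \<theta> (Suc n) k"
    using AE_range by (eventually_elim, intro mult_right_mono pd0; simp)+
  show "lo * v (Suc n) k \<le> tilt n k"
    unfolding tilt_def gibbs_weight_def integral_mult_right_zero[symmetric]
    by (rule integral_mono_AE[OF _ _ le(1)]) (auto simp: pd_integrable')
  show "tilt n k \<le> hi * v (Suc n) k"
    unfolding tilt_def gibbs_weight_def integral_mult_right_zero[symmetric]
    by (rule integral_mono_AE[OF _ _ le(2)]) (auto simp: pd_integrable')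
qed

definition "rate n k = v (Suc n) k / v n k"
definition "bias n k = tilt n k / v n k"

text \<open>A single constant for all bounds of order \<open>1 / n\<close> on the predictive
  probabilities.\<close>
definition "D = (1 + hi) / (1 - \<alpha>)"

lemma D_ge: "D \<ge> 1" "D > 0"
  using alpha hi by (auto simp: D_def)

lemma bias_eq: "n \<ge> 1 \<Longrightarrow> k \<ge> 1 \<Longrightarrow> bias n k = 1 - real n * rate n k"
  using weight_rec(1)[of n k] v_pos[of n k] by (simp add: bias_def rate_def field_simps)

lemma rate_pos: "rate n k > 0"
  using v_pos by (simp add: rate_def)

lemma rate_bound:
  assumes "n \<ge> 1" "k \<ge> 1" shows "rate n k \<le> 1 / (real n * (1 - \<alpha>))" "\<bar>bias n k\<bar> \<le> (1 + hi) * rate n k"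
proof -
  note lower = tilt_bounds(1)[of n k]
  have "tilt n k \<le> hi * v (Suc n) k" by (rule tilt_bounds)
  moreover have "(-1) * v (Suc n) k \<le> lo * v (Suc n) k"
    using lo alpha v_pos[of "Suc n" k] by (intro mult_right_mono) auto
  moreover have "0 \<le> hi * v (Suc n) k" using hi v_pos[of "Suc n" k] by simp
  ultimately have "\<bar>tilt n k\<bar> \<le> (1 + hi) * v (Suc n) k"
    using lower v_pos[of "Suc n" k] unfolding distrib_right abs_le_iff by linarith
  then show "\<bar>bias n k\<bar> \<le> (1 + hi) * rate n k"
    using v_pos[of n k] by (simp add: bias_def rate_def divide_right_mono)
  have "1 * \<alpha> \<le> real n * \<alpha>" using alpha assms by (intro mult_right_mono) auto
  then have "real n * (1 - \<alpha>) \<le> real n + lo" using lo unfolding right_diff_distrib by linarith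
  then have "real n * (1 - \<alpha>) * v (Suc n) k \<le> (real n + lo) * v (Suc n) k"
    using v_pos[of "Suc n" k] by (intro mult_right_mono) auto
  also have "\<dots> \<le> v n k" using weight_rec(1)[OF assms] lower by (simp add: algebra_simps)
  finally show "rate n k \<le> 1 / (real n * (1 - \<alpha>))"
    using v_pos[of n k] assms alpha by (simp add: rate_def field_simps)
qed

lemma rate_D: assumes "n \<ge> 1" "k \<ge> 1" shows "rate n k \<le> D / real n" "\<bar>bias n k\<bar> \<le> D / real n"
proof -
  have 1: "(1 + hi) * rate n k \<le> (1 + hi) * (1 / (real n * (1 - \<alpha>)))"
    using rate_bound(1)[OF assms] hi by (intro mult_left_mono) auto
  have 2: "(1 + hi) * (1 / (real n * (1 - \<alpha>))) = D / real n" by (simp add: D_def)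
  show "\<bar>bias n k\<bar> \<le> D / real n" using rate_bound(2)[OF assms] 1 2 by linarith
  have "1 * rate n k \<le> (1 + hi) * rate n k" using hi rate_pos[of n k] by (intro mult_right_mono) auto
  then show "rate n k \<le> D / real n" using 1 2 by linarith
qed

text \<open>Together with \<open>pred_block_eq\<close> this exhibits the predictive probabilities as
  those of the case \<open>\<theta> = 0\<close> up to corrections of relative order \<open>1 /
  n\<close>.\<close>
lemma pred_new_eq:
  assumes "n \<ge> 1" "card P \<ge> 1"
  shows "pred_new \<alpha> \<mu> n P = \<alpha> * real (card P) * rate n (card P) + bias n (card P)"
  using weight_rec(2)[OF assms] by (simp add: pred_new_def rate_def bias_def add_divide_distrib mult_ac)

lemma pred_block_eq: "pred_block \<alpha> \<mu> n P U = rate n (card P) * (real (card U) - \<alpha>)"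
  by (simp add: pred_block_def rate_def)

text \<open>The map \<open>\<theta> \<mapsto> (\<theta> + k \<alpha>) / (\<theta> + n)\<close> is
  increasing because \<open>k \<alpha> \<le> n\<close>, so its posterior mean is at least its value at
  \<open>lo\<close>. The precise lower bound matters for the negative moments of the number of
  blocks.\<close>
lemma pred_new_ge:
  assumes n: "n \<ge> 1" and k: "card P \<ge> 1" "card P \<le> n"
  shows "pred_new \<alpha> \<mu> n P \<ge> (lo + real (card P) * \<alpha>) / (lo + real n)"
proof -
  let ?k = "card P"
  have kn: "real ?k * \<alpha> \<le> real n" using k alpha by (smt (verit) mult_left_le of_nat_0_le_iff of_nat_mono)
  have "(lo + real ?k * \<alpha>) * v n ?k \<le> (lo + real n) * v (Suc n) (Suc ?k)"
  proof -
    have "lo * v (Suc n) ?k \<le> tilt n ?k" by (rule tilt_bounds)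
    then have "(real n - real ?k * \<alpha>) * (lo * v (Suc n) ?k) \<le> (real n - real ?k * \<alpha>) * tilt n ?k"
      using kn by (intro mult_left_mono) auto
    then show ?thesis unfolding weight_rec[OF n k(1)] by (simp add: algebra_simps)
  qed
  then show ?thesis
    using v_pos[of n ?k] theta_pos(2)[of lo n] n by (simp add: pred_new_def field_simps)
qed

lemma pred_new_pos:
  assumes n: "n \<ge> 1" and k: "card P \<ge> 1"
  shows "pred_new \<alpha> \<mu> n P > 0"
  using v_pos by (simp add: pred_new_def)

text \<open>Replacing \<open>\<alpha>\<close> by the estimator moves mass \<open>(k / n) \<bar>qmle
  - \<alpha>\<bar>\<close> between the entry of a new block and the \<open>k\<close> other entries,
  and all remaining differences are of order \<open>1 / n\<close> in total. The total variation error
  is therefore governed by the estimator alone.\<close>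
lemma tv_error_approx:
  assumes part: "partition_on {1..n} P" and n: "n \<ge> 1"
  shows "\<bar>tv_error \<alpha> \<mu> n P - real (card P) / real n * \<bar>qmle n P - \<alpha>\<bar>\<bar> \<le> 2 * D / real n"
proof -
  let ?k = "card P" and ?a = "qmle n P"
  let ?r = "rate n ?k" and ?b = "bias n ?k"
  note k = part_card_pos[OF part n] part_card_le[OF part]
  have r: "?r = (1 - ?b) / real n" using bias_eq[OF n k(1)] n by (simp add: field_simps)
  have near: "\<bar>\<bar>x\<bar> - \<bar>y\<bar>\<bar> \<le> \<bar>x - y\<bar>" for x y :: real by linarith
  have 1: "\<bar>\<bar>est_new n P - pred_new \<alpha> \<mu> n P\<bar> - real ?k / real n * \<bar>?a - \<alpha>\<bar>\<bar> \<le> 2 * \<bar>?b\<bar>"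
  proof -
    have e: "est_new n P - pred_new \<alpha> \<mu> n P - real ?k / real n * (?a - \<alpha>) = ?b * (\<alpha> * (real ?k / real n) - 1)"
      unfolding est_new_def pred_new_eq[OF n k(1)] r using n by (simp add: field_simps)
    have e2: "real ?k / real n * \<bar>?a - \<alpha>\<bar> = \<bar>real ?k / real n * (?a - \<alpha>)\<bar>" by (simp add: abs_mult)
    have "\<bar>\<bar>est_new n P - pred_new \<alpha> \<mu> n P\<bar> - real ?k / real n * \<bar>?a - \<alpha>\<bar>\<bar> \<le> \<bar>?b * (\<alpha> * (real ?k / real n) - 1)\<bar>"
      unfolding e2 e[symmetric] by (rule near)
    also have "\<dots> \<le> \<bar>?b\<bar> * 2"
      unfolding abs_mult
    proof (rule mult_left_mono)
      have "real ?k / real n \<le> 1" "0 \<le> real ?k / real n" using k n by auto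
      then have "\<alpha> * (real ?k / real n) \<le> 1 * 1" using alpha by (intro mult_mono) auto
      moreover have "0 \<le> \<alpha> * (real ?k / real n)" using alpha by simp
      ultimately show "\<bar>\<alpha> * (real ?k / real n) - 1\<bar> \<le> 2" by linarith
    qed simp
    finally show ?thesis by simp
  qed
  have 2: "\<bar>(\<Sum>U\<in>P. \<bar>est_block n P U - pred_block \<alpha> \<mu> n P U\<bar>) - real ?k / real n * \<bar>?a - \<alpha>\<bar>\<bar> \<le> \<bar>?b\<bar>"
  proof -
    have "(\<Sum>U\<in>P. \<bar>est_block n P U - pred_block \<alpha> \<mu> n P U\<bar>) - real ?k / real n * \<bar>?a - \<alpha>\<bar>
       = (\<Sum>U\<in>P. \<bar>est_block n P U - pred_block \<alpha> \<mu> n P U\<bar> - \<bar>(\<alpha> - ?a) / real n\<bar>)"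
      by (simp add: sum_subtractf abs_minus_commute)
    also have "\<bar>\<dots>\<bar> \<le> (\<Sum>U\<in>P. \<bar>?b\<bar> / real n * real (card U))"
    proof (intro order_trans[OF sum_abs] sum_mono)
      fix U assume U: "U \<in> P"
      have e: "est_block n P U - pred_block \<alpha> \<mu> n P U - (\<alpha> - ?a) / real n = ?b / real n * (real (card U) - \<alpha>)"
        unfolding est_block_def pred_block_eq r using n by (simp add: field_simps)
      have "\<bar>\<bar>est_block n P U - pred_block \<alpha> \<mu> n P U\<bar> - \<bar>(\<alpha> - ?a) / real n\<bar>\<bar> \<le> \<bar>?b / real n * (real (card U) - \<alpha>)\<bar>"
        unfolding e[symmetric] by (rule near)
      also have "\<bar>?b / real n * (real (card U) - \<alpha>)\<bar> \<le> \<bar>?b\<bar> / real n * real (card U)"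
      proof -
        have "\<bar>real (card U) - \<alpha>\<bar> \<le> real (card U)" using part_block(4)[OF part U] alpha by auto
        from mult_left_mono[OF this, of "\<bar>?b\<bar> / real n"] show ?thesis by (simp add: abs_mult)
      qed
      finally show "\<bar>\<bar>est_block n P U - pred_block \<alpha> \<mu> n P U\<bar> - \<bar>(\<alpha> - ?a) / real n\<bar>\<bar> \<le> \<bar>?b\<bar> / real n * real (card U)" .
    qed
    also have "\<dots> = \<bar>?b\<bar> / real n * real (\<Sum>U\<in>P. card U)" by (simp only: of_nat_sum sum_distrib_left)
    also have "\<dots> = \<bar>?b\<bar>" using part_sum_card[OF part] n by simp
    finally show ?thesis .
  qed
  have "\<bar>?b\<bar> \<le> D / real n" by (rule rate_D(2)[OF n k(1)])
  moreover have "2 * D / real n = 2 * (D / real n)" by simp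
  ultimately show ?thesis using 1 2 D_ge unfolding tv_error_def by argo
qed

end

section \<open>Averaging over one step of the chain\<close>

text \<open>The conditional expectation of \<open>f\<close> of the next partition, given that the
  present one is \<open>P\<close>.\<close>
definition step_mean ::
  "real \<Rightarrow> real measure \<Rightarrow> nat \<Rightarrow> (nat set set \<Rightarrow> 'b::real_vector) \<Rightarrow> nat set set \<Rightarrow> 'b" where
  "step_mean \<alpha> \<mu> n f P = pred_new \<alpha> \<mu> n P *\<^sub>R f (open_block (Suc n) P)
     + (\<Sum>U\<in>P. pred_block \<alpha> \<mu> n P U *\<^sub>R f (join_block (Suc n) U P))"

locale gibbs_model = gibbs_weights \<alpha> lo hi \<mu> + gibbs_partition M \<alpha> \<mu> Part
  for \<alpha> lo hi :: real and \<mu> :: "real measure" and M :: "'a measure" and Part :: "nat \<Rightarrow> 'a \<Rightarrow> nat set set"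
begin

lemma Part_1: "\<omega> \<in> space M \<Longrightarrow> Part (Suc 0) \<omega> = {{1}}"
  using init by simp

lemma Part_partition:
  assumes "n \<ge> 1" "\<omega> \<in> space M" shows "partition_on {1..n} (Part n \<omega>)"
  using assms(1)
proof (induction n rule: nat_induct_at_least)
  case base
  then show ?case using Part_1[OF assms(2)] by (simp add: partition_on_space)
next
  case (Suc n)
  then show ?case using step[OF Suc(1) assms(2)] partition_on_open partition_on_join by auto
qed

lemma Part_forget:
  assumes "n \<ge> 1" "\<omega> \<in> space M" shows "forget (Suc n) (Part (Suc n) \<omega>) = Part n \<omega>"
  using step[OF assms] Part_partition[OF assms] forget_open forget_join by auto

lemma measurable_Part [measurable]: "n \<ge> 1 \<Longrightarrow> Part n \<in> measurable M (count_space UNIV)"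
  by (rule measurable_partition)

text \<open>Measurability with respect to \<open>Part n\<close>. As \<open>Part n\<close> determines
  the earlier partitions, these variables form the increasing filtration of the chain.\<close>
definition adapted :: "nat \<Rightarrow> ('a \<Rightarrow> 'c) \<Rightarrow> bool" where
  "adapted n H \<longleftrightarrow> (\<exists>h. \<forall>\<omega>\<in>space M. H \<omega> = h (Part n \<omega>))"

lemma adapted_Suc: assumes "n \<ge> 1" "adapted n H" shows "adapted (Suc n) H"
proof -
  obtain h where "\<forall>\<omega>\<in>space M. H \<omega> = h (Part n \<omega>)" using assms by (auto simp: adapted_def)
  then show ?thesis unfolding adapted_def
    by (intro exI[of _ "\<lambda>P. h (forget (Suc n) P)"]) (use Part_forget[OF assms(1)] in auto)
qed

lemma adapted_mono: 
  assumes "1 \<le> m" "m \<le> n" "adapted m H" shows "adapted n H"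
  using assms(2,1,3) by (induction n rule: dec_induct) (auto intro: adapted_Suc)

lemma adapted_Part: "adapted n (\<lambda>\<omega>. F (Part n \<omega>))"
  by (auto simp: adapted_def)

lemma adapted_Part_le: "1 \<le> m \<Longrightarrow> m \<le> n \<Longrightarrow> adapted n (\<lambda>\<omega>. F (Part m \<omega>))"
  using adapted_mono adapted_Part by blast

lemma adapted_const: "adapted n (\<lambda>_. c)"
  by (auto simp: adapted_def)

lemma adapted_comp2:
  assumes "adapted n G" "adapted n H" shows "adapted n (\<lambda>\<omega>. f (G \<omega>) (H \<omega>))"
proof -
  obtain g h where "\<forall>\<omega>\<in>space M. G \<omega> = g (Part n \<omega>)" "\<forall>\<omega>\<in>space M. H \<omega> = h (Part n \<omega>)"
    using assms unfolding adapted_def by metis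
  then show ?thesis unfolding adapted_def by (intro exI[of _ "\<lambda>P. f (g P) (h P)"]) auto
qed

lemma adapted_comp: "adapted n H \<Longrightarrow> adapted n (\<lambda>\<omega>. f (H \<omega>))"
  using adapted_comp2[of n H H "\<lambda>x _. f x"] by simp

lemma finite_partitions: "finite {P. partition_on {1..n::nat} P}"
  by (rule finitely_many_partition_on) simp

lemma adapted_measurable:
  fixes H :: "'a \<Rightarrow> 'b::topological_space"
  assumes "n \<ge> 1" "adapted n H" shows "H \<in> borel_measurable M"
proof -
  obtain h where h: "\<And>\<omega>. \<omega> \<in> space M \<Longrightarrow> H \<omega> = h (Part n \<omega>)" using assms by (auto simp: adapted_def)
  have "(\<lambda>\<omega>. h (Part n \<omega>)) \<in> borel_measurable M"
    using measurable_Part[OF assms(1)] by (rule measurable_compose) simp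
  then show ?thesis using h by (simp cong: measurable_cong)
qed

lemma adapted_bounded:
  fixes H :: "'a \<Rightarrow> 'b::real_normed_vector"
  assumes "n \<ge> 1" "adapted n H" obtains B where "\<And>\<omega>. \<omega> \<in> space M \<Longrightarrow> norm (H \<omega>) \<le> B"
proof -
  obtain h where h: "\<And>\<omega>. \<omega> \<in> space M \<Longrightarrow> H \<omega> = h (Part n \<omega>)" using assms by (auto simp: adapted_def)
  have "norm (H \<omega>) \<le> (\<Sum>P\<in>{P. partition_on {1..n} P}. norm (h P))" if "\<omega> \<in> space M" for \<omega>
    unfolding h[OF that]
    by (rule member_le_sum[OF _ _ finite_partitions]) (use Part_partition[OF assms(1) that] in auto)
  then show ?thesis by (rule that)
qed

lemma adapted_integrable:
  fixes H :: "'a \<Rightarrow> 'b::{banach, second_countable_topology}"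
  assumes "n \<ge> 1" "adapted n H" shows "integrable M H"
proof -
  obtain B where "\<And>\<omega>. \<omega> \<in> space M \<Longrightarrow> norm (H \<omega>) \<le> B" by (rule adapted_bounded[OF assms]) blast
  then show ?thesis by (intro integrable_const_bound[of _ B] adapted_measurable[OF assms]) auto
qed

lemma Part_integrable:
  fixes F :: "nat set set \<Rightarrow> 'b::{banach, second_countable_topology}"
  assumes "n \<ge> 1" shows "integrable M (\<lambda>\<omega>. F (Part n \<omega>))"
  by (rule adapted_integrable[OF assms adapted_Part])

lemma expectation_Part:
  fixes F :: "nat set set \<Rightarrow> 'b::{banach, second_countable_topology}"
  assumes "n \<ge> 1"
  shows "(LINT \<omega>|M. F (Part n \<omega>)) = (\<Sum>P\<in>{P. partition_on {1..n} P}. prob {\<omega>\<in>space M. Part n \<omega> = P} *\<^sub>R F P)"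
proof -
  have [measurable]: "{\<omega>\<in>space M. Part n \<omega> = P} \<in> events" for P using assms by measurable
  have "(LINT \<omega>|M. F (Part n \<omega>)) =
     (LINT \<omega>|M. (\<Sum>P\<in>{P. partition_on {1..n} P}. indicat_real {\<omega>\<in>space M. Part n \<omega> = P} \<omega> *\<^sub>R F P))"
  proof (rule Bochner_Integration.integral_cong[OF refl])
    fix \<omega> assume w: "\<omega> \<in> space M"
    have "(\<Sum>P\<in>{P. partition_on {1..n} P}. indicat_real {\<omega>\<in>space M. Part n \<omega> = P} \<omega> *\<^sub>R F P)
       = (\<Sum>P\<in>{P. partition_on {1..n} P}. if P = Part n \<omega> then F P else 0)"
      using w by (intro sum.cong) auto
    also have "\<dots> = F (Part n \<omega>)"
      using Part_partition[OF assms w] finite_partitions by (simp add: sum.delta)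
    finally show "F (Part n \<omega>) = (\<Sum>P\<in>{P. partition_on {1..n} P}. indicat_real {\<omega>\<in>space M. Part n \<omega> = P} \<omega> *\<^sub>R F P)" by simp
  qed
  also have "\<dots> = (\<Sum>P\<in>{P. partition_on {1..n} P}. prob {\<omega>\<in>space M. Part n \<omega> = P} *\<^sub>R F P)"
    by (subst Bochner_Integration.integral_sum) (auto intro!: integrable_real_indicator simp: emeasure_eq_measure)
  finally show ?thesis .
qed

lemma joint_prob:
  assumes n: "n \<ge> 1"
  shows "prob {\<omega>\<in>space M. Part n \<omega> = P \<and> Part (Suc n) \<omega> = open_block (Suc n) P}
     = prob {\<omega>\<in>space M. Part n \<omega> = P} * pred_new \<alpha> \<mu> n P"
    and "U \<in> P \<Longrightarrow> prob {\<omega>\<in>space M. Part n \<omega> = P \<and> Part (Suc n) \<omega> = join_block (Suc n) U P}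
     = prob {\<omega>\<in>space M. Part n \<omega> = P} * pred_block \<alpha> \<mu> n P U"
proof -
  have [measurable]: "{\<omega>\<in>space M. Part n \<omega> = P} \<in> events" using n by measurable
  have z: "prob {\<omega>\<in>space M. Part n \<omega> = P \<and> Q \<omega>} = 0" if "\<not> prob {\<omega>\<in>space M. Part n \<omega> = P} > 0" for Q
  proof -
    have "prob {\<omega>\<in>space M. Part n \<omega> = P \<and> Q \<omega>} \<le> prob {\<omega>\<in>space M. Part n \<omega> = P}"
      by (rule finite_measure_mono) auto
    then show ?thesis using that measure_nonneg[of M "{\<omega>\<in>space M. Part n \<omega> = P \<and> Q \<omega>}"] by linarith
  qed
  have z0: "prob {\<omega>\<in>space M. Part n \<omega> = P} = 0" if "\<not> prob {\<omega>\<in>space M. Part n \<omega> = P} > 0"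
    using that measure_nonneg[of M "{\<omega>\<in>space M. Part n \<omega> = P}"] by linarith
  have eq: "{\<omega>\<in>space M. R \<omega> \<and> Part n \<omega> = P} = {\<omega>\<in>space M. Part n \<omega> = P \<and> R \<omega>}" for R by auto
  show "prob {\<omega>\<in>space M. Part n \<omega> = P \<and> Part (Suc n) \<omega> = open_block (Suc n) P}
     = prob {\<omega>\<in>space M. Part n \<omega> = P} * pred_new \<alpha> \<mu> n P"
    using prob_new[OF n, of P] z z0 unfolding cond_prob_def eq
    by (cases "prob {\<omega>\<in>space M. Part n \<omega> = P} > 0") (auto simp: field_simps)
  show "prob {\<omega>\<in>space M. Part n \<omega> = P \<and> Part (Suc n) \<omega> = join_block (Suc n) U P}
     = prob {\<omega>\<in>space M. Part n \<omega> = P} * pred_block \<alpha> \<mu> n P U" if "U \<in> P"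
    using prob_block[OF n _ that] z z0 unfolding cond_prob_def eq
    by (cases "prob {\<omega>\<in>space M. Part n \<omega> = P} > 0") (auto simp: field_simps)
qed

abbreviation "smean n \<equiv> step_mean \<alpha> \<mu> n"

text \<open>The tower property for one step of the chain, with an arbitrary adapted variable
  \<open>H\<close> carrying the past. Since \<open>Part n\<close> has finitely many values, the
  expectation is a finite sum over pairs of consecutive partitions.\<close>
lemma one_step:
  fixes f :: "'c \<Rightarrow> nat set set \<Rightarrow> nat set set \<Rightarrow> 'b::{banach, second_countable_topology}"
  assumes n: "n \<ge> 1" and H: "adapted n H"
  shows "(LINT \<omega>|M. f (H \<omega>) (Part n \<omega>) (Part (Suc n) \<omega>)) = (LINT \<omega>|M. smean n (f (H \<omega>) (Part n \<omega>)) (Part n \<omega>))"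
proof -
  obtain h where h: "\<And>\<omega>. \<omega> \<in> space M \<Longrightarrow> H \<omega> = h (Part n \<omega>)" using H by (auto simp: adapted_def)
  define g where "g P = f (h P) P" for P
  let ?Ps = "{P. partition_on {1..n} P}"
  have n': "Suc n \<ge> 1" by simp
  note [measurable] = measurable_Part[OF n] measurable_Part[OF n']
  let ?I = "\<lambda>P P' \<omega>. indicat_real {\<omega>\<in>space M. Part n \<omega> = P \<and> Part (Suc n) \<omega> = P'} \<omega>"
  have pt: "g (Part n \<omega>) (Part (Suc n) \<omega>) = (\<Sum>P\<in>?Ps. ?I P (open_block (Suc n) P) \<omega> *\<^sub>R g P (open_block (Suc n) P)
        + (\<Sum>U\<in>P. ?I P (join_block (Suc n) U P) \<omega> *\<^sub>R g P (join_block (Suc n) U P)))" (is "_ = sum ?R ?Ps")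
    if w: "\<omega> \<in> space M" for \<omega>
  proof -
    let ?P = "Part n \<omega>"
    note part = Part_partition[OF n w]
    have "sum ?R ?Ps = (\<Sum>P\<in>?Ps. if P = ?P then ?R P else 0)"
      by (rule sum.cong) (auto intro!: sum.neutral)
    also have "\<dots> = ?R ?P" using part finite_partitions by (simp add: sum.delta)
    also have "\<dots> = g ?P (Part (Suc n) \<omega>)"
    proof -
      consider "Part (Suc n) \<omega> = open_block (Suc n) ?P"
        | V where "V \<in> ?P" "Part (Suc n) \<omega> = join_block (Suc n) V ?P"
        using step[OF n w] by auto
      then show ?thesis
      proof cases
        case 1
        have "(\<Sum>U\<in>?P. ?I ?P (join_block (Suc n) U ?P) \<omega> *\<^sub>R g ?P (join_block (Suc n) U ?P)) = 0"
          using 1 open_neq_join[OF part] by (intro sum.neutral) auto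
        then show ?thesis using 1 w by simp
      next
        case 2
        have "(\<Sum>U\<in>?P. ?I ?P (join_block (Suc n) U ?P) \<omega> *\<^sub>R g ?P (join_block (Suc n) U ?P))
          = (\<Sum>U\<in>?P. if U = V then g ?P (join_block (Suc n) U ?P) else 0)"
        proof (rule sum.cong[OF refl])
          fix U assume "U \<in> ?P"
          then have "U = V" if "join_block (Suc n) V ?P = join_block (Suc n) U ?P"
            using inj_onD[OF inj_on_join[OF part]] 2(1) that by metis
          then show "?I ?P (join_block (Suc n) U ?P) \<omega> *\<^sub>R g ?P (join_block (Suc n) U ?P)
            = (if U = V then g ?P (join_block (Suc n) U ?P) else 0)"
            using 2 w by (cases "U = V") (auto simp: indicator_def)
        qed
        also have "\<dots> = g ?P (join_block (Suc n) V ?P)" using 2 part_finite[OF part] by (simp add: sum.delta)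
        finally show ?thesis using 2 open_neq_join[OF part 2(1)] by (simp add: indicator_def)
      qed
    qed
    finally show ?thesis by simp
  qed
  have "(LINT \<omega>|M. f (H \<omega>) (Part n \<omega>) (Part (Suc n) \<omega>)) = (LINT \<omega>|M. (\<Sum>P\<in>?Ps. ?I P (open_block (Suc n) P) \<omega> *\<^sub>R g P (open_block (Suc n) P)
        + (\<Sum>U\<in>P. ?I P (join_block (Suc n) U P) \<omega> *\<^sub>R g P (join_block (Suc n) U P))))"
    by (rule Bochner_Integration.integral_cong[OF refl]) (use pt h in \<open>simp add: g_def\<close>)
  also have "\<dots> = (\<Sum>P\<in>?Ps. prob {\<omega>\<in>space M. Part n \<omega> = P} *\<^sub>R smean n (g P) P)"
  proof -
    have int: "integrable M (\<lambda>\<omega>. ?I P P' \<omega> *\<^sub>R x)" for P P' and x :: 'b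
      by (intro integrable_scaleR_left integrable_real_indicator) (auto simp: emeasure_eq_measure)
    have I: "(LINT \<omega>|M. ?I P P' \<omega> *\<^sub>R x) = prob {\<omega>\<in>space M. Part n \<omega> = P \<and> Part (Suc n) \<omega> = P'} *\<^sub>R x" for P P' and x :: 'b
      by (subst integral_scaleR_left) (auto intro!: integrable_real_indicator simp: emeasure_eq_measure)
    show ?thesis
    proof (subst Bochner_Integration.integral_sum)
      show "integrable M (\<lambda>\<omega>. ?I P (open_block (Suc n) P) \<omega> *\<^sub>R g P (open_block (Suc n) P)
        + (\<Sum>U\<in>P. ?I P (join_block (Suc n) U P) \<omega> *\<^sub>R g P (join_block (Suc n) U P)))" for P
        by (intro Bochner_Integration.integrable_add Bochner_Integration.integrable_sum int)
      show "(\<Sum>P\<in>?Ps. LINT \<omega>|M. ?I P (open_block (Suc n) P) \<omega> *\<^sub>R g P (open_block (Suc n) P)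
          + (\<Sum>U\<in>P. ?I P (join_block (Suc n) U P) \<omega> *\<^sub>R g P (join_block (Suc n) U P)))
        = (\<Sum>P\<in>?Ps. prob {\<omega>\<in>space M. Part n \<omega> = P} *\<^sub>R smean n (g P) P)"
      proof (rule sum.cong[OF refl])
        fix P
        have "(LINT \<omega>|M. ?I P (open_block (Suc n) P) \<omega> *\<^sub>R g P (open_block (Suc n) P)
          + (\<Sum>U\<in>P. ?I P (join_block (Suc n) U P) \<omega> *\<^sub>R g P (join_block (Suc n) U P)))
          = prob {\<omega>\<in>space M. Part n \<omega> = P \<and> Part (Suc n) \<omega> = open_block (Suc n) P} *\<^sub>R g P (open_block (Suc n) P)
           + (\<Sum>U\<in>P. prob {\<omega>\<in>space M. Part n \<omega> = P \<and> Part (Suc n) \<omega> = join_block (Suc n) U P} *\<^sub>R g P (join_block (Suc n) U P))"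
          by (subst Bochner_Integration.integral_add)
            (intro int Bochner_Integration.integrable_sum | simp add: I int Bochner_Integration.integral_sum)+
        also have "\<dots> = prob {\<omega>\<in>space M. Part n \<omega> = P} *\<^sub>R smean n (g P) P"
          by (simp add: joint_prob[OF n] step_mean_def scaleR_add_right scaleR_sum_right)
        finally show "(LINT \<omega>|M. ?I P (open_block (Suc n) P) \<omega> *\<^sub>R g P (open_block (Suc n) P)
          + (\<Sum>U\<in>P. ?I P (join_block (Suc n) U P) \<omega> *\<^sub>R g P (join_block (Suc n) U P))) = \<dots>" .
      qed
    qed
  qed
  also have "\<dots> = (LINT \<omega>|M. smean n (g (Part n \<omega>)) (Part n \<omega>))"
    by (rule expectation_Part[OF n, symmetric])
  also have "\<dots> = (LINT \<omega>|M. smean n (f (H \<omega>) (Part n \<omega>)) (Part n \<omega>))"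
    by (rule Bochner_Integration.integral_cong[OF refl]) (use h in \<open>simp add: g_def\<close>)
  finally show ?thesis .
qed

end

text \<open>A recursion with growth rate \<open>a\<close> below \<open>b\<close> and a source term
  of the size of the increments of \<open>growth b\<close> is dominated by a multiple of \<open>growth
  b\<close>.\<close>
lemma growth_recursion:
  assumes e1: "e 1 \<le> C" and a: "0 \<le> a" and C: "C' \<le> C * (b - a)" and C0: "C \<ge> 0"
    and rec: "\<And>n. n \<ge> 1 \<Longrightarrow> e (Suc n) \<le> (1 + a / real n) * e n + C' * growth b n / real n"
    and b: "b \<ge> 0" and n: "n \<ge> 1"
  shows "e n \<le> C * growth b n"
  using n
proof (induction n rule: nat_induct_at_least)
  case base
  then show ?case using e1 by simp
next
  case (Suc n)
  have g: "growth b n \<ge> 0" using growth_ge_1[OF b, of n] by simp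
  have "e (Suc n) \<le> (1 + a / real n) * e n + C' * growth b n / real n" by (rule rec[OF Suc(1)])
  also have "\<dots> \<le> (1 + a / real n) * (C * growth b n) + C * (b - a) * growth b n / real n"
    using a Suc C g by (intro add_mono mult_left_mono divide_right_mono mult_right_mono) auto
  also have "\<dots> = C * growth b (Suc n)"
    using Suc(1) by (simp add: growth_Suc field_simps)
  finally show ?case .
qed

section \<open>The generator acting on sums over blocks\<close>

context gibbs_model
begin

lemma card_range:
  assumes "n \<ge> 1" "\<omega> \<in> space M"
  shows "1 \<le> card (Part n \<omega>)" "card (Part n \<omega>) \<le> n"
  using part_card_pos[OF Part_partition[OF assms] assms(1)] part_card_le[OF Part_partition[OF assms]] by auto

lemma pred_block_nonneg: "partition_on {1..n} P \<Longrightarrow> U \<in> P \<Longrightarrow> pred_block \<alpha> \<mu> n P U \<ge> 0"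
  using part_block(4)[of n P U] alpha rate_pos[of n "card P"] by (simp add: pred_block_eq)

lemma pred_block_sum:
  assumes "partition_on {1..n} P"
  shows "(\<Sum>U\<in>P. pred_block \<alpha> \<mu> n P U) = rate n (card P) * (real n - \<alpha> * real (card P))"
proof -
  have "(\<Sum>U\<in>P. pred_block \<alpha> \<mu> n P U) = rate n (card P) * (real (\<Sum>U\<in>P. card U) - \<alpha> * real (card P))"
    unfolding pred_block_eq by (simp add: sum_distrib_left[symmetric] sum_subtractf)
  then show ?thesis by (simp only: part_sum_card[OF assms])
qed

lemma pred_sum:
  assumes "partition_on {1..n} P" "n \<ge> 1"
  shows "pred_new \<alpha> \<mu> n P + (\<Sum>U\<in>P. pred_block \<alpha> \<mu> n P U) = 1"
  using part_card_pos[OF assms] assms(2)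
  by (simp add: pred_block_sum[OF assms(1)] pred_new_eq bias_eq algebra_simps)

lemma smean_add: "smean n (\<lambda>P'. f P' + g P') P = smean n f P + smean n g P"
  and smean_cmult: "smean n (\<lambda>P'. c * h P') P = c * smean n h P" for h :: "nat set set \<Rightarrow> 'd::real_algebra"
  by (simp_all add: step_mean_def scaleR_add_right sum.distrib sum_distrib_left distrib_left)

lemma smean_const:
  assumes "partition_on {1..n} P" "n \<ge> 1"
  shows "smean n (\<lambda>_. c) P = c"
  unfolding step_mean_def scaleR_left.sum[symmetric] scaleR_left.add[symmetric] pred_sum[OF assms] by simp

lemma smean_mono:
  fixes f g :: "nat set set \<Rightarrow> real"
  assumes "partition_on {1..n} P" "n \<ge> 1"
    and "f (open_block (Suc n) P) \<le> g (open_block (Suc n) P)"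
    and "\<And>U. U \<in> P \<Longrightarrow> f (join_block (Suc n) U P) \<le> g (join_block (Suc n) U P)"
  shows "smean n f P \<le> smean n g P"
  unfolding step_mean_def real_scaleR_def
  using assms pred_new_pos[OF assms(2) part_card_pos[OF assms(1,2)]] pred_block_nonneg[OF assms(1)]
  by (intro add_mono sum_mono mult_left_mono) auto

lemma smean_norm:
  assumes "partition_on {1..n} P" "n \<ge> 1"
  shows "norm (smean n f P) \<le> smean n (\<lambda>P'. norm (f P')) P"
proof -
  have "norm (smean n f P) \<le> norm (pred_new \<alpha> \<mu> n P *\<^sub>R f (open_block (Suc n) P))
     + (\<Sum>U\<in>P. norm (pred_block \<alpha> \<mu> n P U *\<^sub>R f (join_block (Suc n) U P)))"
    unfolding step_mean_def by (intro norm_triangle_le add_left_mono norm_sum)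
  also have "\<dots> = smean n (\<lambda>P'. norm (f P')) P"
    using pred_new_pos[OF assms(2) part_card_pos[OF assms]] pred_block_nonneg[OF assms(1)]
    by (simp add: step_mean_def)
  finally show ?thesis .
qed

text \<open>A step adds \<open>w 1\<close> with probability about \<open>\<alpha> k / n\<close> and
  replaces \<open>w j\<close> by \<open>w (j + 1)\<close> with probability about \<open>(j - \<alpha>)
  / n\<close> per block of size \<open>j\<close>. The drift of a block sum is thus again a block sum,
  divided by \<open>n\<close>.\<close>
definition generator :: "(nat \<Rightarrow> real) \<Rightarrow> nat \<Rightarrow> real" where
  "generator w j = \<alpha> * w 1 + (real j - \<alpha>) * (w (Suc j) - w j)"

lemma smean_increment:
  assumes P: "partition_on {1..n} P" and n: "n \<ge> 1"
  shows "smean n (\<lambda>P'. block_sum w P' - block_sum w P) P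
    = rate n (card P) * block_sum (generator w) P + bias n (card P) * w 1"
proof -
  have "smean n (\<lambda>P'. block_sum w P' - block_sum w P) P
    = pred_new \<alpha> \<mu> n P * w 1 + (\<Sum>U\<in>P. pred_block \<alpha> \<mu> n P U * (w (Suc (card U)) - w (card U)))"
    unfolding step_mean_def real_scaleR_def
    by (simp add: block_sum_open[OF P] block_sum_join[OF P])
  also have "(\<Sum>U\<in>P. pred_block \<alpha> \<mu> n P U * (w (Suc (card U)) - w (card U)))
     = rate n (card P) * (\<Sum>U\<in>P. (real (card U) - \<alpha>) * (w (Suc (card U)) - w (card U)))"
    by (simp add: pred_block_eq sum_distrib_left mult.assoc)
  finally have e: "smean n (\<lambda>P'. block_sum w P' - block_sum w P) P = pred_new \<alpha> \<mu> n P * w 1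
     + rate n (card P) * (\<Sum>U\<in>P. (real (card U) - \<alpha>) * (w (Suc (card U)) - w (card U)))" .
  have "block_sum (generator w) P = real (card P) * (\<alpha> * w 1)
     + (\<Sum>U\<in>P. (real (card U) - \<alpha>) * (w (Suc (card U)) - w (card U)))"
    by (simp add: block_sum_def generator_def sum.distrib)
  then show ?thesis
    unfolding e pred_new_eq[OF n part_card_pos[OF P n]] by (simp add: distrib_left distrib_right)
qed

text \<open>Jumps are rare: the probability of touching a block of a given kind is of order \<open>k
  / n\<close>, once the factor \<open>j - \<alpha>\<close> is compensated by the smallness of the
  increments of \<open>w\<close>.\<close>
lemma smean_increment_sq:
  assumes P: "partition_on {1..n} P" and n: "n \<ge> 1"
    and B: "(w 1)\<^sup>2 \<le> B" "\<And>j. j \<ge> 1 \<Longrightarrow> (real j - \<alpha>) * (w (Suc j) - w j)\<^sup>2 \<le> B"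
  shows "smean n (\<lambda>P'. (block_sum w P' - block_sum w P)\<^sup>2) P \<le> 3 * B * D * real (card P) / real n"
proof -
  let ?k = "card P"
  note k = part_card_pos[OF P n]
  have B0: "B \<ge> 0" using B(1) by (meson order_trans zero_le_power2)
  have "smean n (\<lambda>P'. (block_sum w P' - block_sum w P)\<^sup>2) P
    = pred_new \<alpha> \<mu> n P * (w 1)\<^sup>2 + (\<Sum>U\<in>P. rate n ?k * ((real (card U) - \<alpha>) * (w (Suc (card U)) - w (card U))\<^sup>2))"
    unfolding step_mean_def real_scaleR_def
    by (simp add: block_sum_open[OF P] block_sum_join[OF P] pred_block_eq mult.assoc)
  also have "\<dots> \<le> pred_new \<alpha> \<mu> n P * B + (\<Sum>U\<in>P. rate n ?k * B)"
    using B part_block(4)[OF P] pred_new_pos[OF n k] rate_pos[of n ?k]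
    by (intro add_mono sum_mono mult_left_mono) auto
  also have "\<dots> = B * (\<alpha> * real ?k * rate n ?k + bias n ?k + real ?k * rate n ?k)"
    unfolding pred_new_eq[OF n k] by (simp add: algebra_simps)
  also have "\<dots> \<le> B * (3 * (real ?k * (D / real n)))"
  proof (rule mult_left_mono[OF _ B0])
    have kr: "real ?k * rate n ?k \<le> real ?k * (D / real n)"
      by (rule mult_left_mono[OF rate_D(1)[OF n k]]) simp
    have "\<alpha> * (real ?k * rate n ?k) \<le> 1 * (real ?k * rate n ?k)"
      using alpha rate_pos[of n ?k] by (intro mult_right_mono) auto
    moreover have "1 * (D / real n) \<le> real ?k * (D / real n)"
      using k D_ge by (intro mult_right_mono) auto
    moreover have "bias n ?k \<le> D / real n" using rate_D(2)[OF n k] by linarith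
    ultimately show "\<alpha> * real ?k * rate n ?k + bias n ?k + real ?k * rate n ?k \<le> 3 * (real ?k * (D / real n))"
      using kr unfolding mult.assoc by argo
  qed
  finally show ?thesis by (simp add: mult_ac)
qed

section \<open>Moments of the number of blocks and of the score\<close>

abbreviation "K n \<omega> \<equiv> real (card (Part n \<omega>))"
abbreviation "BS w n \<omega> \<equiv> block_sum w (Part n \<omega>)"
abbreviation "A n \<equiv> growth \<alpha> n"

lemma A_ge_1: "A n \<ge> 1" using growth_ge_1 alpha by simp
lemma A_pos: "A n > 0" using A_ge_1[of n] by linarith

lemma integrable_K [simp]: "n \<ge> 1 \<Longrightarrow> integrable M (K n)"
  by (rule Part_integrable)

lemma integrable_BS [simp]: "n \<ge> 1 \<Longrightarrow> integrable M (BS w n)" "n \<ge> 1 \<Longrightarrow> integrable M (\<lambda>\<omega>. (BS w n \<omega>)\<^sup>2)"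
  by (rule Part_integrable, assumption)+

lemma expectation_mono_Part:
  fixes F G :: "nat set set \<Rightarrow> real"
  assumes n: "n \<ge> 1" and le: "\<And>P. partition_on {1..n} P \<Longrightarrow> F P \<le> G P"
  shows "(LINT \<omega>|M. F (Part n \<omega>)) \<le> (LINT \<omega>|M. G (Part n \<omega>))"
  using le Part_partition[OF n] by (intro integral_mono Part_integrable[OF n]) auto

text \<open>The constant is chosen so that the mean number of blocks, shifted by \<open>D /
  \<alpha>\<close>, satisfies a homogeneous recursion and is at most \<open>card_const\<close> at time
  one.\<close>
definition "card_const = 1 + 2 * D / \<alpha>"

lemma card_const_pos: "card_const > 0" "card_const \<ge> 1" using D_ge alpha by (auto simp: card_const_def add_pos_pos)

lemma smean_card:
  assumes P: "partition_on {1..n} P" and n: "n \<ge> 1"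
  shows "smean n (\<lambda>P'. real (card P') - real (card P)) P
    = \<alpha> * real (card P) / real n + bias n (card P) * (1 - \<alpha> * real (card P) / real n)"
    and "\<bar>bias n (card P) * (1 - \<alpha> * real (card P) / real n)\<bar> \<le> D / real n"
proof -
  note k = part_card_pos[OF P n] part_card_le[OF P]
  have c: "real (card Q) = block_sum (\<lambda>_. 1) Q" for Q by (simp add: block_sum_const)
  have r: "rate n (card P) = (1 - bias n (card P)) / real n" using bias_eq[OF n k(1)] n by (simp add: field_simps)
  have "smean n (\<lambda>P'. real (card P') - real (card P)) P = rate n (card P) * block_sum (generator (\<lambda>_. 1)) P + bias n (card P)"
    unfolding c by (subst smean_increment[OF P n]) simp
  also have "block_sum (generator (\<lambda>_. 1)) P = \<alpha> * real (card P)"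
  proof -
    have "generator (\<lambda>_. 1) = (\<lambda>_. \<alpha>)" by (rule ext) (simp add: generator_def)
    then show ?thesis by (simp add: block_sum_const)
  qed
  finally show "smean n (\<lambda>P'. real (card P') - real (card P)) P
    = \<alpha> * real (card P) / real n + bias n (card P) * (1 - \<alpha> * real (card P) / real n)"
    unfolding r using n by (simp add: field_simps)
  have "\<alpha> * real (card P) \<le> 1 * real n" using alpha k by (intro mult_mono) auto
  then have "\<alpha> * real (card P) / real n \<le> 1" "0 \<le> \<alpha> * real (card P) / real n"
    using n alpha by (auto simp: divide_le_eq)
  then have "\<bar>1 - \<alpha> * real (card P) / real n\<bar> \<le> 1" by linarith
  with rate_D(2)[OF n k(1)] show "\<bar>bias n (card P) * (1 - \<alpha> * real (card P) / real n)\<bar> \<le> D / real n"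
    unfolding abs_mult using mult_mono[of "\<bar>bias n (card P)\<bar>" "D / real n" "\<bar>1 - \<alpha> * real (card P) / real n\<bar>" 1] D_ge
    by simp
qed

lemma mean_card: 
  assumes "n \<ge> 1" shows "(LINT \<omega>|M. K n \<omega>) \<le> card_const * A n"
proof -
  let ?e = "\<lambda>n. (LINT \<omega>|M. K n \<omega>)"
  have "?e n + D / \<alpha> \<le> card_const * A n"
    using assms
  proof (induction n rule: nat_induct_at_least)
    case base
    have "?e 1 = (LINT \<omega>|M. 1)"
      by (rule Bochner_Integration.integral_cong) (auto simp: Part_1)
    moreover have "D / \<alpha> \<ge> 0" "2 * D / \<alpha> = D / \<alpha> + D / \<alpha>" using D_ge alpha by auto
    ultimately show ?case by (simp add: card_const_def prob_space)
  next
    case (Suc n)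
    have "?e (Suc n) = (LINT \<omega>|M. smean n (\<lambda>P'. real (card P')) (Part n \<omega>))"
      by (rule one_step[OF Suc(1), of "\<lambda>_. ()" "\<lambda>_ _ P'. real (card P')"]) (rule adapted_const)
    also have "\<dots> \<le> (LINT \<omega>|M. (1 + \<alpha> / real n) * K n \<omega> + D / real n)"
    proof (rule expectation_mono_Part[OF Suc(1)])
      fix P assume P: "partition_on {1..n} P"
      have "smean n (\<lambda>P'. real (card P')) P = smean n (\<lambda>P'. (real (card P') - real (card P)) + real (card P)) P" by simp
      also have "\<dots> = smean n (\<lambda>P'. real (card P') - real (card P)) P + real (card P)"
        unfolding smean_add smean_const[OF P Suc(1)] ..
      also have "\<dots> \<le> (1 + \<alpha> / real n) * real (card P) + D / real n"
        using smean_card[OF P Suc(1)] by (simp add: distrib_right)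
      finally show "smean n (\<lambda>P'. real (card P')) P \<le> (1 + \<alpha> / real n) * real (card P) + D / real n" .
    qed
    also have "\<dots> = (1 + \<alpha> / real n) * ?e n + D / real n"
      using Suc(1) by (simp add: prob_space)
    finally have "?e (Suc n) + D / \<alpha> \<le> (1 + \<alpha> / real n) * ?e n + D / real n + D / \<alpha>" by simp
    also have "(1 + \<alpha> / real n) * ?e n + D / real n + D / \<alpha> = (1 + \<alpha> / real n) * (?e n + D / \<alpha>)"
    proof -
      have "\<alpha> / real n * (D / \<alpha>) = D / real n" using alpha by simp
      then show ?thesis by (simp only: distrib_left distrib_right mult_1_left)
    qed
    finally have "?e (Suc n) + D / \<alpha> \<le> (1 + \<alpha> / real n) * (?e n + D / \<alpha>)" .
    also have "\<dots> \<le> (1 + \<alpha> / real n) * (card_const * A n)"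
      using Suc alpha by (intro mult_left_mono) auto
    also have "\<dots> = card_const * A (Suc n)" using Suc(1) by (simp add: growth_Suc)
    finally show ?case .
  qed
  then show ?thesis using D_ge alpha by (smt (verit) divide_pos_pos)
qed

text \<open>The increment of the second moment is twice the mean of the block sum times its drift,
  plus the mean squared jump, which is of order \<open>n powr (\<alpha> - 1)\<close>.\<close>
lemma second_moment_rec:
  assumes n: "n \<ge> 1"
    and B: "(w 1)\<^sup>2 \<le> B" "\<And>j. j \<ge> 1 \<Longrightarrow> (real j - \<alpha>) * (w (Suc j) - w j)\<^sup>2 \<le> B"
    and drift: "\<And>P. partition_on {1..n} P \<Longrightarrow>
      2 * block_sum w P * (rate n (card P) * block_sum (generator w) P + bias n (card P) * w 1) \<le> G P"
  shows "(LINT \<omega>|M. (BS w (Suc n) \<omega>)\<^sup>2) \<le> (LINT \<omega>|M. (BS w n \<omega>)\<^sup>2 + G (Part n \<omega>)) + 3 * B * D * card_const * A n / real n"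
proof -
  have B0: "B \<ge> 0" using B(1) by (meson order_trans zero_le_power2)
  have "(LINT \<omega>|M. (BS w (Suc n) \<omega>)\<^sup>2) = (LINT \<omega>|M. smean n (\<lambda>P'. (block_sum w P')\<^sup>2) (Part n \<omega>))"
    by (rule one_step[OF n, of "\<lambda>_. ()" "\<lambda>_ _ P'. (block_sum w P')\<^sup>2"]) (rule adapted_const)
  also have "\<dots> \<le> (LINT \<omega>|M. ((BS w n \<omega>)\<^sup>2 + G (Part n \<omega>)) + 3 * B * D / real n * K n \<omega>)"
  proof (rule expectation_mono_Part[OF n])
    fix P assume P: "partition_on {1..n} P"
    let ?x = "block_sum w P"
    have "smean n (\<lambda>P'. (block_sum w P')\<^sup>2) P
      = smean n (\<lambda>P'. (?x\<^sup>2 + 2 * ?x * (block_sum w P' - ?x)) + (block_sum w P' - ?x)\<^sup>2) P"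
      by (simp add: power2_eq_square algebra_simps)
    also have "\<dots> = ?x\<^sup>2 + 2 * ?x * (rate n (card P) * block_sum (generator w) P + bias n (card P) * w 1)
       + smean n (\<lambda>P'. (block_sum w P' - ?x)\<^sup>2) P"
      unfolding smean_add smean_const[OF P n] smean_cmult smean_increment[OF P n] by simp
    also have "\<dots> \<le> (?x\<^sup>2 + G P) + 3 * B * D / real n * real (card P)"
      using drift[OF P] smean_increment_sq[OF P n B] by simp
    finally show "smean n (\<lambda>P'. (block_sum w P')\<^sup>2) P \<le> (?x\<^sup>2 + G P) + 3 * B * D / real n * real (card P)" .
  qed
  also have "\<dots> = (LINT \<omega>|M. (BS w n \<omega>)\<^sup>2 + G (Part n \<omega>)) + 3 * B * D / real n * (LINT \<omega>|M. K n \<omega>)"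
    using n Part_integrable[OF n, of G] by simp
  also have "\<dots> \<le> (LINT \<omega>|M. (BS w n \<omega>)\<^sup>2 + G (Part n \<omega>)) + 3 * B * D / real n * (card_const * A n)"
    using B0 D_ge by (intro add_left_mono mult_left_mono mean_card[OF n]) auto
  finally show ?thesis by (simp add: mult_ac)
qed

text \<open>The score is a martingale when \<open>\<theta> = 0\<close>, the quasi-likelihood being
  the likelihood of that model. In general, only the bias of order \<open>1 / n\<close> remains in the
  drift.\<close>
lemma generator_score: "j \<ge> 1 \<Longrightarrow> generator (score_wt \<alpha>) j = 0"
  using alpha score_wt_Suc[of j \<alpha>] by (simp add: generator_def)

lemma score_increment_bounds:
  "(score_wt \<alpha> 1)\<^sup>2 \<le> 1 / \<alpha>\<^sup>2 + 1 / (1 - \<alpha>)"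
  "j \<ge> 1 \<Longrightarrow> (real j - \<alpha>) * (score_wt \<alpha> (Suc j) - score_wt \<alpha> j)\<^sup>2 \<le> 1 / \<alpha>\<^sup>2 + 1 / (1 - \<alpha>)"
proof -
  show "(score_wt \<alpha> 1)\<^sup>2 \<le> 1 / \<alpha>\<^sup>2 + 1 / (1 - \<alpha>)" using alpha by (simp add: power_one_over)
  assume j: "j \<ge> 1"
  then have d: "real j - \<alpha> > 0" "real j - \<alpha> \<ge> 1 - \<alpha>" using alpha by auto
  then have "(real j - \<alpha>) * (score_wt \<alpha> (Suc j) - score_wt \<alpha> j)\<^sup>2 = 1 / (real j - \<alpha>)"
    unfolding score_wt_Suc[OF j] by (simp add: power2_eq_square)
  also have "\<dots> \<le> 1 / (1 - \<alpha>)" using d alpha by (intro divide_left_mono) auto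
  finally show "(real j - \<alpha>) * (score_wt \<alpha> (Suc j) - score_wt \<alpha> j)\<^sup>2 \<le> 1 / \<alpha>\<^sup>2 + 1 / (1 - \<alpha>)"
    using alpha by (simp add: add_increasing)
qed

text \<open>The cross term of order \<open>\<bar>L\<bar> / n\<close> is split by the inequality
  between arithmetic and geometric means so that its quadratic part grows at rate \<open>\<alpha> /
  2\<close> only, which is below the rate \<open>\<alpha>\<close> of the squared jumps.\<close>
lemma score_second_moment:
  obtains C where "C > 0" "\<And>n. n \<ge> 1 \<Longrightarrow> (LINT \<omega>|M. (BS (score_wt \<alpha>) n \<omega>)\<^sup>2) \<le> C * A n"
proof -
  let ?s = "score_wt \<alpha>"
  define B where "B = 1 / \<alpha>\<^sup>2 + 1 / (1 - \<alpha>)"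
  define c where "c = (D / \<alpha>)\<^sup>2 / (\<alpha> / 2)"
  define C' where "C' = c + 3 * B * D * card_const"
  define C where "C = 1 / \<alpha>\<^sup>2 + C' / (\<alpha> / 2)"
  have B0: "B > 0" using alpha by (simp add: B_def add_pos_pos)
  have c0: "c > 0" using D_ge alpha by (simp add: c_def)
  have C'0: "C' > 0" using c0 B0 D_ge card_const_pos by (simp add: C'_def add_pos_pos)
  have C0: "C > 0" using C'0 alpha by (simp add: C_def add_pos_pos)
  have "(LINT \<omega>|M. (BS ?s n \<omega>)\<^sup>2) \<le> C * A n" if "n \<ge> 1" for n
  proof (rule growth_recursion[where e = "\<lambda>n. (LINT \<omega>|M. (BS ?s n \<omega>)\<^sup>2)" and a = "\<alpha> / 2" and C' = C'])
    have "(LINT \<omega>|M. (BS ?s 1 \<omega>)\<^sup>2) = (LINT \<omega>|M. 1 / \<alpha>\<^sup>2)"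
      by (rule Bochner_Integration.integral_cong) (auto simp: Part_1 block_sum_def power_one_over)
    then show "(LINT \<omega>|M. (BS ?s 1 \<omega>)\<^sup>2) \<le> C" using C'0 alpha by (simp add: prob_space C_def)
    show "C' \<le> C * (\<alpha> - \<alpha> / 2)" using alpha C'0 by (simp add: C_def distrib_right)
    fix n :: nat assume n: "n \<ge> 1"
    have "(LINT \<omega>|M. (BS ?s (Suc n) \<omega>)\<^sup>2) \<le>
       (LINT \<omega>|M. (BS ?s n \<omega>)\<^sup>2 + (\<alpha> / 2 / real n * (BS ?s n \<omega>)\<^sup>2 + c / real n)) + 3 * B * D * card_const * A n / real n"
    proof (rule second_moment_rec[OF n])
      show "(?s 1)\<^sup>2 \<le> B" "\<And>j. j \<ge> 1 \<Longrightarrow> (real j - \<alpha>) * (?s (Suc j) - ?s j)\<^sup>2 \<le> B"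
        unfolding B_def by (rule score_increment_bounds; assumption?)+
      fix P assume P: "partition_on {1..n} P"
      note k = part_card_pos[OF P n]
      let ?x = "block_sum ?s P"
      have "block_sum (generator ?s) P = 0"
        unfolding block_sum_def using generator_score part_block(4)[OF P] by (intro sum.neutral) auto
      then have "2 * ?x * (rate n (card P) * block_sum (generator ?s) P + bias n (card P) * ?s 1)
        = 2 * ?x * bias n (card P) / \<alpha>" by simp
      also have "\<dots> \<le> 2 * \<bar>?x\<bar> * (D / real n) / \<alpha>"
      proof (rule divide_right_mono)
        have "?x * bias n (card P) \<le> \<bar>?x\<bar> * \<bar>bias n (card P)\<bar>" by (metis abs_ge_self abs_mult)
        also have "\<dots> \<le> \<bar>?x\<bar> * (D / real n)" using rate_D(2)[OF n k] by (intro mult_left_mono) auto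
        finally show "2 * ?x * bias n (card P) \<le> 2 * \<bar>?x\<bar> * (D / real n)" by simp
      qed (use alpha in simp)
      also have "\<dots> = (2 * \<bar>?x\<bar> * (D / \<alpha>)) / real n" by simp
      also have "\<dots> \<le> (\<alpha> / 2 * ?x\<^sup>2 + c) / real n"
      proof (rule divide_right_mono)
        \<comment> \<open>Completing the square; this is where the constant \<open>c\<close>
          comes from.\<close>
        have "0 \<le> (\<alpha> / 2 * \<bar>?x\<bar> - D / \<alpha>)\<^sup>2 / (\<alpha> / 2)" using alpha by simp
        also have "\<dots> = \<alpha> / 2 * \<bar>?x\<bar>\<^sup>2 + c - 2 * \<bar>?x\<bar> * (D / \<alpha>)"
          using alpha unfolding c_def power2_diff by (simp add: field_simps power2_eq_square)
        finally show "2 * \<bar>?x\<bar> * (D / \<alpha>) \<le> \<alpha> / 2 * ?x\<^sup>2 + c" by simp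
      qed simp
      also have "\<dots> = \<alpha> / 2 / real n * ?x\<^sup>2 + c / real n" by (simp add: add_divide_distrib)
      finally show "2 * ?x * (rate n (card P) * block_sum (generator ?s) P + bias n (card P) * ?s 1)
         \<le> \<alpha> / 2 / real n * ?x\<^sup>2 + c / real n" .
    qed
    also have "(LINT \<omega>|M. (BS ?s n \<omega>)\<^sup>2 + (\<alpha> / 2 / real n * (BS ?s n \<omega>)\<^sup>2 + c / real n))
      = (1 + \<alpha> / 2 / real n) * (LINT \<omega>|M. (BS ?s n \<omega>)\<^sup>2) + c / real n"
      using n by (simp add: prob_space distrib_right)
    also have "c / real n \<le> c * A n / real n" using c0 A_ge_1[of n] by (intro divide_right_mono) auto
    finally show "(LINT \<omega>|M. (BS ?s (Suc n) \<omega>)\<^sup>2) \<le> (1 + \<alpha> / 2 / real n) * (LINT \<omega>|M. (BS ?s n \<omega>)\<^sup>2) + C' * A n / real n"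
      unfolding C'_def distrib_right add_divide_distrib by linarith
  qed (use alpha C0 that in auto)
  then show ?thesis using C0 by (rule that[rotated])
qed

section \<open>Boundedness in mean square\<close>

lemma A_upper: obtains C where "C > 0" "\<And>n. n \<ge> 1 \<Longrightarrow> A n \<le> C * real n powr \<alpha>"
  using growth_bounds[of \<alpha>] alpha by (metis less_trans neg_less_0_iff_less zero_less_one)

lemma A_lower: obtains c where "c > 0" "\<And>n. n \<ge> 1 \<Longrightarrow> c * real n powr \<alpha> \<le> A n"
  using growth_bounds[of \<alpha>] alpha by (metis less_trans neg_less_0_iff_less zero_less_one)

lemma tv_L2_bound:
  obtains C where "C > 0" "\<And>n. n \<ge> 1 \<Longrightarrow>
    real n powr (1 - \<alpha> / 2) * sqrt (LINT \<omega>|M. (tv_error \<alpha> \<mu> n (Part n \<omega>))\<^sup>2) \<le> C"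
proof -
  obtain C where C: "C > 0" "\<And>n. n \<ge> 1 \<Longrightarrow> (LINT \<omega>|M. (BS (score_wt \<alpha>) n \<omega>)\<^sup>2) \<le> C * A n"
    by (rule score_second_moment) blast
  obtain C2 where C2: "C2 > 0" "\<And>n. n \<ge> 1 \<Longrightarrow> A n \<le> C2 * real n powr \<alpha>" by (rule A_upper) blast
  define c where "c = 2 / \<alpha> + 2 * D"
  define R where "R = 8 * C * C2 + 2 * c\<^sup>2"
  have c: "c > 0" using alpha D_ge by (simp add: c_def add_pos_pos)
  have R: "R > 0" using c C C2 by (simp add: R_def add_pos_pos)
  have "real n powr (1 - \<alpha> / 2) * sqrt (LINT \<omega>|M. (tv_error \<alpha> \<mu> n (Part n \<omega>))\<^sup>2) \<le> sqrt R" if n: "n \<ge> 1" for n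
  proof -
    have "(LINT \<omega>|M. (tv_error \<alpha> \<mu> n (Part n \<omega>))\<^sup>2) \<le> (LINT \<omega>|M. (8 * (BS (score_wt \<alpha>) n \<omega>)\<^sup>2 + 2 * c\<^sup>2) / (real n)\<^sup>2)"
    proof (rule expectation_mono_Part[OF n])
      fix P assume P: "partition_on {1..n} P"
      let ?L = "block_sum (score_wt \<alpha>) P"
      have nn: "tv_error \<alpha> \<mu> n P \<ge> 0" unfolding tv_error_def by (intro mult_nonneg_nonneg add_nonneg_nonneg sum_nonneg) auto
      have "tv_error \<alpha> \<mu> n P \<le> real (card P) / real n * \<bar>qmle n P - \<alpha>\<bar> + 2 * D / real n"
        using tv_error_approx[OF P n] by linarith
      also have "\<dots> = (real (card P) * \<bar>qmle n P - \<alpha>\<bar> + 2 * D) / real n" by (simp add: add_divide_distrib)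
      also have "\<dots> \<le> (2 * \<bar>?L\<bar> + c) / real n"
        using qmle_error_score[OF P alpha n] by (intro divide_right_mono) (auto simp: c_def)
      finally have "(tv_error \<alpha> \<mu> n P)\<^sup>2 \<le> ((2 * \<bar>?L\<bar> + c) / real n)\<^sup>2" using nn by (intro power_mono) auto
      also have "\<dots> = (2 * \<bar>?L\<bar> + c)\<^sup>2 / (real n)\<^sup>2" by (simp add: power_divide)
      also have "\<dots> \<le> (8 * ?L\<^sup>2 + 2 * c\<^sup>2) / (real n)\<^sup>2"
      proof (rule divide_right_mono)
        have "0 \<le> (2 * \<bar>?L\<bar> - c)\<^sup>2" by simp
        then show "(2 * \<bar>?L\<bar> + c)\<^sup>2 \<le> 8 * ?L\<^sup>2 + 2 * c\<^sup>2" by (simp add: power2_eq_square algebra_simps)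
      qed simp
      finally show "(tv_error \<alpha> \<mu> n P)\<^sup>2 \<le> (8 * ?L\<^sup>2 + 2 * c\<^sup>2) / (real n)\<^sup>2" .
    qed
    also have "\<dots> = (8 * (LINT \<omega>|M. (BS (score_wt \<alpha>) n \<omega>)\<^sup>2) + 2 * c\<^sup>2) / (real n)\<^sup>2"
      using n by (simp add: prob_space)
    also have "\<dots> \<le> (R * real n powr \<alpha>) / (real n)\<^sup>2"
    proof (rule divide_right_mono)
      have "C * A n \<le> C * (C2 * real n powr \<alpha>)" using C C2 n by (intro mult_left_mono) auto
      moreover have "2 * c\<^sup>2 * 1 \<le> 2 * c\<^sup>2 * real n powr \<alpha>"
        using n alpha by (intro mult_left_mono) (auto intro!: ge_one_powr_ge_zero)
      ultimately show "8 * (LINT \<omega>|M. (BS (score_wt \<alpha>) n \<omega>)\<^sup>2) + 2 * c\<^sup>2 \<le> R * real n powr \<alpha>"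
        using C(2)[OF n] unfolding R_def distrib_right mult.assoc by linarith
    qed simp
    finally have "(LINT \<omega>|M. (tv_error \<alpha> \<mu> n (Part n \<omega>))\<^sup>2) \<le> R * real n powr \<alpha> / (real n)\<^sup>2" .
    then have "sqrt (LINT \<omega>|M. (tv_error \<alpha> \<mu> n (Part n \<omega>))\<^sup>2) \<le> sqrt (R * real n powr \<alpha> / (real n)\<^sup>2)" by simp
    also have "\<dots> = sqrt R * real n powr (\<alpha> / 2) / real n"
      by (simp add: real_sqrt_mult real_sqrt_divide powr_half_sqrt_powr)
    finally have "real n powr (1 - \<alpha> / 2) * sqrt (LINT \<omega>|M. (tv_error \<alpha> \<mu> n (Part n \<omega>))\<^sup>2)
      \<le> real n powr (1 - \<alpha> / 2) * (sqrt R * real n powr (\<alpha> / 2) / real n)" by (intro mult_left_mono) auto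
    also have "\<dots> = sqrt R * (real n powr (1 - \<alpha> / 2) * real n powr (\<alpha> / 2)) / real n" by simp
    also have "\<dots> = sqrt R" using n by (simp flip: powr_add)
    finally show ?thesis .
  qed
  then show ?thesis using R by (intro that[of "sqrt R"]) auto
qed

end

section \<open>Frequencies of the block sizes\<close>

text \<open>Its sum over the blocks is the number of blocks of size \<open>j\<close> minus its
  predicted value, the fraction \<open>p\<^sub>j\<close> of all blocks.\<close>
definition centred_count :: "real \<Rightarrow> nat \<Rightarrow> nat \<Rightarrow> real" where
  "centred_count \<alpha> j l = (if l = j then 1 else 0) - sibuya_pmf \<alpha> j"

context gibbs_model
begin

text \<open>If the drift contributes at most as much as the jumps, the second moment is of order
  \<open>n powr \<alpha>\<close>, negligible against the square of the number of blocks.\<close>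
lemma second_moment_growth:
  assumes B: "(w 1)\<^sup>2 \<le> B" "\<And>j. j \<ge> 1 \<Longrightarrow> (real j - \<alpha>) * (w (Suc j) - w j)\<^sup>2 \<le> B"
    and drift: "\<And>n P. n \<ge> 1 \<Longrightarrow> partition_on {1..n} P \<Longrightarrow>
      2 * block_sum w P * (rate n (card P) * block_sum (generator w) P + bias n (card P) * w 1) \<le> G n P"
    and G: "\<And>n. n \<ge> 1 \<Longrightarrow> (LINT \<omega>|M. G n (Part n \<omega>)) \<le> c * A n / real n"
  obtains C where "C > 0" "\<And>n. n \<ge> 1 \<Longrightarrow> (LINT \<omega>|M. (BS w n \<omega>)\<^sup>2) \<le> C * A n"
proof -
  define C' where "C' = \<bar>c\<bar> + 3 * B * D * card_const"
  define C where "C = (w 1)\<^sup>2 + C' / \<alpha> + 1"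
  have B0: "B \<ge> 0" using B(1) by (meson order_trans zero_le_power2)
  have C'0: "C' \<ge> 0" using B0 D_ge card_const_pos by (simp add: C'_def)
  have C0: "C > 0" using C'0 alpha by (simp add: C_def add_nonneg_pos)
  have "(LINT \<omega>|M. (BS w n \<omega>)\<^sup>2) \<le> C * A n" if "n \<ge> 1" for n
  proof (rule growth_recursion[where e = "\<lambda>n. (LINT \<omega>|M. (BS w n \<omega>)\<^sup>2)" and a = 0 and C' = C'])
    have "(LINT \<omega>|M. (BS w 1 \<omega>)\<^sup>2) = (LINT \<omega>|M. (w 1)\<^sup>2)"
      by (rule Bochner_Integration.integral_cong) (auto simp: Part_1 block_sum_def)
    then show "(LINT \<omega>|M. (BS w 1 \<omega>)\<^sup>2) \<le> C" using C'0 alpha by (simp add: prob_space C_def)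
    show "C' \<le> C * (\<alpha> - 0)" using alpha C'0 by (simp add: C_def distrib_right)
    fix n :: nat assume n: "n \<ge> 1"
    have "(LINT \<omega>|M. (BS w (Suc n) \<omega>)\<^sup>2) \<le>
       (LINT \<omega>|M. (BS w n \<omega>)\<^sup>2 + G n (Part n \<omega>)) + 3 * B * D * card_const * A n / real n"
      by (rule second_moment_rec[OF n B drift[OF n]])
    also have "(LINT \<omega>|M. (BS w n \<omega>)\<^sup>2 + G n (Part n \<omega>)) = (LINT \<omega>|M. (BS w n \<omega>)\<^sup>2) + (LINT \<omega>|M. G n (Part n \<omega>))"
      using n Part_integrable[OF n, of "G n"] by simp
    also have "(LINT \<omega>|M. G n (Part n \<omega>)) \<le> \<bar>c\<bar> * A n / real n"
      using A_pos[of n] by (intro order_trans[OF G[OF n]] divide_right_mono mult_right_mono) auto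
    finally show "(LINT \<omega>|M. (BS w (Suc n) \<omega>)\<^sup>2) \<le> (1 + 0 / real n) * (LINT \<omega>|M. (BS w n \<omega>)\<^sup>2) + C' * A n / real n"
      unfolding C'_def distrib_right add_divide_distrib by simp
  qed (use alpha C0 that in auto)
  then show ?thesis using C0 by (rule that[rotated])
qed

text \<open>By the recursion of the Sibuya probabilities, the centred counts form a closed
  triangular system: that of size \<open>j + 1\<close> is damped by itself and fed only by that of
  size \<open>j\<close>.\<close>
lemma generator_centred_count:
  assumes "l \<ge> 1"
  shows "generator (centred_count \<alpha> (Suc 0)) l = - (1 - \<alpha>) * centred_count \<alpha> (Suc 0) l"
    and "j \<ge> 1 \<Longrightarrow> generator (centred_count \<alpha> (Suc j)) l =
      (real j - \<alpha>) * centred_count \<alpha> j l - (real (Suc j) - \<alpha>) * centred_count \<alpha> (Suc j) l"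
proof -
  show "generator (centred_count \<alpha> (Suc 0)) l = - (1 - \<alpha>) * centred_count \<alpha> (Suc 0) l"
    using assms alpha by (auto simp: generator_def centred_count_def sibuya_pmf_1[OF alpha] algebra_simps)
  assume j: "j \<ge> 1"
  have "(real j - \<alpha>) * sibuya_pmf \<alpha> j = real (Suc j) * sibuya_pmf \<alpha> (Suc j)"
    using sibuya_rec[OF alpha j] by simp
  then show "generator (centred_count \<alpha> (Suc j)) l =
      (real j - \<alpha>) * centred_count \<alpha> j l - (real (Suc j) - \<alpha>) * centred_count \<alpha> (Suc j) l"
    using j by (auto simp: generator_def centred_count_def algebra_simps)
qed

lemma centred_count_bounds:
  assumes "j \<ge> 1"
  shows "(centred_count \<alpha> j 1)\<^sup>2 \<le> (1 + sibuya_pmf \<alpha> j)\<^sup>2 + real j"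
    "l \<ge> 1 \<Longrightarrow> (real l - \<alpha>) * (centred_count \<alpha> j (Suc l) - centred_count \<alpha> j l)\<^sup>2 \<le> (1 + sibuya_pmf \<alpha> j)\<^sup>2 + real j"
    "\<bar>centred_count \<alpha> j l\<bar> \<le> 1 + sibuya_pmf \<alpha> j"
proof -
  have p: "sibuya_pmf \<alpha> j \<ge> 0" using sibuya_pmf_nonneg[OF alpha assms] .
  show b: "\<bar>centred_count \<alpha> j l\<bar> \<le> 1 + sibuya_pmf \<alpha> j" for l using p by (auto simp: centred_count_def)
  have "(centred_count \<alpha> j 1)\<^sup>2 \<le> (1 + sibuya_pmf \<alpha> j)\<^sup>2"
    using b[of 1] by (metis abs_ge_zero power2_abs power_mono)
  then show "(centred_count \<alpha> j 1)\<^sup>2 \<le> (1 + sibuya_pmf \<alpha> j)\<^sup>2 + real j" by (simp add: add_increasing2)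
  assume l: "l \<ge> 1"
  have "(real l - \<alpha>) * (centred_count \<alpha> j (Suc l) - centred_count \<alpha> j l)\<^sup>2 \<le> real j"
    using alpha l by (auto simp: centred_count_def)
  then show "(real l - \<alpha>) * (centred_count \<alpha> j (Suc l) - centred_count \<alpha> j l)\<^sup>2 \<le> (1 + sibuya_pmf \<alpha> j)\<^sup>2 + real j"
    by (simp add: add_increasing)
qed

lemma block_sum_bound:
  assumes "\<And>l. \<bar>w l\<bar> \<le> b" shows "\<bar>block_sum w P\<bar> \<le> real (card P) * b"
proof -
  have "\<bar>block_sum w P\<bar> \<le> (\<Sum>U\<in>P. b)" unfolding block_sum_def
    by (intro order_trans[OF sum_abs] sum_mono assms)
  then show ?thesis by simp
qed

lemma centred_count_bias:
  assumes j: "j \<ge> 1" and n: "n \<ge> 1" and P: "partition_on {1..n} P"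
  shows "2 * block_sum (centred_count \<alpha> j) P * (bias n (card P) * centred_count \<alpha> j 1)
     \<le> 2 * (1 + sibuya_pmf \<alpha> j)\<^sup>2 * D / real n * real (card P)"
proof -
  let ?b = "1 + sibuya_pmf \<alpha> j" and ?z = "block_sum (centred_count \<alpha> j) P"
  have b0: "?b \<ge> 0" using sibuya_pmf_nonneg[OF alpha j] by simp
  have "\<bar>?z * (bias n (card P) * centred_count \<alpha> j 1)\<bar> \<le> (real (card P) * ?b) * (D / real n * ?b)"
    unfolding abs_mult
    using block_sum_bound[OF centred_count_bounds(3)[OF j]] centred_count_bounds(3)[OF j, of 1] b0
      rate_D(2)[OF n part_card_pos[OF P n]] D_ge
    by (intro mult_mono) auto
  then have "2 * (?z * (bias n (card P) * centred_count \<alpha> j 1)) \<le> 2 * ((real (card P) * ?b) * (D / real n * ?b))" by linarith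
  also have "\<dots> = 2 * ?b\<^sup>2 * D / real n * real (card P)" by (simp add: power2_eq_square mult_ac)
  finally show ?thesis by (simp only: mult.assoc)
qed

text \<open>Induction on the block size. In the drift of the square, the feeding term is split so
  that the damping absorbs its part in the current count, and only the second moment of the previous
  count is left.\<close>
lemma centred_count_second_moment:
  assumes "j \<ge> 1"
  shows "\<exists>C>0. \<forall>n\<ge>1. (LINT \<omega>|M. (BS (centred_count \<alpha> j) n \<omega>)\<^sup>2) \<le> C * A n"
  using assms
proof (induction j rule: nat_induct_at_least)
  case base
  let ?w = "centred_count \<alpha> 1"
  define e where "e = 2 * (1 + sibuya_pmf \<alpha> 1)\<^sup>2 * D"
  have e0: "e \<ge> 0" using D_ge by (simp add: e_def)
  show ?case
  proof (rule second_moment_growth[where w = ?w and G = "\<lambda>n P. e / real n * real (card P)" and c = "e * card_const"])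
    show "(?w 1)\<^sup>2 \<le> (1 + sibuya_pmf \<alpha> 1)\<^sup>2 + real 1"
      by (rule centred_count_bounds) simp
    show "(real j - \<alpha>) * (?w (Suc j) - ?w j)\<^sup>2 \<le> (1 + sibuya_pmf \<alpha> 1)\<^sup>2 + real 1" if "j \<ge> 1" for j
      by (rule centred_count_bounds) (use that in simp_all)
    fix n :: nat assume n: "n \<ge> 1"
    show "(LINT \<omega>|M. e / real n * K n \<omega>) \<le> e * card_const * A n / real n"
      using mean_card[OF n] e0 mult_left_mono[of "LINT \<omega>|M. K n \<omega>" "card_const * A n" "e / real n"] n by simp
    fix P assume P: "partition_on {1..n} P"
    have "block_sum (generator ?w) P = (\<Sum>U\<in>P. - (1 - \<alpha>) * ?w (card U))"
      unfolding block_sum_def using generator_centred_count(1) part_block(4)[OF P] by (intro sum.cong) auto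
    then have g: "block_sum (generator ?w) P = - (1 - \<alpha>) * block_sum ?w P"
      by (simp only: sum_distrib_left block_sum_def)
    have "2 * block_sum ?w P * (rate n (card P) * block_sum (generator ?w) P + bias n (card P) * ?w 1)
      = - (2 * (rate n (card P) * (1 - \<alpha>)) * (block_sum ?w P)\<^sup>2) + 2 * block_sum ?w P * (bias n (card P) * ?w 1)"
      unfolding g by (simp add: power2_eq_square algebra_simps)
    also have "\<dots> \<le> 2 * block_sum ?w P * (bias n (card P) * ?w 1)"
      using rate_pos[of n "card P"] alpha by simp
    also have "\<dots> \<le> e / real n * real (card P)"
      unfolding e_def by (rule centred_count_bias[OF _ n P]) simp
    finally show "2 * block_sum ?w P * (rate n (card P) * block_sum (generator ?w) P + bias n (card P) * ?w 1)
      \<le> e / real n * real (card P)" .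
  qed auto
next
  case (Suc j)
  then obtain C where C: "C > 0" "\<And>n. n \<ge> 1 \<Longrightarrow> (LINT \<omega>|M. (BS (centred_count \<alpha> j) n \<omega>)\<^sup>2) \<le> C * A n" by auto
  let ?w = "centred_count \<alpha> (Suc j)" and ?u = "centred_count \<alpha> j"
  have jS: "Suc j \<ge> 1" by simp
  define e where "e = 2 * (1 + sibuya_pmf \<alpha> (Suc j))\<^sup>2 * D"
  define d where "d = D * real j"
  have e0: "e \<ge> 0" "d \<ge> 0" using D_ge by (simp_all add: e_def d_def)
  show ?case
  proof (rule second_moment_growth[where w = ?w and c = "e * card_const + d * C"
        and G = "\<lambda>n P. e / real n * real (card P) + d / real n * (block_sum ?u P)\<^sup>2"])
    show "(?w 1)\<^sup>2 \<le> (1 + sibuya_pmf \<alpha> (Suc j))\<^sup>2 + real (Suc j)"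
      by (rule centred_count_bounds) simp
    show "(real l - \<alpha>) * (?w (Suc l) - ?w l)\<^sup>2 \<le> (1 + sibuya_pmf \<alpha> (Suc j))\<^sup>2 + real (Suc j)" if "l \<ge> 1" for l
      by (rule centred_count_bounds) (use that in simp_all)
    fix n :: nat assume n: "n \<ge> 1"
    have "e / real n * (LINT \<omega>|M. K n \<omega>) \<le> e / real n * (card_const * A n)"
      using e0 by (intro mult_left_mono mean_card n) auto
    moreover have "d / real n * (LINT \<omega>|M. (BS ?u n \<omega>)\<^sup>2) \<le> d / real n * (C * A n)"
      using e0 by (intro mult_left_mono C n) auto
    moreover have "(e * card_const + d * C) * A n / real n = e / real n * (card_const * A n) + d / real n * (C * A n)"
      by (simp add: distrib_right add_divide_distrib)
    moreover have "(LINT \<omega>|M. e / real n * K n \<omega> + d / real n * (BS ?u n \<omega>)\<^sup>2)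
      = e / real n * (LINT \<omega>|M. K n \<omega>) + d / real n * (LINT \<omega>|M. (BS ?u n \<omega>)\<^sup>2)"
      using n by simp
    ultimately show "(LINT \<omega>|M. e / real n * K n \<omega> + d / real n * (BS ?u n \<omega>)\<^sup>2) \<le> (e * card_const + d * C) * A n / real n"
      by linarith
    fix P assume P: "partition_on {1..n} P"
    let ?x = "block_sum ?w P" and ?y = "block_sum ?u P" and ?r = "rate n (card P)"
    have "block_sum (generator ?w) P = (\<Sum>U\<in>P. (real j - \<alpha>) * ?u (card U) - (real (Suc j) - \<alpha>) * ?w (card U))"
      unfolding block_sum_def using generator_centred_count(2)[OF _ Suc(1)] part_block(4)[OF P] by (intro sum.cong) auto
    then have g: "block_sum (generator ?w) P = (real j - \<alpha>) * ?y - (real (Suc j) - \<alpha>) * ?x"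
      by (simp only: sum_distrib_left block_sum_def sum_subtractf)
    have ja: "real j - \<alpha> > 0" using Suc(1) alpha by simp
    have "2 * ?x * ((real j - \<alpha>) * ?y - (real (Suc j) - \<alpha>) * ?x) \<le> real j * ?y\<^sup>2"
    proof -
      have "0 \<le> (real j - \<alpha>) * (?x - ?y)\<^sup>2" using ja by simp
      then have "2 * ?x * ((real j - \<alpha>) * ?y - (real (Suc j) - \<alpha>) * ?x) \<le> (real j - \<alpha>) * ?y\<^sup>2 + ((real j - \<alpha>) - 2 * (real (Suc j) - \<alpha>)) * ?x\<^sup>2"
        by (simp add: power2_eq_square algebra_simps)
      also have "\<dots> \<le> real j * ?y\<^sup>2 + 0"
        using ja alpha by (intro add_mono mult_right_mono mult_nonpos_nonneg) auto
      finally show ?thesis by simp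
    qed
    then have "?r * (2 * ?x * ((real j - \<alpha>) * ?y - (real (Suc j) - \<alpha>) * ?x)) \<le> ?r * (real j * ?y\<^sup>2)"
      using rate_pos[of n "card P"] by (intro mult_left_mono) auto
    also have "\<dots> \<le> D / real n * (real j * ?y\<^sup>2)"
      by (intro mult_right_mono rate_D(1)[OF n part_card_pos[OF P n]]) simp
    finally have 1: "2 * ?x * (?r * block_sum (generator ?w) P) \<le> d / real n * ?y\<^sup>2"
      unfolding g d_def by (simp add: mult_ac)
    have 2: "2 * ?x * (bias n (card P) * ?w 1) \<le> e / real n * real (card P)"
      unfolding e_def by (rule centred_count_bias[OF jS n P])
    show "2 * ?x * (?r * block_sum (generator ?w) P + bias n (card P) * ?w 1)
      \<le> e / real n * real (card P) + d / real n * ?y\<^sup>2"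
      using 1 2 unfolding distrib_left by linarith
  qed auto
qed

text \<open>From the second to the first absolute moment, by \<open>\<bar>x\<bar> \<le> c +
  x\<^sup>2 / c\<close> with \<open>c\<close> the root of the growth.\<close>
lemma centred_count_mean:
  assumes "j \<ge> 1"
  shows "\<exists>C>0. \<forall>n\<ge>1. (LINT \<omega>|M. \<bar>BS (centred_count \<alpha> j) n \<omega>\<bar>) \<le> C * sqrt (A n)"
proof -
  obtain C where C: "C > 0" "\<And>n. n \<ge> 1 \<Longrightarrow> (LINT \<omega>|M. (BS (centred_count \<alpha> j) n \<omega>)\<^sup>2) \<le> C * A n"
    using centred_count_second_moment[OF assms] by auto
  have "(LINT \<omega>|M. \<bar>BS (centred_count \<alpha> j) n \<omega>\<bar>) \<le> (1 + C) * sqrt (A n)" if n: "n \<ge> 1" for n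
  proof -
    have s: "sqrt (A n) > 0" using A_pos by simp
    have "(LINT \<omega>|M. \<bar>BS (centred_count \<alpha> j) n \<omega>\<bar>) \<le> (LINT \<omega>|M. sqrt (A n) + (BS (centred_count \<alpha> j) n \<omega>)\<^sup>2 / sqrt (A n))"
    proof (rule expectation_mono_Part[OF n])
      fix P
      let ?x = "block_sum (centred_count \<alpha> j) P"
      have "0 \<le> (\<bar>?x\<bar> - sqrt (A n))\<^sup>2" "0 \<le> \<bar>?x\<bar> * sqrt (A n)" using s by auto
      then have "\<bar>?x\<bar> * sqrt (A n) \<le> (sqrt (A n))\<^sup>2 + ?x\<^sup>2"
        unfolding power2_diff power2_abs by linarith
      then show "\<bar>?x\<bar> \<le> sqrt (A n) + ?x\<^sup>2 / sqrt (A n)"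
        using s by (simp add: field_simps power2_eq_square)
    qed
    also have "\<dots> = sqrt (A n) + (LINT \<omega>|M. (BS (centred_count \<alpha> j) n \<omega>)\<^sup>2) / sqrt (A n)"
      using n by (simp add: prob_space)
    also have "\<dots> \<le> sqrt (A n) + C * A n / sqrt (A n)"
      using s by (intro add_left_mono divide_right_mono C n) auto
    also have "C * A n / sqrt (A n) = C * sqrt (A n)"
      using real_div_sqrt[of "A n"] A_pos[of n] by (simp only: times_divide_eq_right[symmetric])
    finally show ?thesis by (simp add: distrib_right)
  qed
  then show ?thesis using C by (intro exI[of _ "1 + C"]) auto
qed

text \<open>Sizes up to \<open>J\<close> are handled by the centred counts. For larger sizes the
  weight is nearly constant, and the constant part contributes exactly to both sides because the
  Sibuya probabilities sum to one.\<close>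
theorem block_sum_law_of_large_numbers:
  assumes conv: "w \<longlonglongrightarrow> l" and s: "(\<lambda>m. sibuya_pmf \<alpha> (Suc m) * w (Suc m)) sums s"
  shows "(\<lambda>n. (LINT \<omega>|M. \<bar>BS w n \<omega> - s * K n \<omega>\<bar>) / A n) \<longlonglongrightarrow> 0"
proof (rule LIMSEQ_I)
  fix \<epsilon> :: real assume eps: "\<epsilon> > 0"
  define \<eta> where "\<eta> = \<epsilon> / (4 * card_const)"
  have eta: "\<eta> > 0" using eps card_const_pos by (simp add: \<eta>_def)
  obtain J where J: "\<And>j. j \<ge> J \<Longrightarrow> \<bar>w j - l\<bar> < \<eta>"
    using LIMSEQ_D[OF conv eta] by auto
  define cc where "cc j = \<bar>w (Suc j) - l\<bar>" for j
  have key: "\<bar>block_sum w P - s * real (card P)\<bar> \<le> (\<Sum>j<J. cc j * \<bar>block_sum (centred_count \<alpha> (Suc j)) P\<bar>) + 2 * \<eta> * real (card P)"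
    if P: "partition_on {1..n} P" for P n
  proof -
    let ?p = "\<lambda>m. sibuya_pmf \<alpha> (Suc m)"
    \<comment> \<open>The remainder of the weight beyond \<open>J\<close>, uniformly
      small.\<close>
    define t where "t j = (if j \<le> J then 0 else w j - l)" for j
    have t: "\<bar>t j\<bar> \<le> \<eta>" for j using J[of j] eta by (auto simp: t_def)
    have w: "w (card U) - l = (\<Sum>j<J. (w (Suc j) - l) * (if card U = Suc j then 1 else 0)) + t (card U)" if U: "U \<in> P" for U
    proof (cases "card U \<le> J")
      case True
      then obtain i where i: "card U = Suc i" "i < J" using part_block(4)[OF P U] by (cases "card U") auto
      have "(\<Sum>j<J. (w (Suc j) - l) * (if card U = Suc j then 1 else 0)) = (\<Sum>j<J. if j = i then w (Suc j) - l else 0)"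
        by (rule sum.cong) (auto simp: i)
      also have "\<dots> = w (card U) - l" using i by (simp add: sum.delta)
      finally show ?thesis using True by (simp add: t_def)
    next
      case False
      have "(\<Sum>j<J. (w (Suc j) - l) * (if card U = Suc j then 1 else 0)) = 0"
        by (rule sum.neutral) (use False in auto)
      then show ?thesis using False by (simp add: t_def)
    qed
    have "(\<lambda>m. ?p m * w (Suc m) - l * ?p m) sums (s - l * 1)"
      by (intro sums_diff s sums_mult sibuya_sums[OF alpha])
    then have ss: "(\<lambda>m. ?p m * (w (Suc m) - l)) sums (s - l)" by (simp add: algebra_simps)
    have tail: "\<bar>(s - l) - (\<Sum>j<J. ?p j * (w (Suc j) - l))\<bar> \<le> \<eta>"
    proof -
      have "(\<lambda>m. ?p m * t (Suc m)) sums (s - l - (\<Sum>j<J. ?p j * (w (Suc j) - l)))"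
      proof -
        have "(\<lambda>m. ?p m * (w (Suc m) - l) - (if m < J then ?p m * (w (Suc m) - l) else 0)) sums (s - l - (\<Sum>j<J. ?p j * (w (Suc j) - l)))"
          using sums_If_finite_set[of "{..<J}" "\<lambda>m. ?p m * (w (Suc m) - l)"] by (intro sums_diff ss) simp
        then show ?thesis by (rule sums_cong[THEN iffD1, rotated]) (auto simp: t_def)
      qed
      moreover have "(\<lambda>m. ?p m * \<eta>) sums (1 * \<eta>)" by (intro sums_mult2 sibuya_sums[OF alpha])
      moreover have "norm (?p m * t (Suc m)) \<le> ?p m * \<eta>" for m
        using sibuya_pmf_nonneg[OF alpha, of "Suc m"] t by (simp add: abs_mult mult_left_mono)
      ultimately have "norm (\<Sum>m. ?p m * t (Suc m)) \<le> (\<Sum>m. ?p m * \<eta>)"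
        by (intro norm_suminf_le) (auto simp: sums_iff)
      then show ?thesis
        using \<open>(\<lambda>m. ?p m * t (Suc m)) sums _\<close> \<open>(\<lambda>m. ?p m * \<eta>) sums _\<close> by (simp add: sums_iff)
    qed
    let ?k = "real (card P)"
    define T where "T = (s - l) - (\<Sum>j<J. ?p j * (w (Suc j) - l))"
    have "block_sum w P - l * ?k = (\<Sum>U\<in>P. (w (card U) - l))"
      by (simp add: block_sum_def sum_subtractf)
    also have "\<dots> = (\<Sum>U\<in>P. (\<Sum>j<J. (w (Suc j) - l) * (if card U = Suc j then 1 else 0)) + t (card U))"
      by (rule sum.cong[OF refl w])
    also have "\<dots> = (\<Sum>j<J. (w (Suc j) - l) * (\<Sum>U\<in>P. (if card U = Suc j then 1 else 0))) + block_sum t P"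
      unfolding sum.distrib block_sum_def sum_distrib_left by (subst sum.swap) simp
    also have "(\<Sum>j<J. (w (Suc j) - l) * (\<Sum>U\<in>P. (if card U = Suc j then 1 else 0)))
      = (\<Sum>j<J. (w (Suc j) - l) * (block_sum (centred_count \<alpha> (Suc j)) P + ?p j * ?k))"
      by (simp add: block_sum_def centred_count_def sum_subtractf mult.commute)
    also have "\<dots> = (\<Sum>j<J. (w (Suc j) - l) * block_sum (centred_count \<alpha> (Suc j)) P) + (\<Sum>j<J. ?p j * (w (Suc j) - l)) * ?k"
      by (simp add: distrib_left sum.distrib sum_distrib_left mult_ac)
    finally have "block_sum w P - s * ?k = (\<Sum>j<J. (w (Suc j) - l) * block_sum (centred_count \<alpha> (Suc j)) P) + block_sum t P - T * ?k"
      unfolding T_def by (simp add: algebra_simps)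
    moreover have "\<bar>\<Sum>j<J. (w (Suc j) - l) * block_sum (centred_count \<alpha> (Suc j)) P\<bar> \<le> (\<Sum>j<J. cc j * \<bar>block_sum (centred_count \<alpha> (Suc j)) P\<bar>)"
      by (rule order_trans[OF sum_abs]) (simp add: cc_def abs_mult)
    moreover have "\<bar>block_sum t P\<bar> \<le> ?k * \<eta>" by (rule block_sum_bound[OF t])
    moreover have "\<bar>T * ?k\<bar> \<le> \<eta> * ?k" unfolding abs_mult using tail by (simp add: T_def mult_right_mono)
    ultimately show ?thesis by (simp add: algebra_simps)
  qed
  have "\<forall>j. \<exists>C>0. \<forall>n\<ge>1. (LINT \<omega>|M. \<bar>BS (centred_count \<alpha> (Suc j)) n \<omega>\<bar>) \<le> C * sqrt (A n)"
    using centred_count_mean by simp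
  then obtain C where C: "\<And>j. C j > 0" "\<And>j n. n \<ge> 1 \<Longrightarrow> (LINT \<omega>|M. \<bar>BS (centred_count \<alpha> (Suc j)) n \<omega>\<bar>) \<le> C j * sqrt (A n)"
    by metis
  define R where "R = (\<Sum>j<J. cc j * C j)"
  have R: "R \<ge> 0" unfolding R_def using C(1) by (intro sum_nonneg mult_nonneg_nonneg) (auto simp: cc_def less_imp_le)
  have main: "(LINT \<omega>|M. \<bar>BS w n \<omega> - s * K n \<omega>\<bar>) / A n \<le> R / sqrt (A n) + \<epsilon> / 2" if n: "n \<ge> 1" for n
  proof -
    have int: "integrable M (\<lambda>\<omega>. cc j * \<bar>BS (centred_count \<alpha> (Suc j)) n \<omega>\<bar>)" for j
      using n by simp
    have "(LINT \<omega>|M. \<bar>BS w n \<omega> - s * K n \<omega>\<bar>) \<le> (LINT \<omega>|M. (\<Sum>j<J. cc j * \<bar>BS (centred_count \<alpha> (Suc j)) n \<omega>\<bar>) + 2 * \<eta> * K n \<omega>)"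
      by (rule expectation_mono_Part[OF n key])
    also have "\<dots> = (\<Sum>j<J. cc j * (LINT \<omega>|M. \<bar>BS (centred_count \<alpha> (Suc j)) n \<omega>\<bar>)) + 2 * \<eta> * (LINT \<omega>|M. K n \<omega>)"
      using int n by (subst Bochner_Integration.integral_add) (auto simp: Bochner_Integration.integral_sum)
    also have "\<dots> \<le> (\<Sum>j<J. cc j * (C j * sqrt (A n))) + 2 * \<eta> * (card_const * A n)"
      using C(2)[OF n] mean_card[OF n] eta by (intro add_mono sum_mono mult_left_mono) (auto simp: cc_def)
    also have "\<dots> = R * sqrt (A n) + \<epsilon> / 2 * A n"
      using card_const_pos by (simp add: R_def sum_distrib_right mult.assoc \<eta>_def)
    finally have "(LINT \<omega>|M. \<bar>BS w n \<omega> - s * K n \<omega>\<bar>) / A n \<le> (R * sqrt (A n) + \<epsilon> / 2 * A n) / A n"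
      using A_pos[of n] by (intro divide_right_mono) auto
    also have "\<dots> = R * (sqrt (A n) / A n) + \<epsilon> / 2" using A_pos[of n] by (simp add: add_divide_distrib)
    also have "sqrt (A n) / A n = 1 / sqrt (A n)" using A_pos[of n] by (simp add: sqrt_divide_self_eq inverse_eq_divide)
    finally show ?thesis by simp
  qed
  have "(\<lambda>n. R / sqrt (A n)) \<longlonglongrightarrow> 0"
  proof -
    obtain c where c: "c > 0" "\<And>n. n \<ge> 1 \<Longrightarrow> c * real n powr \<alpha> \<le> A n" by (rule A_lower) blast
    have "filterlim (\<lambda>n. c * real n powr \<alpha>) at_top sequentially" using c(1) alpha by real_asymp
    then have "filterlim A at_top sequentially"
      by (rule filterlim_at_top_mono) (rule eventually_mono[OF eventually_ge_at_top[of 1]], rule c(2))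
    then have "filterlim (\<lambda>n. sqrt (A n)) at_top sequentially"
      using sqrt_at_top filterlim_compose by blast
    then show ?thesis by (intro tendsto_divide_0[OF tendsto_const] filterlim_at_top_imp_at_infinity)
  qed
  then obtain N where N: "\<And>n. n \<ge> N \<Longrightarrow> \<bar>R / sqrt (A n)\<bar> < \<epsilon> / 2"
    using LIMSEQ_D[of "\<lambda>n. R / sqrt (A n)" 0 "\<epsilon> / 2"] eps by auto
  have "norm ((LINT \<omega>|M. \<bar>BS w n \<omega> - s * K n \<omega>\<bar>) / A n - 0) < \<epsilon>" if "n \<ge> max N 1" for n
  proof -
    have "(LINT \<omega>|M. \<bar>BS w n \<omega> - s * K n \<omega>\<bar>) / A n \<ge> 0"
      using A_pos[of n] by (intro divide_nonneg_nonneg integral_nonneg_AE) auto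
    moreover have "n \<ge> 1" "n \<ge> N" using that by auto
    ultimately show ?thesis
      using main[of n] N[of n] abs_ge_self[of "R / sqrt (A n)"] unfolding diff_0_right real_norm_def by linarith
  qed
  then show "\<exists>N. \<forall>n\<ge>N. norm ((LINT \<omega>|M. \<bar>BS w n \<omega> - s * K n \<omega>\<bar>) / A n - 0) < \<epsilon>" by blast
qed

end

section \<open>Almost sure convergence of the number of blocks\<close>

text \<open>For a monotone sequence, convergence along \<open>j ^ q\<close> suffices, because
  consecutive members of this subsequence have ratio tending to one.\<close>
lemma tendsto_of_power_subsequence:
  fixes k :: "nat \<Rightarrow> real"
  assumes mono: "\<And>m n. 1 \<le> m \<Longrightarrow> m \<le> n \<Longrightarrow> k m \<le> k n" and nonneg: "\<And>n. 0 \<le> k n"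
    and q: "q \<ge> 1" and b: "b > 0"
    and conv: "(\<lambda>j. k (Suc j ^ q) / real (Suc j ^ q) powr b) \<longlonglongrightarrow> S"
  shows "(\<lambda>n. k n / real n powr b) \<longlonglongrightarrow> S"
proof -
  \<comment> \<open>The index with \<open>(J + 1) ^ q \<le> n < (J + 2) ^ q\<close>.\<close>
  define J :: "nat \<Rightarrow> nat" where "J n = (LEAST j. n < (j + 2) ^ q)" for n
  have up: "n < (J n + 2) ^ q" for n
  proof -
    have "n + 2 \<le> (n + 2 :: nat) ^ q" using q by (simp add: self_le_power)
    then have "\<exists>j. n < (j + 2) ^ q" by (intro exI[of _ n]) linarith
    then show ?thesis unfolding J_def by (rule LeastI_ex)
  qed
  have low: "Suc (J n) ^ q \<le> n" if "n \<ge> 1" for n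
  proof (cases "J n")
    case (Suc i)
    then have "\<not> n < (i + 2) ^ q" unfolding J_def by (intro not_less_Least) simp
    then show ?thesis using Suc by simp
  qed (use that in simp)
  have J_top: "filterlim J at_top sequentially"
    unfolding filterlim_at_top
  proof
    fix j
    have "j \<le> J n" if n: "n \<ge> (j + 1) ^ q" for n
    proof (rule ccontr)
      assume "\<not> j \<le> J n"
      then have "(J n + 2) ^ q \<le> (j + 1) ^ q" by (intro power_mono) auto
      then show False using up[of n] n by linarith
    qed
    then show "\<forall>\<^sub>F n in sequentially. j \<le> J n" by (auto simp: eventually_at_top_linorder)
  qed
  define y where "y j = k (Suc j ^ q) / real (Suc j ^ q) powr b" for j
  define r where "r j = real (Suc (Suc j) ^ q) powr b / real (Suc j ^ q) powr b" for j
  have rpos: "r j > 0" for j by (simp add: r_def del: of_nat_Suc of_nat_power)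
  have e: "real (Suc j ^ q) powr b = real (Suc j) powr (real q * b)" for j
    by (simp add: powr_powr[symmetric] powr_realpow del: of_nat_Suc)
  have "(\<lambda>j. (real j + 2) powr (real q * b) / (real j + 1) powr (real q * b)) \<longlonglongrightarrow> 1" by real_asymp
  then have r1: "r \<longlonglongrightarrow> 1" unfolding r_def e by (simp add: add_ac)
  have ylim: "y \<longlonglongrightarrow> S" using conv by (simp add: y_def[abs_def])
  have "(\<lambda>j. y (Suc j) * r j) \<longlonglongrightarrow> S * 1" by (intro tendsto_mult r1 LIMSEQ_Suc ylim)
  from filterlim_compose[OF this J_top] have U: "(\<lambda>n. y (Suc (J n)) * r (J n)) \<longlonglongrightarrow> S" by simp
  have "(\<lambda>j. y j / r j) \<longlonglongrightarrow> S / 1" by (intro tendsto_divide r1 ylim) simp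
  from filterlim_compose[OF this J_top] have L: "(\<lambda>n. y (J n) / r (J n)) \<longlonglongrightarrow> S" by simp
  show ?thesis
  proof (rule tendsto_sandwich[OF _ _ L U])
    show "\<forall>\<^sub>F n in sequentially. y (J n) / r (J n) \<le> k n / real n powr b"
      using eventually_ge_at_top[of 1]
    proof eventually_elim
      case (elim n)
      have "y (J n) / r (J n) = k (Suc (J n) ^ q) / real (Suc (Suc (J n)) ^ q) powr b"
        by (simp add: y_def r_def del: of_nat_Suc of_nat_power)
      also have "\<dots> \<le> k n / real n powr b"
      proof (rule frac_le)
        show "k (Suc (J n) ^ q) \<le> k n" using low[OF elim] by (intro mono) auto
        show "real n powr b \<le> real (Suc (Suc (J n)) ^ q) powr b"
        proof (rule powr_mono2)
          have "n \<le> Suc (Suc (J n)) ^ q" using up[of n] by simp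
          then show "real n \<le> real (Suc (Suc (J n)) ^ q)" by (rule of_nat_mono)
        qed (use b in auto)
      qed (use nonneg elim in auto)
      finally show ?case .
    qed
    show "\<forall>\<^sub>F n in sequentially. k n / real n powr b \<le> y (Suc (J n)) * r (J n)"
      using eventually_ge_at_top[of 1]
    proof eventually_elim
      case (elim n)
      have "k n / real n powr b \<le> k (Suc (Suc (J n)) ^ q) / real (Suc (J n) ^ q) powr b"
      proof (rule frac_le)
        show "k n \<le> k (Suc (Suc (J n)) ^ q)" using up[of n] elim by (intro mono) auto
        show "real (Suc (J n) ^ q) powr b \<le> real n powr b"
          using low[OF elim] b by (intro powr_mono2) (auto simp del: of_nat_power)
      qed (use nonneg in \<open>auto simp del: of_nat_Suc of_nat_power\<close>)
      also have "\<dots> = y (Suc (J n)) * r (J n)"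
        by (simp add: y_def r_def del: of_nat_Suc of_nat_power)
      finally show ?case .
    qed
  qed
qed

lemma (in prob_space) AE_convergent_summable_increments:
  fixes Y :: "nat \<Rightarrow> 'a \<Rightarrow> real"
  assumes int: "\<And>j. integrable M (Y j)"
    and c: "\<And>j. expectation (\<lambda>\<omega>. \<bar>Y (Suc j) \<omega> - Y j \<omega>\<bar>) \<le> c j" "summable c"
  shows "AE \<omega> in M. convergent (\<lambda>j. Y j \<omega>)"
proof -
  define d where "d j \<omega> = \<bar>Y (Suc j) \<omega> - Y j \<omega>\<bar>" for j \<omega>
  have dint: "integrable M (d j)" for j unfolding d_def using int by simp
  note [measurable] = borel_measurable_integrable[OF dint]
  have "(\<integral>\<^sup>+ \<omega>. (\<Sum>j. ennreal (d j \<omega>)) \<partial>M) = (\<Sum>j. \<integral>\<^sup>+ \<omega>. ennreal (d j \<omega>) \<partial>M)"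
    by (rule nn_integral_suminf) measurable
  also have "\<dots> \<le> (\<Sum>j. ennreal (c j))"
  proof (intro suminf_le summableI)
    fix j
    have "(\<integral>\<^sup>+ \<omega>. ennreal (d j \<omega>) \<partial>M) = ennreal (expectation (d j))"
      by (intro nn_integral_eq_integral dint) (simp add: d_def)
    also have "\<dots> \<le> ennreal (c j)" using c(1)[of j] by (intro ennreal_leI) (simp add: d_def[abs_def])
    finally show "(\<integral>\<^sup>+ \<omega>. ennreal (d j \<omega>) \<partial>M) \<le> ennreal (c j)" .
  qed
  also have "\<dots> < \<infinity>"
  proof -
    have "0 \<le> c j" for j
    proof -
      have "0 \<le> expectation (\<lambda>\<omega>. \<bar>Y (Suc j) \<omega> - Y j \<omega>\<bar>)" by (intro integral_nonneg_AE) auto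
      also have "\<dots> \<le> c j" by (rule c)
      finally show ?thesis .
    qed
    then show ?thesis using c(2) by (subst suminf_ennreal2) auto
  qed
  finally have "(\<integral>\<^sup>+ \<omega>. (\<Sum>j. ennreal (d j \<omega>)) \<partial>M) \<noteq> \<infinity>" by simp
  then have "AE \<omega> in M. (\<Sum>j. ennreal (d j \<omega>)) \<noteq> \<infinity>"
    by (intro nn_integral_PInf_AE) measurable
  then show ?thesis
  proof eventually_elim
    case (elim \<omega>)
    then have "summable (\<lambda>j. d j \<omega>)" by (intro summable_suminf_not_top) (auto simp: d_def)
    then have "summable (\<lambda>j. Y (Suc j) \<omega> - Y j \<omega>)"
      unfolding d_def by (rule summable_rabs_cancel)
    then have "convergent (\<lambda>n. \<Sum>j<n. Y (Suc j) \<omega> - Y j \<omega>)" by (simp add: summable_iff_convergent)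
    then have "convergent (\<lambda>n. (Y n \<omega> - Y 0 \<omega>) + Y 0 \<omega>)"
      unfolding sum_lessThan_telescope[of "\<lambda>j. Y j \<omega>"] by (intro convergent_add convergent_const)
    then show ?case by simp
  qed
qed

context gibbs_model
begin

lemmas gibbs_step = step

lemma K_mono:
  assumes w: "\<omega> \<in> space M" and mn: "1 \<le> m" "m \<le> n" shows "K m \<omega> \<le> K n \<omega>"
  using mn(2)
proof (induction n rule: dec_induct)
  case (step n)
  then have n: "n \<ge> 1" using mn by simp
  have "card (Part n \<omega>) \<le> card (Part (Suc n) \<omega>)"
  proof -
    note P = Part_partition[OF n w]
    show ?thesis
      using gibbs_step[OF n w] card_open_block[OF P] card_join_block[OF P] by auto
  qed
  then show ?case using step by simp
qed simp

text \<open>The normalized number of blocks is a martingale up to a drift that is summable against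
  \<open>1 / growth\<close>. Its squared increments have mean of order \<open>1 / (m growth \<alpha>
  m)\<close>, which is exactly the size of the decrements of \<open>1 / growth\<close>, so that the
  sum telescopes.\<close>
lemma ratio_increment:
  obtains C where "C > 0" "\<And>n m. 1 \<le> n \<Longrightarrow> n \<le> m \<Longrightarrow>
    (LINT \<omega>|M. (K m \<omega> / A m - K n \<omega> / A n)\<^sup>2) \<le> C * (1 / A n - 1 / A m)"
proof -
  define c where "c = 12 * D * card_const"
  define C where "C = c * ((1 + \<alpha>) / \<alpha>)"
  have c0: "c > 0" using D_ge card_const_pos by (simp add: c_def)
  have C0: "C > 0" using c0 alpha by (simp add: C_def)
  have "(LINT \<omega>|M. (K m \<omega> / A m - K n \<omega> / A n)\<^sup>2) \<le> C * (1 / A n - 1 / A m)" if n: "1 \<le> n" and nm: "n \<le> m" for n m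
    using nm
  proof (induction m rule: dec_induct)
    case base
    then show ?case by simp
  next
    case (step m)
    have m: "m \<ge> 1" using step n by simp
    define a where "a = 1 / (real m * A m)"
    have a0: "a > 0" using m A_pos[of m] by (simp add: a_def)
    have adm: "adapted m (K n)" by (rule adapted_Part_le[OF n step(1), of "\<lambda>P. real (card P)"])
    have A1: "A (Suc m) = A m * (1 + \<alpha> / real m)" by (rule growth_Suc[OF m])
    have Am: "A m \<le> A (Suc m)" using alpha by (intro growth_mono) auto
    let ?X = "\<lambda>\<omega>. K m \<omega> / A m - K n \<omega> / A n"
    let ?W = "\<lambda>\<omega>. (?X \<omega>)\<^sup>2 + 2 * D * a * (K m \<omega> / A m + K n \<omega> / A n) + 8 * D * a * (K m \<omega> / A m)"
    have intX: "integrable M (\<lambda>\<omega>. (?X \<omega>)\<^sup>2)"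
      by (rule adapted_integrable[OF m adapted_comp2[OF adapted_Part adm, of "\<lambda>k h. (k / A m - h / A n)\<^sup>2" "\<lambda>P. real (card P)"]])
    have "(LINT \<omega>|M. (K (Suc m) \<omega> / A (Suc m) - K n \<omega> / A n)\<^sup>2)
      = (LINT \<omega>|M. smean m (\<lambda>P'. (real (card P') / A (Suc m) - K n \<omega> / A n)\<^sup>2) (Part m \<omega>))"
      by (rule one_step[OF m adm, of "\<lambda>h _ P'. (real (card P') / A (Suc m) - h / A n)\<^sup>2"])
    also have "\<dots> \<le> (LINT \<omega>|M. ?W \<omega>)"
    proof (rule integral_mono)
      show "integrable M (\<lambda>\<omega>. smean m (\<lambda>P'. (real (card P') / A (Suc m) - K n \<omega> / A n)\<^sup>2) (Part m \<omega>))"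
        by (rule adapted_integrable[OF m adapted_comp2[OF adapted_Part adm, of "\<lambda>P h. smean m (\<lambda>P'. (real (card P') / A (Suc m) - h / A n)\<^sup>2) P" "\<lambda>P. P"]])
      show "integrable M ?W" using intX m n by simp
      fix \<omega> assume w: "\<omega> \<in> space M"
      let ?P = "Part m \<omega>" and ?x = "?X \<omega>"
      note P = Part_partition[OF m w]
      note k = card_range[OF m w]
      define \<beta> where "\<beta> = \<alpha> * real (card ?P) / real m"
      have beta: "0 \<le> \<beta>" "\<beta> \<le> 1" "\<beta> \<le> real (card ?P) / real m"
      proof -
        show b3: "\<beta> \<le> real (card ?P) / real m" unfolding \<beta>_def using alpha by (intro divide_right_mono mult_left_le_one_le) auto
        show "0 \<le> \<beta>" unfolding \<beta>_def using alpha by simp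
        have "real (card ?P) / real m \<le> 1" using k m by simp
        with b3 show "\<beta> \<le> 1" by linarith
      qed
      define \<delta> where "\<delta> P' = ((real (card P') - real (card ?P)) - \<beta>) / A (Suc m)" for P' :: "nat set set"
      have split: "real (card P') / A (Suc m) - K n \<omega> / A n = ?x + \<delta> P'" for P'
      proof -
        have "real (card ?P) / A m = (real (card ?P) + \<beta>) / A (Suc m)"
        proof -
          have "real (card ?P) + \<beta> = real (card ?P) * (1 + \<alpha> / real m)" by (simp add: \<beta>_def distrib_left mult.commute)
          moreover have "1 + \<alpha> / real m > 0" using alpha by (simp add: add_pos_nonneg)
          ultimately show ?thesis unfolding A1 by simp
        qed
        then show ?thesis by (simp add: \<delta>_def diff_divide_distrib add_divide_distrib)
      qed
      have "smean m \<delta> ?P = smean m (\<lambda>P'. (1 / A (Suc m)) * ((real (card P') - real (card ?P)) + (- \<beta>))) ?P"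
        by (simp add: \<delta>_def[abs_def])
      also have "\<dots> = (bias m (card ?P) * (1 - \<alpha> * real (card ?P) / real m)) / A (Suc m)"
        unfolding smean_cmult smean_add smean_const[OF P m] smean_card(1)[OF P m] by (simp add: \<beta>_def)
      finally have "\<bar>smean m \<delta> ?P\<bar> \<le> D / real m / A (Suc m)"
        using divide_right_mono[OF smean_card(2)[OF P m], of "A (Suc m)"] A_pos[of "Suc m"] by simp
      also have "\<dots> \<le> D / real m / A m" using Am A_pos D_ge m by (intro divide_left_mono) auto
      finally have sd: "\<bar>smean m \<delta> ?P\<bar> \<le> D * a" by (simp add: a_def)
      have "smean m (\<lambda>P'. (\<delta> P')\<^sup>2) ?P \<le> smean m (\<lambda>P'. (2 / (A (Suc m))\<^sup>2) * ((real (card P') - real (card ?P))\<^sup>2 + \<beta>\<^sup>2)) ?P"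
      proof -
        have "(\<delta> P')\<^sup>2 \<le> (2 / (A (Suc m))\<^sup>2) * ((real (card P') - real (card ?P))\<^sup>2 + \<beta>\<^sup>2)" for P'
        proof -
          have "(x - \<beta>)\<^sup>2 \<le> 2 * (x\<^sup>2 + \<beta>\<^sup>2)" for x :: real
            using zero_le_power2[of "x + \<beta>"] by (simp add: power2_eq_square algebra_simps)
          from divide_right_mono[OF this, of "(A (Suc m))\<^sup>2"] show ?thesis
            unfolding \<delta>_def power_divide by simp
        qed
        then show ?thesis by (intro smean_mono[OF P m]) auto
      qed
      also have "\<dots> = (2 / (A (Suc m))\<^sup>2) * (smean m (\<lambda>P'. (real (card P') - real (card ?P))\<^sup>2) ?P + \<beta>\<^sup>2)"
        unfolding smean_cmult smean_add smean_const[OF P m] ..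
      also have "\<dots> \<le> (2 / (A (Suc m))\<^sup>2) * (4 * D * (real (card ?P) / real m))"
      proof (rule mult_left_mono)
        have "smean m (\<lambda>P'. (block_sum (\<lambda>_. 1) P' - block_sum (\<lambda>_. 1) ?P)\<^sup>2) ?P \<le> 3 * 1 * D * real (card ?P) / real m"
          by (rule smean_increment_sq[OF P m]) auto
        then have "smean m (\<lambda>P'. (real (card P') - real (card ?P))\<^sup>2) ?P \<le> 3 * D * (real (card ?P) / real m)"
          by (simp add: block_sum_const)
        moreover have "\<beta>\<^sup>2 \<le> 1 * (real (card ?P) / real m)"
          using beta mult_left_le[of \<beta> \<beta>] by (simp add: power2_eq_square)
        moreover have "1 * (real (card ?P) / real m) \<le> D * (real (card ?P) / real m)"
          using D_ge by (intro mult_right_mono) auto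
        ultimately show "smean m (\<lambda>P'. (real (card P') - real (card ?P))\<^sup>2) ?P + \<beta>\<^sup>2 \<le> 4 * D * (real (card ?P) / real m)"
          by argo
      qed simp
      also have "\<dots> \<le> (2 / (A m)\<^sup>2) * (4 * D * (real (card ?P) / real m))"
        using Am A_pos[of m] D_ge by (intro mult_right_mono divide_left_mono power_mono mult_nonneg_nonneg) auto
      also have "\<dots> = 8 * D * a * (K m \<omega> / A m)" by (simp add: a_def power2_eq_square mult_ac)
      finally have sd2: "smean m (\<lambda>P'. (\<delta> P')\<^sup>2) ?P \<le> 8 * D * a * (K m \<omega> / A m)" .
      have "smean m (\<lambda>P'. (real (card P') / A (Suc m) - K n \<omega> / A n)\<^sup>2) ?P = smean m (\<lambda>P'. (?x\<^sup>2 + 2 * ?x * \<delta> P') + (\<delta> P')\<^sup>2) ?P"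
      proof -
        have "(x + y)\<^sup>2 = (x\<^sup>2 + 2 * x * y) + y\<^sup>2" for x y :: real by (simp add: power2_sum)
        then show ?thesis by (simp only: split)
      qed
      also have "\<dots> = ?x\<^sup>2 + 2 * ?x * smean m \<delta> ?P + smean m (\<lambda>P'. (\<delta> P')\<^sup>2) ?P"
        unfolding smean_add smean_cmult smean_const[OF P m] ..
      also have "2 * ?x * smean m \<delta> ?P \<le> 2 * D * a * (K m \<omega> / A m + K n \<omega> / A n)"
      proof -
        have "\<bar>?x\<bar> \<le> K m \<omega> / A m + K n \<omega> / A n" using A_pos[of m] A_pos[of n] by (simp add: abs_le_iff)
        then have "\<bar>?x * smean m \<delta> ?P\<bar> \<le> (K m \<omega> / A m + K n \<omega> / A n) * (D * a)"
          unfolding abs_mult using sd A_pos[of m] A_pos[of n] by (intro mult_mono) auto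
        then have "2 * (?x * smean m \<delta> ?P) \<le> 2 * ((K m \<omega> / A m + K n \<omega> / A n) * (D * a))" by linarith
        also have "\<dots> = 2 * D * a * (K m \<omega> / A m + K n \<omega> / A n)" by (simp only: mult_ac)
        finally show ?thesis by (simp only: mult.assoc)
      qed
      finally show "smean m (\<lambda>P'. (real (card P') / A (Suc m) - K n \<omega> / A n)\<^sup>2) ?P \<le> ?W \<omega>"
        using sd2 by linarith
    qed
    also have "\<dots> = (LINT \<omega>|M. (?X \<omega>)\<^sup>2) + 2 * D * a * ((LINT \<omega>|M. K m \<omega>) / A m + (LINT \<omega>|M. K n \<omega>) / A n) + 8 * D * a * ((LINT \<omega>|M. K m \<omega>) / A m)"
      using intX m n by simp
    also have "\<dots> \<le> C * (1 / A n - 1 / A m) + 2 * D * a * (card_const + card_const) + 8 * D * a * card_const"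
      using mean_card[OF m] mean_card[OF n] A_pos D_ge a0
      by (intro add_mono step.IH mult_left_mono) (auto simp: divide_le_eq)
    also have "\<dots> = C * (1 / A n - 1 / A m) + c * a" by (simp add: c_def algebra_simps)
    also have "c * a \<le> C * (1 / A m - 1 / A (Suc m))"
    proof -
      have "1 / A m - 1 / A (Suc m) = \<alpha> / (real m + \<alpha>) * (1 / A m)"
      proof -
        have nz: "real m + \<alpha> \<noteq> 0" "real m \<noteq> 0" using m alpha by auto
        have "1 / (1 + \<alpha> / real m) = real m / (real m + \<alpha>)" using nz by (simp add: field_simps)
        moreover have "\<alpha> / (real m + \<alpha>) = 1 - real m / (real m + \<alpha>)" using nz by (simp add: field_simps)
        ultimately have "\<alpha> / (real m + \<alpha>) = 1 - 1 / (1 + \<alpha> / real m)" by simp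
        then show ?thesis unfolding A1 by (simp add: left_diff_distrib diff_divide_distrib mult.commute)
      qed
      also have "\<dots> \<ge> \<alpha> / ((1 + \<alpha>) * real m) * (1 / A m)"
        using alpha m A_pos[of m] by (intro mult_right_mono divide_left_mono) (auto simp: distrib_right mult_ge1_I add_pos_pos)
      finally have "\<alpha> / ((1 + \<alpha>) * real m) * (1 / A m) \<le> 1 / A m - 1 / A (Suc m)" .
      from mult_left_mono[OF this, of C] C0 show ?thesis
        using alpha by (simp add: C_def a_def)
    qed
    finally show ?case by (simp add: algebra_simps)
  qed
  then show ?thesis using C0 by (rule that[rotated])
qed

text \<open>Along the subsequence \<open>j ^ q\<close> with \<open>q \<alpha> \<ge> 4\<close> the
  increments have means of order \<open>1 / j\<^sup>2\<close>, hence they are summable almost surely;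
  monotonicity fills the gaps.\<close>
theorem alpha_diversity_limit:
  "AE \<omega> in M. (\<lambda>n. K n \<omega> / real n powr \<alpha>) \<longlonglongrightarrow> alpha_diversity \<alpha> Part \<omega>"
proof -
  obtain C where C: "C > 0" "\<And>n m. 1 \<le> n \<Longrightarrow> n \<le> m \<Longrightarrow>
    (LINT \<omega>|M. (K m \<omega> / A m - K n \<omega> / A n)\<^sup>2) \<le> C * (1 / A n - 1 / A m)" by (rule ratio_increment) blast
  obtain c where c: "c > 0" "\<And>n. n \<ge> 1 \<Longrightarrow> c * real n powr \<alpha> \<le> A n" by (rule A_lower) blast
  obtain q :: nat where q: "real q > 4 / \<alpha>" using reals_Archimedean2 by blast
  have q4: "real q * \<alpha> \<ge> 4" using q alpha by (simp add: field_simps)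
  moreover have "q \<noteq> 0" using q4 by (intro notI) simp
  ultimately have q4: "real q * \<alpha> \<ge> 4" "q \<ge> 1" by simp_all
  let ?n = "\<lambda>j. Suc j ^ q"
  have n1: "?n j \<ge> 1" for j by simp
  define Y where "Y j \<omega> = K (?n j) \<omega> / A (?n j)" for j \<omega>
  define R where "R = C / c + 1"
  have "AE \<omega> in M. convergent (\<lambda>j. Y j \<omega>)"
  proof (rule AE_convergent_summable_increments)
    show "integrable M (Y j)" for j unfolding Y_def using n1[of j] by simp
    show "summable (\<lambda>j. R * (1 / (real j + 1)\<^sup>2))"
      using inverse_squares_sums by (intro summable_mult) (auto simp: sums_iff add_ac)
    show "expectation (\<lambda>\<omega>. \<bar>Y (Suc j) \<omega> - Y j \<omega>\<bar>) \<le> R * (1 / (real j + 1)\<^sup>2)" for j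
    proof -
      let ?t = "(real j + 1)\<^sup>2"
      have t: "?t > 0" by (simp add: add_nonneg_pos)
      have le: "?n j \<le> ?n (Suc j)" by (intro power_mono) auto
      have int2: "integrable M (\<lambda>\<omega>. (Y (Suc j) \<omega> - Y j \<omega>)\<^sup>2)"
      proof -
        have "adapted (?n (Suc j)) (K (?n j))" by (rule adapted_Part_le[OF n1 le, of "\<lambda>P. real (card P)"])
        from adapted_integrable[OF n1 adapted_comp2[OF adapted_Part this, of "\<lambda>k h. (k / A (?n (Suc j)) - h / A (?n j))\<^sup>2" "\<lambda>P. real (card P)"]]
        show ?thesis unfolding Y_def .
      qed
      have intY: "integrable M (Y j)" for j unfolding Y_def using n1[of j] by simp
      have "expectation (\<lambda>\<omega>. \<bar>Y (Suc j) \<omega> - Y j \<omega>\<bar>) \<le> expectation (\<lambda>\<omega>. ?t * (Y (Suc j) \<omega> - Y j \<omega>)\<^sup>2 + 1 / ?t)"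
      proof (rule integral_mono)
        fix \<omega>
        have "\<bar>x\<bar> \<le> t * x\<^sup>2 + 1 / t" if "t > 0" for x t :: real
        proof -
          have "0 \<le> (t * \<bar>x\<bar> - 1)\<^sup>2" "0 \<le> t * \<bar>x\<bar>" using that by auto
          then have "t * \<bar>x\<bar> \<le> t\<^sup>2 * \<bar>x\<bar>\<^sup>2 + 1" by (simp add: power2_diff power_mult_distrib)
          then show ?thesis using that by (simp add: field_simps power2_eq_square)
        qed
        from this[OF t] show "\<bar>Y (Suc j) \<omega> - Y j \<omega>\<bar> \<le> ?t * (Y (Suc j) \<omega> - Y j \<omega>)\<^sup>2 + 1 / ?t" .
      qed (use int2 intY in auto)
      also have "\<dots> = ?t * expectation (\<lambda>\<omega>. (Y (Suc j) \<omega> - Y j \<omega>)\<^sup>2) + 1 / ?t"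
        using int2 by (simp add: prob_space)
      also have "expectation (\<lambda>\<omega>. (Y (Suc j) \<omega> - Y j \<omega>)\<^sup>2) \<le> C / c / (?t * ?t)"
      proof -
        have "expectation (\<lambda>\<omega>. (Y (Suc j) \<omega> - Y j \<omega>)\<^sup>2) \<le> C * (1 / A (?n j) - 1 / A (?n (Suc j)))"
          unfolding Y_def by (rule C(2)[OF n1 le])
        also have "\<dots> \<le> C * (1 / A (?n j))" using C A_pos[of "?n (Suc j)"] by (intro mult_left_mono) auto
        also have "\<dots> \<le> C * (1 / (c * (?t * ?t)))"
        proof (intro mult_left_mono divide_left_mono)
          have "?t * ?t = (real j + 1) powr 4"
            by (simp add: powr_numeral power2_eq_square eval_nat_numeral)
          also have "\<dots> \<le> (real j + 1) powr (real q * \<alpha>)" using q4 by (intro powr_mono) auto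
          also have "\<dots> = real (?n j) powr \<alpha>" by (simp add: powr_powr[symmetric] powr_realpow add_ac)
          finally show "c * (?t * ?t) \<le> A (?n j)" using c(1) c(2)[OF n1[of j]] mult_left_mono[of "?t * ?t" "real (?n j) powr \<alpha>" c] by linarith
        qed (use C c t A_pos[of "?n j"] in auto)
        finally show ?thesis by simp
      qed
      then have "?t * expectation (\<lambda>\<omega>. (Y (Suc j) \<omega> - Y j \<omega>)\<^sup>2) + 1 / ?t \<le> ?t * (C / c / (?t * ?t)) + 1 / ?t"
        using t by (intro add_right_mono mult_left_mono) auto
      also have "\<dots> = R * (1 / ?t)"
      proof -
        have "t * (C / c / (t * t)) + 1 / t = R * (1 / t)" if "t > 0" for t
          using that by (simp add: R_def add_divide_distrib)
        from this[OF t] show ?thesis .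
      qed
      finally show ?thesis .
    qed
  qed
  then show ?thesis
    using AE_space
  proof eventually_elim
    case (elim \<omega>)
    then obtain l where l: "(\<lambda>j. Y j \<omega>) \<longlonglongrightarrow> l" by (auto simp: convergent_def)
    have n_top: "filterlim ?n at_top sequentially"
    proof (rule filterlim_at_top_mono[OF filterlim_ident])
      show "\<forall>\<^sub>F j in sequentially. j \<le> ?n j"
        using q4(2) by (intro always_eventually allI) (metis Suc_leD self_le_power less_eq_Suc_le zero_less_Suc One_nat_def)
    qed
    have "(\<lambda>n. A n / real n powr \<alpha>) \<longlonglongrightarrow> rGamma (1 + \<alpha>)" using alpha by (intro growth_asymp) auto
    from tendsto_mult[OF l filterlim_compose[OF this n_top]]
    have "(\<lambda>j. K (?n j) \<omega> / real (?n j) powr \<alpha>) \<longlonglongrightarrow> l * rGamma (1 + \<alpha>)"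
      using A_pos by (simp add: Y_def less_imp_neq[OF A_pos, symmetric])
    then have "(\<lambda>n. K n \<omega> / real n powr \<alpha>) \<longlonglongrightarrow> l * rGamma (1 + \<alpha>)"
      using K_mono[OF elim(2)] q4 alpha by (intro tendsto_of_power_subsequence) auto
    then show ?case unfolding alpha_diversity_def by (simp add: limI)
  qed
qed

lemma alpha_diversity_nonneg: "AE \<omega> in M. alpha_diversity \<alpha> Part \<omega> \<ge> 0"
  using alpha_diversity_limit by eventually_elim (auto intro: LIMSEQ_le_const)

section \<open>Negative moments of the number of blocks\<close>

text \<open>The number of blocks is unlikely to be much smaller than \<open>n powr \<alpha>\<close>.
  The function \<open>f k\<close>, of order \<open>k powr (- \<delta>)\<close>, is chosen so that the
  lower bound \<open>pred_new_ge\<close> makes it decrease on average by exactly the factor \<open>1 -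
  \<alpha> \<delta> / n\<close> per step. All factors of \<open>f\<close> are positive only if
  \<open>\<delta> < 1 + lo / \<alpha>\<close>, and this is where \<open>- \<alpha> < lo\<close>
  enters.\<close>
lemma negative_moment:
  obtains \<delta> C where "\<delta> > 0" "C > 0"
    "\<And>n. n \<ge> 1 \<Longrightarrow> (LINT \<omega>|M. (real n powr \<alpha> / K n \<omega>) powr \<delta>) \<le> C"
proof -
  define l where "l = lo / \<alpha>"
  define \<delta> where "\<delta> = (1 + l) / 2"
  have l: "-1 < l" "l \<le> 0" using lo alpha by (auto simp: l_def field_simps)
  have d: "0 < \<delta>" "\<delta> < 1" "-1 < l - \<delta>" "\<delta> < 1 + l"
    using l unfolding \<delta>_def by (argo+)
  define f where "f k = (\<Prod>i\<in>{1..<k}. 1 - \<delta> / (real i + l))" for k :: nat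
  have fpos: "f k > 0" for k
    unfolding f_def
  proof (rule prod_pos)
    fix i assume "i \<in> {1..<k}"
    then have "real i + l > \<delta>" using d by simp
    moreover from this have "real i + l > 0" using d by simp
    ultimately show "1 - \<delta> / (real i + l) > 0" by simp
  qed
  have fSuc: "f (Suc k) = f k * (1 - \<delta> / (real k + l))" if "k \<ge> 1" for k
    using that by (simp add: f_def prod.atLeastLessThan_Suc)
  obtain c where c: "c > 0" "\<And>k. k \<ge> 1 \<Longrightarrow> c \<le> f k * real k powr \<delta>"
  proof -
    let ?g = "\<lambda>z n. (\<Prod>i\<in>{1..<n}. real i + z) / (fact (n - 1) * real n powr z)"
    have pz: "(\<Prod>i\<in>{1..<n}. real i + z) > 0" if "z > -1" for n and z :: real
      by (rule prod_pos) (use that in auto)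
    have "(\<lambda>n. ?g (l - \<delta>) n / ?g l n) \<longlonglongrightarrow> rGamma (1 + (l - \<delta>)) / rGamma (1 + l)"
      using l d rGamma_pos[of "1 + l"] by (intro tendsto_divide shifted_prod_asymp) auto
    moreover have "\<forall>\<^sub>F n in sequentially. ?g (l - \<delta>) n / ?g l n = f n * real n powr \<delta>"
      using eventually_ge_at_top[of 1]
    proof eventually_elim
      case (elim n)
      have "f n = (\<Prod>i\<in>{1..<n}. (real i + (l - \<delta>)) / (real i + l))"
        unfolding f_def by (rule prod.cong) (use l in \<open>auto simp: field_simps\<close>)
      then have fn: "f n = (\<Prod>i\<in>{1..<n}. real i + (l - \<delta>)) / (\<Prod>i\<in>{1..<n}. real i + l)" by (simp add: prod_dividef)
      have "real n powr l / real n powr (l - \<delta>) = real n powr \<delta>" by (simp flip: powr_diff)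
      then show ?case using elim pz[OF l(1), of n] by (simp add: fn field_simps)
    qed
    ultimately have "(\<lambda>n. f n * real n powr \<delta>) \<longlonglongrightarrow> rGamma (1 + (l - \<delta>)) / rGamma (1 + l)"
      using Lim_transform_eventually by fast
    then show ?thesis
    proof (rule bounds_of_pos_limit)
      show "rGamma (1 + (l - \<delta>)) / rGamma (1 + l) > 0" using l d by (intro divide_pos_pos rGamma_pos) auto
      show "0 < f n * real n powr \<delta>" if "n \<ge> 1" for n using fpos[of n] that by simp
    qed (rule that, auto)
  qed
  have ad: "- (\<alpha> * \<delta>) > -1" using alpha d mult_strict_mono[of \<alpha> 1 \<delta> 1] by simp
  obtain C where C: "C > 0" "\<And>n. n \<ge> 1 \<Longrightarrow> growth (- (\<alpha> * \<delta>)) n \<le> C * real n powr (- (\<alpha> * \<delta>))"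
    using growth_bounds[OF ad] by metis
  have Ef: "(LINT \<omega>|M. f (card (Part n \<omega>))) \<le> growth (- (\<alpha> * \<delta>)) n" if "n \<ge> 1" for n
    using that
  proof (induction n rule: nat_induct_at_least)
    case base
    have "(LINT \<omega>|M. f (card (Part 1 \<omega>))) = (LINT \<omega>|M. 1)"
      by (rule Bochner_Integration.integral_cong) (auto simp: Part_1 f_def)
    then show ?case by (simp add: prob_space)
  next
    case (Suc n)
    have "(LINT \<omega>|M. f (card (Part (Suc n) \<omega>))) = (LINT \<omega>|M. smean n (\<lambda>P'. f (card P')) (Part n \<omega>))"
      by (rule one_step[OF Suc(1), of "\<lambda>_. ()" "\<lambda>_ _ P'. f (card P')"]) (rule adapted_const)
    also have "\<dots> \<le> (LINT \<omega>|M. (1 - \<alpha> * \<delta> / real n) * f (card (Part n \<omega>)))"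
    proof (rule expectation_mono_Part[OF Suc(1)])
      fix P assume P: "partition_on {1..n} P"
      let ?k = "card P" and ?p = "pred_new \<alpha> \<mu> n P"
      note k = part_card_pos[OF P Suc(1)] part_card_le[OF P]
      have kl: "real ?k + l > 0" using k l by simp
      have "smean n (\<lambda>P'. f (card P')) P = ?p * f (Suc ?k) + (\<Sum>U\<in>P. pred_block \<alpha> \<mu> n P U * f ?k)"
        unfolding step_mean_def by (simp add: card_open_block[OF P] card_join_block[OF P])
      also have "\<dots> = ?p * f (Suc ?k) + (1 - ?p) * f ?k"
      proof -
        have "(\<Sum>U\<in>P. pred_block \<alpha> \<mu> n P U) = 1 - ?p" using pred_sum[OF P Suc(1)] by linarith
        then show ?thesis by (simp only: sum_distrib_right[symmetric])
      qed
      also have "\<dots> = (1 - ?p * (\<delta> / (real ?k + l))) * f ?k"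
        unfolding fSuc[OF k(1)] by (simp add: algebra_simps)
      also have "\<dots> \<le> (1 - \<alpha> * \<delta> / real n) * f ?k"
      proof (rule mult_right_mono)
        have "lo + real ?k * \<alpha> = \<alpha> * (real ?k + l)" using alpha by (simp add: l_def distrib_left mult.commute)
        then have "\<alpha> * (real ?k + l) / (lo + real n) \<le> ?p" using pred_new_ge[OF Suc(1) k] by simp
        moreover have "\<alpha> * (real ?k + l) / real n \<le> \<alpha> * (real ?k + l) / (lo + real n)"
          using kl alpha lo theta_pos(2)[of lo n] Suc(1) by (intro divide_left_mono) auto
        ultimately have "\<alpha> * (real ?k + l) / real n * (\<delta> / (real ?k + l)) \<le> ?p * (\<delta> / (real ?k + l))"
          using kl d by (intro mult_right_mono) auto
        then show "1 - ?p * (\<delta> / (real ?k + l)) \<le> 1 - \<alpha> * \<delta> / real n" using kl by simp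
      qed (use fpos in \<open>simp add: less_imp_le\<close>)
      finally show "smean n (\<lambda>P'. f (card P')) P \<le> (1 - \<alpha> * \<delta> / real n) * f ?k" .
    qed
    also have "\<dots> = (1 - \<alpha> * \<delta> / real n) * (LINT \<omega>|M. f (card (Part n \<omega>)))" by simp
    also have "\<dots> \<le> (1 - \<alpha> * \<delta> / real n) * growth (- (\<alpha> * \<delta>)) n"
    proof (intro mult_left_mono Suc.IH)
      have "\<alpha> * \<delta> \<le> 1 * 1" using alpha d by (intro mult_mono) auto
      then show "0 \<le> 1 - \<alpha> * \<delta> / real n" using Suc(1) by (simp add: field_simps)
    qed
    also have "\<dots> = growth (- (\<alpha> * \<delta>)) (Suc n)" using Suc(1) by (simp add: growth_Suc)
    finally show ?case .
  qed
  have "(LINT \<omega>|M. (real n powr \<alpha> / K n \<omega>) powr \<delta>) \<le> C / c" if n: "n \<ge> 1" for n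
  proof -
    have "(LINT \<omega>|M. (real n powr \<alpha> / K n \<omega>) powr \<delta>) \<le> (LINT \<omega>|M. real n powr (\<alpha> * \<delta>) / c * f (card (Part n \<omega>)))"
    proof (rule expectation_mono_Part[OF n])
      fix P assume P: "partition_on {1..n} P"
      have k: "real (card P) > 0" using part_card_pos[OF P n] by simp
      have "(real n powr \<alpha> / real (card P)) powr \<delta> = real n powr (\<alpha> * \<delta>) / real (card P) powr \<delta>"
        by (simp add: powr_divide powr_powr)
      also have "\<dots> \<le> real n powr (\<alpha> * \<delta>) * (f (card P) / c)"
      proof -
        have "1 / real (card P) powr \<delta> \<le> f (card P) / c"
          using c(2)[OF part_card_pos[OF P n]] c(1) k by (simp add: field_simps)
        from mult_left_mono[OF this, of "real n powr (\<alpha> * \<delta>)"] show ?thesis by simp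
      qed
      finally show "(real n powr \<alpha> / real (card P)) powr \<delta> \<le> real n powr (\<alpha> * \<delta>) / c * f (card P)" by simp
    qed
    also have "\<dots> = real n powr (\<alpha> * \<delta>) / c * (LINT \<omega>|M. f (card (Part n \<omega>)))" by simp
    also have "\<dots> \<le> real n powr (\<alpha> * \<delta>) / c * (C * real n powr (- (\<alpha> * \<delta>)))"
      using Ef[OF n] C(2)[OF n] c(1) by (intro mult_left_mono) auto
    also have "\<dots> = C / c" using n by (simp flip: powr_add)
    finally show ?thesis .
  qed
  then show ?thesis using c C d by (intro that[of \<delta> "C / c"]) auto
qed

end

section \<open>Convergence in probability and tightness\<close>

context prob_space
begin

text \<open>Uniform approximation by convergent sequences, in the form used for all density
  arguments below.\<close>
lemma LIMSEQ_approx: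
  fixes a :: "nat \<Rightarrow> 'b::real_normed_vector"
  assumes "\<And>\<epsilon>::real. \<epsilon> > 0 \<Longrightarrow> \<exists>b l. b \<longlonglongrightarrow> l \<and> (\<forall>n\<ge>1. norm (a n - b n) \<le> \<epsilon>) \<and> norm (L - l) \<le> \<epsilon>"
  shows "a \<longlonglongrightarrow> L"
proof (rule LIMSEQ_I)
  fix \<epsilon> :: real assume e: "\<epsilon> > 0"
  then obtain b l where bl: "b \<longlonglongrightarrow> l" "\<And>n. n \<ge> 1 \<Longrightarrow> norm (a n - b n) \<le> \<epsilon> / 4" "norm (L - l) \<le> \<epsilon> / 4"
    using assms[of "\<epsilon> / 4"] by auto
  obtain N where N: "\<And>n. n \<ge> N \<Longrightarrow> norm (b n - l) < \<epsilon> / 4"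
    using LIMSEQ_D[OF bl(1), of "\<epsilon> / 4"] e by auto
  have "norm (a n - L) < \<epsilon>" if n: "n \<ge> max N 1" for n
  proof -
    have "a n - L = (a n - b n) + ((b n - l) + (l - L))" by simp
    also have "norm \<dots> \<le> norm (a n - b n) + norm ((b n - l) + (l - L))" by (rule norm_triangle_ineq)
    also have "\<dots> \<le> norm (a n - b n) + (norm (b n - l) + norm (l - L))"
      by (intro add_left_mono norm_triangle_ineq)
    finally show ?thesis
      using bl(2)[of n] N[of n] bl(3) e n unfolding norm_minus_commute[of l L] by simp
  qed
  then show "\<exists>N. \<forall>n\<ge>N. norm (a n - L) < \<epsilon>" by blast
qed

text \<open>Convergence to zero in probability, expressed by the bounded metric \<open>min 1
  \<bar>x\<bar>\<close> so that it can be manipulated through expectations. The conditions start at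
  \<open>n = 1\<close>, the index of the first partition.\<close>
definition vanishing :: "(nat \<Rightarrow> 'a \<Rightarrow> real) \<Rightarrow> bool" where
  "vanishing X \<longleftrightarrow> (\<forall>n\<ge>1. X n \<in> borel_measurable M)
     \<and> (\<lambda>n. expectation (\<lambda>\<omega>. min 1 \<bar>X n \<omega>\<bar>)) \<longlonglongrightarrow> 0"

definition tight_seq :: "(nat \<Rightarrow> 'a \<Rightarrow> real) \<Rightarrow> bool" where
  "tight_seq X \<longleftrightarrow> (\<forall>n\<ge>1. X n \<in> borel_measurable M)
     \<and> (\<forall>\<epsilon>>0. \<exists>K\<ge>1. \<forall>n\<ge>1. prob {\<omega>\<in>space M. \<bar>X n \<omega>\<bar> > K} \<le> \<epsilon>)"

lemma integrable_min_abs [simp]: 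
  "Y \<in> borel_measurable M \<Longrightarrow> integrable M (\<lambda>\<omega>. min 1 \<bar>Y \<omega> :: real\<bar>)"
  by (rule integrable_const_bound[of _ 1]) auto

lemma tendsto_0_dominated:
  fixes a b :: "nat \<Rightarrow> real"
  assumes "\<And>n. n \<ge> 1 \<Longrightarrow> 0 \<le> a n \<and> a n \<le> b n" "b \<longlonglongrightarrow> 0" shows "a \<longlonglongrightarrow> 0"
  by (rule tendsto_sandwich[OF _ _ tendsto_const assms(2)])
    (rule eventually_mono[OF eventually_ge_at_top[of 1]], use assms(1) in simp)+

lemma vanishing_mono:
  assumes Y: "vanishing Y" and X: "\<And>n. n \<ge> 1 \<Longrightarrow> X n \<in> borel_measurable M"
    and le: "\<And>n \<omega>. n \<ge> 1 \<Longrightarrow> \<omega> \<in> space M \<Longrightarrow> min 1 \<bar>X n \<omega>\<bar> \<le> \<bar>Y n \<omega>\<bar>"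
  shows "vanishing X"
  unfolding vanishing_def
proof (intro conjI allI impI X)
  have Ym: "n \<ge> 1 \<Longrightarrow> Y n \<in> borel_measurable M" for n using Y by (simp add: vanishing_def)
  show "(\<lambda>n. expectation (\<lambda>\<omega>. min 1 \<bar>X n \<omega>\<bar>)) \<longlonglongrightarrow> 0"
  proof (rule tendsto_0_dominated)
    show "(\<lambda>n. expectation (\<lambda>\<omega>. min 1 \<bar>Y n \<omega>\<bar>)) \<longlonglongrightarrow> 0" using Y by (simp add: vanishing_def)
    show "0 \<le> expectation (\<lambda>\<omega>. min 1 \<bar>X n \<omega>\<bar>) \<and> expectation (\<lambda>\<omega>. min 1 \<bar>X n \<omega>\<bar>) \<le> expectation (\<lambda>\<omega>. min 1 \<bar>Y n \<omega>\<bar>)"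
      if n: "n \<ge> 1" for n
      using le[OF n] X[OF n] Ym[OF n]
      by (intro conjI integral_nonneg_AE integral_mono) auto
  qed
qed

lemma vanishing_add:
  assumes "vanishing X" "vanishing Y" shows "vanishing (\<lambda>n \<omega>. X n \<omega> + Y n \<omega>)"
  unfolding vanishing_def
proof (intro conjI allI impI)
  have m: "n \<ge> 1 \<Longrightarrow> X n \<in> borel_measurable M" "n \<ge> 1 \<Longrightarrow> Y n \<in> borel_measurable M" for n
    using assms by (auto simp: vanishing_def)
  then show "n \<ge> 1 \<Longrightarrow> (\<lambda>\<omega>. X n \<omega> + Y n \<omega>) \<in> borel_measurable M" for n by auto
  show "(\<lambda>n. expectation (\<lambda>\<omega>. min 1 \<bar>X n \<omega> + Y n \<omega>\<bar>)) \<longlonglongrightarrow> 0"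
  proof (rule tendsto_0_dominated)
    show "(\<lambda>n. expectation (\<lambda>\<omega>. min 1 \<bar>X n \<omega>\<bar>) + expectation (\<lambda>\<omega>. min 1 \<bar>Y n \<omega>\<bar>)) \<longlonglongrightarrow> 0"
      using tendsto_add[of "\<lambda>n. expectation (\<lambda>\<omega>. min 1 \<bar>X n \<omega>\<bar>)" 0 _ "\<lambda>n. expectation (\<lambda>\<omega>. min 1 \<bar>Y n \<omega>\<bar>)" 0] assms
      by (simp add: vanishing_def)
    show "0 \<le> expectation (\<lambda>\<omega>. min 1 \<bar>X n \<omega> + Y n \<omega>\<bar>) \<and> expectation (\<lambda>\<omega>. min 1 \<bar>X n \<omega> + Y n \<omega>\<bar>)
       \<le> expectation (\<lambda>\<omega>. min 1 \<bar>X n \<omega>\<bar>) + expectation (\<lambda>\<omega>. min 1 \<bar>Y n \<omega>\<bar>)" if n: "n \<ge> 1" for n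
    proof
      have "expectation (\<lambda>\<omega>. min 1 \<bar>X n \<omega> + Y n \<omega>\<bar>) \<le> expectation (\<lambda>\<omega>. min 1 \<bar>X n \<omega>\<bar> + min 1 \<bar>Y n \<omega>\<bar>)"
        using m[OF n] by (intro integral_mono) auto
      then show "expectation (\<lambda>\<omega>. min 1 \<bar>X n \<omega> + Y n \<omega>\<bar>)
       \<le> expectation (\<lambda>\<omega>. min 1 \<bar>X n \<omega>\<bar>) + expectation (\<lambda>\<omega>. min 1 \<bar>Y n \<omega>\<bar>)"
        using m[OF n] by simp
    qed (intro integral_nonneg_AE, simp)
  qed
qed

lemma vanishing_const: "a \<longlonglongrightarrow> 0 \<Longrightarrow> vanishing (\<lambda>n \<omega>. a n)"
  unfolding vanishing_def
  by (auto simp: prob_space intro!: tendsto_0_dominated[of "\<lambda>n. min 1 \<bar>a n\<bar>" "\<lambda>n. \<bar>a n\<bar>"] tendsto_rabs_zero)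

lemma vanishing_L1:
  assumes "\<And>n. n \<ge> 1 \<Longrightarrow> integrable M (X n)" "(\<lambda>n. expectation (\<lambda>\<omega>. \<bar>X n \<omega>\<bar>)) \<longlonglongrightarrow> 0"
  shows "vanishing X"
  unfolding vanishing_def
proof (intro conjI allI impI)
  show "n \<ge> 1 \<Longrightarrow> X n \<in> borel_measurable M" for n using assms by auto
  show "(\<lambda>n. expectation (\<lambda>\<omega>. min 1 \<bar>X n \<omega>\<bar>)) \<longlonglongrightarrow> 0"
    by (rule tendsto_0_dominated[OF _ assms(2)])
      (use assms(1) in \<open>auto intro!: integral_nonneg_AE integral_mono\<close>)
qed

lemma vanishing_AE:
  assumes "\<And>n. n \<ge> 1 \<Longrightarrow> X n \<in> borel_measurable M" "AE \<omega> in M. (\<lambda>n. X n \<omega>) \<longlonglongrightarrow> 0"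
  shows "vanishing X"
  unfolding vanishing_def
proof (intro conjI allI impI)
  show "n \<ge> 1 \<Longrightarrow> X n \<in> borel_measurable M" for n using assms by auto
  have "(\<lambda>n. expectation (\<lambda>\<omega>. min 1 \<bar>X (Suc n) \<omega>\<bar>)) \<longlonglongrightarrow> expectation (\<lambda>_. 0)"
  proof (rule integral_dominated_convergence[where w = "\<lambda>_. 1"])
    show "AE \<omega> in M. (\<lambda>n. min 1 \<bar>X (Suc n) \<omega>\<bar>) \<longlonglongrightarrow> 0"
      using assms(2)
    proof eventually_elim
      case (elim \<omega>)
      have "(\<lambda>n. min 1 \<bar>X n \<omega>\<bar>) \<longlonglongrightarrow> min 1 \<bar>0\<bar>"
        by (intro tendsto_min tendsto_const tendsto_rabs elim)
      then show ?case by (intro LIMSEQ_Suc) simp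
    qed
  qed (use assms(1) in auto)
  then show "(\<lambda>n. expectation (\<lambda>\<omega>. min 1 \<bar>X n \<omega>\<bar>)) \<longlonglongrightarrow> 0"
    using LIMSEQ_imp_Suc by fastforce
qed

lemma tight_moment:
  assumes X: "\<And>n. n \<ge> 1 \<Longrightarrow> X n \<in> borel_measurable M" and d: "\<delta> > 0"
    and int: "\<And>n. n \<ge> 1 \<Longrightarrow> integrable M (\<lambda>\<omega>. \<bar>X n \<omega>\<bar> powr \<delta>)"
    and C: "\<And>n. n \<ge> 1 \<Longrightarrow> expectation (\<lambda>\<omega>. \<bar>X n \<omega>\<bar> powr \<delta>) \<le> C"
  shows "tight_seq X"
  unfolding tight_seq_def
proof (intro conjI allI impI X)
  fix \<epsilon> :: real assume eps: "\<epsilon> > 0"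
  define K where "K = max 1 ((\<bar>C\<bar> / \<epsilon>) powr (1 / \<delta>))"
  have K: "K \<ge> 1" "\<bar>C\<bar> / \<epsilon> \<le> K powr \<delta>"
  proof -
    show "K \<ge> 1" by (simp add: K_def)
    have "\<bar>C\<bar> / \<epsilon> = ((\<bar>C\<bar> / \<epsilon>) powr (1 / \<delta>)) powr \<delta>" using d eps by (simp add: powr_powr)
    also have "\<dots> \<le> K powr \<delta>" using d by (intro powr_mono2) (auto simp: K_def)
    finally show "\<bar>C\<bar> / \<epsilon> \<le> K powr \<delta>" .
  qed
  have "prob {\<omega>\<in>space M. \<bar>X n \<omega>\<bar> > K} \<le> \<epsilon>" if n: "n \<ge> 1" for n
  proof -
    have Kd: "K powr \<delta> > 0" using K by simp
    note [measurable] = X[OF n]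
    have "prob {\<omega>\<in>space M. \<bar>X n \<omega>\<bar> > K} \<le> prob {\<omega>\<in>space M. \<bar>X n \<omega>\<bar> powr \<delta> \<ge> K powr \<delta>}"
      using K d by (intro finite_measure_mono) (auto intro!: powr_mono2)
    also have "\<dots> \<le> expectation (\<lambda>\<omega>. \<bar>X n \<omega>\<bar> powr \<delta>) / (K powr \<delta>)"
      by (rule integral_Markov_inequality_measure[OF int[OF n], of "{}"]) (use Kd in auto)
    also have "\<dots> \<le> \<bar>C\<bar> / (K powr \<delta>)" using C[OF n] Kd by (intro divide_right_mono) auto
    also have "\<dots> \<le> \<epsilon>" using K(2) eps Kd by (simp add: field_simps)
    finally show ?thesis .
  qed
  with K show "\<exists>K\<ge>1. \<forall>n\<ge>1. prob {\<omega>\<in>space M. \<bar>X n \<omega>\<bar> > K} \<le> \<epsilon>" by blast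
qed

lemma tight_mult:
  assumes "tight_seq X" "tight_seq Y" shows "tight_seq (\<lambda>n \<omega>. X n \<omega> * Y n \<omega>)"
  unfolding tight_seq_def
proof (intro conjI allI impI)
  have m: "n \<ge> 1 \<Longrightarrow> X n \<in> borel_measurable M" "n \<ge> 1 \<Longrightarrow> Y n \<in> borel_measurable M" for n
    using assms by (auto simp: tight_seq_def)
  then show "n \<ge> 1 \<Longrightarrow> (\<lambda>\<omega>. X n \<omega> * Y n \<omega>) \<in> borel_measurable M" for n by auto
  fix \<epsilon> :: real assume "\<epsilon> > 0"
  then have e: "\<epsilon> / 2 > 0" by simp
  obtain K where K: "K \<ge> 1" "\<And>n. n \<ge> 1 \<Longrightarrow> prob {\<omega>\<in>space M. \<bar>X n \<omega>\<bar> > K} \<le> \<epsilon> / 2"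
    using assms(1) e unfolding tight_seq_def by blast
  obtain L where L: "L \<ge> 1" "\<And>n. n \<ge> 1 \<Longrightarrow> prob {\<omega>\<in>space M. \<bar>Y n \<omega>\<bar> > L} \<le> \<epsilon> / 2"
    using assms(2) e unfolding tight_seq_def by blast
  have "prob {\<omega>\<in>space M. \<bar>X n \<omega> * Y n \<omega>\<bar> > K * L} \<le> \<epsilon>" if n: "n \<ge> 1" for n
  proof -
    note [measurable] = m[OF n]
    have "prob {\<omega>\<in>space M. \<bar>X n \<omega> * Y n \<omega>\<bar> > K * L}
      \<le> prob ({\<omega>\<in>space M. \<bar>X n \<omega>\<bar> > K} \<union> {\<omega>\<in>space M. \<bar>Y n \<omega>\<bar> > L})"
    proof (intro finite_measure_mono subsetI)
      fix \<omega> assume w: "\<omega> \<in> {\<omega>\<in>space M. \<bar>X n \<omega> * Y n \<omega>\<bar> > K * L}"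
      have "\<not> (\<bar>X n \<omega>\<bar> \<le> K \<and> \<bar>Y n \<omega>\<bar> \<le> L)"
        using w K L mult_mono[of "\<bar>X n \<omega>\<bar>" K "\<bar>Y n \<omega>\<bar>" L] by (auto simp: abs_mult)
      then show "\<omega> \<in> {\<omega>\<in>space M. \<bar>X n \<omega>\<bar> > K} \<union> {\<omega>\<in>space M. \<bar>Y n \<omega>\<bar> > L}" using w by auto
    qed measurable
    also have "\<dots> \<le> prob {\<omega>\<in>space M. \<bar>X n \<omega>\<bar> > K} + prob {\<omega>\<in>space M. \<bar>Y n \<omega>\<bar> > L}"
      by (intro measure_Un_le) measurable
    finally show ?thesis using K(2)[OF n] L(2)[OF n] by linarith
  qed
  moreover have "K * L \<ge> 1" using K(1) L(1) mult_mono[of 1 K 1 L] by simp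
  ultimately show "\<exists>K\<ge>1. \<forall>n\<ge>1. prob {\<omega>\<in>space M. \<bar>X n \<omega> * Y n \<omega>\<bar> > K} \<le> \<epsilon>" by blast
qed

lemma vanishing_mult_tight:
  assumes X: "vanishing X" and Y: "tight_seq Y" shows "vanishing (\<lambda>n \<omega>. X n \<omega> * Y n \<omega>)"
  unfolding vanishing_def
proof (intro conjI allI impI)
  have m: "n \<ge> 1 \<Longrightarrow> X n \<in> borel_measurable M" "n \<ge> 1 \<Longrightarrow> Y n \<in> borel_measurable M" for n
    using assms by (auto simp: tight_seq_def vanishing_def)
  then show "n \<ge> 1 \<Longrightarrow> (\<lambda>\<omega>. X n \<omega> * Y n \<omega>) \<in> borel_measurable M" for n by auto
  show "(\<lambda>n. expectation (\<lambda>\<omega>. min 1 \<bar>X n \<omega> * Y n \<omega>\<bar>)) \<longlonglongrightarrow> 0"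
  proof (rule LIMSEQ_I)
    fix \<epsilon> :: real assume e: "\<epsilon> > 0"
    obtain K where K: "K \<ge> 1" "\<And>n. n \<ge> 1 \<Longrightarrow> prob {\<omega>\<in>space M. \<bar>Y n \<omega>\<bar> > K} \<le> \<epsilon> / 2"
      using Y e unfolding tight_seq_def by (meson half_gt_zero)
    have "\<epsilon> / (2 * K) > 0" using e K by simp
    then obtain N where N: "\<And>n. n \<ge> N \<Longrightarrow> \<bar>expectation (\<lambda>\<omega>. min 1 \<bar>X n \<omega>\<bar>)\<bar> < \<epsilon> / (2 * K)"
      using X LIMSEQ_D unfolding vanishing_def by (metis diff_zero real_norm_def)
    have "norm (expectation (\<lambda>\<omega>. min 1 \<bar>X n \<omega> * Y n \<omega>\<bar>) - 0) < \<epsilon>" if n: "n \<ge> max N 1" for n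
    proof -
      have n1: "n \<ge> 1" "n \<ge> N" using n by auto
      note [measurable] = m[OF n1(1)]
      have "expectation (\<lambda>\<omega>. min 1 \<bar>X n \<omega> * Y n \<omega>\<bar>)
        \<le> expectation (\<lambda>\<omega>. K * min 1 \<bar>X n \<omega>\<bar> + indicator {\<omega>\<in>space M. \<bar>Y n \<omega>\<bar> > K} \<omega>)"
      proof (rule integral_mono)
        fix \<omega> assume w: "\<omega> \<in> space M"
        show "min 1 \<bar>X n \<omega> * Y n \<omega>\<bar> \<le> K * min 1 \<bar>X n \<omega>\<bar> + indicator {\<omega>\<in>space M. \<bar>Y n \<omega>\<bar> > K} \<omega>"
        proof (cases "\<bar>Y n \<omega>\<bar> > K")
          case True
          then show ?thesis using w K by (simp add: min_le_iff_disj)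
        next
          case False
          then have "\<bar>X n \<omega> * Y n \<omega>\<bar> \<le> K * \<bar>X n \<omega>\<bar>"
            unfolding abs_mult by (subst mult.commute) (intro mult_right_mono, auto)
          then show ?thesis using False K by (auto simp: min_def)
        qed
      qed (auto simp: emeasure_eq_measure)
      also have "\<dots> = K * expectation (\<lambda>\<omega>. min 1 \<bar>X n \<omega>\<bar>) + prob {\<omega>\<in>space M. \<bar>Y n \<omega>\<bar> > K}"
        by (subst Bochner_Integration.integral_add) (auto simp: emeasure_eq_measure)
      also have "\<dots> < K * (\<epsilon> / (2 * K)) + \<epsilon> / 2"
        using N[OF n1(2)] K by (intro add_less_le_mono mult_strict_left_mono K(2)[OF n1(1)]) auto
      also have "\<dots> = \<epsilon>" using K by simp
      finally have "expectation (\<lambda>\<omega>. min 1 \<bar>X n \<omega> * Y n \<omega>\<bar>) < \<epsilon>" .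
      moreover have "expectation (\<lambda>\<omega>. min 1 \<bar>X n \<omega> * Y n \<omega>\<bar>) \<ge> 0" by (intro integral_nonneg_AE) auto
      ultimately show ?thesis by simp
    qed
    then show "\<exists>N. \<forall>n\<ge>N. norm (expectation (\<lambda>\<omega>. min 1 \<bar>X n \<omega> * Y n \<omega>\<bar>) - 0) < \<epsilon>" by blast
  qed
qed

section \<open>Weak limits tested on a sub-sigma-algebra\<close>

text \<open>Bounded sequences whose integrals over the events of \<open>G\<close> converge also
  converge when tested against integrable \<open>G\<close>-measurable functions, since simple
  functions are dense in \<open>L\<^sup>1\<close>.\<close>
lemma weak_limit_extend:
  fixes Z :: "nat \<Rightarrow> 'a \<Rightarrow> 'b::{banach, second_countable_topology}"
  assumes G: "subalgebra M G"
    and Z: "\<And>n. n \<ge> 1 \<Longrightarrow> Z n \<in> borel_measurable M" "z \<in> borel_measurable M"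
    and B: "\<And>n \<omega>. n \<ge> 1 \<Longrightarrow> \<omega> \<in> space M \<Longrightarrow> norm (Z n \<omega>) \<le> B" "\<And>\<omega>. \<omega> \<in> space M \<Longrightarrow> norm (z \<omega>) \<le> B"
    and conv: "\<And>A. A \<in> sets G \<Longrightarrow> (\<lambda>n. LINT \<omega>|M. indicat_real A \<omega> *\<^sub>R Z n \<omega>) \<longlonglongrightarrow> (LINT \<omega>|M. indicat_real A \<omega> *\<^sub>R z \<omega>)"
    and g: "integrable M g" "g \<in> borel_measurable G"
  shows "(\<lambda>n. LINT \<omega>|M. (g \<omega> :: real) *\<^sub>R Z n \<omega>) \<longlonglongrightarrow> (LINT \<omega>|M. g \<omega> *\<^sub>R z \<omega>)"
proof -
  let ?G = "restr_to_subalg M G"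
  have B0: "B \<ge> 0" using B(2) not_empty by (meson all_not_in_conv norm_ge_zero order_trans)
  have setsG: "sets ?G = sets G" using sets_restr_to_subalg[OF G] .
  have intM: "integrable M f" if "integrable ?G f" for f :: "'a \<Rightarrow> real" using integrable_from_subalg[OF G that] .
  have intZ: "integrable M (\<lambda>\<omega>. f \<omega> *\<^sub>R Z n \<omega>)" if "integrable M f" "n \<ge> 1" for f :: "'a \<Rightarrow> real" and n
  proof (rule Bochner_Integration.integrable_bound[of _ "\<lambda>\<omega>. f \<omega> * B"])
    show "AE \<omega> in M. norm (f \<omega> *\<^sub>R Z n \<omega>) \<le> norm (f \<omega> * B)"
      using B(1)[OF that(2)] B0 by (intro AE_I2) (auto simp: abs_mult intro!: mult_left_mono)
  qed (use that Z(1)[OF that(2)] in auto)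
  have intz: "integrable M (\<lambda>\<omega>. f \<omega> *\<^sub>R z \<omega>)" if "integrable M f" for f :: "'a \<Rightarrow> real"
  proof (rule Bochner_Integration.integrable_bound[of _ "\<lambda>\<omega>. f \<omega> * B"])
    show "AE \<omega> in M. norm (f \<omega> *\<^sub>R z \<omega>) \<le> norm (f \<omega> * B)"
      using B(2) B0 by (intro AE_I2) (auto simp: abs_mult intro!: mult_left_mono)
  qed (use that Z(2) in auto)
  have bnd: "norm (LINT \<omega>|M. f \<omega> *\<^sub>R y \<omega>) \<le> B * (LINT \<omega>|M. \<bar>f \<omega>\<bar>)"
    if f: "integrable M f" and fy: "integrable M (\<lambda>\<omega>. f \<omega> *\<^sub>R y \<omega>)" and y: "\<And>\<omega>. \<omega> \<in> space M \<Longrightarrow> norm (y \<omega>) \<le> B" for f and y :: "'a \<Rightarrow> 'b"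
  proof -
    have "norm (LINT \<omega>|M. f \<omega> *\<^sub>R y \<omega>) \<le> (LINT \<omega>|M. norm (f \<omega> *\<^sub>R y \<omega>))" by (rule integral_norm_bound)
    also have "\<dots> \<le> (LINT \<omega>|M. B * \<bar>f \<omega>\<bar>)"
    proof (rule integral_mono)
      show "norm (f \<omega> *\<^sub>R y \<omega>) \<le> B * \<bar>f \<omega>\<bar>" if "\<omega> \<in> space M" for \<omega>
        using y[OF that] by (simp add: mult_right_mono mult.commute[of "\<bar>f \<omega>\<bar>"])
    qed (rule integrable_norm[OF fy], use f in simp)
    finally show ?thesis by simp
  qed
  have "integrable ?G g" by (rule integrable_in_subalg[OF G g(2,1)])
  then show ?thesis
  proof (induction g rule: integrable_induct)
    case (base A c)
    then have A: "A \<in> sets G" "A \<in> sets M" using setsG G by (auto simp: subalgebra_def)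
    have "(\<lambda>n. c *\<^sub>R (LINT \<omega>|M. indicat_real A \<omega> *\<^sub>R Z n \<omega>)) \<longlonglongrightarrow> c *\<^sub>R (LINT \<omega>|M. indicat_real A \<omega> *\<^sub>R z \<omega>)"
      by (intro tendsto_intros conv A)
    moreover have "(indicat_real A \<omega> *\<^sub>R c) *\<^sub>R y = c *\<^sub>R (indicat_real A \<omega> *\<^sub>R y)" for \<omega> and y :: 'b by simp
    ultimately show ?case by (simp only: integral_scaleR_right)
  next
    case (add f g)
    note i = intM[OF add(1)] intM[OF add(2)]
    have "(\<lambda>n. (LINT \<omega>|M. f \<omega> *\<^sub>R Z n \<omega>) + (LINT \<omega>|M. g \<omega> *\<^sub>R Z n \<omega>)) \<longlonglongrightarrow> (LINT \<omega>|M. f \<omega> *\<^sub>R z \<omega>) + (LINT \<omega>|M. g \<omega> *\<^sub>R z \<omega>)"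
      by (rule tendsto_add[OF add(3,4)])
    moreover have "\<forall>\<^sub>F n in sequentially. (LINT \<omega>|M. f \<omega> *\<^sub>R Z n \<omega>) + (LINT \<omega>|M. g \<omega> *\<^sub>R Z n \<omega>) = (LINT \<omega>|M. (f \<omega> + g \<omega>) *\<^sub>R Z n \<omega>)"
      using eventually_ge_at_top[of 1] by eventually_elim (simp add: scaleR_add_left intZ i)
    ultimately have "(\<lambda>n. LINT \<omega>|M. (f \<omega> + g \<omega>) *\<^sub>R Z n \<omega>) \<longlonglongrightarrow> (LINT \<omega>|M. f \<omega> *\<^sub>R z \<omega>) + (LINT \<omega>|M. g \<omega> *\<^sub>R z \<omega>)"
      by (rule Lim_transform_eventually)
    then show ?case by (simp add: scaleR_add_left intz i)
  next
    case (lim f s)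
    have f: "integrable M f" using intM lim by blast
    have s: "integrable M (s i)" for i using intM lim by blast
    have L1: "(\<lambda>i. LINT \<omega>|M. \<bar>f \<omega> - s i \<omega>\<bar>) \<longlonglongrightarrow> (LINT \<omega>|M. 0)"
    proof (rule integral_dominated_convergence[where w = "\<lambda>\<omega>. 3 * \<bar>f \<omega>\<bar>"])
      have sp: "space ?G = space M" by (simp add: space_restr_to_subalg)
      show "AE \<omega> in M. (\<lambda>i. \<bar>f \<omega> - s i \<omega>\<bar>) \<longlonglongrightarrow> 0"
      proof (rule AE_I2)
        fix \<omega> assume "\<omega> \<in> space M"
        then have "(\<lambda>i. s i \<omega>) \<longlonglongrightarrow> f \<omega>" using lim sp by simp
        then have "(\<lambda>i. \<bar>f \<omega> - s i \<omega>\<bar>) \<longlonglongrightarrow> \<bar>f \<omega> - f \<omega>\<bar>" by (intro tendsto_intros)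
        then show "(\<lambda>i. \<bar>f \<omega> - s i \<omega>\<bar>) \<longlonglongrightarrow> 0" by simp
      qed
      show "AE \<omega> in M. norm \<bar>f \<omega> - s i \<omega>\<bar> \<le> 3 * \<bar>f \<omega>\<bar>" for i
      proof (rule AE_I2)
        fix \<omega> assume "\<omega> \<in> space M"
        then have "\<bar>s i \<omega>\<bar> \<le> 2 * \<bar>f \<omega>\<bar>" using lim sp by simp
        then show "norm \<bar>f \<omega> - s i \<omega>\<bar> \<le> 3 * \<bar>f \<omega>\<bar>" by simp
      qed
    qed (use f s in auto)
    show ?case
    proof (rule LIMSEQ_approx)
      fix \<epsilon> :: real assume e: "\<epsilon> > 0"
      have "(\<lambda>i. B * (LINT \<omega>|M. \<bar>f \<omega> - s i \<omega>\<bar>)) \<longlonglongrightarrow> B * (LINT \<omega>|M. 0)"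
        by (intro tendsto_intros L1)
      then have "\<forall>\<^sub>F i in sequentially. B * (LINT \<omega>|M. \<bar>f \<omega> - s i \<omega>\<bar>) < \<epsilon>"
        using e by (intro order_tendstoD(2)) auto
      then obtain i where i: "B * (LINT \<omega>|M. \<bar>f \<omega> - s i \<omega>\<bar>) < \<epsilon>"
        by (auto simp: eventually_sequentially)
      have fs: "integrable M (\<lambda>\<omega>. f \<omega> - s i \<omega>)" using f s by simp
      have "norm ((LINT \<omega>|M. f \<omega> *\<^sub>R Z n \<omega>) - (LINT \<omega>|M. s i \<omega> *\<^sub>R Z n \<omega>)) \<le> \<epsilon>" if n: "n \<ge> 1" for n
        using bnd[OF fs intZ[OF fs n] B(1)[OF n]] intZ[OF f n] intZ[OF s n] i
        by (simp add: scaleR_diff_left)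
      moreover have "norm ((LINT \<omega>|M. f \<omega> *\<^sub>R z \<omega>) - (LINT \<omega>|M. s i \<omega> *\<^sub>R z \<omega>)) \<le> \<epsilon>"
        using bnd[OF fs intz[OF fs] B(2)] intz[OF f] intz[OF s] i by (simp add: scaleR_diff_left)
      ultimately show "\<exists>b l. b \<longlonglongrightarrow> l \<and> (\<forall>n\<ge>1. norm ((LINT \<omega>|M. f \<omega> *\<^sub>R Z n \<omega>) - b n) \<le> \<epsilon>) \<and> norm ((LINT \<omega>|M. f \<omega> *\<^sub>R z \<omega>) - l) \<le> \<epsilon>"
        using lim(5)[of i] by blast
    qed
  qed
qed

text \<open>By Dynkin's theorem it suffices to test on a generating system that is closed under
  intersection. Countable disjoint unions are approximated by finite ones, uniformly in
  \<open>n\<close> as the sequence is bounded.\<close>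
lemma weak_limit_generate:
  fixes Z :: "nat \<Rightarrow> 'a \<Rightarrow> 'b::{banach, second_countable_topology}"
  assumes E: "Int_stable E" "E \<subseteq> events" "space M \<in> E"
    and Z: "\<And>n. n \<ge> 1 \<Longrightarrow> Z n \<in> borel_measurable M" "z \<in> borel_measurable M"
    and B: "\<And>n \<omega>. n \<ge> 1 \<Longrightarrow> \<omega> \<in> space M \<Longrightarrow> norm (Z n \<omega>) \<le> B" "\<And>\<omega>. \<omega> \<in> space M \<Longrightarrow> norm (z \<omega>) \<le> B"
    and conv: "\<And>A. A \<in> E \<Longrightarrow> (\<lambda>n. LINT \<omega>|M. indicat_real A \<omega> *\<^sub>R Z n \<omega>) \<longlonglongrightarrow> (LINT \<omega>|M. indicat_real A \<omega> *\<^sub>R z \<omega>)"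
    and A: "A \<in> sigma_sets (space M) E"
  shows "(\<lambda>n. LINT \<omega>|M. indicat_real A \<omega> *\<^sub>R Z n \<omega>) \<longlonglongrightarrow> (LINT \<omega>|M. indicat_real A \<omega> *\<^sub>R z \<omega>)"
proof -
  have B0: "B \<ge> 0" using B(2) not_empty by (meson all_not_in_conv norm_ge_zero order_trans)
  have sub: "sigma_sets (space M) E \<subseteq> events" using E(2) by (rule sets.sigma_sets_subset)
  have intI: "integrable M (\<lambda>\<omega>. indicat_real A \<omega> *\<^sub>R y \<omega>)"
    if "A \<in> events" "y \<in> borel_measurable M" "\<And>\<omega>. \<omega> \<in> space M \<Longrightarrow> norm (y \<omega>) \<le> B" for A and y :: "'a \<Rightarrow> 'b"
    using that B0 by (intro integrable_const_bound[of _ B]) (auto simp: indicator_def)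
  have bnd: "norm (LINT \<omega>|M. indicat_real A \<omega> *\<^sub>R y \<omega>) \<le> B * prob A"
    if "A \<in> events" "y \<in> borel_measurable M" "\<And>\<omega>. \<omega> \<in> space M \<Longrightarrow> norm (y \<omega>) \<le> B" for A and y :: "'a \<Rightarrow> 'b"
  proof -
    have "norm (LINT \<omega>|M. indicat_real A \<omega> *\<^sub>R y \<omega>) \<le> (LINT \<omega>|M. norm (indicat_real A \<omega> *\<^sub>R y \<omega>))" by (rule integral_norm_bound)
    also have "\<dots> \<le> (LINT \<omega>|M. B * indicat_real A \<omega>)"
    proof (rule integral_mono)
      show "integrable M (\<lambda>\<omega>. B * indicat_real A \<omega>)" using that(1) by (simp add: emeasure_eq_measure)
      show "norm (indicat_real A \<omega> *\<^sub>R y \<omega>) \<le> B * indicat_real A \<omega>" if "\<omega> \<in> space M" for \<omega>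
        using \<open>\<And>\<omega>. \<omega> \<in> space M \<Longrightarrow> norm (y \<omega>) \<le> B\<close>[OF that] by (auto simp: indicator_def)
    qed (rule integrable_norm[OF intI[OF that]])
    finally show ?thesis using that(1) by simp
  qed
  have complement: "(LINT \<omega>|M. indicat_real (space M - A) \<omega> *\<^sub>R y \<omega>) = (LINT \<omega>|M. indicat_real (space M) \<omega> *\<^sub>R y \<omega>) - (LINT \<omega>|M. indicat_real A \<omega> *\<^sub>R y \<omega>)"
    if "A \<in> events" "y \<in> borel_measurable M" "\<And>\<omega>. \<omega> \<in> space M \<Longrightarrow> norm (y \<omega>) \<le> B" for A and y :: "'a \<Rightarrow> 'b"
  proof -
    have "(LINT \<omega>|M. indicat_real (space M) \<omega> *\<^sub>R y \<omega>) - (LINT \<omega>|M. indicat_real A \<omega> *\<^sub>R y \<omega>)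
      = (LINT \<omega>|M. indicat_real (space M) \<omega> *\<^sub>R y \<omega> - indicat_real A \<omega> *\<^sub>R y \<omega>)"
      by (rule Bochner_Integration.integral_diff[OF intI[OF sets.top that(2,3)] intI[OF that], symmetric])
    also have "\<dots> = (LINT \<omega>|M. indicat_real (space M - A) \<omega> *\<^sub>R y \<omega>)"
      by (rule Bochner_Integration.integral_cong) (auto simp: indicator_def)
    finally show ?thesis by simp
  qed
  have Epow: "E \<subseteq> Pow (space M)" using E(2) sets.space_closed by blast
  show ?thesis
    using E(1) Epow A
  proof (induction rule: sigma_sets_induct_disjoint)
    case (basic A)
    then show ?case by (rule conv)
  next
    case empty
    then show ?case by simp
  next
    case (compl A)
    then have Am: "A \<in> events" using sub by auto
    have "(\<lambda>n. (LINT \<omega>|M. indicat_real (space M) \<omega> *\<^sub>R Z n \<omega>) - (LINT \<omega>|M. indicat_real A \<omega> *\<^sub>R Z n \<omega>))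
       \<longlonglongrightarrow> (LINT \<omega>|M. indicat_real (space M) \<omega> *\<^sub>R z \<omega>) - (LINT \<omega>|M. indicat_real A \<omega> *\<^sub>R z \<omega>)"
      by (intro tendsto_diff conv E(3) compl(2))
    moreover have "(LINT \<omega>|M. indicat_real (space M - A) \<omega> *\<^sub>R z \<omega>)
      = (LINT \<omega>|M. indicat_real (space M) \<omega> *\<^sub>R z \<omega>) - (LINT \<omega>|M. indicat_real A \<omega> *\<^sub>R z \<omega>)"
      by (rule complement[OF Am Z(2) B(2)])
    ultimately have "(\<lambda>n. (LINT \<omega>|M. indicat_real (space M) \<omega> *\<^sub>R Z n \<omega>) - (LINT \<omega>|M. indicat_real A \<omega> *\<^sub>R Z n \<omega>))
       \<longlonglongrightarrow> (LINT \<omega>|M. indicat_real (space M - A) \<omega> *\<^sub>R z \<omega>)" by simp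
    moreover have "\<forall>\<^sub>F n in sequentially. (LINT \<omega>|M. indicat_real (space M) \<omega> *\<^sub>R Z n \<omega>) - (LINT \<omega>|M. indicat_real A \<omega> *\<^sub>R Z n \<omega>)
       = (LINT \<omega>|M. indicat_real (space M - A) \<omega> *\<^sub>R Z n \<omega>)"
      using eventually_ge_at_top[of 1]
      by eventually_elim (rule complement[OF Am Z(1) B(1), symmetric])
    ultimately show ?case by (rule Lim_transform_eventually)
  next
    case (union F)
    then have F: "\<And>i. F i \<in> events" using sub by auto
    define H where "H k = (\<Union>i<k. F i)" for k :: nat
    define U where "U = (\<Union>i. F i)"
    have Hm: "H k \<in> events" "U \<in> events" for k using F by (auto simp: H_def U_def)
    have Hconv: "(\<lambda>n. LINT \<omega>|M. indicat_real (H k) \<omega> *\<^sub>R Z n \<omega>) \<longlonglongrightarrow> (LINT \<omega>|M. indicat_real (H k) \<omega> *\<^sub>R z \<omega>)" for k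
    proof -
      have ind: "indicat_real (H k) \<omega> = (\<Sum>i<k. indicat_real (F i) \<omega>)" for \<omega>
        unfolding H_def using union(1) by (subst indicator_UN_disjoint) (auto simp: disjoint_family_on_def)
      have eq: "(LINT \<omega>|M. indicat_real (H k) \<omega> *\<^sub>R y \<omega>) = (\<Sum>i<k. LINT \<omega>|M. indicat_real (F i) \<omega> *\<^sub>R y \<omega>)"
        if "y \<in> borel_measurable M" "\<And>\<omega>. \<omega> \<in> space M \<Longrightarrow> norm (y \<omega>) \<le> B" for y :: "'a \<Rightarrow> 'b"
        unfolding ind scaleR_sum_left by (rule Bochner_Integration.integral_sum) (intro intI F that)
      have "(\<lambda>n. \<Sum>i<k. LINT \<omega>|M. indicat_real (F i) \<omega> *\<^sub>R Z n \<omega>) \<longlonglongrightarrow> (\<Sum>i<k. LINT \<omega>|M. indicat_real (F i) \<omega> *\<^sub>R z \<omega>)"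
        by (intro tendsto_sum union)
      moreover have "\<forall>\<^sub>F n in sequentially. (\<Sum>i<k. LINT \<omega>|M. indicat_real (F i) \<omega> *\<^sub>R Z n \<omega>) = (LINT \<omega>|M. indicat_real (H k) \<omega> *\<^sub>R Z n \<omega>)"
        using eventually_ge_at_top[of 1] by eventually_elim (rule eq[OF Z(1) B(1), symmetric])
      ultimately have "(\<lambda>n. LINT \<omega>|M. indicat_real (H k) \<omega> *\<^sub>R Z n \<omega>) \<longlonglongrightarrow> (\<Sum>i<k. LINT \<omega>|M. indicat_real (F i) \<omega> *\<^sub>R z \<omega>)"
        by (rule Lim_transform_eventually)
      also have "(\<Sum>i<k. LINT \<omega>|M. indicat_real (F i) \<omega> *\<^sub>R z \<omega>) = (LINT \<omega>|M. indicat_real (H k) \<omega> *\<^sub>R z \<omega>)"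
        by (rule eq[OF Z(2) B(2), symmetric])
      finally show ?thesis .
    qed
    have diff: "norm ((LINT \<omega>|M. indicat_real U \<omega> *\<^sub>R y \<omega>) - (LINT \<omega>|M. indicat_real (H k) \<omega> *\<^sub>R y \<omega>)) \<le> B * prob (U - H k)"
      if "y \<in> borel_measurable M" "\<And>\<omega>. \<omega> \<in> space M \<Longrightarrow> norm (y \<omega>) \<le> B" for y :: "'a \<Rightarrow> 'b" and k
    proof -
      have "(LINT \<omega>|M. indicat_real U \<omega> *\<^sub>R y \<omega>) - (LINT \<omega>|M. indicat_real (H k) \<omega> *\<^sub>R y \<omega>)
        = (LINT \<omega>|M. indicat_real U \<omega> *\<^sub>R y \<omega> - indicat_real (H k) \<omega> *\<^sub>R y \<omega>)"
        by (rule Bochner_Integration.integral_diff[OF intI[OF Hm(2) that] intI[OF Hm(1) that], symmetric])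
      also have "\<dots> = (LINT \<omega>|M. indicat_real (U - H k) \<omega> *\<^sub>R y \<omega>)"
        by (rule Bochner_Integration.integral_cong) (auto simp: indicator_def U_def H_def)
      finally show ?thesis using bnd[OF sets.Diff[OF Hm(2,1)] that] by simp
    qed
    have tail: "(\<lambda>k. prob (U - H k)) \<longlonglongrightarrow> 0"
    proof -
      have "(\<lambda>k. prob (H k)) \<longlonglongrightarrow> prob (\<Union>k. H k)"
        using Hm by (intro finite_Lim_measure_incseq) (auto simp: incseq_def H_def intro: less_le_trans)
      moreover have "(\<Union>k. H k) = U" by (auto simp: H_def U_def)
      ultimately have "(\<lambda>k. prob U - prob (H k)) \<longlonglongrightarrow> prob U - prob U" by (intro tendsto_diff tendsto_const) simp
      moreover have "prob (U - H k) = prob U - prob (H k)" for k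
        using Hm by (intro finite_measure_Diff) (auto simp: H_def U_def)
      ultimately show ?thesis by simp
    qed
    show ?case unfolding U_def[symmetric]
    proof (rule LIMSEQ_approx)
      fix \<epsilon> :: real assume e: "\<epsilon> > 0"
      have "(\<lambda>k. B * prob (U - H k)) \<longlonglongrightarrow> B * 0" by (intro tendsto_intros tail)
      then have "\<forall>\<^sub>F k in sequentially. B * prob (U - H k) < \<epsilon>" using e by (intro order_tendstoD(2)) auto
      then obtain k where "B * prob (U - H k) < \<epsilon>" by (auto simp: eventually_sequentially)
      then show "\<exists>b l. b \<longlonglongrightarrow> l \<and> (\<forall>n\<ge>1. norm ((LINT \<omega>|M. indicat_real U \<omega> *\<^sub>R Z n \<omega>) - b n) \<le> \<epsilon>)
          \<and> norm ((LINT \<omega>|M. indicat_real U \<omega> *\<^sub>R z \<omega>) - l) \<le> \<epsilon>"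
        using Hconv[of k] diff[OF Z(1) B(1), of _ k] diff[OF Z(2) B(2), of k]
        by (meson less_imp_le order_trans)
    qed
  qed
qed

end

section \<open>The filtration and the stopped exponential martingale\<close>

text \<open>The quadratic term in the exponent cancels the quadratic term of the expansion of
  \<open>iexp\<close>.\<close>
lemma exp_increment_bound:
  assumes x: "\<bar>x\<bar> \<le> 1"
  shows "norm (exp (\<i> * complex_of_real x + complex_of_real (x\<^sup>2 / 2)) - 1 - \<i> * complex_of_real x) \<le> 4 * \<bar>x\<bar> ^ 3"
proof -
  let ?x = "complex_of_real x"
  define w where "w = \<i> * ?x + complex_of_real (x\<^sup>2 / 2)"
  have x2: "x\<^sup>2 \<le> \<bar>x\<bar>" using x mult_left_le[of "\<bar>x\<bar>" "\<bar>x\<bar>"] by (simp add: power2_eq_square abs_mult[symmetric])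
  have nw: "norm w \<le> 3 / 2 * \<bar>x\<bar>"
  proof -
    have "norm w \<le> norm (\<i> * ?x) + norm (complex_of_real (x\<^sup>2 / 2))" unfolding w_def by (rule norm_triangle_ineq)
    also have "\<dots> = \<bar>x\<bar> + x\<^sup>2 / 2" by (simp add: norm_mult norm_power norm_divide)
    finally show ?thesis using x2 by linarith
  qed
  have Re: "\<bar>Re w\<bar> \<le> 1 / 2" using x x2 by (simp add: w_def)
  have e2: "exp (1/2 :: real) \<le> 2"
  proof -
    have "exp (1/2 :: real) ^ 2 = exp 1" by (simp flip: exp_of_nat_mult)
    also have "\<dots> \<le> 2 ^ 2" using exp_le by simp
    finally show ?thesis by (rule power2_le_imp_le) simp
  qed
  have "norm (exp w - (\<Sum>k\<le>2. w ^ k / fact k)) \<le> exp \<bar>Re w\<bar> * norm w ^ Suc 2 / fact 2"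
    by (rule Taylor_exp)
  also have "\<dots> \<le> 2 * (3 / 2 * \<bar>x\<bar>) ^ Suc 2 / fact 2"
  proof (intro divide_right_mono mult_mono power_mono nw)
    show "exp \<bar>Re w\<bar> \<le> 2" using Re e2 by (meson exp_le_cancel_iff order_trans)
  qed auto
  also have "\<dots> = 27 / 8 * \<bar>x\<bar> ^ 3" by (simp add: power_mult_distrib numeral_eq_Suc)
  finally have 1: "norm (exp w - (1 + w + w\<^sup>2 / 2)) \<le> 27 / 8 * \<bar>x\<bar> ^ 3"
    by (simp add: numeral_2_eq_2)
  have "1 + w + w\<^sup>2 / 2 - 1 - \<i> * ?x = \<i> * ?x ^ 3 / 2 + ?x ^ 4 / 8"
    unfolding w_def by (simp add: power2_eq_square power3_eq_cube eval_nat_numeral field_simps)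
  also have "norm \<dots> \<le> \<bar>x\<bar> ^ 3 / 2 + \<bar>x\<bar> ^ 4 / 8"
    by (rule norm_triangle_le) (simp add: norm_mult norm_divide norm_power)
  also have "\<bar>x\<bar> ^ 4 \<le> \<bar>x\<bar> ^ 3" using x by (intro power_decreasing) auto
  finally have 2: "norm (1 + w + w\<^sup>2 / 2 - 1 - \<i> * ?x) \<le> 5 / 8 * \<bar>x\<bar> ^ 3" by simp
  have "exp w - 1 - \<i> * ?x = (exp w - (1 + w + w\<^sup>2 / 2)) + (1 + w + w\<^sup>2 / 2 - 1 - \<i> * ?x)" by simp
  also have "norm \<dots> \<le> 27 / 8 * \<bar>x\<bar> ^ 3 + 5 / 8 * \<bar>x\<bar> ^ 3"
    by (rule norm_triangle_le) (use 1 2 in linarith)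
  finally show ?thesis by (simp add: w_def)
qed

context gibbs_model
begin

abbreviation "G \<equiv> partition_sigma_inf M Part"

text \<open>The union of the sigma-algebras generated by the individual partitions, an algebra that
  generates \<open>G\<close>.\<close>
definition past_events :: "'a set set" where
  "past_events = {A. A \<subseteq> space M \<and> (\<exists>m\<ge>1. adapted m (\<lambda>\<omega>. \<omega> \<in> A))}"

lemma past_events_eq:
  "past_events = (\<Union>n\<in>{1..}. sets (vimage_algebra (space M) (Part n) (count_space UNIV)))"
proof -
  have s: "sets (vimage_algebra (space M) (Part n) (count_space UNIV)) = {Part n -` X \<inter> space M | X. True}" for n
    by (subst sets_vimage_algebra2) auto
  show ?thesis
  proof (intro equalityI subsetI)
    fix A assume "A \<in> past_events"
    then obtain m h where m: "m \<ge> 1" "A \<subseteq> space M" "\<And>\<omega>. \<omega> \<in> space M \<Longrightarrow> (\<omega> \<in> A) = h (Part m \<omega>)"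
      by (auto simp: past_events_def adapted_def)
    then have "A = Part m -` {P. h P} \<inter> space M" by auto
    then show "A \<in> (\<Union>n\<in>{1..}. sets (vimage_algebra (space M) (Part n) (count_space UNIV)))"
      unfolding s using m(1) by blast
  next
    fix A assume "A \<in> (\<Union>n\<in>{1..}. sets (vimage_algebra (space M) (Part n) (count_space UNIV)))"
    then obtain n X where "n \<ge> 1" "A = Part n -` X \<inter> space M" unfolding s by auto
    then show "A \<in> past_events" unfolding past_events_def adapted_def
      by (auto intro!: exI[of _ n] exI[of _ "\<lambda>P. P \<in> X"])
  qed
qed

lemma past_events_sub: "past_events \<subseteq> events"
proof
  fix A assume A: "A \<in> past_events"
  then obtain m where m: "m \<ge> 1" "A \<subseteq> space M" "adapted m (\<lambda>\<omega>. \<omega> \<in> A)" by (auto simp: past_events_def)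
  have "(\<lambda>\<omega>. if \<omega> \<in> A then 1 else 0 :: real) \<in> borel_measurable M"
    by (rule adapted_measurable[OF m(1) adapted_comp[OF m(3), of "\<lambda>b. if b then 1 else 0"]])
  then have "{\<omega> \<in> space M. (if \<omega> \<in> A then 1 else 0 :: real) = 1} \<in> events" by measurable
  also have "{\<omega> \<in> space M. (if \<omega> \<in> A then 1 else 0 :: real) = 1} = A" using m(2) by auto
  finally show "A \<in> events" .
qed

lemma past_events_Pow: "past_events \<subseteq> Pow (space M)"
  by (auto simp: past_events_def)

lemma sets_G: "sets G = sigma_sets (space M) past_events" and space_G: "space G = space M"
  using past_events_Pow unfolding partition_sigma_inf_def past_events_eq[symmetric] by (simp_all add: sets_measure_of)

lemma subalgebra_G: "subalgebra M G"
  using sets.sigma_sets_subset[OF past_events_sub] by (simp add: subalgebra_def sets_G space_G)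

lemma space_past: "space M \<in> past_events"
  by (auto simp: past_events_def adapted_def intro!: exI[of _ 1])

lemma Int_stable_past: "Int_stable past_events"
proof (rule Int_stableI)
  fix A B assume "A \<in> past_events" "B \<in> past_events"
  then obtain m n where mn: "m \<ge> 1" "n \<ge> 1" "A \<subseteq> space M" "B \<subseteq> space M" "adapted m (\<lambda>\<omega>. \<omega> \<in> A)" "adapted n (\<lambda>\<omega>. \<omega> \<in> B)"
    by (auto simp: past_events_def)
  then have "adapted (max m n) (\<lambda>\<omega>. \<omega> \<in> A)" "adapted (max m n) (\<lambda>\<omega>. \<omega> \<in> B)"
    using adapted_mono[of m "max m n"] adapted_mono[of n "max m n"] by auto
  from adapted_comp2[OF this, of "\<lambda>a b. a \<and> b"] show "A \<inter> B \<in> past_events"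
    using mn by (auto simp: past_events_def intro!: exI[of _ "max m n"])
qed

lemma G_measurable_Part: 
  fixes F :: "nat set set \<Rightarrow> 'b::topological_space"
  assumes "n \<ge> 1" shows "(\<lambda>\<omega>. F (Part n \<omega>)) \<in> borel_measurable G"
proof (rule measurableI)
  fix X :: "'b set"
  have "adapted n (\<lambda>\<omega>. \<omega> \<in> (\<lambda>\<omega>. F (Part n \<omega>)) -` X \<inter> space M)"
    by (auto simp: adapted_def intro!: exI[of _ "\<lambda>P. F P \<in> X"])
  then have "(\<lambda>\<omega>. F (Part n \<omega>)) -` X \<inter> space M \<in> past_events"
    using assms by (auto simp: past_events_def)
  then show "(\<lambda>\<omega>. F (Part n \<omega>)) -` X \<inter> space G \<in> sets G" by (auto simp: sets_G space_G)
qed simp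

lemma G_measurable_diversity: "alpha_diversity \<alpha> Part \<in> borel_measurable G"
  unfolding alpha_diversity_def[abs_def]
proof (rule borel_measurable_lim_metric)
  show "(\<lambda>\<omega>. K n \<omega> / real n powr \<alpha>) \<in> borel_measurable G" for n
  proof (cases n)
    case (Suc m)
    then show ?thesis by (intro G_measurable_Part[of n "\<lambda>P. real (card P) / real n powr \<alpha>"]) simp
  qed simp
qed

lemma diversity_measurable [measurable]: "alpha_diversity \<alpha> Part \<in> borel_measurable M"
  by (rule measurable_from_subalg[OF subalgebra_G G_measurable_diversity])

text \<open>The exponent of the exponential martingale of the score. As the increments of the sum of
  \<open>info_wt\<close> are the squared increments of the score, an increment has the form
  \<open>\<i> x + x\<^sup>2 / 2\<close> treated in \<open>exp_increment_bound\<close>.\<close>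
definition exponent :: "real \<Rightarrow> nat set set \<Rightarrow> complex" where
  "exponent u P = \<i> * of_real (u * block_sum (score_wt \<alpha>) P) + of_real (u\<^sup>2 * block_sum (info_wt \<alpha>) P / 2)"

definition "jump = 1 / \<alpha> + 1 / (1 - \<alpha>)"

lemma jump_pos: "jump > 0"
  using alpha by (simp add: jump_def add_pos_pos)

lemma score_jump:
  assumes P: "partition_on {1..n} P"
    and P': "P' = open_block (Suc n) P \<or> (\<exists>U\<in>P. P' = join_block (Suc n) U P)"
  shows "\<bar>block_sum (score_wt \<alpha>) P' - block_sum (score_wt \<alpha>) P\<bar> \<le> jump"
    "block_sum (info_wt \<alpha>) P' - block_sum (info_wt \<alpha>) P = (block_sum (score_wt \<alpha>) P' - block_sum (score_wt \<alpha>) P)\<^sup>2"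
proof -
  have "\<bar>block_sum (score_wt \<alpha>) P' - block_sum (score_wt \<alpha>) P\<bar> \<le> jump \<and>
    block_sum (info_wt \<alpha>) P' - block_sum (info_wt \<alpha>) P = (block_sum (score_wt \<alpha>) P' - block_sum (score_wt \<alpha>) P)\<^sup>2"
    using P'
  proof
    assume "P' = open_block (Suc n) P"
    then show ?thesis using alpha by (simp add: block_sum_open[OF P] jump_def power_one_over)
  next
    assume "\<exists>U\<in>P. P' = join_block (Suc n) U P"
    then obtain U where U: "U \<in> P" "P' = join_block (Suc n) U P" by blast
    have c: "card U \<ge> 1" by (rule part_block(4)[OF P U(1)])
    then have d: "real (card U) - \<alpha> \<ge> 1 - \<alpha>" "real (card U) - \<alpha> > 0" using alpha by auto
    have "1 / (real (card U) - \<alpha>) \<le> 1 / (1 - \<alpha>)" using d alpha by (intro divide_left_mono) auto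
    also have "\<dots> \<le> jump" using alpha by (simp add: jump_def)
    finally show ?thesis using d
      by (simp add: U(2) block_sum_join[OF P U(1)] score_wt_Suc[OF c] info_wt_Suc[OF c] power_divide)
  qed
  then show "\<bar>block_sum (score_wt \<alpha>) P' - block_sum (score_wt \<alpha>) P\<bar> \<le> jump"
    "block_sum (info_wt \<alpha>) P' - block_sum (info_wt \<alpha>) P = (block_sum (score_wt \<alpha>) P' - block_sum (score_wt \<alpha>) P)\<^sup>2"
    by auto
qed

lemma smean_of_real: "smean n (\<lambda>P'. complex_of_real (f P')) P = of_real (smean n f P)"
  by (simp add: step_mean_def scaleR_conv_of_real)

definition "drift_const = D / \<alpha>"
definition "cubic_const = 12 * jump * (1 / \<alpha>\<^sup>2 + 1 / (1 - \<alpha>)) * D"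

lemma consts_nonneg: "drift_const \<ge> 0" "cubic_const \<ge> 0"
  using alpha D_ge jump_pos by (simp_all add: drift_const_def cubic_const_def)

text \<open>The exponential is a martingale up to the bias of the score and a cubic remainder. The
  cube of a jump is bounded by the maximal jump times its square, which reduces the remainder to the
  second moment of the jumps.\<close>
lemma smean_exp_exponent:
  assumes P: "partition_on {1..n} P" and n: "n \<ge> 1" and u: "\<bar>u\<bar> * jump \<le> 1"
  shows "norm (smean n (\<lambda>P'. exp (exponent u P' - exponent u P) - 1) P)
    \<le> \<bar>u\<bar> * drift_const / real n + \<bar>u\<bar> ^ 3 * cubic_const * real (card P) / real n"
proof -
  let ?\<Delta> = "\<lambda>P'. block_sum (score_wt \<alpha>) P' - block_sum (score_wt \<alpha>) P"
  define R where "R P' = exp (exponent u P' - exponent u P) - 1 - \<i> * of_real (u * ?\<Delta> P')" for P'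
  have "smean n (\<lambda>P'. exp (exponent u P' - exponent u P) - 1) P = smean n (\<lambda>P'. (\<i> * of_real u) * of_real (?\<Delta> P') + R P') P"
    by (simp add: R_def)
  also have "\<dots> = (\<i> * of_real u) * of_real (smean n ?\<Delta> P) + smean n R P"
    unfolding smean_add smean_cmult smean_of_real ..
  also have "smean n ?\<Delta> P = bias n (card P) / \<alpha>"
  proof -
    have "block_sum (generator (score_wt \<alpha>)) P = 0"
      unfolding block_sum_def using generator_score part_block(4)[OF P] by (intro sum.neutral) auto
    then show ?thesis by (simp add: smean_increment[OF P n])
  qed
  finally have "norm (smean n (\<lambda>P'. exp (exponent u P' - exponent u P) - 1) P) \<le> norm ((\<i> * of_real u) * complex_of_real (bias n (card P) / \<alpha>)) + norm (smean n R P)"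
    by (simp only: norm_triangle_ineq)
  also have "norm ((\<i> * of_real u) * complex_of_real (bias n (card P) / \<alpha>)) \<le> \<bar>u\<bar> * drift_const / real n"
  proof -
    have "\<bar>bias n (card P) / \<alpha>\<bar> \<le> drift_const / real n"
      using divide_right_mono[OF rate_D(2)[OF n part_card_pos[OF P n]], of \<alpha>] alpha by (simp add: drift_const_def mult.commute)
    from mult_left_mono[OF this, of "\<bar>u\<bar>"] show ?thesis by (simp add: norm_mult norm_divide abs_mult)
  qed
  also have "norm (smean n R P) \<le> \<bar>u\<bar> ^ 3 * cubic_const * real (card P) / real n"
  proof -
    have R: "norm (R P') \<le> (4 * \<bar>u\<bar> ^ 3 * jump) * (?\<Delta> P')\<^sup>2"
      if P': "P' = open_block (Suc n) P \<or> (\<exists>U\<in>P. P' = join_block (Suc n) U P)" for P'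
    proof -
      note j = score_jump[OF P P']
      have "exponent u P' - exponent u P = \<i> * of_real (u * ?\<Delta> P') + of_real (u\<^sup>2 * (block_sum (info_wt \<alpha>) P' - block_sum (info_wt \<alpha>) P) / 2)"
        by (simp add: exponent_def right_diff_distrib diff_divide_distrib)
      then have e: "exponent u P' - exponent u P = \<i> * of_real (u * ?\<Delta> P') + of_real ((u * ?\<Delta> P')\<^sup>2 / 2)"
        unfolding j(2) power_mult_distrib .
      have "\<bar>u * ?\<Delta> P'\<bar> \<le> \<bar>u\<bar> * jump" unfolding abs_mult using j(1) by (intro mult_left_mono) auto
      then have "\<bar>u * ?\<Delta> P'\<bar> \<le> 1" using u by linarith
      from exp_increment_bound[OF this] have "norm (R P') \<le> 4 * \<bar>u * ?\<Delta> P'\<bar> ^ 3"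
        unfolding R_def e .
      also have "\<dots> = 4 * \<bar>u\<bar> ^ 3 * (\<bar>?\<Delta> P'\<bar> * (?\<Delta> P')\<^sup>2)" 
      proof -
        have "\<bar>d\<bar> ^ 3 = \<bar>d\<bar> * d\<^sup>2" for d :: real
          by (simp only: power3_eq_cube power2_eq_square power2_abs[of d, unfolded power2_eq_square] mult.assoc)
        then show ?thesis by (simp only: abs_mult power_mult_distrib mult.assoc)
      qed
      also have "\<dots> \<le> 4 * \<bar>u\<bar> ^ 3 * (jump * (?\<Delta> P')\<^sup>2)" using j(1) by (intro mult_left_mono mult_right_mono) auto
      finally show ?thesis by (simp add: mult_ac)
    qed
    have "norm (smean n R P) \<le> smean n (\<lambda>P'. norm (R P')) P" by (rule smean_norm[OF P n])
    also have "\<dots> \<le> smean n (\<lambda>P'. (4 * \<bar>u\<bar> ^ 3 * jump) * (?\<Delta> P')\<^sup>2) P"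
      by (rule smean_mono[OF P n]) (rule R, blast)+
    also have "\<dots> = (4 * \<bar>u\<bar> ^ 3 * jump) * smean n (\<lambda>P'. (?\<Delta> P')\<^sup>2) P" by (rule smean_cmult)
    also have "\<dots> \<le> (4 * \<bar>u\<bar> ^ 3 * jump) * (3 * (1 / \<alpha>\<^sup>2 + 1 / (1 - \<alpha>)) * D * real (card P) / real n)"
      using jump_pos by (intro mult_left_mono smean_increment_sq[OF P n] score_increment_bounds) auto
    also have "\<dots> = \<bar>u\<bar> ^ 3 * cubic_const * real (card P) / real n"
      by (simp add: cubic_const_def mult_ac)
    finally show ?thesis .
  qed
  finally show ?thesis by simp
qed

text \<open>The exponential martingale frozen once the accumulated information exceeds
  \<open>B\<close>; without stopping it would not be bounded. The value at index \<open>j\<close>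
  belongs to the partition at time \<open>j + 1\<close>.\<close>
primrec stopped_exp :: "real \<Rightarrow> real \<Rightarrow> nat \<Rightarrow> 'a \<Rightarrow> complex" where
  "stopped_exp u B 0 \<omega> = exp (exponent u (Part (Suc 0) \<omega>))"
| "stopped_exp u B (Suc j) \<omega> = stopped_exp u B j \<omega> *
     (if BS (info_wt \<alpha>) (Suc j) \<omega> \<le> B
      then exp (exponent u (Part (Suc (Suc j)) \<omega>) - exponent u (Part (Suc j) \<omega>)) else 1)"

lemma stopped_exp_adapted: "adapted (Suc j) (stopped_exp u B j)"
proof (induction j)
  case 0
  have "stopped_exp u B 0 = (\<lambda>\<omega>. exp (exponent u (Part (Suc 0) \<omega>)))" by (rule ext) simp
  show ?case unfolding \<open>stopped_exp u B 0 = _\<close> by (rule adapted_Part)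
next
  case (Suc j)
  have 1: "adapted (Suc (Suc j)) (stopped_exp u B j)" by (rule adapted_Suc[OF _ Suc]) simp
  have 2: "adapted (Suc (Suc j)) (\<lambda>\<omega>. Part (Suc j) \<omega>)" "adapted (Suc (Suc j)) (\<lambda>\<omega>. Part (Suc (Suc j)) \<omega>)"
    using adapted_Part_le[of "Suc j" "Suc (Suc j)" "\<lambda>P. P"] adapted_Part[of "Suc (Suc j)" "\<lambda>P. P"] by simp_all
  have "adapted (Suc (Suc j)) (\<lambda>\<omega>. stopped_exp u B j \<omega> *
     (if block_sum (info_wt \<alpha>) (Part (Suc j) \<omega>) \<le> B
      then exp (exponent u (Part (Suc (Suc j)) \<omega>) - exponent u (Part (Suc j) \<omega>)) else 1))"
    by (rule adapted_comp2[OF 1 adapted_comp2[OF 2, of "\<lambda>P P'. if block_sum (info_wt \<alpha>) P \<le> B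
      then exp (exponent u P' - exponent u P) else 1"], of "(*)"])
  moreover have "stopped_exp u B (Suc j) = (\<lambda>\<omega>. stopped_exp u B j \<omega> *
     (if block_sum (info_wt \<alpha>) (Part (Suc j) \<omega>) \<le> B
      then exp (exponent u (Part (Suc (Suc j)) \<omega>) - exponent u (Part (Suc j) \<omega>)) else 1))"
    by (rule ext) simp
  ultimately show ?case by simp
qed

lemma info_mono:
  assumes "\<omega> \<in> space M"
  shows "BS (info_wt \<alpha>) (Suc j) \<omega> \<le> BS (info_wt \<alpha>) (Suc (Suc j)) \<omega>"
    "BS (info_wt \<alpha>) (Suc (Suc j)) \<omega> \<le> BS (info_wt \<alpha>) (Suc j) \<omega> + jump\<^sup>2"
proof -
  have s: "Suc j \<ge> 1" by simp
  note P = Part_partition[OF s assms]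
  have c: "Part (Suc (Suc j)) \<omega> = open_block (Suc (Suc j)) (Part (Suc j) \<omega>) \<or>
     (\<exists>U\<in>Part (Suc j) \<omega>. Part (Suc (Suc j)) \<omega> = join_block (Suc (Suc j)) U (Part (Suc j) \<omega>))"
    using gibbs_step[OF s assms] by simp
  note j = score_jump[OF P c]
  show "BS (info_wt \<alpha>) (Suc j) \<omega> \<le> BS (info_wt \<alpha>) (Suc (Suc j)) \<omega>"
    using j(2) zero_le_power2[of "BS (score_wt \<alpha>) (Suc (Suc j)) \<omega> - BS (score_wt \<alpha>) (Suc j) \<omega>"] by linarith
  have "(BS (score_wt \<alpha>) (Suc (Suc j)) \<omega> - BS (score_wt \<alpha>) (Suc j) \<omega>)\<^sup>2 \<le> jump\<^sup>2"
    using power_mono[OF j(1), of 2] by simp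
  then show "BS (info_wt \<alpha>) (Suc (Suc j)) \<omega> \<le> BS (info_wt \<alpha>) (Suc j) \<omega> + jump\<^sup>2"
    using j(2) by linarith
qed

lemma stopped_exp_eq:
  assumes "\<omega> \<in> space M" "BS (info_wt \<alpha>) (Suc j) \<omega> \<le> B"
  shows "stopped_exp u B j \<omega> = exp (exponent u (Part (Suc j) \<omega>))"
  using assms(2)
proof (induction j)
  case (Suc j)
  then have "BS (info_wt \<alpha>) (Suc j) \<omega> \<le> B" using info_mono(1)[OF assms(1), of j] by linarith
  with Suc.IH show ?case by (simp add: exp_add[symmetric])
qed simp

lemma norm_exp_exponent: "norm (exp (exponent u P)) = exp (u\<^sup>2 * block_sum (info_wt \<alpha>) P / 2)"
  by (simp add: exponent_def)

text \<open>The modulus is the exponential of the information accumulated until the process is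
  stopped, which exceeds \<open>B\<close> by at most one jump.\<close>
lemma stopped_exp_norm:
  assumes w: "\<omega> \<in> space M" and B: "B \<ge> 0"
  shows "norm (stopped_exp u B j \<omega>) \<le> exp (u\<^sup>2 * (B + jump\<^sup>2) / 2)"
proof (induction j)
  case 0
  have "BS (info_wt \<alpha>) (Suc 0) \<omega> = (1 / \<alpha>)\<^sup>2" using w by (simp add: Part_1 block_sum_def power_one_over)
  also have "\<dots> \<le> jump\<^sup>2" using alpha by (intro power_mono) (auto simp: jump_def)
  finally have "u\<^sup>2 * BS (info_wt \<alpha>) (Suc 0) \<omega> / 2 \<le> u\<^sup>2 * (B + jump\<^sup>2) / 2"
    using B by (intro divide_right_mono mult_left_mono) auto
  then show ?case by (simp only: stopped_exp.simps norm_exp_exponent exp_le_cancel_iff)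
next
  case (Suc j)
  show ?case
  proof (cases "BS (info_wt \<alpha>) (Suc j) \<omega> \<le> B")
    case True
    then have "stopped_exp u B (Suc j) \<omega> = exp (exponent u (Part (Suc (Suc j)) \<omega>))"
      using stopped_exp_eq[OF w True] by (simp add: exp_add[symmetric])
    moreover have "u\<^sup>2 * BS (info_wt \<alpha>) (Suc (Suc j)) \<omega> / 2 \<le> u\<^sup>2 * (B + jump\<^sup>2) / 2"
      using info_mono(2)[OF w, of j] True by (intro divide_right_mono mult_left_mono) auto
    ultimately show ?thesis by (simp only: norm_exp_exponent exp_le_cancel_iff)
  next
    case False
    then show ?thesis using Suc by simp
  qed
qed

lemma stopped_exp_step:
  assumes A: "adapted (Suc j) (\<lambda>\<omega>. \<omega> \<in> S)" and u: "\<bar>u\<bar> * jump \<le> 1" and B: "B \<ge> 0"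
  shows "norm ((LINT \<omega>|M. indicat_real S \<omega> *\<^sub>R stopped_exp u B (Suc j) \<omega>) - (LINT \<omega>|M. indicat_real S \<omega> *\<^sub>R stopped_exp u B j \<omega>))
    \<le> exp (u\<^sup>2 * (B + jump\<^sup>2) / 2) *
       (\<bar>u\<bar> * drift_const / real (Suc j) + \<bar>u\<bar> ^ 3 * cubic_const * card_const * A (Suc j) / real (Suc j))"
proof -
  let ?n = "Suc j" and ?E = "exp (u\<^sup>2 * (B + jump\<^sup>2) / 2)"
  have n: "?n \<ge> 1" by simp
  define H where "H \<omega> = indicat_real S \<omega> *\<^sub>R stopped_exp u B j \<omega>" for \<omega>
  have Had: "adapted ?n H"
  proof -
    have "adapted ?n (\<lambda>\<omega>. (if \<omega> \<in> S then 1 else 0 :: real) *\<^sub>R stopped_exp u B j \<omega>)"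
      by (rule adapted_comp2[OF A stopped_exp_adapted, of "\<lambda>b z. (if b then 1 else 0 :: real) *\<^sub>R z"])
    moreover have "H = (\<lambda>\<omega>. (if \<omega> \<in> S then 1 else 0 :: real) *\<^sub>R stopped_exp u B j \<omega>)"
      by (rule ext) (simp add: H_def indicator_def)
    ultimately show ?thesis by simp
  qed
  define f where "f h P P' = h * (if block_sum (info_wt \<alpha>) P \<le> B then exp (exponent u P' - exponent u P) - 1 else 0)" for h :: complex and P P'
  define H' where "H' \<omega> = indicat_real S \<omega> *\<^sub>R stopped_exp u B (Suc j) \<omega>" for \<omega>
  have H'ad: "adapted (Suc ?n) H'"
  proof -
    have A': "adapted (Suc ?n) (\<lambda>\<omega>. \<omega> \<in> S)" by (rule adapted_Suc[OF n A])
    have "adapted (Suc ?n) (\<lambda>\<omega>. (if \<omega> \<in> S then 1 else 0 :: real) *\<^sub>R stopped_exp u B (Suc j) \<omega>)"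
      by (rule adapted_comp2[OF A' stopped_exp_adapted, of "\<lambda>b z. (if b then 1 else 0 :: real) *\<^sub>R z"])
    moreover have "H' = (\<lambda>\<omega>. (if \<omega> \<in> S then 1 else 0 :: real) *\<^sub>R stopped_exp u B (Suc j) \<omega>)"
      by (rule ext) (simp add: H'_def indicator_def)
    ultimately show ?thesis by simp
  qed
  have "(LINT \<omega>|M. H' \<omega>) - (LINT \<omega>|M. H \<omega>) = (LINT \<omega>|M. H' \<omega> - H \<omega>)"
    by (rule Bochner_Integration.integral_diff[OF adapted_integrable[OF _ H'ad] adapted_integrable[OF n Had], symmetric]) simp
  also have "\<dots> = (LINT \<omega>|M. f (H \<omega>) (Part ?n \<omega>) (Part (Suc ?n) \<omega>))"
    by (rule Bochner_Integration.integral_cong) (auto simp: H_def H'_def f_def algebra_simps)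
  also have "\<dots> = (LINT \<omega>|M. smean ?n (f (H \<omega>) (Part ?n \<omega>)) (Part ?n \<omega>))"
    by (rule one_step[OF n Had])
  also have "norm \<dots> \<le> (LINT \<omega>|M. norm (smean ?n (f (H \<omega>) (Part ?n \<omega>)) (Part ?n \<omega>)))"
    by (rule integral_norm_bound)
  also have "\<dots> \<le> (LINT \<omega>|M. ?E * (\<bar>u\<bar> * drift_const / real ?n + \<bar>u\<bar> ^ 3 * cubic_const / real ?n * K ?n \<omega>))"
  proof (rule integral_mono)
    show "integrable M (\<lambda>\<omega>. norm (smean ?n (f (H \<omega>) (Part ?n \<omega>)) (Part ?n \<omega>)))"
      by (rule adapted_integrable[OF n adapted_comp2[OF Had adapted_Part, of "\<lambda>h P. norm (smean ?n (f h P) P)" "\<lambda>P. P"]])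
    show "integrable M (\<lambda>\<omega>. ?E * (\<bar>u\<bar> * drift_const / real ?n + \<bar>u\<bar> ^ 3 * cubic_const / real ?n * K ?n \<omega>))"
      using n by (intro integrable_mult_right Bochner_Integration.integrable_add integrable_K) auto
    fix \<omega> assume w: "\<omega> \<in> space M"
    let ?P = "Part ?n \<omega>"
    note P = Part_partition[OF n w]
    let ?c = "if block_sum (info_wt \<alpha>) ?P \<le> B then 1 else 0 :: complex"
    have "smean ?n (f (H \<omega>) ?P) ?P = smean ?n (\<lambda>P'. (H \<omega> * ?c) * (exp (exponent u P' - exponent u ?P) - 1)) ?P"
      by (rule arg_cong[of _ _ "\<lambda>g. smean ?n g ?P"]) (auto simp: f_def)
    also have "\<dots> = (H \<omega> * ?c) * smean ?n (\<lambda>P'. exp (exponent u P' - exponent u ?P) - 1) ?P" by (rule smean_cmult)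
    also have "norm \<dots> \<le> ?E * (\<bar>u\<bar> * drift_const / real ?n + \<bar>u\<bar> ^ 3 * cubic_const * real (card ?P) / real ?n)"
      unfolding norm_mult
    proof (rule mult_mono)
      have "norm (H \<omega>) \<le> ?E" using stopped_exp_norm[OF w B, of u j] by (auto simp: H_def indicator_def)
      then show "norm (H \<omega>) * norm ?c \<le> ?E" by simp
    qed (rule smean_exp_exponent[OF P n u], auto)
    finally show "norm (smean ?n (f (H \<omega>) ?P) ?P) \<le> ?E * (\<bar>u\<bar> * drift_const / real ?n + \<bar>u\<bar> ^ 3 * cubic_const / real ?n * K ?n \<omega>)"
      by (simp add: mult.assoc)
  qed
  also have "\<dots> = ?E * (\<bar>u\<bar> * drift_const / real ?n + \<bar>u\<bar> ^ 3 * cubic_const / real ?n * (LINT \<omega>|M. K ?n \<omega>))"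
    using n integrable_K[OF n] by (simp add: prob_space)
  also have "\<dots> \<le> ?E * (\<bar>u\<bar> * drift_const / real ?n + \<bar>u\<bar> ^ 3 * cubic_const / real ?n * (card_const * A ?n))"
    using consts_nonneg by (intro mult_left_mono add_left_mono mean_card[OF n]) auto
  finally show ?thesis by (simp add: H_def H'_def mult_ac)
qed

text \<open>Summing the errors of the single steps: the drifts give a harmonic sum, the cubic
  remainders sum up to a multiple of \<open>growth \<alpha>\<close> because \<open>\<alpha> growth
  \<alpha> j / j\<close> is the increment of \<open>growth \<alpha>\<close>.\<close>
lemma stopped_exp_total:
  assumes S: "adapted (Suc i) (\<lambda>\<omega>. \<omega> \<in> S)" and u: "\<bar>u\<bar> * jump \<le> 1" and B: "B \<ge> 0" and ij: "i \<le> j"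
  shows "norm ((LINT \<omega>|M. indicat_real S \<omega> *\<^sub>R stopped_exp u B j \<omega>) - (LINT \<omega>|M. indicat_real S \<omega> *\<^sub>R stopped_exp u B i \<omega>))
    \<le> exp (u\<^sup>2 * (B + jump\<^sup>2) / 2) * (\<bar>u\<bar> * drift_const * harm j + \<bar>u\<bar> ^ 3 * (cubic_const * card_const / \<alpha>) * A (Suc j))"
  using ij
proof (induction j rule: dec_induct)
  case base
  show ?case using consts_nonneg card_const_pos alpha A_pos[of "Suc i"] harm_nonneg[of i, where 'a = real] by simp
next
  case (step j)
  let ?I = "\<lambda>j. LINT \<omega>|M. indicat_real S \<omega> *\<^sub>R stopped_exp u B j \<omega>" and ?E = "exp (u\<^sup>2 * (B + jump\<^sup>2) / 2)"
  have Sj: "adapted (Suc j) (\<lambda>\<omega>. \<omega> \<in> S)" using step(1) by (intro adapted_mono[OF _ _ S]) auto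
  have "norm (?I (Suc j) - ?I i) \<le> norm (?I (Suc j) - ?I j) + norm (?I j - ?I i)"
    using norm_triangle_ineq[of "?I (Suc j) - ?I j" "?I j - ?I i"] by simp
  also have "\<dots> \<le> ?E * (\<bar>u\<bar> * drift_const / real (Suc j) + \<bar>u\<bar> ^ 3 * cubic_const * card_const * A (Suc j) / real (Suc j))
    + ?E * (\<bar>u\<bar> * drift_const * harm j + \<bar>u\<bar> ^ 3 * (cubic_const * card_const / \<alpha>) * A (Suc j))"
    by (rule add_mono[OF stopped_exp_step[OF Sj u B] step.IH])
  also have "\<dots> = ?E * (\<bar>u\<bar> * drift_const * harm (Suc j) + \<bar>u\<bar> ^ 3 * (cubic_const * card_const / \<alpha>) * A (Suc (Suc j)))"
  proof -
    have h: "harm (Suc j) = harm j + 1 / real (Suc j)" by (simp add: harm_Suc inverse_eq_divide)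
    have a: "A (Suc (Suc j)) = A (Suc j) + \<alpha> * A (Suc j) / real (Suc j)"
      by (subst growth_Suc) (simp_all add: distrib_left mult.commute)
    have "\<bar>u\<bar> ^ 3 * (cubic_const * card_const / \<alpha>) * (\<alpha> * A (Suc j) / real (Suc j)) = \<bar>u\<bar> ^ 3 * cubic_const * card_const * A (Suc j) / real (Suc j)"
      using alpha by simp
    then show ?thesis unfolding h a by (simp add: distrib_left)
  qed
  finally show ?case .
qed

section \<open>Central limit theorem for the score\<close>

text \<open>The limiting variance of the score divided by \<open>n powr (\<alpha> / 2)\<close>. The
  maximum only matters on the null set where the limit defining the diversity does not exist.\<close>
definition asym_var :: "'a \<Rightarrow> real" where
  "asym_var \<omega> = fisher_info \<alpha> * max 0 (alpha_diversity \<alpha> Part \<omega>)"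

lemma asym_var_nonneg: "asym_var \<omega> \<ge> 0"
  using fisher_info_pos[OF alpha] by (simp add: asym_var_def)

lemma asym_var_G: "asym_var \<in> borel_measurable G"
  unfolding asym_var_def[abs_def] using G_measurable_diversity by measurable

lemma asym_var_M [measurable]: "asym_var \<in> borel_measurable M"
  by (rule measurable_from_subalg[OF subalgebra_G asym_var_G])

lemma BS_measurable [measurable]: "n \<ge> 1 \<Longrightarrow> BS w n \<in> borel_measurable M"
  using integrable_BS(1) by blast

lemma K_measurable [measurable]: "n \<ge> 1 \<Longrightarrow> K n \<in> borel_measurable M"
  using integrable_K by blast

lemma info_minus_card_vanishing:
  "vanishing (\<lambda>n \<omega>. (BS (info_wt \<alpha>) n \<omega> - fisher_info \<alpha> * K n \<omega>) / real n powr \<alpha>)"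
proof (rule vanishing_L1)
  let ?X = "\<lambda>n \<omega>. (BS (info_wt \<alpha>) n \<omega> - fisher_info \<alpha> * K n \<omega>) / real n powr \<alpha>"
  show "integrable M (?X n)" if "n \<ge> 1" for n using that by simp
  obtain l where l: "info_wt \<alpha> \<longlonglongrightarrow> l" using info_wt_convergent[OF alpha] by (auto simp: convergent_def)
  obtain C where C: "C > 0" "\<And>n. n \<ge> 1 \<Longrightarrow> A n \<le> C * real n powr \<alpha>" by (rule A_upper) blast
  note lln = block_sum_law_of_large_numbers[OF l fisher_info_sums[OF alpha]]
  show "(\<lambda>n. expectation (\<lambda>\<omega>. \<bar>?X n \<omega>\<bar>)) \<longlonglongrightarrow> 0"
  proof (rule tendsto_0_dominated)
    show "(\<lambda>n. C * ((LINT \<omega>|M. \<bar>BS (info_wt \<alpha>) n \<omega> - fisher_info \<alpha> * K n \<omega>\<bar>) / A n)) \<longlonglongrightarrow> 0"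
      using tendsto_mult[OF tendsto_const lln, of C] by simp
    fix n :: nat assume n: "n \<ge> 1"
    let ?Y = "LINT \<omega>|M. \<bar>BS (info_wt \<alpha>) n \<omega> - fisher_info \<alpha> * K n \<omega>\<bar>"
    have Y: "?Y \<ge> 0" by (intro integral_nonneg_AE) auto
    have "expectation (\<lambda>\<omega>. \<bar>?X n \<omega>\<bar>) = ?Y / real n powr \<alpha>" by simp
    also have "\<dots> \<le> C * (?Y / A n)"
    proof -
      have "1 / real n powr \<alpha> \<le> C / A n" using C(2)[OF n] A_pos[of n] n by (simp add: field_simps)
      from mult_left_mono[OF this Y] show ?thesis by (simp add: mult_ac)
    qed
    finally show "0 \<le> expectation (\<lambda>\<omega>. \<bar>?X n \<omega>\<bar>) \<and> expectation (\<lambda>\<omega>. \<bar>?X n \<omega>\<bar>) \<le> C * (?Y / A n)"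
      by (intro conjI integral_nonneg_AE) auto
  qed
qed

text \<open>The accumulated information is, per block, asymptotically the Fisher
  information.\<close>
lemma info_vanishing: "vanishing (\<lambda>n \<omega>. BS (info_wt \<alpha>) n \<omega> / real n powr \<alpha> - asym_var \<omega>)"
proof -
  have "vanishing (\<lambda>n \<omega>. fisher_info \<alpha> * (K n \<omega> / real n powr \<alpha>) - asym_var \<omega>)"
  proof (rule vanishing_AE)
    show "(\<lambda>\<omega>. fisher_info \<alpha> * (K n \<omega> / real n powr \<alpha>) - asym_var \<omega>) \<in> borel_measurable M" if "n \<ge> 1" for n
      using that by measurable
    show "AE \<omega> in M. (\<lambda>n. fisher_info \<alpha> * (K n \<omega> / real n powr \<alpha>) - asym_var \<omega>) \<longlonglongrightarrow> 0"
      using alpha_diversity_limit alpha_diversity_nonneg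
    proof eventually_elim
      case (elim \<omega>)
      have "(\<lambda>n. fisher_info \<alpha> * (K n \<omega> / real n powr \<alpha>) - asym_var \<omega>) \<longlonglongrightarrow> fisher_info \<alpha> * alpha_diversity \<alpha> Part \<omega> - asym_var \<omega>"
        by (intro tendsto_intros elim)
      then show ?case using elim by (simp add: asym_var_def)
    qed
  qed
  from vanishing_add[OF info_minus_card_vanishing this] show ?thesis
    by (simp add: diff_divide_distrib)
qed

definition norming :: "real \<Rightarrow> nat \<Rightarrow> real" where
  "norming t n = t * real n powr (- \<alpha> / 2)"

definition info_cap :: "real \<Rightarrow> nat \<Rightarrow> real" where
  "info_cap c n = (c + 1) * real n powr \<alpha>"

context
  fixes t c :: real
  assumes c: "c \<ge> 0"
begin

abbreviation "mart_bound \<equiv> exp (t\<^sup>2 * (c + 1 + jump\<^sup>2) / 2)"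
abbreviation "mart n \<equiv> stopped_exp (norming t n) (info_cap c n) (n - 1)"

lemma info_cap_nonneg: "info_cap c n \<ge> 0" using c by (simp add: info_cap_def)

lemma norming_sq: "(norming t n)\<^sup>2 = t\<^sup>2 / real n powr \<alpha>"
proof -
  have "(real n powr (- \<alpha> / 2))\<^sup>2 = real n powr (-\<alpha>)"
    by (cases "n = 0") (simp_all add: power2_eq_square flip: powr_add)
  then show ?thesis unfolding norming_def power_mult_distrib by (simp add: powr_minus_divide)
qed

lemma norming_cap: "(norming t n)\<^sup>2 * (info_cap c n + jump\<^sup>2) \<le> t\<^sup>2 * (c + 1 + jump\<^sup>2)"
proof (cases "n = 0")
  case False
  then have n1: "real n powr \<alpha> \<ge> 1" using alpha by (intro ge_one_powr_ge_zero) auto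
  have "t\<^sup>2 / p * ((c + 1) * p + x) = t\<^sup>2 * ((c + 1) + x / p)" if "p > 0" for p x :: real
    using that by (simp add: distrib_left)
  from this[of "real n powr \<alpha>" "jump\<^sup>2"]
  have "(norming t n)\<^sup>2 * (info_cap c n + jump\<^sup>2) = t\<^sup>2 * ((c + 1) + jump\<^sup>2 / real n powr \<alpha>)"
    using n1 unfolding norming_sq info_cap_def by linarith
  also have "\<dots> \<le> t\<^sup>2 * ((c + 1) + jump\<^sup>2)"
    using n1 by (intro mult_left_mono add_left_mono) (auto simp: divide_le_eq mult_le_cancel_left1)
  finally show ?thesis by simp
qed (use c in \<open>simp add: norming_def\<close>)

lemma stopped_bound:
  assumes "\<omega> \<in> space M" shows "norm (stopped_exp (norming t n) (info_cap c n) j \<omega>) \<le> mart_bound"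
proof -
  have "exp ((norming t n)\<^sup>2 * (info_cap c n + jump\<^sup>2) / 2) \<le> mart_bound" using norming_cap by simp
  with stopped_exp_norm[OF assms info_cap_nonneg] show ?thesis by (rule order_trans)
qed

lemma mart_bound_ge: "mart_bound \<ge> 1"
  using c by simp

lemma mart_measurable: "n \<ge> 1 \<Longrightarrow> mart n \<in> borel_measurable M"
  using adapted_measurable[OF _ stopped_exp_adapted[of "n - 1"]] by simp

lemma stopped_integrable:
  assumes "S \<in> events" shows "complex_integrable M (\<lambda>\<omega>. indicat_real S \<omega> *\<^sub>R stopped_exp (norming t n) (info_cap c n) j \<omega>)"
proof (rule integrable_const_bound[of _ mart_bound])
  show "AE \<omega> in M. norm (indicat_real S \<omega> *\<^sub>R stopped_exp (norming t n) (info_cap c n) j \<omega>) \<le> mart_bound"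
    using stopped_bound mart_bound_ge by (intro AE_I2) (auto simp: indicator_def)
  show "(\<lambda>\<omega>. indicat_real S \<omega> *\<^sub>R stopped_exp (norming t n) (info_cap c n) j \<omega>) \<in> borel_measurable M"
    using assms adapted_measurable[OF _ stopped_exp_adapted[of j]] by measurable
qed

lemma norming_tendsto: "norming t \<longlonglongrightarrow> 0"
proof -
  have "(\<lambda>n. real n powr (- \<alpha> / 2)) \<longlonglongrightarrow> 0" using alpha by real_asymp
  from tendsto_mult[OF tendsto_const this, of t] show ?thesis by (simp add: norming_def[abs_def])
qed

text \<open>For an event of the past, the expectation of the stopped exponential changes by a
  vanishing amount between the time of that event and time \<open>n\<close>, and at the former time
  the exponential tends to one since the scale \<open>t n powr (- \<alpha> / 2)\<close> tends to
  zero.\<close>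
lemma mart_weak_past:
  assumes S: "S \<in> past_events"
  shows "(\<lambda>n. LINT \<omega>|M. indicat_real S \<omega> *\<^sub>R mart n \<omega>) \<longlonglongrightarrow> (LINT \<omega>|M. indicat_real S \<omega> *\<^sub>R (1 :: complex))"
proof -
  have Sm: "S \<in> events" using S past_events_sub by blast
  obtain m where m: "m \<ge> 1" "adapted m (\<lambda>\<omega>. \<omega> \<in> S)" using S by (auto simp: past_events_def)
  define i where "i = m - 1"
  have Si: "adapted (Suc i) (\<lambda>\<omega>. \<omega> \<in> S)" using m by (simp add: i_def)
  have start: "(\<lambda>n. LINT \<omega>|M. indicat_real S \<omega> *\<^sub>R stopped_exp (norming t n) (info_cap c n) i \<omega>) \<longlonglongrightarrow> (LINT \<omega>|M. indicat_real S \<omega> *\<^sub>R (1 :: complex))"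
  proof (rule integral_dominated_convergence[where w = "\<lambda>_. mart_bound"])
    show "(\<lambda>\<omega>. indicat_real S \<omega> *\<^sub>R (1 :: complex)) \<in> borel_measurable M" using Sm by measurable
    show "(\<lambda>\<omega>. indicat_real S \<omega> *\<^sub>R stopped_exp (norming t n) (info_cap c n) i \<omega>) \<in> borel_measurable M" for n
      by (rule borel_measurable_integrable[OF stopped_integrable[OF Sm]])
    show "AE \<omega> in M. norm (indicat_real S \<omega> *\<^sub>R stopped_exp (norming t n) (info_cap c n) i \<omega>) \<le> mart_bound" for n
      using stopped_bound mart_bound_ge by (intro AE_I2) (auto simp: indicator_def)
    show "AE \<omega> in M. (\<lambda>n. indicat_real S \<omega> *\<^sub>R stopped_exp (norming t n) (info_cap c n) i \<omega>) \<longlonglongrightarrow> indicat_real S \<omega> *\<^sub>R (1 :: complex)"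
    proof (rule AE_I2)
      fix \<omega> assume w: "\<omega> \<in> space M"
      let ?P = "Part (Suc i) \<omega>"
      have "filterlim (\<lambda>n. real n powr \<alpha>) at_top sequentially" using alpha by real_asymp
      then have "filterlim (info_cap c) at_top sequentially"
        unfolding info_cap_def[abs_def] using c by (intro filterlim_tendsto_pos_mult_at_top[OF tendsto_const]) auto
      then have "\<forall>\<^sub>F n in sequentially. BS (info_wt \<alpha>) (Suc i) \<omega> \<le> info_cap c n" by (auto simp: filterlim_at_top)
      then have ev: "\<forall>\<^sub>F n in sequentially. exp (exponent (norming t n) ?P) = stopped_exp (norming t n) (info_cap c n) i \<omega>"
        by eventually_elim (simp add: stopped_exp_eq[OF w])
      have "(\<lambda>n. exp (exponent (norming t n) ?P)) \<longlonglongrightarrow> exp (exponent 0 ?P)"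
        unfolding exponent_def by (intro tendsto_intros norming_tendsto) simp
      then have "(\<lambda>n. exp (exponent (norming t n) ?P)) \<longlonglongrightarrow> 1" by (simp add: exponent_def)
      from Lim_transform_eventually[OF this ev]
      show "(\<lambda>n. indicat_real S \<omega> *\<^sub>R stopped_exp (norming t n) (info_cap c n) i \<omega>) \<longlonglongrightarrow> indicat_real S \<omega> *\<^sub>R (1 :: complex)"
        by (intro tendsto_intros)
    qed
  qed simp
  obtain C where C: "C > 0" "\<And>n. n \<ge> 1 \<Longrightarrow> A n \<le> C * real n powr \<alpha>" by (rule A_upper) blast
  let ?d = "\<lambda>n. (LINT \<omega>|M. indicat_real S \<omega> *\<^sub>R mart n \<omega>) - (LINT \<omega>|M. indicat_real S \<omega> *\<^sub>R stopped_exp (norming t n) (info_cap c n) i \<omega>)"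
  define bd where "bd n = mart_bound * (\<bar>t\<bar> * drift_const * (real n powr (- \<alpha> / 2) * (1 + ln (real n)))
      + \<bar>t\<bar> ^ 3 * (cubic_const * card_const / \<alpha>) * C * ((real n powr (- \<alpha> / 2)) ^ 3 * real n powr \<alpha>))" for n
  have "bd \<longlonglongrightarrow> mart_bound * (\<bar>t\<bar> * drift_const * 0 + \<bar>t\<bar> ^ 3 * (cubic_const * card_const / \<alpha>) * C * 0)"
  proof -
    have 1: "(\<lambda>n. real n powr (- \<alpha> / 2) * (1 + ln (real n))) \<longlonglongrightarrow> 0" using alpha by real_asymp
    have 2: "(\<lambda>n. (real n powr (- \<alpha> / 2)) ^ 3 * real n powr \<alpha>) \<longlonglongrightarrow> 0" using alpha by real_asymp
    show ?thesis unfolding bd_def by (intro tendsto_intros 1 2)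
  qed
  then have bd0: "bd \<longlonglongrightarrow> 0" by simp
  have ev: "\<forall>\<^sub>F n in sequentially. \<bar>norming t n\<bar> * jump \<le> 1"
  proof -
    have "(\<lambda>n. \<bar>norming t n\<bar> * jump) \<longlonglongrightarrow> \<bar>0\<bar> * jump" by (intro tendsto_intros norming_tendsto)
    then have "\<forall>\<^sub>F n in sequentially. \<bar>norming t n\<bar> * jump < 1" by (rule order_tendstoD) simp
    then show ?thesis by eventually_elim simp
  qed
  have "?d \<longlonglongrightarrow> 0"
  proof (rule Lim_null_comparison[OF _ bd0])
    show "\<forall>\<^sub>F n in sequentially. norm (?d n) \<le> bd n"
      using ev eventually_ge_at_top[of "Suc i"]
    proof eventually_elim
      case (elim n)
      then have n: "n \<ge> 1" "i \<le> n - 1" by auto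
      have "norm (?d n) \<le> exp ((norming t n)\<^sup>2 * (info_cap c n + jump\<^sup>2) / 2) *
         (\<bar>norming t n\<bar> * drift_const * harm (n - 1) + \<bar>norming t n\<bar> ^ 3 * (cubic_const * card_const / \<alpha>) * A (Suc (n - 1)))"
        by (rule stopped_exp_total[OF Si elim(1) info_cap_nonneg n(2)])
      also have "\<dots> \<le> mart_bound * (\<bar>norming t n\<bar> * drift_const * (1 + ln (real n)) + \<bar>norming t n\<bar> ^ 3 * (cubic_const * card_const / \<alpha>) * (C * real n powr \<alpha>))"
      proof (intro mult_mono add_mono mult_left_mono)
        show "exp ((norming t n)\<^sup>2 * (info_cap c n + jump\<^sup>2) / 2) \<le> mart_bound" using norming_cap by simp
        have "harm (n - 1) \<le> (harm n :: real)" by (rule harm_mono) simp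
        also have "\<dots> \<le> 1 + ln (real n)"
          using decseqD[OF decseq_harm_diff_ln, of 0 "n - 1"] n by (simp add: harm_expand)
        finally show "harm (n - 1) \<le> 1 + ln (real n)" .
        show "A (Suc (n - 1)) \<le> C * real n powr \<alpha>" using C(2)[OF n(1)] n by simp
      qed (use consts_nonneg card_const_pos alpha mart_bound_ge A_pos harm_nonneg[where 'a = real] in \<open>auto intro!: add_nonneg_nonneg mult_nonneg_nonneg divide_nonneg_nonneg less_imp_le[OF A_pos]\<close>)
      also have "\<dots> = bd n"
        unfolding bd_def norming_def by (simp add: abs_mult power_mult_distrib mult_ac)
      finally show ?case .
    qed
  qed
  from tendsto_add[OF this start] show ?thesis by simp
qed

text \<open>Hence the stopped exponentials converge to one weakly, although not pointwise: their
  fluctuations are asymptotically independent of every event of the filtration.\<close>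
lemma mart_weak:
  assumes "integrable M g" "g \<in> borel_measurable G"
  shows "(\<lambda>n. LINT \<omega>|M. g \<omega> *\<^sub>R mart n \<omega>) \<longlonglongrightarrow> (LINT \<omega>|M. g \<omega> *\<^sub>R (1 :: complex))"
proof (rule weak_limit_extend[OF subalgebra_G mart_measurable _ _ _ _ assms])
  show "norm (mart n \<omega>) \<le> mart_bound" if "\<omega> \<in> space M" for n \<omega> by (rule stopped_bound[OF that])
  show "norm (1 :: complex) \<le> mart_bound" using mart_bound_ge by simp
  fix S assume "S \<in> sets G"
  then have S: "S \<in> sigma_sets (space M) past_events" by (simp add: sets_G)
  show "(\<lambda>n. LINT \<omega>|M. indicat_real S \<omega> *\<^sub>R mart n \<omega>) \<longlonglongrightarrow> (LINT \<omega>|M. indicat_real S \<omega> *\<^sub>R (1 :: complex))"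
  proof (rule weak_limit_generate[OF Int_stable_past past_events_sub space_past mart_measurable _ _ _ mart_weak_past S])
    show "norm (mart n \<omega>) \<le> mart_bound" if "\<omega> \<in> space M" for n \<omega> by (rule stopped_bound[OF that])
    show "norm (1 :: complex) \<le> mart_bound" using mart_bound_ge by simp
  qed auto
qed auto

text \<open>On an event where the limiting variance is at most \<open>c\<close>, stopping at
  information \<open>(c + 1) n powr \<alpha>\<close> is eventually without effect, in probability.
  There the characteristic function of the score is the exponential martingale times a factor
  converging to \<open>U\<close>, and the weak limit one of the martingale can be tested against the
  \<open>G\<close>-measurable \<open>U\<close>.\<close>
lemma score_clt_bounded:
  assumes S: "S \<in> sets G" and bounded: "\<And>\<omega>. \<omega> \<in> S \<Longrightarrow> asym_var \<omega> \<le> c"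
  shows "(\<lambda>n. LINT \<omega>|M. indicat_real S \<omega> *\<^sub>R iexp (norming t n * BS (score_wt \<alpha>) n \<omega>)) \<longlonglongrightarrow>
    (LINT \<omega>|M. indicat_real S \<omega> *\<^sub>R complex_of_real (exp (- (t\<^sup>2 * asym_var \<omega> / 2))))"
proof -
  have Sm [measurable]: "S \<in> events" using S subalgebra_G by (auto simp: subalgebra_def)
  define U where "U \<omega> = exp (- (t\<^sup>2 * asym_var \<omega> / 2))" for \<omega>
  have U: "0 < U \<omega>" "U \<omega> \<le> 1" for \<omega> using asym_var_nonneg[of \<omega>] by (auto simp: U_def)
  have UG: "U \<in> borel_measurable G" unfolding U_def[abs_def] using asym_var_G by measurable
  have [measurable]: "U \<in> borel_measurable M" by (rule measurable_from_subalg[OF subalgebra_G UG])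
  define g where "g \<omega> = indicat_real S \<omega> * U \<omega>" for \<omega>
  have gG: "g \<in> borel_measurable G" unfolding g_def[abs_def] using UG S by measurable
  have [measurable]: "g \<in> borel_measurable M" by (rule measurable_from_subalg[OF subalgebra_G gG])
  have gi: "integrable M g"
    by (rule integrable_const_bound[of _ 1]) (auto simp: g_def indicator_def less_imp_le U)
  define F where "F n \<omega> = iexp (norming t n * BS (score_wt \<alpha>) n \<omega>)" for n \<omega>
  have Fm: "F n \<in> borel_measurable M" if "n \<ge> 1" for n unfolding F_def using BS_measurable[OF that] by measurable
  define X where "X n \<omega> = BS (info_wt \<alpha>) n \<omega> / real n powr \<alpha> - asym_var \<omega>" for n \<omega>
  define R where "R = (1 + mart_bound) * (1 + t\<^sup>2)"
  have R0: "R \<ge> 0" using mart_bound_ge by (simp add: R_def)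
  have pt: "norm (F n \<omega> - U \<omega> *\<^sub>R mart n \<omega>) \<le> R * min 1 \<bar>X n \<omega>\<bar>"
    if w: "\<omega> \<in> S" "\<omega> \<in> space M" and n: "n \<ge> 1" for n \<omega>
  proof -
    let ?q = "BS (info_wt \<alpha>) n \<omega> / real n powr \<alpha>" and ?e = "asym_var \<omega>"
    have np: "real n powr \<alpha> > 0" using n by simp
    have q0: "?q \<ge> 0" unfolding block_sum_def using info_wt_pos[OF alpha] by (intro divide_nonneg_nonneg sum_nonneg) (auto simp: less_imp_le)
    have nT: "norm (mart n \<omega>) \<le> mart_bound" by (rule stopped_bound[OF w(2)])
    have nF: "norm (F n \<omega>) = 1" unfolding F_def by (simp add: norm_exp_i_times)
    show ?thesis
    proof (cases "BS (info_wt \<alpha>) n \<omega> \<le> info_cap c n")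
      case True
      have T: "mart n \<omega> = exp (exponent (norming t n) (Part n \<omega>))"
        using stopped_exp_eq[OF w(2), of "n - 1" "info_cap c n"] True n by simp
      have ph: "exponent (norming t n) (Part n \<omega>) = \<i> * complex_of_real (norming t n * BS (score_wt \<alpha>) n \<omega>) + complex_of_real (t\<^sup>2 * ?q / 2)"
        unfolding exponent_def norming_sq by simp
      have "mart n \<omega> * complex_of_real (exp (- (t\<^sup>2 * ?q / 2))) = F n \<omega>"
        unfolding T ph F_def exp_of_real[symmetric] exp_add[symmetric] by simp
      then have "F n \<omega> - U \<omega> *\<^sub>R mart n \<omega> = mart n \<omega> * complex_of_real (exp (- (t\<^sup>2 * ?q / 2)) - U \<omega>)"
        by (simp add: scaleR_conv_of_real algebra_simps)
      then have "norm (F n \<omega> - U \<omega> *\<^sub>R mart n \<omega>) = norm (mart n \<omega>) * \<bar>exp (- (t\<^sup>2 * ?q / 2)) - U \<omega>\<bar>"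
        by (simp only: norm_mult norm_of_real)
      also have "\<dots> \<le> mart_bound * ((1 + t\<^sup>2) * min 1 \<bar>X n \<omega>\<bar>)"
      proof (rule mult_mono[OF nT])
        have lip: "\<bar>exp (- x) - exp (- y)\<bar> \<le> min 1 \<bar>x - y\<bar>" if "x \<ge> 0" "y \<ge> 0" for x y :: real
        proof -
          have main: "exp (- x) - exp (- y) \<le> min 1 (y - x) \<and> exp (- x) - exp (- y) \<ge> 0" if "0 \<le> x" "x \<le> y" for x y :: real
          proof -
            have "exp (- y) = exp (- x) * exp (- (y - x))" by (simp add: exp_add[symmetric])
            moreover have "exp (- (y - x)) \<ge> 1 - (y - x)" using exp_ge_add_one_self[of "- (y - x)"] by linarith
            ultimately have "exp (- x) - exp (- y) \<le> exp (- x) * (y - x)"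
              using mult_left_mono[of "1 - (y - x)" "exp (- (y - x))" "exp (- x)"] by (simp add: algebra_simps)
            also have "\<dots> \<le> 1 * (y - x)" using that by (intro mult_right_mono) auto
            finally have "exp (- x) - exp (- y) \<le> y - x" by simp
            moreover have "exp (- x) - exp (- y) \<le> 1"
            proof -
              have "exp (- x) \<le> 1" "exp (- y) > 0" using that by auto
              then show ?thesis by linarith
            qed
            ultimately show ?thesis using that by simp
          qed
          show ?thesis using main[of x y] main[of y x] that by (cases "x \<le> y") auto
        qed
        have "\<bar>exp (- (t\<^sup>2 * ?q / 2)) - U \<omega>\<bar> \<le> min 1 \<bar>t\<^sup>2 * ?q / 2 - t\<^sup>2 * ?e / 2\<bar>"
          unfolding U_def
        proof (rule lip)
          show "0 \<le> t\<^sup>2 * ?q / 2" by (rule divide_nonneg_nonneg[OF mult_nonneg_nonneg[OF _ q0]]) auto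
        qed (use asym_var_nonneg in auto)
        also have "t\<^sup>2 * ?q / 2 - t\<^sup>2 * ?e / 2 = t\<^sup>2 / 2 * X n \<omega>" by (simp add: X_def algebra_simps)
        also have "min 1 \<bar>t\<^sup>2 / 2 * X n \<omega>\<bar> \<le> (1 + t\<^sup>2) * min 1 \<bar>X n \<omega>\<bar>"
        proof (cases "\<bar>X n \<omega>\<bar> \<le> 1")
          case True
          have "\<bar>t\<^sup>2 / 2 * X n \<omega>\<bar> = t\<^sup>2 / 2 * \<bar>X n \<omega>\<bar>" by (simp add: abs_mult)
          also have "\<dots> \<le> (1 + t\<^sup>2) * \<bar>X n \<omega>\<bar>" by (intro mult_right_mono) (auto simp: field_simps add_nonneg_nonneg)
          finally show ?thesis using True by (simp add: min_def)
        next
          case False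
          have "min 1 \<bar>t\<^sup>2 / 2 * X n \<omega>\<bar> \<le> 1" by simp
          also have "1 \<le> (1 + t\<^sup>2) * 1" by simp
          also have "(1 + t\<^sup>2) * 1 = (1 + t\<^sup>2) * min 1 \<bar>X n \<omega>\<bar>" using False by simp
          finally show ?thesis .
        qed
        finally show "\<bar>exp (- (t\<^sup>2 * ?q / 2)) - U \<omega>\<bar> \<le> (1 + t\<^sup>2) * min 1 \<bar>X n \<omega>\<bar>" .
      qed (use mart_bound_ge in auto)
      also have "\<dots> = mart_bound * (1 + t\<^sup>2) * min 1 \<bar>X n \<omega>\<bar>" by simp
      also have "\<dots> \<le> R * min 1 \<bar>X n \<omega>\<bar>" unfolding R_def by (intro mult_right_mono) auto
      finally show ?thesis .
    next
      case False
      then have "?q > c + 1" using np by (simp add: info_cap_def field_simps)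
      then have "\<bar>X n \<omega>\<bar> \<ge> 1" using bounded[OF w(1)] by (simp add: X_def)
      then have m: "min 1 \<bar>X n \<omega>\<bar> = 1" by simp
      have "norm (F n \<omega> - U \<omega> *\<^sub>R mart n \<omega>) \<le> norm (F n \<omega>) + norm (U \<omega> *\<^sub>R mart n \<omega>)" by (rule norm_triangle_ineq4)
      also have "norm (U \<omega> *\<^sub>R mart n \<omega>) \<le> 1 * mart_bound"
        unfolding norm_scaleR using U[of \<omega>] nT by (intro mult_mono) auto
      finally have "norm (F n \<omega> - U \<omega> *\<^sub>R mart n \<omega>) \<le> (1 + mart_bound) * 1" using nF by simp
      also have "\<dots> \<le> R" unfolding R_def using mart_bound_ge by (intro mult_left_mono) auto
      finally show ?thesis unfolding m by simp
    qed
  qed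
  have Fint: "integrable M (\<lambda>\<omega>. indicat_real S \<omega> *\<^sub>R F n \<omega>)" if "n \<ge> 1" for n
  proof (rule integrable_const_bound[of _ 1])
    show "AE \<omega> in M. norm (indicat_real S \<omega> *\<^sub>R F n \<omega>) \<le> 1"
      by (rule AE_I2) (simp add: indicator_def F_def norm_exp_i_times)
    show "(\<lambda>\<omega>. indicat_real S \<omega> *\<^sub>R F n \<omega>) \<in> borel_measurable M" using Fm[OF that] by measurable
  qed
  have Tint: "integrable M (\<lambda>\<omega>. g \<omega> *\<^sub>R mart n \<omega>)" if "n \<ge> 1" for n
  proof (rule integrable_const_bound[of _ mart_bound])
    show "AE \<omega> in M. norm (g \<omega> *\<^sub>R mart n \<omega>) \<le> mart_bound"
    proof (rule AE_I2)
      fix \<omega> assume "\<omega> \<in> space M"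
      then have "norm (mart n \<omega>) \<le> mart_bound" by (rule stopped_bound)
      then have "\<bar>g \<omega>\<bar> * norm (mart n \<omega>) \<le> 1 * mart_bound" using U[of \<omega>] by (intro mult_mono) (auto simp: g_def indicator_def)
      then show "norm (g \<omega> *\<^sub>R mart n \<omega>) \<le> mart_bound" by simp
    qed
  qed (use mart_measurable[OF that] in measurable)
  have diff: "(\<lambda>n. (LINT \<omega>|M. indicat_real S \<omega> *\<^sub>R F n \<omega>) - (LINT \<omega>|M. g \<omega> *\<^sub>R mart n \<omega>)) \<longlonglongrightarrow> 0"
  proof (rule Lim_null_comparison)
    show "(\<lambda>n. R * expectation (\<lambda>\<omega>. min 1 \<bar>X n \<omega>\<bar>)) \<longlonglongrightarrow> 0"
      using info_vanishing tendsto_mult[OF tendsto_const, of "\<lambda>n. expectation (\<lambda>\<omega>. min 1 \<bar>X n \<omega>\<bar>)" 0 sequentially R]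
      by (simp add: vanishing_def X_def[abs_def])
    show "\<forall>\<^sub>F n in sequentially. norm ((LINT \<omega>|M. indicat_real S \<omega> *\<^sub>R F n \<omega>) - (LINT \<omega>|M. g \<omega> *\<^sub>R mart n \<omega>)) \<le> R * expectation (\<lambda>\<omega>. min 1 \<bar>X n \<omega>\<bar>)"
      using eventually_ge_at_top[of 1]
    proof eventually_elim
      case (elim n)
      have Xm: "X n \<in> borel_measurable M" unfolding X_def using elim by measurable
      have "(LINT \<omega>|M. indicat_real S \<omega> *\<^sub>R F n \<omega>) - (LINT \<omega>|M. g \<omega> *\<^sub>R mart n \<omega>) = (LINT \<omega>|M. indicat_real S \<omega> *\<^sub>R F n \<omega> - g \<omega> *\<^sub>R mart n \<omega>)"
        by (rule Bochner_Integration.integral_diff[OF Fint[OF elim] Tint[OF elim], symmetric])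
      also have "norm \<dots> \<le> (LINT \<omega>|M. norm (indicat_real S \<omega> *\<^sub>R F n \<omega> - g \<omega> *\<^sub>R mart n \<omega>))" by (rule integral_norm_bound)
      also have "\<dots> \<le> (LINT \<omega>|M. R * min 1 \<bar>X n \<omega>\<bar>)"
      proof (rule integral_mono)
        show "integrable M (\<lambda>\<omega>. norm (indicat_real S \<omega> *\<^sub>R F n \<omega> - g \<omega> *\<^sub>R mart n \<omega>))"
          by (intro integrable_norm Bochner_Integration.integrable_diff Fint Tint elim)
        show "integrable M (\<lambda>\<omega>. R * min 1 \<bar>X n \<omega>\<bar>)" using integrable_min_abs[OF Xm] by simp
        show "norm (indicat_real S \<omega> *\<^sub>R F n \<omega> - g \<omega> *\<^sub>R mart n \<omega>) \<le> R * min 1 \<bar>X n \<omega>\<bar>" if "\<omega> \<in> space M" for \<omega>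
          using pt[OF _ that elim] R0 by (cases "\<omega> \<in> S") (auto simp: g_def)
      qed
      finally show ?case by simp
    qed
  qed
  from tendsto_add[OF this mart_weak[OF gi gG]]
  have "(\<lambda>n. LINT \<omega>|M. indicat_real S \<omega> *\<^sub>R F n \<omega>) \<longlonglongrightarrow> (LINT \<omega>|M. g \<omega> *\<^sub>R (1 :: complex))" by simp
  also have "(LINT \<omega>|M. g \<omega> *\<^sub>R (1 :: complex)) = (LINT \<omega>|M. indicat_real S \<omega> *\<^sub>R complex_of_real (U \<omega>))"
    by (rule Bochner_Integration.integral_cong) (auto simp: g_def scaleR_conv_of_real)
  finally show ?thesis by (simp add: F_def U_def)
qed

end

text \<open>The restriction to bounded limiting variance is removed by cutting off an event of small
  probability.\<close>
theorem score_clt: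
  assumes S: "S \<in> sets G"
  shows "(\<lambda>n. LINT \<omega>|M. indicat_real S \<omega> *\<^sub>R iexp (t * real n powr (- \<alpha> / 2) * BS (score_wt \<alpha>) n \<omega>)) \<longlonglongrightarrow>
    (LINT \<omega>|M. indicat_real S \<omega> *\<^sub>R complex_of_real (exp (- (t\<^sup>2 * asym_var \<omega> / 2))))"
proof (rule LIMSEQ_approx)
  fix \<epsilon> :: real assume e: "\<epsilon> > 0"
  have Sm [measurable]: "S \<in> events" using S subalgebra_G by (auto simp: subalgebra_def)
  have "(\<lambda>m. prob {\<omega>\<in>space M. asym_var \<omega> > real m}) \<longlonglongrightarrow> prob (\<Inter>m. {\<omega>\<in>space M. asym_var \<omega> > real m})"
    by (rule finite_Lim_measure_decseq) (auto simp: decseq_def)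
  also have "(\<Inter>m. {\<omega>\<in>space M. asym_var \<omega> > real m}) = {}"
  proof -
    have False if "\<forall>m. real m < asym_var \<omega>" for \<omega>
      using that reals_Archimedean2[of "asym_var \<omega>"] by (meson less_asym)
    then show ?thesis by auto
  qed
  finally obtain m where m: "prob {\<omega>\<in>space M. asym_var \<omega> > real m} < \<epsilon>"
    using LIMSEQ_D[of "\<lambda>m. prob {\<omega>\<in>space M. asym_var \<omega> > real m}" 0 \<epsilon>] e by fastforce
  define S' where "S' = S \<inter> {\<omega>\<in>space G. asym_var \<omega> \<le> real m}"
  have S'G: "S' \<in> sets G" unfolding S'_def using S asym_var_G
    unfolding borel_measurable_iff_le by (intro sets.Int) blast+
  then have S'm [measurable]: "S' \<in> events" using subalgebra_G by (auto simp: subalgebra_def)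
  define F where "F n \<omega> = iexp (t * real n powr (- \<alpha> / 2) * BS (score_wt \<alpha>) n \<omega>)" for n \<omega>
  define U where "U \<omega> = complex_of_real (exp (- (t\<^sup>2 * asym_var \<omega> / 2)))" for \<omega>
  have Fm: "F n \<in> borel_measurable M" if "n \<ge> 1" for n unfolding F_def using BS_measurable[OF that] by measurable
  have Um: "U \<in> borel_measurable M" unfolding U_def by measurable
  have nF: "norm (F n \<omega>) \<le> 1" for n \<omega> unfolding F_def by (simp add: norm_exp_i_times)
  have nU: "norm (U \<omega>) \<le> 1" for \<omega> unfolding U_def using asym_var_nonneg[of \<omega>] by simp
  have close: "norm ((LINT \<omega>|M. indicat_real S \<omega> *\<^sub>R y \<omega>) - (LINT \<omega>|M. indicat_real S' \<omega> *\<^sub>R y \<omega>)) \<le> \<epsilon>"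
    if y: "y \<in> borel_measurable M" "\<And>\<omega>. norm (y \<omega>) \<le> 1" for y :: "'a \<Rightarrow> complex"
  proof -
    have int: "integrable M (\<lambda>\<omega>. indicat_real S \<omega> *\<^sub>R y \<omega>)" "integrable M (\<lambda>\<omega>. indicat_real S' \<omega> *\<^sub>R y \<omega>)"
      using y by (auto intro!: integrable_const_bound[of _ 1] simp: indicator_def)
    have "(LINT \<omega>|M. indicat_real S \<omega> *\<^sub>R y \<omega>) - (LINT \<omega>|M. indicat_real S' \<omega> *\<^sub>R y \<omega>) = (LINT \<omega>|M. indicat_real S \<omega> *\<^sub>R y \<omega> - indicat_real S' \<omega> *\<^sub>R y \<omega>)"
      by (rule Bochner_Integration.integral_diff[OF int, symmetric])
    also have "norm \<dots> \<le> (LINT \<omega>|M. norm (indicat_real S \<omega> *\<^sub>R y \<omega> - indicat_real S' \<omega> *\<^sub>R y \<omega>))" by (rule integral_norm_bound)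
    also have "\<dots> \<le> (LINT \<omega>|M. indicat_real {\<omega>\<in>space M. asym_var \<omega> > real m} \<omega>)"
    proof (rule integral_mono)
      show "integrable M (\<lambda>\<omega>. norm (indicat_real S \<omega> *\<^sub>R y \<omega> - indicat_real S' \<omega> *\<^sub>R y \<omega>))"
        by (intro integrable_norm Bochner_Integration.integrable_diff int)
      show "norm (indicat_real S \<omega> *\<^sub>R y \<omega> - indicat_real S' \<omega> *\<^sub>R y \<omega>) \<le> indicat_real {\<omega>\<in>space M. asym_var \<omega> > real m} \<omega>" if "\<omega> \<in> space M" for \<omega>
        using y(2)[of \<omega>] that by (auto simp: indicator_def S'_def space_G)
    qed (simp add: emeasure_eq_measure)
    also have "\<dots> \<le> \<epsilon>" using m by simp
    finally show ?thesis .
  qed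
  have m0: "real m \<ge> 0" by simp
  have "(\<lambda>n. LINT \<omega>|M. indicat_real S' \<omega> *\<^sub>R F n \<omega>) \<longlonglongrightarrow> (LINT \<omega>|M. indicat_real S' \<omega> *\<^sub>R U \<omega>)"
    using score_clt_bounded[OF m0 S'G, of t] unfolding F_def U_def norming_def by (simp add: S'_def)
  then show "\<exists>b l. b \<longlonglongrightarrow> l \<and>
      (\<forall>n\<ge>1. norm ((LINT \<omega>|M. indicat_real S \<omega> *\<^sub>R iexp (t * real n powr (- \<alpha> / 2) * BS (score_wt \<alpha>) n \<omega>)) - b n) \<le> \<epsilon>) \<and>
      norm ((LINT \<omega>|M. indicat_real S \<omega> *\<^sub>R complex_of_real (exp (- (t\<^sup>2 * asym_var \<omega> / 2)))) - l) \<le> \<epsilon>"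
    using close[OF Fm nF] close[OF Um nU] unfolding F_def U_def by blast
qed

end

section \<open>Tools for stable convergence\<close>

lemma iexp_Lipschitz: "norm (iexp a - iexp b) \<le> (2 + \<bar>t\<bar>) * min 1 \<bar>x\<bar>" if "a - b = t * x"
proof -
  have "iexp a - iexp b = iexp b * (iexp (a - b) - 1)" by (simp add: right_diff_distrib exp_add[symmetric] algebra_simps)
  then have e: "norm (iexp a - iexp b) = norm (iexp (a - b) - 1)" by (simp add: norm_mult norm_exp_i_times)
  have 1: "norm (iexp a - iexp b) \<le> \<bar>t\<bar> * \<bar>x\<bar>" unfolding e using iexp_approx1[of "a - b" 0] that by (simp add: abs_mult)
  have 2: "norm (iexp a - iexp b) \<le> 2" using norm_triangle_ineq4[of "iexp a" "iexp b"] by (simp add: norm_exp_i_times)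
  show ?thesis
  proof (cases "\<bar>x\<bar> \<le> 1")
    case True
    have "\<bar>t\<bar> * \<bar>x\<bar> \<le> (2 + \<bar>t\<bar>) * \<bar>x\<bar>" by (intro mult_right_mono) auto
    then show ?thesis using 1 True by (simp add: min_def)
  next
    case False
    then show ?thesis using 2 by (simp add: min_def)
  qed
qed

text \<open>Slutsky's lemma for characteristic functions on an event.\<close>
lemma (in prob_space) iexp_vanishing:
  assumes S: "S \<in> events" and X: "\<And>n. n \<ge> 1 \<Longrightarrow> X n \<in> borel_measurable M" "\<And>n. n \<ge> 1 \<Longrightarrow> Y n \<in> borel_measurable M"
    and v: "vanishing (\<lambda>n \<omega>. X n \<omega> - Y n \<omega>)"
    and lim: "(\<lambda>n. LINT \<omega>|M. indicat_real S \<omega> *\<^sub>R iexp (t * Y n \<omega>)) \<longlonglongrightarrow> l"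
  shows "(\<lambda>n. LINT \<omega>|M. indicat_real S \<omega> *\<^sub>R iexp (t * X n \<omega>)) \<longlonglongrightarrow> l"
proof -
  have int: "integrable M (\<lambda>\<omega>. indicat_real S \<omega> *\<^sub>R iexp (t * Z \<omega>))" if "Z \<in> borel_measurable M" for Z
    using that S by (intro integrable_const_bound[of _ 1]) (auto simp: indicator_def norm_exp_i_times)
  have "(\<lambda>n. (LINT \<omega>|M. indicat_real S \<omega> *\<^sub>R iexp (t * X n \<omega>)) - (LINT \<omega>|M. indicat_real S \<omega> *\<^sub>R iexp (t * Y n \<omega>))) \<longlonglongrightarrow> 0"
  proof (rule Lim_null_comparison)
    show "(\<lambda>n. (2 + \<bar>t\<bar>) * expectation (\<lambda>\<omega>. min 1 \<bar>X n \<omega> - Y n \<omega>\<bar>)) \<longlonglongrightarrow> 0"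
      using v tendsto_mult[OF tendsto_const, of "\<lambda>n. expectation (\<lambda>\<omega>. min 1 \<bar>X n \<omega> - Y n \<omega>\<bar>)" 0 sequentially "2 + \<bar>t\<bar>"]
      by (simp add: vanishing_def)
    show "\<forall>\<^sub>F n in sequentially. norm ((LINT \<omega>|M. indicat_real S \<omega> *\<^sub>R iexp (t * X n \<omega>)) - (LINT \<omega>|M. indicat_real S \<omega> *\<^sub>R iexp (t * Y n \<omega>)))
      \<le> (2 + \<bar>t\<bar>) * expectation (\<lambda>\<omega>. min 1 \<bar>X n \<omega> - Y n \<omega>\<bar>)"
      using eventually_ge_at_top[of 1]
    proof eventually_elim
      case (elim n)
      note i = int[OF X(1)[OF elim]] int[OF X(2)[OF elim]]
      have "(LINT \<omega>|M. indicat_real S \<omega> *\<^sub>R iexp (t * X n \<omega>)) - (LINT \<omega>|M. indicat_real S \<omega> *\<^sub>R iexp (t * Y n \<omega>))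
        = (LINT \<omega>|M. indicat_real S \<omega> *\<^sub>R iexp (t * X n \<omega>) - indicat_real S \<omega> *\<^sub>R iexp (t * Y n \<omega>))"
        by (rule Bochner_Integration.integral_diff[OF i, symmetric])
      also have "norm \<dots> \<le> (LINT \<omega>|M. norm (indicat_real S \<omega> *\<^sub>R iexp (t * X n \<omega>) - indicat_real S \<omega> *\<^sub>R iexp (t * Y n \<omega>)))"
        by (rule integral_norm_bound)
      also have "\<dots> \<le> (LINT \<omega>|M. (2 + \<bar>t\<bar>) * min 1 \<bar>X n \<omega> - Y n \<omega>\<bar>)"
      proof (rule integral_mono)
        show "integrable M (\<lambda>\<omega>. norm (indicat_real S \<omega> *\<^sub>R iexp (t * X n \<omega>) - indicat_real S \<omega> *\<^sub>R iexp (t * Y n \<omega>)))"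
          by (intro integrable_norm Bochner_Integration.integrable_diff i)
        show "integrable M (\<lambda>\<omega>. (2 + \<bar>t\<bar>) * min 1 \<bar>X n \<omega> - Y n \<omega>\<bar>)"
          by (intro integrable_mult_right integrable_min_abs borel_measurable_diff X elim)
        fix \<omega>
        have "norm (indicat_real S \<omega> *\<^sub>R iexp (t * X n \<omega>) - indicat_real S \<omega> *\<^sub>R iexp (t * Y n \<omega>))
          = indicat_real S \<omega> * norm (iexp (t * X n \<omega>) - iexp (t * Y n \<omega>))"
          by (simp add: scaleR_diff_right[symmetric] del: scaleR_diff_right)
        also have "\<dots> \<le> 1 * norm (iexp (t * X n \<omega>) - iexp (t * Y n \<omega>))"
          by (intro mult_right_mono) (auto simp: indicator_def)
        also have "\<dots> \<le> (2 + \<bar>t\<bar>) * min 1 \<bar>X n \<omega> - Y n \<omega>\<bar>"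
          using iexp_Lipschitz[of "t * X n \<omega>" "t * Y n \<omega>" t "X n \<omega> - Y n \<omega>"] by (simp add: right_diff_distrib)
        finally show "norm (indicat_real S \<omega> *\<^sub>R iexp (t * X n \<omega>) - indicat_real S \<omega> *\<^sub>R iexp (t * Y n \<omega>))
          \<le> (2 + \<bar>t\<bar>) * min 1 \<bar>X n \<omega> - Y n \<omega>\<bar>" .
      qed
      finally show ?case by simp
    qed
  qed
  from tendsto_add[OF this lim] show ?thesis by simp
qed

text \<open>Fubini's theorem on the joint law of the \<open>H\<close>-measurable pair and the
  independent variable. The normal variable is paired with a constant so that both independent
  variables have the same type.\<close>
lemma (in prob_space) mixed_normal_char:
  assumes H: "subalgebra M H" and indep: "indep_set (sets H) (sets (vimage_algebra (space M) N borel))"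
    and N: "distributed M lborel N std_normal_density"
    and A: "A \<in> sets H" and s: "s \<in> borel_measurable H"
  shows "(LINT \<omega>|M. indicat_real A \<omega> *\<^sub>R iexp (t * (s \<omega> * N \<omega>))) = (LINT \<omega>|M. indicat_real A \<omega> *\<^sub>R complex_of_real (exp (- (t\<^sup>2 * (s \<omega>)\<^sup>2 / 2))))"
proof -
  have Nm [measurable]: "N \<in> borel_measurable M" using distributed_measurable[OF N] by simp
  define X where "X \<omega> = (indicat_real A \<omega>, s \<omega>)" for \<omega>
  let ?B = "borel \<Otimes>\<^sub>M borel :: (real \<times> real) measure"
  have XH: "X \<in> measurable H ?B" unfolding X_def[abs_def] using A s by measurable
  have Xm [measurable]: "X \<in> measurable M ?B" by (rule measurable_from_subalg[OF H XH])
  have spH: "space H = space M" using H by (simp add: subalgebra_def)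
  define N2 where "N2 \<omega> = (N \<omega>, 0 :: real)" for \<omega>
  have N2m [measurable]: "N2 \<in> measurable M ?B" unfolding N2_def[abs_def] by measurable
  have "indep_var ?B X ?B N2"
    unfolding indep_var_eq
  proof (intro conjI Xm N2m)
    have 1: "sigma_sets (space M) {X -` E \<inter> space M | E. E \<in> sets ?B} \<subseteq> sets H"
      unfolding spH[symmetric] using XH by (intro sets.sigma_sets_subset) (auto intro: measurable_sets)
    have "N2 \<in> measurable (vimage_algebra (space M) N borel) ?B"
      unfolding N2_def[abs_def] using measurable_vimage_algebra1[of N "space M" borel] by measurable
    then have 2: "sigma_sets (space M) {N2 -` E \<inter> space M | E. E \<in> sets ?B} \<subseteq> sets (vimage_algebra (space M) N borel)"
      using sets.sigma_sets_subset[of _ "vimage_algebra (space M) N borel"]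
      by (auto intro!: sets.sigma_sets_subset[of _ "vimage_algebra (space M) N borel", simplified] dest: measurable_sets)
    show "indep_set (sigma_sets (space M) {X -` E \<inter> space M | E. E \<in> sets ?B}) (sigma_sets (space M) {N2 -` E \<inter> space M | E. E \<in> sets ?B})"
      using indep 1 2 unfolding indep_sets2_eq by blast
  qed
  then have joint: "distr M ?B X \<Otimes>\<^sub>M distr M ?B N2 = distr M (?B \<Otimes>\<^sub>M ?B) (\<lambda>\<omega>. (X \<omega>, N2 \<omega>))"
    unfolding indep_var_distribution_eq by simp
  have dN: "distr M borel N = std_normal_distribution"
    using distributed_distr_eq_density[OF N] by (metis distr_cong sets_lborel)
  interpret PX: prob_space "distr M ?B X" by (rule prob_space_distr[OF Xm])
  interpret PN: prob_space "distr M ?B N2" by (rule prob_space_distr[OF N2m])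
  interpret P: pair_prob_space "distr M ?B X" "distr M ?B N2" ..
  define f :: "(real \<times> real) \<times> (real \<times> real) \<Rightarrow> complex"
    where "f p = (max 0 (min 1 (fst (fst p)))) *\<^sub>R iexp (t * (snd (fst p) * fst (snd p)))" for p
  have fm: "f \<in> borel_measurable (?B \<Otimes>\<^sub>M ?B)" unfolding f_def[abs_def] by measurable
  have fi: "integrable (distr M ?B X \<Otimes>\<^sub>M distr M ?B N2) f"
  proof (rule P.integrable_const_bound[of _ 1])
    show "f \<in> borel_measurable (distr M ?B X \<Otimes>\<^sub>M distr M ?B N2)" unfolding joint using fm by simp
    show "AE p in distr M ?B X \<Otimes>\<^sub>M distr M ?B N2. norm (f p) \<le> 1"
      by (rule AE_I2) (auto simp: f_def norm_exp_i_times)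
  qed
  have "(LINT \<omega>|M. indicat_real A \<omega> *\<^sub>R iexp (t * (s \<omega> * N \<omega>))) = (LINT \<omega>|M. f (X \<omega>, N2 \<omega>))"
    by (rule Bochner_Integration.integral_cong) (auto simp: f_def X_def N2_def indicator_def)
  also have "\<dots> = integral\<^sup>L (distr M (?B \<Otimes>\<^sub>M ?B) (\<lambda>\<omega>. (X \<omega>, N2 \<omega>))) f"
    by (rule integral_distr[symmetric]) (measurable, rule fm)
  also have "\<dots> = (\<integral>x. (\<integral>y. f (x, y) \<partial>distr M ?B N2) \<partial>distr M ?B X)"
    unfolding joint[symmetric] by (rule P.integral_fst'[OF fi, symmetric])
  also have "\<dots> = (\<integral>x. (max 0 (min 1 (fst x))) *\<^sub>R complex_of_real (exp (- (t * snd x)\<^sup>2 / 2)) \<partial>distr M ?B X)"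
  proof (rule Bochner_Integration.integral_cong[OF refl])
    fix x :: "real \<times> real"
    have "(\<integral>y. f (x, y) \<partial>distr M ?B N2) = (LINT \<omega>|M. f (x, N2 \<omega>))"
    proof (rule integral_distr[OF N2m])
      show "(\<lambda>y. f (x, y)) \<in> borel_measurable ?B" unfolding f_def fst_conv snd_conv by measurable
    qed
    also have "\<dots> = (max 0 (min 1 (fst x))) *\<^sub>R (LINT \<omega>|M. iexp (t * snd x * N \<omega>))"
      unfolding f_def N2_def by (simp add: mult.assoc)
    also have "(LINT \<omega>|M. iexp (t * snd x * N \<omega>)) = (\<integral>y. iexp (t * snd x * y) \<partial>distr M borel N)"
      by (rule integral_distr[OF Nm, symmetric]) measurable
    also have "(\<integral>y. iexp (t * snd x * y) \<partial>distr M borel N) = char std_normal_distribution (t * snd x)"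
      unfolding dN char_def by simp
    finally show "(\<integral>y. f (x, y) \<partial>distr M ?B N2) = (max 0 (min 1 (fst x))) *\<^sub>R complex_of_real (exp (- (t * snd x)\<^sup>2 / 2))"
      unfolding char_std_normal_distribution .
  qed
  also have "\<dots> = (LINT \<omega>|M. (max 0 (min 1 (fst (X \<omega>)))) *\<^sub>R complex_of_real (exp (- (t * snd (X \<omega>))\<^sup>2 / 2)))"
    by (rule integral_distr) measurable
  also have "\<dots> = (LINT \<omega>|M. indicat_real A \<omega> *\<^sub>R complex_of_real (exp (- (t\<^sup>2 * (s \<omega>)\<^sup>2 / 2))))"
    by (rule Bochner_Integration.integral_cong) (auto simp: X_def indicator_def power_mult_distrib)
  finally show ?thesis .
qed

text \<open>Levy's continuity theorem under the conditional probability given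
  \<open>A\<close>.\<close>
lemma (in prob_space) Levy_on_event:
  fixes W :: "nat \<Rightarrow> 'a \<Rightarrow> real" and h :: "real \<Rightarrow> real"
  assumes A: "A \<in> events" and W: "\<And>n. W n \<in> borel_measurable M" "Y \<in> borel_measurable M"
    and char: "\<And>t. (\<lambda>n. LINT \<omega>|M. indicat_real A \<omega> *\<^sub>R iexp (t * W n \<omega>)) \<longlonglongrightarrow> (LINT \<omega>|M. indicat_real A \<omega> *\<^sub>R iexp (t * Y \<omega>))"
    and h: "\<And>x. isCont h x" "\<And>x. \<bar>h x\<bar> \<le> B"
  shows "(\<lambda>n. LINT \<omega>|M. indicat_real A \<omega> *\<^sub>R h (W n \<omega>)) \<longlonglongrightarrow> (LINT \<omega>|M. indicat_real A \<omega> *\<^sub>R h (Y \<omega>))"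
proof (cases "prob A = 0")
  case True
  then have "A \<in> null_sets M" using A by (simp add: null_sets_def emeasure_eq_measure)
  then have "AE \<omega> in M. \<omega> \<notin> A" by (rule AE_not_in)
  then have "(LINT \<omega>|M. indicat_real A \<omega> *\<^sub>R y \<omega>) = 0" for y :: "'a \<Rightarrow> real"
    by (intro integral_eq_zero_AE) auto
  then show ?thesis by simp
next
  case False
  then have pA: "prob A > 0" using measure_nonneg[of M A] by linarith
  define d where "d \<omega> = indicat_real A \<omega> / prob A" for \<omega>
  have dm [measurable]: "d \<in> borel_measurable M" unfolding d_def[abs_def] using A by measurable
  have d0: "d \<omega> \<ge> 0" for \<omega> using pA by (simp add: d_def)
  define Q where "Q = density M d"
  have dens: "(LINT \<omega>|Q. y \<omega>) = (LINT \<omega>|M. indicat_real A \<omega> *\<^sub>R y \<omega>) /\<^sub>R prob A"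
    if "y \<in> borel_measurable M" for y :: "'a \<Rightarrow> 'b::{banach, second_countable_topology}"
  proof -
    have "(LINT \<omega>|Q. y \<omega>) = (LINT \<omega>|M. d \<omega> *\<^sub>R y \<omega>)"
      unfolding Q_def by (rule integral_density[OF that dm]) (simp add: d0)
    also have "\<dots> = (LINT \<omega>|M. (1 / prob A) *\<^sub>R (indicat_real A \<omega> *\<^sub>R y \<omega>))"
      by (rule Bochner_Integration.integral_cong) (auto simp: d_def)
    finally show ?thesis by (simp only: integral_scaleR_right inverse_eq_divide)
  qed
  interpret Q: prob_space Q
  proof
    have "emeasure Q (space Q) = (\<integral>\<^sup>+ \<omega>. ennreal (d \<omega>) \<partial>M)"
      unfolding Q_def by (simp add: emeasure_density cong: nn_integral_cong)
    also have "\<dots> = ennreal (LINT \<omega>|M. d \<omega>)"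
      using A by (intro nn_integral_eq_integral) (auto simp: d0, auto simp: d_def[abs_def] emeasure_eq_measure)
    also have "(LINT \<omega>|M. d \<omega>) = 1" using A pA by (simp add: d_def)
    finally show "emeasure Q (space Q) = 1" by simp
  qed
  have mQ: "measurable Q borel = (measurable M borel :: ('a \<Rightarrow> 'b::topological_space) set)" by (rule measurable_cong_sets) (simp_all add: Q_def)
  have WQ: "W n \<in> borel_measurable Q" "Y \<in> borel_measurable Q" for n using W by (simp_all add: mQ)
  have ch: "char (distr Q borel Z) t = (LINT \<omega>|M. indicat_real A \<omega> *\<^sub>R iexp (t * Z \<omega>)) /\<^sub>R prob A"
    if Z: "Z \<in> borel_measurable M" for Z t
  proof -
    have "char (distr Q borel Z) t = (LINT \<omega>|Q. iexp (t * Z \<omega>))"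
      unfolding char_def using Z by (subst integral_distr) (auto simp: mQ)
    also have "\<dots> = (LINT \<omega>|M. indicat_real A \<omega> *\<^sub>R iexp (t * Z \<omega>)) /\<^sub>R prob A"
      by (rule dens) (use Z in measurable)
    finally show ?thesis .
  qed
  have rd: "\<And>n. real_distribution (distr Q borel (W n))" "real_distribution (distr Q borel Y)"
    using WQ by auto
  have wc: "weak_conv_m (\<lambda>n. distr Q borel (W n)) (distr Q borel Y)"
  proof (rule levy_continuity[OF rd])
    show "(\<lambda>n. char (distr Q borel (W n)) t) \<longlonglongrightarrow> char (distr Q borel Y) t" for t
      unfolding ch[OF W(1)] ch[OF W(2)] by (intro tendsto_intros char)
  qed
  have "(\<lambda>n. integral\<^sup>L (distr Q borel (W n)) h) \<longlonglongrightarrow> integral\<^sup>L (distr Q borel Y) h"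
    by (rule weak_conv_imp_integral_bdd_continuous_conv[OF rd wc h(1)]) (use h(2) in simp)
  moreover have hm [measurable]: "h \<in> borel_measurable borel"
    using h(1) by (intro borel_measurable_continuous_onI continuous_at_imp_continuous_on) auto
  have "integral\<^sup>L (distr Q borel Z) h = (LINT \<omega>|M. indicat_real A \<omega> *\<^sub>R h (Z \<omega>)) /\<^sub>R prob A"
    if Z: "Z \<in> borel_measurable M" for Z
  proof -
    have "integral\<^sup>L (distr Q borel Z) h = (LINT \<omega>|Q. h (Z \<omega>))"
      using Z by (intro integral_distr) (auto simp: mQ)
    also have "\<dots> = (LINT \<omega>|M. indicat_real A \<omega> *\<^sub>R h (Z \<omega>)) /\<^sub>R prob A"
      by (rule dens) (use Z in measurable)
    finally show ?thesis .
  qed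
  ultimately have "(\<lambda>n. (LINT \<omega>|M. indicat_real A \<omega> *\<^sub>R h (W n \<omega>)) /\<^sub>R prob A) \<longlonglongrightarrow> (LINT \<omega>|M. indicat_real A \<omega> *\<^sub>R h (Y \<omega>)) /\<^sub>R prob A"
    using W by simp
  from tendsto_scaleR[OF tendsto_const[of "prob A"] this] show ?thesis using pA by simp
qed

text \<open>Self-adjointness of the conditional expectation. It moves the conditioning in the
  definition of stable convergence from the bounded functions to the test function.\<close>
lemma (in prob_space) cond_exp_swap:
  assumes H: "subalgebra M H" and f: "integrable M f" and y: "y \<in> borel_measurable M" "\<And>\<omega>. \<bar>y \<omega>\<bar> \<le> B"
  shows "(LINT \<omega>|M. f \<omega> * real_cond_exp M H y \<omega>) = (LINT \<omega>|M. real_cond_exp M H f \<omega> * y \<omega>)"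
proof -
  interpret finite_measure_subalgebra M H by unfold_locales (rule H)
  have yi: "integrable M y" using y by (intro integrable_const_bound[of _ B]) auto
  have b: "AE \<omega> in M. real_cond_exp M H y \<omega> \<ge> - B" "AE \<omega> in M. real_cond_exp M H y \<omega> \<le> B"
    using y(2) by (intro real_cond_exp_ge_c real_cond_exp_le_c yi AE_I2; simp add: abs_le_iff minus_le_iff)+
  have mE: "real_cond_exp M H y \<in> borel_measurable M" using borel_measurable_cond_exp2 by blast
  have i1: "integrable M (\<lambda>\<omega>. real_cond_exp M H y \<omega> * f \<omega>)"
  proof (rule Bochner_Integration.integrable_bound[of _ "\<lambda>\<omega>. B * f \<omega>"])
    show "AE \<omega> in M. norm (real_cond_exp M H y \<omega> * f \<omega>) \<le> norm (B * f \<omega>)"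
      using b
    proof eventually_elim
      case (elim \<omega>)
      then have "\<bar>real_cond_exp M H y \<omega>\<bar> \<le> \<bar>B\<bar>" by linarith
      then show ?case by (simp add: abs_mult mult_right_mono)
    qed
  qed (use f mE in auto)
  have i2: "integrable M (\<lambda>\<omega>. real_cond_exp M H f \<omega> * y \<omega>)"
  proof (rule Bochner_Integration.integrable_bound[of _ "\<lambda>\<omega>. real_cond_exp M H f \<omega> * B"])
    show "AE \<omega> in M. norm (real_cond_exp M H f \<omega> * y \<omega>) \<le> norm (real_cond_exp M H f \<omega> * B)"
    proof (rule AE_I2)
      fix \<omega> have "\<bar>y \<omega>\<bar> \<le> \<bar>B\<bar>" using y(2)[of \<omega>] by linarith
      then show "norm (real_cond_exp M H f \<omega> * y \<omega>) \<le> norm (real_cond_exp M H f \<omega> * B)" by (simp add: abs_mult mult_left_mono)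
    qed
  qed (use real_cond_exp_int(1)[OF f] y(1) in auto)
  have "(LINT \<omega>|M. f \<omega> * real_cond_exp M H y \<omega>) = (LINT \<omega>|M. real_cond_exp M H y \<omega> * f \<omega>)" by (simp add: mult.commute)
  also have "\<dots> = (LINT \<omega>|M. real_cond_exp M H y \<omega> * real_cond_exp M H f \<omega>)"
    by (rule real_cond_exp_intg(2)[OF i1, symmetric]) (use f in auto)
  also have "\<dots> = (LINT \<omega>|M. real_cond_exp M H f \<omega> * real_cond_exp M H y \<omega>)" by (simp add: mult.commute)
  also have "\<dots> = (LINT \<omega>|M. real_cond_exp M H f \<omega> * y \<omega>)"
    by (rule real_cond_exp_intg(2)[OF i2]) (use y in auto)
  finally show ?thesis .
qed

section \<open>From the score to the total variation error\<close>

context gibbs_model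
begin

definition "tv_scaled n \<omega> = real n powr (1 - \<alpha> / 2) * tv_error \<alpha> \<mu> n (Part n \<omega>)"

definition "est_err n \<omega> = qmle n (Part n \<omega>) - \<alpha>"

text \<open>Giving the total variation error the sign of the estimation error makes it
  asymptotically linear in the score, hence accessible to characteristic functions; the absolute value
  is restored at the end.\<close>
definition "signed_tv n \<omega> = (if est_err n \<omega> \<ge> 0 then 1 else - 1) * tv_scaled n \<omega>"

lemma tv_error_nonneg: "tv_error \<alpha> \<mu> n P \<ge> 0"
  unfolding tv_error_def by (intro mult_nonneg_nonneg add_nonneg_nonneg sum_nonneg) auto

lemma abs_signed_tv: "\<bar>signed_tv n \<omega>\<bar> = tv_scaled n \<omega>"
  using tv_error_nonneg[of n "Part n \<omega>"] by (simp add: signed_tv_def tv_scaled_def)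

lemma signed_tv_measurable: "n \<ge> 1 \<Longrightarrow> signed_tv n \<in> borel_measurable M"
  unfolding signed_tv_def[abs_def] tv_scaled_def est_err_def
  by (rule adapted_measurable[OF _ adapted_Part[of n "\<lambda>P. (if qmle n P - \<alpha> \<ge> 0 then 1 else - 1) * (real n powr (1 - \<alpha> / 2) * tv_error \<alpha> \<mu> n P)"]])

lemma est_err_measurable: "n \<ge> 1 \<Longrightarrow> est_err n \<in> borel_measurable M"
  unfolding est_err_def[abs_def] by (rule adapted_measurable[OF _ adapted_Part[of n "\<lambda>P. qmle n P - \<alpha>"]])

lemma tv_scaled_measurable: "tv_scaled n \<in> borel_measurable M"
proof (cases "n \<ge> 1")
  case True
  then show ?thesis unfolding tv_scaled_def[abs_def]
    by (rule adapted_measurable[OF _ adapted_Part[of n "\<lambda>P. real n powr (1 - \<alpha> / 2) * tv_error \<alpha> \<mu> n P"]])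
next
  case False
  then have "tv_scaled n = (\<lambda>\<omega>. 0)" by (intro ext) (simp add: tv_scaled_def)
  then show ?thesis by simp
qed

definition "scaled_err n \<omega> = real n powr (- \<alpha> / 2) * (K n \<omega> * \<bar>est_err n \<omega>\<bar>)"

lemma scaled_err_tight: "tight_seq scaled_err"
proof -
  obtain C where C: "C > 0" "\<And>n. n \<ge> 1 \<Longrightarrow> (LINT \<omega>|M. (BS (score_wt \<alpha>) n \<omega>)\<^sup>2) \<le> C * A n"
    by (rule score_second_moment) blast
  obtain C2 where C2: "C2 > 0" "\<And>n. n \<ge> 1 \<Longrightarrow> A n \<le> C2 * real n powr \<alpha>" by (rule A_upper) blast
  have sq: "(real n powr (- \<alpha> / 2))\<^sup>2 = real n powr (- \<alpha>)" if "n \<ge> 1" for n :: nat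
    using that by (simp add: power2_eq_square flip: powr_add)
  have ad: "adapted n (\<lambda>\<omega>. \<bar>scaled_err n \<omega>\<bar> powr 2)" for n
    unfolding scaled_err_def est_err_def
    by (rule adapted_Part[of n "\<lambda>P. \<bar>real n powr (- \<alpha> / 2) * (real (card P) * \<bar>qmle n P - \<alpha>\<bar>)\<bar> powr 2"])
  show ?thesis
  proof (rule tight_moment[where \<delta> = 2 and C = "8 * C * C2 + 8 / \<alpha>\<^sup>2"])
    show "scaled_err n \<in> borel_measurable M" if n: "n \<ge> 1" for n
      unfolding scaled_err_def[abs_def] using est_err_measurable[OF n] K_measurable[OF n] by measurable
    fix n :: nat assume n: "n \<ge> 1"
    show "integrable M (\<lambda>\<omega>. \<bar>scaled_err n \<omega>\<bar> powr 2)" by (rule adapted_integrable[OF n ad])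
    have np: "real n powr \<alpha> \<ge> 1" using n alpha by (intro ge_one_powr_ge_zero) auto
    have "(LINT \<omega>|M. \<bar>scaled_err n \<omega>\<bar> powr 2) \<le> (LINT \<omega>|M. real n powr (- \<alpha>) * (8 * (BS (score_wt \<alpha>) n \<omega>)\<^sup>2 + 8 / \<alpha>\<^sup>2))"
    proof (rule integral_mono[OF adapted_integrable[OF n ad]])
      show "integrable M (\<lambda>\<omega>. real n powr (- \<alpha>) * (8 * (BS (score_wt \<alpha>) n \<omega>)\<^sup>2 + 8 / \<alpha>\<^sup>2))" using n by simp
      fix \<omega> assume w: "\<omega> \<in> space M"
      let ?L = "BS (score_wt \<alpha>) n \<omega>"
      have "K n \<omega> * \<bar>est_err n \<omega>\<bar> \<le> 2 * \<bar>?L\<bar> + 2 / \<alpha>"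
        unfolding est_err_def by (rule qmle_error_score[OF Part_partition[OF n w] alpha n])
      then have "(K n \<omega> * \<bar>est_err n \<omega>\<bar>)\<^sup>2 \<le> (2 * \<bar>?L\<bar> + 2 / \<alpha>)\<^sup>2" by (intro power_mono) auto
      also have "\<dots> \<le> 8 * ?L\<^sup>2 + 8 / \<alpha>\<^sup>2"
      proof -
        have "0 \<le> (2 * \<bar>?L\<bar> - 2 / \<alpha>)\<^sup>2" by simp
        then have "(2 * \<bar>?L\<bar> + 2 / \<alpha>)\<^sup>2 \<le> 2 * (2 * \<bar>?L\<bar>)\<^sup>2 + 2 * (2 / \<alpha>)\<^sup>2" by (simp add: power2_sum power2_diff)
        also have "\<dots> = 8 * ?L\<^sup>2 + 8 / \<alpha>\<^sup>2" by (simp add: power_mult_distrib power_divide)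
        finally show ?thesis .
      qed
      finally have "real n powr (- \<alpha>) * (K n \<omega> * \<bar>est_err n \<omega>\<bar>)\<^sup>2 \<le> real n powr (- \<alpha>) * (8 * ?L\<^sup>2 + 8 / \<alpha>\<^sup>2)"
        by (intro mult_left_mono) auto
      moreover have "\<bar>scaled_err n \<omega>\<bar> powr 2 = real n powr (- \<alpha>) * (K n \<omega> * \<bar>est_err n \<omega>\<bar>)\<^sup>2"
        unfolding scaled_err_def sq[OF n, symmetric] by (simp add: powr_numeral power_mult_distrib abs_mult)
      ultimately show "\<bar>scaled_err n \<omega>\<bar> powr 2 \<le> real n powr (- \<alpha>) * (8 * ?L\<^sup>2 + 8 / \<alpha>\<^sup>2)" by simp
    qed
    also have "\<dots> = real n powr (- \<alpha>) * (8 * (LINT \<omega>|M. (BS (score_wt \<alpha>) n \<omega>)\<^sup>2) + 8 / \<alpha>\<^sup>2)"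
      using n by (simp add: prob_space)
    also have "\<dots> \<le> real n powr (- \<alpha>) * (8 * (C * (C2 * real n powr \<alpha>)) + 8 / \<alpha>\<^sup>2 * real n powr \<alpha>)"
    proof (intro mult_left_mono add_mono)
      have "C * A n \<le> C * (C2 * real n powr \<alpha>)" using C C2 n by (intro mult_left_mono) auto
      then show "(LINT \<omega>|M. (BS (score_wt \<alpha>) n \<omega>)\<^sup>2) \<le> C * (C2 * real n powr \<alpha>)" using C(2)[OF n] by linarith
      show "8 / \<alpha>\<^sup>2 \<le> 8 / \<alpha>\<^sup>2 * real n powr \<alpha>" using np by (simp add: mult_le_cancel_left1 divide_right_mono)
    qed auto
    also have "\<dots> = (8 * C * C2 + 8 / \<alpha>\<^sup>2) * (real n powr (- \<alpha>) * real n powr \<alpha>)" by (simp add: algebra_simps)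
    also have "real n powr (- \<alpha>) * real n powr \<alpha> = 1" using n by (simp flip: powr_add)
    finally show "(LINT \<omega>|M. \<bar>scaled_err n \<omega>\<bar> powr 2) \<le> 8 * C * C2 + 8 / \<alpha>\<^sup>2" by simp
  qed simp
qed

definition "inv_card n \<omega> = real n powr \<alpha> / K n \<omega>"

lemma inv_card_tight: "tight_seq inv_card"
proof -
  obtain \<delta> C where d: "\<delta> > 0" "C > 0" "\<And>n. n \<ge> 1 \<Longrightarrow> (LINT \<omega>|M. (real n powr \<alpha> / K n \<omega>) powr \<delta>) \<le> C"
    by (rule negative_moment) blast
  show ?thesis
  proof (rule tight_moment[OF _ d(1)])
    fix n :: nat assume n: "n \<ge> 1"
    show "inv_card n \<in> borel_measurable M" unfolding inv_card_def[abs_def] using K_measurable[OF n] by measurable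
    have e: "(\<lambda>\<omega>. \<bar>inv_card n \<omega>\<bar> powr \<delta>) = (\<lambda>\<omega>. (real n powr \<alpha> / K n \<omega>) powr \<delta>)"
      by (rule ext) (simp add: inv_card_def)
    show "integrable M (\<lambda>\<omega>. \<bar>inv_card n \<omega>\<bar> powr \<delta>)"
      unfolding e by (rule adapted_integrable[OF n adapted_Part[of n "\<lambda>P. (real n powr \<alpha> / real (card P)) powr \<delta>"]])
    show "expectation (\<lambda>\<omega>. \<bar>inv_card n \<omega>\<bar> powr \<delta>) \<le> C" unfolding e by (rule d(3)[OF n])
  qed
qed

text \<open>The linearization of the estimator in probability. All error terms are products of the
  tight sequences \<open>scaled_err\<close> and \<open>inv_card\<close> with a vanishing sequence.
  When the estimator is far from \<open>\<alpha>\<close>, the last summand of \<open>Y\<close> is at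
  least one, which covers that event.\<close>
lemma linearized_error_vanishing:
  "vanishing (\<lambda>n \<omega>. real n powr (- \<alpha> / 2) * (fisher_info \<alpha> * K n \<omega> * est_err n \<omega> - BS (score_wt \<alpha>) n \<omega>))"
proof -
  let ?I = "fisher_info \<alpha>" and ?c = "\<lambda>n. real n powr (- \<alpha> / 2)"
  let ?R = scaled_err and ?B = inv_card
  define V where "V n \<omega> = (BS (info_wt \<alpha>) n \<omega> - ?I * K n \<omega>) / real n powr \<alpha>" for n \<omega>
  define C0 where "C0 = (2 / \<alpha> + 2 / (1 - \<alpha>)) * (1 / \<alpha>\<^sup>2 + pi\<^sup>2 / 6 / (1 - \<alpha>)\<^sup>2)"
  define e0 where "e0 = min \<alpha> (1 - \<alpha>) / 2"
  have e0: "e0 > 0" using alpha by (simp add: e0_def)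
  have C0: "C0 \<ge> 0" using alpha by (simp add: C0_def)
  have lim0: "?c \<longlonglongrightarrow> 0" "(\<lambda>n. real n powr (- \<alpha>)) \<longlonglongrightarrow> 0" using alpha by real_asymp+
  have RB: "tight_seq (\<lambda>n \<omega>. ?R n \<omega> * ?B n \<omega>)" by (rule tight_mult[OF scaled_err_tight inv_card_tight])
  have RRB: "tight_seq (\<lambda>n \<omega>. ?R n \<omega> * (?R n \<omega> * ?B n \<omega>))" by (rule tight_mult[OF scaled_err_tight RB])
  have Vv: "vanishing (\<lambda>n \<omega>. \<bar>V n \<omega>\<bar>)"
    using info_minus_card_vanishing unfolding V_def[abs_def] vanishing_def by auto
  have const: "vanishing (\<lambda>n \<omega>. x n * a)" if "x \<longlonglongrightarrow> 0" for x :: "nat \<Rightarrow> real" and a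
    using tendsto_mult_left_zero[OF that] by (rule vanishing_const)
  define Y where "Y n \<omega> = ?c n * (1 / \<alpha>) + (\<bar>V n \<omega>\<bar> * (?R n \<omega> * ?B n \<omega>) + ((real n powr (- \<alpha>) * (2 / \<alpha>\<^sup>2)) * (?R n \<omega> * ?B n \<omega>)
      + ((?c n * C0) * (?R n \<omega> * (?R n \<omega> * ?B n \<omega>)) + (?c n * (1 / e0)) * (?R n \<omega> * ?B n \<omega>))))" for n \<omega>
  have "vanishing Y"
    unfolding Y_def
    by (intro vanishing_add const lim0 vanishing_mult_tight[OF Vv RB] vanishing_mult_tight[OF const[OF lim0(2)] RB]
        vanishing_mult_tight[OF const[OF lim0(1)] RRB] vanishing_mult_tight[OF const[OF lim0(1)] RB])
  then show ?thesis
  proof (rule vanishing_mono)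
    fix n :: nat assume n: "n \<ge> 1"
    show "(\<lambda>\<omega>. ?c n * (?I * K n \<omega> * est_err n \<omega> - BS (score_wt \<alpha>) n \<omega>)) \<in> borel_measurable M"
      using est_err_measurable[OF n] K_measurable[OF n] BS_measurable[OF n] by measurable
    fix \<omega> assume w: "\<omega> \<in> space M"
    note P = Part_partition[OF n w]
    let ?e = "\<bar>est_err n \<omega>\<bar>" and ?k = "K n \<omega>"
    have k: "?k \<ge> 1" using card_range[OF n w] by simp
    have np: "real n powr \<alpha> > 0" "?c n > 0" using n by auto
    have R0: "?R n \<omega> \<ge> 0" "?B n \<omega> \<ge> 0" using np by (simp_all add: scaled_err_def inv_card_def)
    have cc: "?c n * ?c n * real n powr \<alpha> = 1" using n by (simp flip: powr_add)
    have cB: "real n powr (- \<alpha>) * ?B n \<omega> * ?k = 1" using n k by (simp add: inv_card_def flip: powr_add)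
    have eR: "?c n * ?e = ?R n \<omega> * ?B n \<omega> * real n powr (- \<alpha>)"
      using cB by (simp add: scaled_err_def mult_ac)
    have e: "?e = ?c n * (?R n \<omega> * ?B n \<omega>)"
    proof -
      have "?c n * (?R n \<omega> * ?B n \<omega>) = (?c n * ?c n * real n powr \<alpha>) * ?e"
        using k by (simp add: scaled_err_def inv_card_def)
      then show ?thesis unfolding cc by simp
    qed
    have nn: "?c n * (1 / \<alpha>) \<ge> 0" "\<bar>V n \<omega>\<bar> * (?R n \<omega> * ?B n \<omega>) \<ge> 0" "(real n powr (- \<alpha>) * (2 / \<alpha>\<^sup>2)) * (?R n \<omega> * ?B n \<omega>) \<ge> 0"
      "(?c n * C0) * (?R n \<omega> * (?R n \<omega> * ?B n \<omega>)) \<ge> 0" "(?c n * (1 / e0)) * (?R n \<omega> * ?B n \<omega>) \<ge> 0"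
      using R0 C0 e0 alpha by auto
    have "min 1 \<bar>?c n * (?I * ?k * est_err n \<omega> - BS (score_wt \<alpha>) n \<omega>)\<bar> \<le> Y n \<omega>"
    proof (cases "?e \<le> e0")
      case True
      have "\<bar>?I * ?k * est_err n \<omega> - BS (score_wt \<alpha>) n \<omega>\<bar>
         \<le> 1 / \<alpha> + ?e * (\<bar>BS (info_wt \<alpha>) n \<omega> - ?I * ?k\<bar> + 2 / \<alpha>\<^sup>2 + ?e * ?k * C0)"
        using qmle_linearization[OF P alpha n, of ?I] True unfolding est_err_def C0_def e0_def by simp
      from mult_left_mono[OF this, of "?c n"]
      have "?c n * \<bar>?I * ?k * est_err n \<omega> - BS (score_wt \<alpha>) n \<omega>\<bar>
        \<le> ?c n * (1 / \<alpha> + ?e * (\<bar>BS (info_wt \<alpha>) n \<omega> - ?I * ?k\<bar> + 2 / \<alpha>\<^sup>2 + ?e * ?k * C0))" by simp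
      moreover have "x * (a + y * (b + d + y * k * C)) = x * a + ((x * y) * b + ((x * y) * d + (x * (k * y)) * y * C))"
        for x a y b d k C :: real by (simp add: algebra_simps)
      ultimately have "\<bar>?c n * (?I * ?k * est_err n \<omega> - BS (score_wt \<alpha>) n \<omega>)\<bar>
        \<le> ?c n * (1 / \<alpha>) + ((?c n * ?e) * \<bar>BS (info_wt \<alpha>) n \<omega> - ?I * ?k\<bar> + ((?c n * ?e) * (2 / \<alpha>\<^sup>2) + (?c n * (?k * ?e)) * ?e * C0))"
        by (simp only: abs_mult abs_of_nonneg[OF powr_ge_zero])
      also have "(?c n * ?e) * \<bar>BS (info_wt \<alpha>) n \<omega> - ?I * ?k\<bar> = \<bar>V n \<omega>\<bar> * (?R n \<omega> * ?B n \<omega>)"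
        unfolding eR V_def using np by (simp add: powr_minus_divide)
      also have "(?c n * ?e) * (2 / \<alpha>\<^sup>2) = (real n powr (- \<alpha>) * (2 / \<alpha>\<^sup>2)) * (?R n \<omega> * ?B n \<omega>)"
        unfolding eR by (simp only: mult_ac)
      also have "(?c n * (?k * ?e)) * ?e * C0 = (?c n * C0) * (?R n \<omega> * (?R n \<omega> * ?B n \<omega>))"
      proof -
        have "(?c n * (?k * ?e)) * ?e * C0 = ?R n \<omega> * ?e * C0" by (simp add: scaled_err_def)
        also have "\<dots> = ?R n \<omega> * (?c n * (?R n \<omega> * ?B n \<omega>)) * C0" by (simp only: e[symmetric])
        also have "\<dots> = (?c n * C0) * (?R n \<omega> * (?R n \<omega> * ?B n \<omega>))" by (simp only: mult_ac)
        finally show ?thesis .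
      qed
      finally show ?thesis using nn unfolding Y_def by linarith
    next
      case False
      then have "1 \<le> ?e / e0" using e0 by simp
      also have "\<dots> = (?c n * (1 / e0)) * (?R n \<omega> * ?B n \<omega>)" by (subst e) simp
      finally show ?thesis using nn unfolding Y_def by linarith
    qed
    then show "min 1 \<bar>?c n * (?I * ?k * est_err n \<omega> - BS (score_wt \<alpha>) n \<omega>)\<bar> \<le> \<bar>Y n \<omega>\<bar>" by linarith
  qed
qed

lemma signed_tv_score_vanishing:
  "vanishing (\<lambda>n \<omega>. signed_tv n \<omega> - real n powr (- \<alpha> / 2) * BS (score_wt \<alpha>) n \<omega> / fisher_info \<alpha>)"
proof -
  let ?I = "fisher_info \<alpha>" and ?c = "\<lambda>n. real n powr (- \<alpha> / 2)"
  have I: "?I > 0" by (rule fisher_info_pos[OF alpha])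
  have c0: "?c \<longlonglongrightarrow> 0" using alpha by real_asymp
  have m: "(\<lambda>\<omega>. signed_tv n \<omega> - ?c n * BS (score_wt \<alpha>) n \<omega> / ?I) \<in> borel_measurable M"
    "(\<lambda>\<omega>. signed_tv n \<omega> - ?c n * (K n \<omega> * est_err n \<omega>)) \<in> borel_measurable M"
    "(\<lambda>\<omega>. ?c n * (?I * K n \<omega> * est_err n \<omega> - BS (score_wt \<alpha>) n \<omega>) / ?I) \<in> borel_measurable M" if n: "n \<ge> 1" for n
    using signed_tv_measurable[OF n] est_err_measurable[OF n] K_measurable[OF n] BS_measurable[OF n] by measurable
  have "vanishing (\<lambda>n \<omega>. signed_tv n \<omega> - ?c n * (K n \<omega> * est_err n \<omega>))"
  proof (rule vanishing_mono[OF vanishing_const m(2)])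
    show "(\<lambda>n. ?c n * (2 * D)) \<longlonglongrightarrow> 0" using tendsto_mult_left_zero[OF c0] by simp
    fix n :: nat and \<omega> assume n: "n \<ge> 1" and w: "\<omega> \<in> space M"
    let ?s = "if est_err n \<omega> \<ge> 0 then 1 else - 1 :: real"
    have nn: "real n powr (1 - \<alpha> / 2) / real n = ?c n" using n by (simp add: powr_diff powr_minus_divide)
    have "signed_tv n \<omega> - ?c n * (K n \<omega> * est_err n \<omega>) = ?s * (tv_scaled n \<omega> - ?c n * (K n \<omega> * \<bar>est_err n \<omega>\<bar>))"
      by (simp add: signed_tv_def)
    then have "\<bar>signed_tv n \<omega> - ?c n * (K n \<omega> * est_err n \<omega>)\<bar> = \<bar>tv_scaled n \<omega> - ?c n * (K n \<omega> * \<bar>est_err n \<omega>\<bar>)\<bar>"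
      by (simp add: abs_mult)
    also have "tv_scaled n \<omega> - ?c n * (K n \<omega> * \<bar>est_err n \<omega>\<bar>)
      = real n powr (1 - \<alpha> / 2) * (tv_error \<alpha> \<mu> n (Part n \<omega>) - K n \<omega> / real n * \<bar>qmle n (Part n \<omega>) - \<alpha>\<bar>)"
      unfolding nn[symmetric] by (simp add: tv_scaled_def est_err_def right_diff_distrib)
    also have "\<bar>\<dots>\<bar> = real n powr (1 - \<alpha> / 2) * \<bar>tv_error \<alpha> \<mu> n (Part n \<omega>) - K n \<omega> / real n * \<bar>qmle n (Part n \<omega>) - \<alpha>\<bar>\<bar>"
      by (simp only: abs_mult abs_of_nonneg[OF powr_ge_zero])
    also have "\<dots> \<le> real n powr (1 - \<alpha> / 2) * (2 * D / real n)"
      by (intro mult_left_mono tv_error_approx[OF Part_partition[OF n w] n]) simp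
    also have "\<dots> = ?c n * (2 * D)" unfolding nn[symmetric] by simp
    finally show "min 1 \<bar>signed_tv n \<omega> - ?c n * (K n \<omega> * est_err n \<omega>)\<bar> \<le> \<bar>?c n * (2 * D)\<bar>" by linarith
  qed
  moreover have "vanishing (\<lambda>n \<omega>. ?c n * (?I * K n \<omega> * est_err n \<omega> - BS (score_wt \<alpha>) n \<omega>) * (1 / ?I))"
  proof (rule vanishing_mult_tight[OF linearized_error_vanishing])
    show "tight_seq (\<lambda>n \<omega>. 1 / ?I)"
      by (rule tight_moment[where \<delta> = 1 and C = "1 / ?I"]) (use I in \<open>auto simp: prob_space\<close>)
  qed
  ultimately have "vanishing (\<lambda>n \<omega>. (signed_tv n \<omega> - ?c n * (K n \<omega> * est_err n \<omega>))
     + ?c n * (?I * K n \<omega> * est_err n \<omega> - BS (score_wt \<alpha>) n \<omega>) * (1 / ?I))"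
    by (rule vanishing_add)
  moreover have "(signed_tv n \<omega> - ?c n * (K n \<omega> * est_err n \<omega>)) + ?c n * (?I * K n \<omega> * est_err n \<omega> - BS (score_wt \<alpha>) n \<omega>) * (1 / ?I)
     = signed_tv n \<omega> - ?c n * BS (score_wt \<alpha>) n \<omega> / ?I" for n \<omega>
    using I by (simp add: field_simps)
  ultimately show ?thesis by (simp only:)
qed

text \<open>The central limit theorem of the score, read at \<open>t / fisher_info\<close>.\<close>
lemma signed_tv_char:
  assumes S: "S \<in> sets G"
  shows "(\<lambda>n. LINT \<omega>|M. indicat_real S \<omega> *\<^sub>R iexp (t * signed_tv n \<omega>)) \<longlonglongrightarrow>
    (LINT \<omega>|M. indicat_real S \<omega> *\<^sub>R complex_of_real (exp (- (t\<^sup>2 * (max 0 (alpha_diversity \<alpha> Part \<omega>) / fisher_info \<alpha>) / 2))))"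
proof (rule iexp_vanishing[OF _ signed_tv_measurable _ signed_tv_score_vanishing])
  let ?I = "fisher_info \<alpha>"
  have I: "?I > 0" by (rule fisher_info_pos[OF alpha])
  show "S \<in> events" using S subalgebra_G by (auto simp: subalgebra_def)
  show "(\<lambda>\<omega>. real n powr (- \<alpha> / 2) * BS (score_wt \<alpha>) n \<omega> / ?I) \<in> borel_measurable M" if "n \<ge> 1" for n
    using BS_measurable[OF that] by measurable
  have 1: "t / ?I * real n powr (- \<alpha> / 2) * x = t * (real n powr (- \<alpha> / 2) * x / ?I)" for n and x :: real by simp
  have 2: "(t / ?I)\<^sup>2 * asym_var \<omega> / 2 = t\<^sup>2 * (max 0 (alpha_diversity \<alpha> Part \<omega>) / ?I) / 2" for \<omega>
    using I by (simp add: asym_var_def power2_eq_square)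
  show "(\<lambda>n. LINT \<omega>|M. indicat_real S \<omega> *\<^sub>R iexp (t * (real n powr (- \<alpha> / 2) * BS (score_wt \<alpha>) n \<omega> / ?I))) \<longlonglongrightarrow>
    (LINT \<omega>|M. indicat_real S \<omega> *\<^sub>R complex_of_real (exp (- (t\<^sup>2 * (max 0 (alpha_diversity \<alpha> Part \<omega>) / ?I) / 2))))"
    using score_clt[OF S, of "t / ?I"] unfolding 1 2 .
qed

text \<open>By Levy's theorem on each event of \<open>G\<close>, the integrals of bounded continuous
  functions of the error over that event converge; extension to integrable test functions by density
  and the symmetry of the conditional expectation yield stable convergence.\<close>
theorem tv_stable:
  assumes N: "distributed M lborel N std_normal_density"
    and indep: "indep_set (sets G) (sets (vimage_algebra (space M) N borel))"
  shows "stable_conv M G (\<lambda>n \<omega>. real n powr (1 - \<alpha> / 2) * tv_error \<alpha> \<mu> n (Part n \<omega>))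
     (\<lambda>\<omega>. sqrt (alpha_diversity \<alpha> Part \<omega> / fisher_info \<alpha>) * \<bar>N \<omega>\<bar>)"
proof -
  let ?I = "fisher_info \<alpha>" and ?S = "alpha_diversity \<alpha> Part"
  let ?Y = "\<lambda>\<omega>. sqrt (?S \<omega> / ?I) * \<bar>N \<omega>\<bar>"
  have I: "?I > 0" by (rule fisher_info_pos[OF alpha])
  have Nm [measurable]: "N \<in> borel_measurable M" using distributed_measurable[OF N] by simp
  define s where "s \<omega> = sqrt (max 0 (?S \<omega>) / ?I)" for \<omega>
  have sG: "s \<in> borel_measurable G" unfolding s_def[abs_def] using G_measurable_diversity by measurable
  have sm [measurable]: "s \<in> borel_measurable M" by (rule measurable_from_subalg[OF subalgebra_G sG])
  have s2: "(s \<omega>)\<^sup>2 = max 0 (?S \<omega>) / ?I" "s \<omega> \<ge> 0" for \<omega> using I by (simp_all add: s_def)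
  have Ym [measurable]: "?Y \<in> borel_measurable M" by measurable
  have Y_eq: "AE \<omega> in M. ?Y \<omega> = \<bar>s \<omega> * N \<omega>\<bar>"
    using alpha_diversity_nonneg
  proof eventually_elim
    case (elim \<omega>)
    then show ?case using s2(2)[of \<omega>] by (simp add: s_def abs_mult)
  qed
  show ?thesis
    unfolding stable_conv_def tv_scaled_def[symmetric]
  proof (intro conjI allI impI)
    show "subalgebra M G" by (rule subalgebra_G)
    show "(\<lambda>\<omega>. tv_scaled n \<omega>) \<in> borel_measurable M" for n using tv_scaled_measurable by simp
    show "?Y \<in> borel_measurable M" by (rule Ym)
    fix f :: "'a \<Rightarrow> real" and h :: "real \<Rightarrow> real"
    assume f: "integrable M f" and h: "continuous_on UNIV h" "bounded (range h)"
    obtain B where B: "\<And>x. \<bar>h x\<bar> \<le> B" using h(2) by (auto simp: bounded_iff)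
    have hm [measurable]: "h \<in> borel_measurable borel" by (rule borel_measurable_continuous_onI[OF h(1)])
    interpret GG: finite_measure_subalgebra M G by unfold_locales (rule subalgebra_G)
    define g where "g = real_cond_exp M G f"
    have g: "integrable M g" "g \<in> borel_measurable G" unfolding g_def using f by auto
    have hc: "isCont (\<lambda>x. h \<bar>x\<bar>) x" for x
      using h(1) by (intro isCont_o2[of _ abs h]) (auto simp: continuous_on_eq_continuous_at)
    have onS: "(\<lambda>n. LINT \<omega>|M. indicat_real S \<omega> *\<^sub>R h (tv_scaled n \<omega>)) \<longlonglongrightarrow> (LINT \<omega>|M. indicat_real S \<omega> *\<^sub>R h (?Y \<omega>))" if S: "S \<in> sets G" for S
    proof -
      have Sm [measurable]: "S \<in> events" using S subalgebra_G by (auto simp: subalgebra_def)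
      have "(\<lambda>n. LINT \<omega>|M. indicat_real S \<omega> *\<^sub>R h \<bar>signed_tv (Suc n) \<omega>\<bar>) \<longlonglongrightarrow> (LINT \<omega>|M. indicat_real S \<omega> *\<^sub>R h \<bar>s \<omega> * N \<omega>\<bar>)"
      proof (rule Levy_on_event[OF Sm, where h = "\<lambda>x. h \<bar>x\<bar>" and B = B])
        show "signed_tv (Suc n) \<in> borel_measurable M" for n by (rule signed_tv_measurable) simp
        show "(\<lambda>n. LINT \<omega>|M. indicat_real S \<omega> *\<^sub>R iexp (t * signed_tv (Suc n) \<omega>)) \<longlonglongrightarrow> (LINT \<omega>|M. indicat_real S \<omega> *\<^sub>R iexp (t * (s \<omega> * N \<omega>)))" for t
          unfolding mixed_normal_char[OF subalgebra_G indep N S sG] s2(1)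
          by (rule LIMSEQ_Suc[OF signed_tv_char[OF S]])
      qed (use B hc in auto)
      also have "(LINT \<omega>|M. indicat_real S \<omega> *\<^sub>R h \<bar>s \<omega> * N \<omega>\<bar>) = (LINT \<omega>|M. indicat_real S \<omega> *\<^sub>R h (?Y \<omega>))"
        by (rule integral_cong_AE) (measurable, use Y_eq in eventually_elim, simp)
      finally have "(\<lambda>n. LINT \<omega>|M. indicat_real S \<omega> *\<^sub>R h (tv_scaled (Suc n) \<omega>)) \<longlonglongrightarrow> (LINT \<omega>|M. indicat_real S \<omega> *\<^sub>R h (?Y \<omega>))"
        unfolding abs_signed_tv .
      then show ?thesis by (rule LIMSEQ_imp_Suc)
    qed
    have "(\<lambda>n. LINT \<omega>|M. g \<omega> *\<^sub>R h (tv_scaled n \<omega>)) \<longlonglongrightarrow> (LINT \<omega>|M. g \<omega> *\<^sub>R h (?Y \<omega>))"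
      by (rule weak_limit_extend[OF subalgebra_G _ _ _ _ onS g, where B = B])
        (use tv_scaled_measurable B in \<open>auto intro: measurable_compose[OF _ hm]\<close>)
    moreover have "(LINT \<omega>|M. f \<omega> * real_cond_exp M G (\<lambda>\<omega>. h (tv_scaled n \<omega>)) \<omega>) = (LINT \<omega>|M. g \<omega> *\<^sub>R h (tv_scaled n \<omega>))" for n
      unfolding g_def real_scaleR_def
      by (rule cond_exp_swap[OF subalgebra_G f, where B = B]) (use B tv_scaled_measurable[of n] in \<open>auto intro: measurable_compose[OF _ hm]\<close>)
    moreover have "(LINT \<omega>|M. f \<omega> * real_cond_exp M G (\<lambda>\<omega>. h (?Y \<omega>)) \<omega>) = (LINT \<omega>|M. g \<omega> *\<^sub>R h (?Y \<omega>))"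
      unfolding g_def real_scaleR_def
      by (rule cond_exp_swap[OF subalgebra_G f, where B = B]) (use B in auto)
    ultimately show "(\<lambda>n. LINT \<omega>|M. f \<omega> * real_cond_exp M G (\<lambda>\<omega>. h (tv_scaled n \<omega>)) \<omega>) \<longlonglongrightarrow> (LINT \<omega>|M. f \<omega> * real_cond_exp M G (\<lambda>\<omega>. h (?Y \<omega>)) \<omega>)"
      by simp
  qed
qed

end

theorem theorem4p3:
  fixes M :: "'a measure"
    and \<alpha> lo hi :: real
    and \<mu> :: "real measure"
    and Part :: "nat \<Rightarrow> 'a \<Rightarrow> nat set set"
    and N :: "'a \<Rightarrow> real"
  assumes "0 < \<alpha>" and "\<alpha> < 1"
    and "prob_space \<mu>" and "sets \<mu> = sets borel"
    and "measure_supp \<mu> \<subseteq> {lo..hi}"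
    and "- \<alpha> < lo" and "lo \<le> 0" and "0 \<le> hi"
    and "gibbs_partition M \<alpha> \<mu> Part"
    and "distributed M lborel N std_normal_density"
    and "prob_space.indep_set M (sets (partition_sigma_inf M Part))
           (sets (vimage_algebra (space M) N borel))"
  shows "limsup (\<lambda>n. ereal (real n powr (1 - \<alpha> / 2)
           * sqrt (LINT \<omega>|M. (tv_error \<alpha> \<mu> n (Part n \<omega>))\<^sup>2))) < \<infinity> \<and>
         stable_conv M (partition_sigma_inf M Part)
           (\<lambda>n \<omega>. real n powr (1 - \<alpha> / 2) * tv_error \<alpha> \<mu> n (Part n \<omega>))
           (\<lambda>\<omega>. sqrt (alpha_diversity \<alpha> Part \<omega> / fisher_info \<alpha>) * \<bar>N \<omega>\<bar>)"
proof -
  interpret gibbs_model \<alpha> lo hi \<mu> M Part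
    using assms by (intro gibbs_model.intro gibbs_weights.intro) auto
  obtain C where C: "C > 0" "\<And>n. n \<ge> 1 \<Longrightarrow>
    real n powr (1 - \<alpha> / 2) * sqrt (LINT \<omega>|M. (tv_error \<alpha> \<mu> n (Part n \<omega>))\<^sup>2) \<le> C"
    by (rule tv_L2_bound) blast
  have "limsup (\<lambda>n. ereal (real n powr (1 - \<alpha> / 2) * sqrt (LINT \<omega>|M. (tv_error \<alpha> \<mu> n (Part n \<omega>))\<^sup>2))) \<le> ereal C"
    by (rule Limsup_bounded) (rule eventually_mono[OF eventually_ge_at_top[of 1]], use C(2) in simp)
  then have "limsup (\<lambda>n. ereal (real n powr (1 - \<alpha> / 2) * sqrt (LINT \<omega>|M. (tv_error \<alpha> \<mu> n (Part n \<omega>))\<^sup>2))) < \<infinity>"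
    by (rule order.strict_trans1) simp
  with tv_stable[OF assms(10,11)] show ?thesis by blast
qed

end
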